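(* Let $n\ge2$ be an integer. Assume that the coupling operators $C_{i\,i-1}$, $i=2,\dots,n$, satisfy the Coupling hypothesis of order $n$ with $\Pi_i=C_{i\,i-1}$ for all $i\in\{2,\dots,n\}$, and that $\mathbf{B}_n^{*}$ satisfies the Admissibility hypothesis of index $n$. Consider the property: (OBS) there exists $T_n^{*}>0$ such that for all $T>T_n^{*}$ there exists $C>0$ such that for all $U^0\in\mathcal H_n$ the solution $U=(u_1,\dots,u_n,u_1',\dots,u_n')$ of the bi-diagonal cascade system with initial data $U^0$ satisfies $C\sum_{i=1}^ne_{1+i-n}(U_i)(0)\le\int_0^T\|\mathbf{B}_n^{*}U_n\|_{G_n}^2\,dt$. Then (OBS) holds if and only if the operators $\Pi_i=C_{i\,i-1}$, $i=2,\dots,n$, satisfy the Coupling observability hypothesis of order $n$ and $\mathbf{B}_n^{*}$ satisfies the Observability hypothesis of index $n$. Moreover, any time $T_n^{*}$ as in (OBS) has to satisfy $T_n^{*}\ge\max\big(\max_{2\le i\le n}T_{i,c},\,T_{0,n}\big)$, where $T_{i,c}$ ($i=2,\dots,n$) denotes the minimal control time for the observability inequality of the operator $\Pi_i=C_{i\,i-1}$ in the Coupling observability hypothesis and $T_{0,n}$ denotes the minimal control time for the inequality in the Observability hypothesis of index $n$.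
   Context: Abstract setting. $H$ is a Hilbert space with norm $|\cdot|$ and scalar product $\langle\cdot,\cdot\rangle$. $A:D(A)\subset H\to H$ is a positive self-adjoint operator with compact resolvent such that, for some $\omega>0$, $|Au|\ge\omega|u|$ for all $u\in D(A)$. For $k\in\mathbb N$, $H_k=D(A^{k/2})$ with norm $|A^{k/2}\cdot|$ ($H_0=H$), and $H_{-k}$ is the dual of $H_k$ with pivot space $H$, with norm $|A^{-k/2}\cdot|$. For $k\in\mathbb Z$ and a pair $W=(w,w')$, $e_k(W)=\frac12\big(|A^{k/2}w|^2+|A^{(k-1)/2}w'|^2\big)$. Coupling hypothesis of order $n$. For all $i\in\{2,\dots,n\}$: $C_{i\,i-1}$ is a bounded operator on $H$; $C_{i\,i-1}^{*}\in\mathcal L(H_k)$ for $k\in\{0,1,\dots,n-i+1\}$; $\|C_{i\,i-1}\|=\beta_i$ and $|C_{i\,i-1}w|^2\le\beta_i\langle C_{i\,i-1}w,w\rangle$ for all $w\in H$; there exists $\alpha_i>0$ such that $\alpha_i|\Pi_iw|^2\le\langle C_{i\,i-1}w,w\rangle$ for all $w\in H$. Coupling observability hypothesis of order $n$. For all $i\in\{2,\dots,n\}$: $\Pi_i\in\mathcal L(H)$ and there exists $T_{0,i}>0$ such that for all $T>T_{0,i}$ there exists $\gamma_i(T)>0$ such that all solutions $w$ of $w''+Aw=0$ satisfy $\int_0^T|\Pi_iw'|^2dt\ge\gamma_i(T)e_1(W)(0)$, where $W=(w,w')$. Admissibility hypothesis of index $n$. $G_n$ is a Hilbert space (identified with its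 dual), $\mathbf{B}_n^{*}\in\mathcal L(H_2\times H;G_n)$, and for all $T>0$ there exists $D_n(T)>0$ such that all solutions $w$ of $w''+Aw=f\in L^2([0,T];H)$ satisfy, with $W=(w,w')$, $$\int_0^T\|\mathbf{B}_n^{*}(w,w')\|_{G_n}^2dt\le D_n(T)\Big(e_1(W)(0)+e_1(W)(T)+\int_0^Te_1(W)(t)\,dt+\int_0^T|f|^2dt\Big).$$ For solutions of energy regularity ($(w,w')(0)\in H_1\times H$) the function $\mathbf{B}_n^{*}(w,w')\in L^2(0,T;G_n)$ is understood through the extension by density given by this inequality. Observability hypothesis of index $n$. There exists a time such that for all larger $T$ there exists $R_n(T)>0$ such that all solutions $w$ of $w''+Aw=0$ satisfy $\int_0^T\|\mathbf{B}_n^{*}(w,w')\|_{G_n}^2dt\ge R_n(T)e_1(W)(0)$. Minimal control time: the minimal control time $T_m$ under which an observability inequality holds is the minimal time for which the inequality (with some positive constant depending on $T$) holds for all $T>T_m$ and does not hold for $T<T_m$. Bi-diagonal cascade system of order $n$: $$u_1''+Au_1=0,\qquad u_i''+Au_i+C_{i\,i-1}u_{i-1}=0\quad(2\le i\le n),$$ with initial data $U^0=(u_1,\dots,u_n,u_1',\dots,u_n')(0)\in\mathcal H_n=H_1^n\times H^n$. For a solution, $U_i=(u_i,u_i')$. *)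

theory Defs
  imports "HOL-Analysis.Analysis"
begin

section \<open>The operator and its fractional powers\<close>

text \<open>A Hilbert space is a type of class \<open>{real_inner, complete_space}\<close>. Unbounded operators are
  given by a domain \<open>D\<close> and a function \<open>A\<close> whose values outside \<open>D\<close> are irrelevant.\<close>

definition linear_on_set :: "'a::real_vector set \<Rightarrow> ('a \<Rightarrow> 'b::real_vector) \<Rightarrow> bool" where
  "linear_on_set S f \<longleftrightarrow>
     (\<forall>x\<in>S. \<forall>y\<in>S. f (x + y) = f x + f y) \<and> (\<forall>c. \<forall>x\<in>S. f (c *\<^sub>R x) = c *\<^sub>R f x)"

text \<open>Densely defined, and the graph of the adjoint coincides with the graph of the operator.\<close>

definition self_adjoint_operator ::
    "'h::{real_inner,complete_space} set \<Rightarrow> ('h \<Rightarrow> 'h) \<Rightarrow> bool" where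
  "self_adjoint_operator D A \<longleftrightarrow>
     subspace D \<and> linear_on_set D A \<and> closure D = UNIV \<and>
     (\<forall>v z. (\<forall>u\<in>D. A u \<bullet> v = u \<bullet> z) \<longleftrightarrow> v \<in> D \<and> A v = z)"

text \<open>The set whose closure is taken is the image of the closed unit ball under
  \<open>(A - \<mu>)\<^sup>-\<^sup>1\<close>.\<close>

definition compact_resolvent ::
    "'h::{real_inner,complete_space} set \<Rightarrow> ('h \<Rightarrow> 'h) \<Rightarrow> bool" where
  "compact_resolvent D A \<longleftrightarrow>
     (\<exists>\<mu>::real. bij_betw (\<lambda>u. A u - \<mu> *\<^sub>R u) D UNIV \<and>
        compact (closure {u \<in> D. norm (A u - \<mu> *\<^sub>R u) \<le> 1}))"

definition abstract_setting ::
    "'h::{real_inner,complete_space} set \<Rightarrow> ('h \<Rightarrow> 'h) \<Rightarrow> bool" where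
  "abstract_setting D A \<longleftrightarrow>
     self_adjoint_operator D A \<and> (\<forall>u\<in>D. 0 \<le> A u \<bullet> u) \<and> compact_resolvent D A \<and>
     (\<exists>\<omega>>0. \<forall>u\<in>D. \<omega> * norm u \<le> norm (A u))"

definition eigenspace ::
    "'h::{real_inner,complete_space} set \<Rightarrow> ('h \<Rightarrow> 'h) \<Rightarrow> real \<Rightarrow> 'h set" where
  "eigenspace D A \<mu> = {u \<in> D. A u = \<mu> *\<^sub>R u}"

definition eigenvalues ::
    "'h::{real_inner,complete_space} set \<Rightarrow> ('h \<Rightarrow> 'h) \<Rightarrow> real set" where
  "eigenvalues D A = {\<mu>. \<exists>u\<in>eigenspace D A \<mu>. u \<noteq> 0}"

definition orth_proj :: "'h::{real_inner,complete_space} set \<Rightarrow> 'h \<Rightarrow> 'h" where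
  "orth_proj S x = (THE y. y \<in> S \<and> (\<forall>z\<in>S. (x - y) \<bullet> z = 0))"

text \<open>Functional calculus of a positive self-adjoint operator with compact resolvent:
  \<open>A\<^sup>s x = \<Sum>\<^sub>\<mu> \<mu>\<^sup>s P\<^sub>\<mu> x\<close>, the sum ranging over the (positive) eigenvalues and
  \<open>P\<^sub>\<mu>\<close> being the orthogonal projection onto the eigenspace.\<close>

definition op_powr ::
    "'h::{real_inner,complete_space} set \<Rightarrow> ('h \<Rightarrow> 'h) \<Rightarrow> real \<Rightarrow> 'h \<Rightarrow> 'h" where
  "op_powr D A s x =
     infsum (\<lambda>\<mu>. (\<mu> powr s) *\<^sub>R orth_proj (eigenspace D A \<mu>) x) (eigenvalues D A)"

definition dom_powr ::
    "'h::{real_inner,complete_space} set \<Rightarrow> ('h \<Rightarrow> 'h) \<Rightarrow> real \<Rightarrow> 'h set" where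
  "dom_powr D A s =
     {x. (\<lambda>\<mu>. (\<mu> powr s * norm (orth_proj (eigenspace D A \<mu>) x))\<^sup>2) summable_on eigenvalues D A}"

definition Hspace ::
    "'h::{real_inner,complete_space} set \<Rightarrow> ('h \<Rightarrow> 'h) \<Rightarrow> nat \<Rightarrow> 'h set" where
  "Hspace D A k = dom_powr D A (real k / 2)"

text \<open>The norm of \<open>H\<^sub>k\<close>. For negative \<open>k\<close> the space \<open>H\<^sub>k\<close> is a completion of \<open>H\<close>; its norm is
  only ever evaluated at elements of \<open>H\<close>, where it is again given by \<open>A\<^bsup>k/2\<^esup>\<close>.\<close>

definition Hnorm ::
    "'h::{real_inner,complete_space} set \<Rightarrow> ('h \<Rightarrow> 'h) \<Rightarrow> int \<Rightarrow> 'h \<Rightarrow> real" where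
  "Hnorm D A k x = norm (op_powr D A (of_int k / 2) x)"

definition energy ::
    "'h::{real_inner,complete_space} set \<Rightarrow> ('h \<Rightarrow> 'h) \<Rightarrow> int \<Rightarrow> 'h \<Rightarrow> 'h \<Rightarrow> real" where
  "energy D A k w w' = 1 / 2 * ((Hnorm D A k w)\<^sup>2 + (Hnorm D A (k - 1) w')\<^sup>2)"


section \<open>Solutions\<close>

text \<open>Bochner measurability (almost separably valued). All time integrals are Lebesgue integrals
  of real functions.\<close>

definition strongly_measurable :: "'t measure \<Rightarrow> ('t \<Rightarrow> 'b::real_normed_vector) \<Rightarrow> bool" where
  "strongly_measurable M f \<longleftrightarrow>
     f \<in> borel_measurable M \<and> (\<exists>S. countable S \<and> (AE t in M. f t \<in> closure S))"

definition L2_fun :: "real \<Rightarrow> (real \<Rightarrow> 'b::real_normed_vector) \<Rightarrow> bool" where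
  "L2_fun T f \<longleftrightarrow>
     strongly_measurable (lebesgue_on {0..T}) f \<and>
     integrable (lebesgue_on {0..T}) (\<lambda>t. (norm (f t))\<^sup>2)"

text \<open>Continuity from \<open>[0,T]\<close> into \<open>H\<^sub>k\<close> with its norm.\<close>

definition continuous_into ::
    "'h::{real_inner,complete_space} set \<Rightarrow> ('h \<Rightarrow> 'h) \<Rightarrow> nat \<Rightarrow> real \<Rightarrow> (real \<Rightarrow> 'h) \<Rightarrow> bool" where
  "continuous_into D A k T w \<longleftrightarrow>
     (\<forall>t\<in>{0..T}. w t \<in> Hspace D A k) \<and>
     (\<forall>t\<in>{0..T}. ((\<lambda>s. Hnorm D A (int k) (w s - w t)) \<longlongrightarrow> 0) (at t within {0..T}))"

text \<open>Finite energy (weak, equivalently mild) solutions of \<open>w'' + A w = f\<close> on \<open>[0,T]\<close>: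
  \<open>w \<in> C([0,T];H\<^sub>1) \<inter> C\<^sup>1([0,T];H)\<close>, the equation being tested against \<open>D(A)\<close> and
  integrated once in time. The second function is the derivative of the first.\<close>

definition wave_solution ::
    "'h::{real_inner,complete_space} set \<Rightarrow> ('h \<Rightarrow> 'h) \<Rightarrow> real \<Rightarrow> (real \<Rightarrow> 'h) \<Rightarrow>
     (real \<Rightarrow> 'h) \<Rightarrow> (real \<Rightarrow> 'h) \<Rightarrow> bool" where
  "wave_solution D A T f w w' \<longleftrightarrow>
     L2_fun T f \<and>
     continuous_into D A 1 T w \<and> continuous_on {0..T} w' \<and>
     (\<forall>t\<in>{0..T}. (w has_vector_derivative w' t) (at t within {0..T})) \<and>
     (\<forall>\<phi>\<in>D. \<forall>t\<in>{0..T}.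
        w' t \<bullet> \<phi> = w' 0 \<bullet> \<phi> + (LINT s|lebesgue_on {0..t}. f s \<bullet> \<phi> - w s \<bullet> A \<phi>))"

text \<open>Solutions along which an observation operator defined on \<open>H\<^sub>2 \<times> H\<close> can be evaluated
  pointwise in time.\<close>

definition regular_wave_solution ::
    "'h::{real_inner,complete_space} set \<Rightarrow> ('h \<Rightarrow> 'h) \<Rightarrow> real \<Rightarrow> (real \<Rightarrow> 'h) \<Rightarrow>
     (real \<Rightarrow> 'h) \<Rightarrow> (real \<Rightarrow> 'h) \<Rightarrow> bool" where
  "regular_wave_solution D A T f w w' \<longleftrightarrow>
     wave_solution D A T f w w' \<and> continuous_into D A 2 T w"

text \<open>\<open>C i\<close> stands for the coupling operator with indices \<open>i\<close> and \<open>i - 1\<close>; the components of the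
  system are \<open>u i\<close>, with velocities \<open>u' i\<close>, for \<open>1 \<le> i \<le> n\<close>.\<close>

definition cascade_solution ::
    "'h::{real_inner,complete_space} set \<Rightarrow> ('h \<Rightarrow> 'h) \<Rightarrow> nat \<Rightarrow> (nat \<Rightarrow> 'h \<Rightarrow> 'h) \<Rightarrow> real \<Rightarrow>
     (nat \<Rightarrow> real \<Rightarrow> 'h) \<Rightarrow> (nat \<Rightarrow> real \<Rightarrow> 'h) \<Rightarrow> bool" where
  "cascade_solution D A n C T u u' \<longleftrightarrow>
     wave_solution D A T (\<lambda>_. 0) (u 1) (u' 1) \<and>
     (\<forall>i\<in>{2..n}. wave_solution D A T (\<lambda>t. - C i (u (i - 1) t)) (u i) (u' i))"


section \<open>Observation operators\<close>

definition bounded_observation ::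
    "'h::{real_inner,complete_space} set \<Rightarrow> ('h \<Rightarrow> 'h) \<Rightarrow>
     ('h \<times> 'h \<Rightarrow> 'g::{real_inner,complete_space}) \<Rightarrow> bool" where
  "bounded_observation D A B \<longleftrightarrow>
     linear_on_set (Hspace D A 2 \<times> UNIV) B \<and>
     (\<exists>K. \<forall>x\<in>Hspace D A 2. \<forall>y. norm (B (x, y)) \<le> K * sqrt ((Hnorm D A 2 x)\<^sup>2 + (norm y)\<^sup>2))"

definition admissible ::
    "'h::{real_inner,complete_space} set \<Rightarrow> ('h \<Rightarrow> 'h) \<Rightarrow>
     ('h \<times> 'h \<Rightarrow> 'g::{real_inner,complete_space}) \<Rightarrow> bool" where
  "admissible D A B \<longleftrightarrow>
     bounded_observation D A B \<and>
     (\<forall>T>0. \<exists>K>0. \<forall>f w w'. regular_wave_solution D A T f w w' \<longrightarrow>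
        (LINT t|lebesgue_on {0..T}. (norm (B (w t, w' t)))\<^sup>2)
          \<le> K * (energy D A 1 (w 0) (w' 0) + energy D A 1 (w T) (w' T)
                  + (LINT t|lebesgue_on {0..T}. energy D A 1 (w t) (w' t))
                  + (LINT t|lebesgue_on {0..T}. (norm (f t))\<^sup>2)))"

text \<open>\<open>g\<close> is the function \<open>B(w,w')\<close> in \<open>L\<^sup>2(0,T;G)\<close> for a finite energy solution \<open>w\<close> of
  \<open>w'' + A w = f\<close>: the limit of the observations of regular solutions whose initial data and
  right-hand sides approximate those of \<open>w\<close>. If \<open>B\<close> is admissible, such a \<open>g\<close> exists and is unique
  up to null sets.\<close>

definition is_observation ::
    "'h::{real_inner,complete_space} set \<Rightarrow> ('h \<Rightarrow> 'h) \<Rightarrow>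
     ('h \<times> 'h \<Rightarrow> 'g::{real_inner,complete_space}) \<Rightarrow> real \<Rightarrow> (real \<Rightarrow> 'h) \<Rightarrow>
     (real \<Rightarrow> 'h) \<Rightarrow> (real \<Rightarrow> 'h) \<Rightarrow> (real \<Rightarrow> 'g) \<Rightarrow> bool" where
  "is_observation D A B T f w w' g \<longleftrightarrow>
     wave_solution D A T f w w' \<and> L2_fun T g \<and>
     (\<exists>F W W'. (\<forall>k::nat. regular_wave_solution D A T (F k) (W k) (W' k)) \<and>
        (\<lambda>k. energy D A 1 (W k 0 - w 0) (W' k 0 - w' 0)) \<longlonglongrightarrow> 0 \<and>
        (\<lambda>k. LINT t|lebesgue_on {0..T}. (norm (F k t - f t))\<^sup>2) \<longlonglongrightarrow> 0 \<and>
        (\<lambda>k. LINT t|lebesgue_on {0..T}. (norm (B (W k t, W' k t) - g t))\<^sup>2) \<longlonglongrightarrow> 0)"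

definition observability_inequality ::
    "'h::{real_inner,complete_space} set \<Rightarrow> ('h \<Rightarrow> 'h) \<Rightarrow>
     ('h \<times> 'h \<Rightarrow> 'g::{real_inner,complete_space}) \<Rightarrow> real \<Rightarrow> bool" where
  "observability_inequality D A B T \<longleftrightarrow>
     (\<exists>R>0. \<forall>w w'. wave_solution D A T (\<lambda>_. 0) w w' \<longrightarrow>
        (\<exists>g. is_observation D A B T (\<lambda>_. 0) w w' g \<and>
           (LINT t|lebesgue_on {0..T}. (norm (g t))\<^sup>2) \<ge> R * energy D A 1 (w 0) (w' 0)))"

definition observability_hypothesis ::
    "'h::{real_inner,complete_space} set \<Rightarrow> ('h \<Rightarrow> 'h) \<Rightarrow>
     ('h \<times> 'h \<Rightarrow> 'g::{real_inner,complete_space}) \<Rightarrow> bool" where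
  "observability_hypothesis D A B \<longleftrightarrow> (\<exists>T0>0. \<forall>T>T0. observability_inequality D A B T)"


section \<open>Coupling operators\<close>

definition bounded_on_Hspace ::
    "'h::{real_inner,complete_space} set \<Rightarrow> ('h \<Rightarrow> 'h) \<Rightarrow> nat \<Rightarrow> ('h \<Rightarrow> 'h) \<Rightarrow> bool" where
  "bounded_on_Hspace D A k L \<longleftrightarrow>
     linear_on_set (Hspace D A k) L \<and>
     (\<exists>K. \<forall>x\<in>Hspace D A k. L x \<in> Hspace D A k \<and> Hnorm D A (int k) (L x) \<le> K * Hnorm D A (int k) x)"

definition coupling_hypothesis ::
    "'h::{real_inner,complete_space} set \<Rightarrow> ('h \<Rightarrow> 'h) \<Rightarrow> nat \<Rightarrow>
     (nat \<Rightarrow> 'h \<Rightarrow> 'h) \<Rightarrow> (nat \<Rightarrow> 'h \<Rightarrow> 'h) \<Rightarrow> bool" where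
  "coupling_hypothesis D A n C P \<longleftrightarrow>
     (\<forall>i\<in>{2..n}.
        bounded_linear (C i) \<and>
        (\<forall>k\<in>{0..n - i + 1}. bounded_on_Hspace D A k (adjoint (C i))) \<and>
        (\<forall>w. (norm (C i w))\<^sup>2 \<le> onorm (C i) * (C i w \<bullet> w)) \<and>
        (\<exists>\<alpha>>0. \<forall>w. \<alpha> * (norm (P i w))\<^sup>2 \<le> C i w \<bullet> w))"

definition coupling_observability_inequality ::
    "'h::{real_inner,complete_space} set \<Rightarrow> ('h \<Rightarrow> 'h) \<Rightarrow> ('h \<Rightarrow> 'h) \<Rightarrow> real \<Rightarrow> bool" where
  "coupling_observability_inequality D A P T \<longleftrightarrow>
     (\<exists>\<gamma>>0. \<forall>w w'. wave_solution D A T (\<lambda>_. 0) w w' \<longrightarrow>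
        (LINT t|lebesgue_on {0..T}. (norm (P (w' t)))\<^sup>2) \<ge> \<gamma> * energy D A 1 (w 0) (w' 0))"

definition coupling_observability_hypothesis ::
    "'h::{real_inner,complete_space} set \<Rightarrow> ('h \<Rightarrow> 'h) \<Rightarrow> nat \<Rightarrow> (nat \<Rightarrow> 'h \<Rightarrow> 'h) \<Rightarrow> bool" where
  "coupling_observability_hypothesis D A n P \<longleftrightarrow>
     (\<forall>i\<in>{2..n}. bounded_linear (P i) \<and>
        (\<exists>T0>0. \<forall>T>T0. coupling_observability_inequality D A (P i) T))"


section \<open>Observability of the cascade and minimal times\<close>

definition cascade_observable_after ::
    "'h::{real_inner,complete_space} set \<Rightarrow> ('h \<Rightarrow> 'h) \<Rightarrow> nat \<Rightarrow> (nat \<Rightarrow> 'h \<Rightarrow> 'h) \<Rightarrow>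
     ('h \<times> 'h \<Rightarrow> 'g::{real_inner,complete_space}) \<Rightarrow> real \<Rightarrow> bool" where
  "cascade_observable_after D A n C B Tstar \<longleftrightarrow>
     (\<forall>T>Tstar. \<exists>c>0. \<forall>u0 u0'. (\<forall>i\<in>{1..n}. u0 i \<in> Hspace D A 1) \<longrightarrow>
        (\<forall>u u'. cascade_solution D A n C T u u' \<and> (\<forall>i\<in>{1..n}. u i 0 = u0 i \<and> u' i 0 = u0' i) \<longrightarrow>
           (\<exists>g. is_observation D A B T (\<lambda>t. - C n (u (n - 1) t)) (u n) (u' n) g \<and>
              c * (\<Sum>i=1..n. energy D A (1 + int i - int n) (u i 0) (u' i 0))
                \<le> (LINT t|lebesgue_on {0..T}. (norm (g t))\<^sup>2))))"

text \<open>\<open>P T\<close> states that an observability inequality holds on the time interval \<open>[0,T]\<close>.\<close>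

definition is_minimal_control_time :: "(real \<Rightarrow> bool) \<Rightarrow> real \<Rightarrow> bool" where
  "is_minimal_control_time P Tm \<longleftrightarrow> 0 \<le> Tm \<and> (\<forall>T>Tm. P T) \<and> (\<forall>T. 0 < T \<and> T < Tm \<longrightarrow> \<not> P T)"

definition minimal_control_time :: "(real \<Rightarrow> bool) \<Rightarrow> real" where
  "minimal_control_time P = (THE Tm. is_minimal_control_time P Tm)"

lemma minimal_control_time_eqI:
  assumes "is_minimal_control_time P Tm"
  shows "minimal_control_time P = Tm"
  unfolding minimal_control_time_def
proof (rule the_equality[of "is_minimal_control_time P", OF assms])
  fix S assume S: "is_minimal_control_time P S"
  have False if "a < b" "is_minimal_control_time P a" "is_minimal_control_time P b" for a b
  proof -
    have "a < (a + b) / 2" "(a + b) / 2 < b" "0 < (a + b) / 2"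
      using that by (auto simp: is_minimal_control_time_def)
    then show False
      using that(2,3) unfolding is_minimal_control_time_def by blast
  qed
  then show "S = Tm"
    using S assms by (meson linorder_neqE_linordered_idom)
qed

end

theory Submission
  imports Defs
begin

text \<open>
  Write a wave \<open>w\<close> through \<open>z = A\<^bsup>1/2\<^esup> w\<close> and \<open>y = w'\<close>, and put \<open>G = A\<^bsup>-1/2\<^esup>\<close>, a bounded operator.
  The energy of index \<open>1 - m\<close> is then half the squared norm of \<open>(G\<^bsup>m\<^esup> z, G\<^bsup>m\<^esup> y)\<close>, and the
  primitive in time of a free wave \<open>(z, y)\<close> is \<open>(- G y, G z)\<close>, so integrating in time climbs the scale.

  Sufficiency: peel the components off from \<open>u\<^sub>n\<close> down to \<open>u\<^sub>1\<close>. If \<open>u\<^bsub>j+1\<^esub>, \<dots>, u\<^sub>n\<close> are observable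
  on a short window when \<open>u\<^sub>j = 0\<close>, then by superposition their energies at both ends of a long interval are
  bounded by the observation plus a multiple of the conserved energy of \<open>u\<^sub>j\<close>. Pairing suitable
  primitives of \<open>u\<^sub>j\<close> and \<open>u\<^bsub>j+1\<^esub>\<close> expresses \<open>\<integral>\<langle>C v, v\<rangle>\<close> by boundary terms. The integral grows
  linearly with the length of the interval while the constants in the boundary terms do not depend on it.

  Necessity: starting all components but \<open>u\<^bsub>i-1\<^esub>\<close> at rest gives observability by \<open>C\<^bsub>i i-1\<^esub>\<close> in the
  level \<open>H\<^bsub>-(n-i)\<^esub>\<close>. For waves that are many times differentiable in time, level \<open>0\<close> is reached one
  step at a time, by integrations by parts in time, each of which shortens the observation interval by an
  arbitrarily small amount.
\<close>


section \<open>Hilbert space preliminaries\<close>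

text \<open>The levels are dictated by the coupling. In the variable \<open>z\<close> the source of
  component \<open>i\<close> is \<open>C i\<close> applied to \<open>G z\<close> of component
  \<open>i - 1\<close>. A bound of \<open>C i\<close> at level \<open>n - i\<close> thus turns
  control of component \<open>i - 1\<close> at level \<open>n - i + 1\<close> into control of the
  source at level \<open>n - i\<close>. One level is exchanged per equation, and component
  \<open>n\<close> sits at level 0, the one at which admissibility speaks; hence the weights
  \<open>1 + i - n\<close>. The obstacle in the necessity part is that \<open>C i\<close> need not
  commute with \<open>G\<close>, so an inequality in a weak norm cannot be lifted by applying a
  power of \<open>A\<close>. Differentiation in time does commute with \<open>C i\<close>, and on
  free waves it shifts the scale as the square root of \<open>A\<close> would; levels are therefore
  traded for time derivatives. Two devices keep unbounded operators away: the equations are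
  multiplied by the bounded \<open>G\<close>, and every identity that needs a genuine time
  derivative is proved for finite spectral truncations and passed to the limit. Observations enter
  only through the number \<open>Obs\<close>, the limit of the squared norms of truncated
  observations.\<close>

lemma hilbert_projection:
  fixes S :: "'h::{real_inner,complete_space} set"
  assumes S: "subspace S" "closed S"
  obtains y where "y \<in> S" "\<forall>z\<in>S. (x - y) \<bullet> z = 0"
proof -
  define Q where "Q = (\<lambda>z. (norm (x - z))\<^sup>2) ` S"
  define d where "d = Inf Q"
  have ne: "Q \<noteq> {}" unfolding Q_def using subspace_0[OF S(1)] by blast
  have bd: "bdd_below Q" unfolding Q_def by (rule bdd_belowI[of _ 0]) auto
  have low: "d \<le> (norm (x - z))\<^sup>2" if "z \<in> S" for z
    unfolding d_def by (rule cInf_lower[OF _ bd]) (use that in \<open>auto simp: Q_def\<close>)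
  have "\<exists>z\<in>S. (norm (x - z))\<^sup>2 < d + 1 / real (Suc k)" for k
  proof -
    have "Inf Q < d + 1 / real (Suc k)" unfolding d_def by simp
    from cInf_lessD[OF ne this] show ?thesis unfolding Q_def by auto
  qed
  then obtain Y where Y: "\<And>k. Y k \<in> S" "\<And>k. (norm (x - Y k))\<^sup>2 < d + 1 / real (Suc k)"
    by metis
  \<comment> \<open>Parallelogram identity: the midpoint of two near minimisers lies in
    \<open>S\<close>, so its squared distance to \<open>x\<close> is at least
    \<open>d\<close>.\<close>
  have close: "(norm (Y k - Y l))\<^sup>2 \<le> 2 / real (Suc k) + 2 / real (Suc l)" for k l
  proof -
    have "(1/2) *\<^sub>R (Y k + Y l) \<in> S"
      using Y S(1) by (simp add: subspace_add subspace_scale)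
    from low[OF this] have "4 * d \<le> 4 * (norm (x - (1/2) *\<^sub>R (Y k + Y l)))\<^sup>2" by simp
    also have "\<dots> = 2 * (norm (x - Y k))\<^sup>2 + 2 * (norm (x - Y l))\<^sup>2 - (norm (Y k - Y l))\<^sup>2"
      unfolding power2_norm_eq_inner
      by (simp add: inner_diff_left inner_diff_right inner_add_left inner_add_right inner_commute)
    finally show ?thesis using Y(2)[of k] Y(2)[of l] by simp
  qed
  have "Cauchy Y"
  proof (rule metric_CauchyI)
    fix e :: real assume e: "e > 0"
    obtain N where N: "4 / e\<^sup>2 < real N" using reals_Archimedean2 by blast
    have "dist (Y k) (Y l) < e" if "k \<ge> N" "l \<ge> N" for k l
    proof -
      have N0: "0 < real N" using N e by (smt (verit) divide_nonneg_nonneg zero_le_power2)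
      have "2 / real (Suc k) + 2 / real (Suc l) \<le> 2 / real (Suc N) + 2 / real (Suc N)"
        by (intro add_mono divide_left_mono) (use that in auto)
      also have "\<dots> = 4 / real (Suc N)" by simp
      also have "\<dots> < 4 / real N" using N0 by (intro divide_strict_left_mono) auto
      also have "\<dots> < e\<^sup>2" using N N0 e by (simp add: field_simps)
      finally have "(norm (Y k - Y l))\<^sup>2 < e\<^sup>2" using close[of k l] by simp
      then show ?thesis using e by (simp add: dist_norm power2_less_imp_less)
    qed
    then show "\<exists>M. \<forall>m\<ge>M. \<forall>n\<ge>M. dist (Y m) (Y n) < e" by blast
  qed
  then obtain y where y: "Y \<longlonglongrightarrow> y" using Cauchy_convergent convergent_def by blast
  have yS: "y \<in> S" using closed_sequentially[OF S(2) _ y] Y(1) by auto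
  have "(\<lambda>k. (norm (x - Y k))\<^sup>2) \<longlonglongrightarrow> (norm (x - y))\<^sup>2" by (intro tendsto_intros y)
  moreover have "(\<lambda>k. d + 1 / real (Suc k)) \<longlonglongrightarrow> d + 0"
    by (intro tendsto_intros LIMSEQ_Suc[OF lim_const_over_n])
  ultimately have "(norm (x - y))\<^sup>2 \<le> d + 0"
    by (rule LIMSEQ_le) (use Y(2) in \<open>auto intro: less_imp_le\<close>)
  then have min: "(norm (x - y))\<^sup>2 \<le> (norm (x - y - z))\<^sup>2" if "z \<in> S" for z
    using order_trans[OF _ low[of "y + z"], of "(norm (x - y))\<^sup>2"] that yS S(1)
    by (simp add: subspace_add diff_diff_eq)
  have "(x - y) \<bullet> z = 0" if z: "z \<in> S" for z
  proof (cases "z = 0")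
    case False
    \<comment> \<open>The minimiser in \<open>t\<close> of the distance from \<open>x\<close> to
      \<open>y + t z\<close>; it would beat \<open>y\<close> unless the inner product
      vanishes.\<close>
    define t where "t = ((x - y) \<bullet> z) / (z \<bullet> z)"
    have zz: "z \<bullet> z > 0" using False by simp
    have "(norm (x - y))\<^sup>2 \<le> (norm (x - y - t *\<^sub>R z))\<^sup>2"
      using z S(1) by (intro min) (simp add: subspace_scale)
    also have "\<dots> = (norm (x - y))\<^sup>2 - 2 * t * ((x - y) \<bullet> z) + t\<^sup>2 * (z \<bullet> z)"
      unfolding power2_norm_eq_inner
      by (simp add: inner_diff_left inner_diff_right inner_commute power2_eq_square algebra_simps)
    also have "\<dots> = (norm (x - y))\<^sup>2 - ((x - y) \<bullet> z)\<^sup>2 / (z \<bullet> z)"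
      using zz unfolding t_def by (simp add: field_simps power2_eq_square)
    finally have "((x - y) \<bullet> z)\<^sup>2 / (z \<bullet> z) \<le> 0" by simp
    then show ?thesis using zz by (simp add: divide_le_0_iff)
  qed simp
  with yS that show thesis by blast
qed

lemma orth_proj_unique:
  fixes S :: "'h::{real_inner,complete_space} set"
  assumes "subspace S" "y \<in> S" "\<forall>z\<in>S. (x - y) \<bullet> z = 0"
  shows "orth_proj S x = y"
  unfolding orth_proj_def
proof (rule the_equality)
  show "y \<in> S \<and> (\<forall>z\<in>S. (x - y) \<bullet> z = 0)" using assms by blast
  fix y' assume y': "y' \<in> S \<and> (\<forall>z\<in>S. (x - y') \<bullet> z = 0)"
  have "y' - y \<in> S" using assms y' by (simp add: subspace_diff)
  then have "(x - y) \<bullet> (y' - y) - (x - y') \<bullet> (y' - y) = 0" using assms y' by simp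
  then have "(y' - y) \<bullet> (y' - y) = 0" by (simp add: inner_diff_left)
  then show "y' = y" by simp
qed

context
  fixes S :: "'h::{real_inner,complete_space} set"
  assumes S: "subspace S" "closed S"
begin

lemma orth_proj_in: "orth_proj S x \<in> S"
  and orth_proj_orthogonal: "z \<in> S \<Longrightarrow> (x - orth_proj S x) \<bullet> z = 0"
proof -
  obtain y where "y \<in> S" "\<forall>z\<in>S. (x - y) \<bullet> z = 0" using hilbert_projection[OF S] by blast
  then show "orth_proj S x \<in> S" "z \<in> S \<Longrightarrow> (x - orth_proj S x) \<bullet> z = 0"
    using orth_proj_unique[OF S(1)] by auto
qed

lemma orth_proj_inner: "z \<in> S \<Longrightarrow> orth_proj S x \<bullet> z = x \<bullet> z"
  using orth_proj_orthogonal[of z x] by (simp add: inner_diff_left)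

lemma orth_proj_self: "x \<in> S \<Longrightarrow> orth_proj S x = x"
  by (rule orth_proj_unique[OF S(1)]) auto

lemma norm_orth_proj_le: "norm (orth_proj S x) \<le> norm x"
proof -
  have "norm (orth_proj S x) * norm (orth_proj S x) = x \<bullet> orth_proj S x"
    using orth_proj_inner[OF orth_proj_in, of x x]
    by (simp add: power2_norm_eq_inner flip: power2_eq_square)
  also have "\<dots> \<le> norm x * norm (orth_proj S x)" by (rule norm_cauchy_schwarz)
  finally show ?thesis
    by (cases "orth_proj S x = 0") auto
qed

lemma bounded_linear_orth_proj: "bounded_linear (orth_proj S)"
proof (rule bounded_linear_intro[of _ 1])
  show "orth_proj S (x + y) = orth_proj S x + orth_proj S y" for x y
    by (rule orth_proj_unique[OF S(1)])
       (use S orth_proj_in in \<open>auto simp: subspace_add inner_diff_left inner_add_left orth_proj_inner\<close>)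
  show "orth_proj S (c *\<^sub>R x) = c *\<^sub>R orth_proj S x" for c x
    by (rule orth_proj_unique[OF S(1)])
       (use S orth_proj_in in \<open>auto simp: subspace_scale inner_diff_left orth_proj_inner\<close>)
  show "norm (orth_proj S x) \<le> norm x * 1" for x using norm_orth_proj_le[of x] by simp
qed

lemma orth_proj_symmetric: "orth_proj S x \<bullet> y = x \<bullet> orth_proj S y"
  by (metis inner_commute orth_proj_in orth_proj_inner)

end

section \<open>Riesz representation and adjoints\<close>

lemma riesz_representation:
  fixes f :: "'h::{real_inner,complete_space} \<Rightarrow> real"
  assumes "bounded_linear f"
  shows "\<exists>a. \<forall>x. f x = a \<bullet> x"
proof (cases "\<forall>x. f x = 0")
  case True
  then show ?thesis by (intro exI[of _ 0]) simp
next
  case False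
  interpret bounded_linear f by fact
  obtain x0 where x0: "f x0 \<noteq> 0" using False by blast
  define S where "S = {x. f x = 0}"
  have "subspace S" unfolding S_def subspace_def by (simp add: add scaleR)
  moreover have "closed S"
    unfolding S_def by (intro closed_Collect_eq continuous_intros linear_continuous_on[OF assms])
  ultimately obtain y where y: "y \<in> S" "\<forall>z\<in>S. (x0 - y) \<bullet> z = 0"
    using hilbert_projection by blast
  define e where "e = x0 - y"
  have fe: "f e = f x0" using y(1) by (simp add: e_def S_def diff)
  then have e0: "e \<noteq> 0" using x0 by auto
  have "f x = ((f e / (e \<bullet> e)) *\<^sub>R e) \<bullet> x" for x
  proof -
    have "x - (f x / f e) *\<^sub>R e \<in> S" using x0 fe by (simp add: S_def diff scaleR)
    then have "e \<bullet> (x - (f x / f e) *\<^sub>R e) = 0" using y(2) e_def by blast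
    then have "e \<bullet> x = f x / f e * (e \<bullet> e)" by (simp add: inner_diff_right)
    then show ?thesis using x0 fe e0 by simp
  qed
  then show ?thesis by blast
qed

text \<open>\<open>adjoint\<close> is a choice among the maps satisfying this relation, so it
  suffices that one exists; representing the functional \<open>\<lambda>x. f x \<bullet> y\<close>
  supplies its value at each \<open>y\<close>.\<close>

lemma adjoint_inner:
  fixes f :: "'h::{real_inner,complete_space} \<Rightarrow> 'h"
  assumes "bounded_linear f"
  shows "f x \<bullet> y = x \<bullet> adjoint f y"
proof -
  interpret bounded_linear f by fact
  have "\<exists>a. \<forall>x. f x \<bullet> y = x \<bullet> a" for y
  proof -
    have "bounded_linear (\<lambda>x. f x \<bullet> y)"
      by (rule bounded_linear_compose[OF bounded_linear_inner_left assms])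
    from riesz_representation[OF this] obtain a where "\<forall>x. f x \<bullet> y = a \<bullet> x" by blast
    then have "\<forall>x. f x \<bullet> y = x \<bullet> a" by (simp add: inner_commute)
    then show ?thesis by blast
  qed
  then have "\<exists>g. \<forall>x y. f x \<bullet> y = x \<bullet> g y" by metis
  then show ?thesis unfolding adjoint_def by (rule someI2_ex) blast
qed

lemma inner_ext:
  fixes x y :: "'a::real_inner"
  assumes "\<And>z. x \<bullet> z = y \<bullet> z"
  shows "x = y"
  using assms[of "x - y"] by (metis eq_iff_diff_eq_0 inner_diff_left inner_eq_zero_iff)

section \<open>Derivatives and primitives of functions with values in a Hilbert space\<close>

lemma continuous_on_Icc_bounded:
  fixes f :: "real \<Rightarrow> 'a::real_normed_vector"
  assumes "continuous_on {a..b} f"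
  shows "\<exists>K>0. \<forall>t\<in>{a..b}. norm (f t) \<le> K"
proof -
  have "bounded (f ` {a..b})"
    by (intro compact_imp_bounded compact_continuous_image assms compact_Icc)
  then obtain K where "K > 0" "\<forall>x\<in>f ` {a..b}. norm x \<le> K" unfolding bounded_pos by blast
  then show ?thesis by (intro exI[of _ K]) auto
qed

text \<open>Test against the remainder itself: with \<psi> the error of the linear approximation,
  the scalar mean value inequality bounds \<open>\<psi> \<bullet> \<psi>\<close> by
  \<open>norm \<psi>\<close> times a small multiple of the step, and one factor cancels. Continuity
  of \<open>q\<close> in norm makes the smallness independent of the direction \<psi>.\<close>

lemma weak_imp_vector_derivative:
  fixes p q :: "real \<Rightarrow> 'a::real_inner"
  assumes q: "continuous_on {a..b} q" and t: "t \<in> {a..b}"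
    and weak: "\<And>s \<psi>. s \<in> {a..b} \<Longrightarrow>
      ((\<lambda>s. p s \<bullet> \<psi>) has_vector_derivative q s \<bullet> \<psi>) (at s within {a..b})"
  shows "(p has_vector_derivative q t) (at t within {a..b})"
  unfolding has_vector_derivative_def has_derivative_within_alt
proof (intro conjI allI impI bounded_linear_scaleR_left)
  fix e :: real assume e: "e > 0"
  obtain d where d: "d > 0" "\<And>s. s \<in> {a..b} \<Longrightarrow> dist s t < d \<Longrightarrow> dist (q s) (q t) < e"
    using q t e unfolding continuous_on_iff by meson
  have "norm (p y - p t - (y - t) *\<^sub>R q t) \<le> e * norm (y - t)"
    if y: "y \<in> {a..b}" "norm (y - t) < d" for y
  proof -
    define \<psi> where "\<psi> = p y - p t - (y - t) *\<^sub>R q t"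
    define I where "I = closed_segment t y"
    have I: "I \<subseteq> {a..b}" unfolding I_def using t y by (auto simp: closed_segment_eq_real_ivl)
    have "norm ((\<lambda>s. p s \<bullet> \<psi> - s * (q t \<bullet> \<psi>)) y - (\<lambda>s. p s \<bullet> \<psi> - s * (q t \<bullet> \<psi>)) t)
        \<le> (e * norm \<psi>) * norm (y - t)"
    proof (rule differentiable_bound[of I _ "\<lambda>s h. h * (q s \<bullet> \<psi> - q t \<bullet> \<psi>)"])
      show "convex I" "y \<in> I" "t \<in> I" unfolding I_def by auto
      fix s assume s: "s \<in> I"
      have "((\<lambda>s. p s \<bullet> \<psi>) has_derivative (\<lambda>h. h *\<^sub>R (q s \<bullet> \<psi>))) (at s within I)"
        using weak[of s \<psi>] I s unfolding has_vector_derivative_def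
        by (meson has_derivative_subset subsetD)
      moreover have "((\<lambda>s. s * (q t \<bullet> \<psi>)) has_derivative (\<lambda>h. h * (q t \<bullet> \<psi>))) (at s within I)"
        by (auto intro!: derivative_eq_intros)
      ultimately show "((\<lambda>s. p s \<bullet> \<psi> - s * (q t \<bullet> \<psi>)) has_derivative
          (\<lambda>h. h * (q s \<bullet> \<psi> - q t \<bullet> \<psi>))) (at s within I)"
        by (simp add: right_diff_distrib has_derivative_diff)
      have "dist s t < d" using s y(2) unfolding I_def
        by (auto simp: closed_segment_eq_real_ivl dist_real_def split: if_splits)
      then have "norm (q s - q t) \<le> e" using d(2) s I by (metis dist_norm less_imp_le subsetD)
      moreover have "\<bar>q s \<bullet> \<psi> - q t \<bullet> \<psi>\<bar> \<le> norm (q s - q t) * norm \<psi>"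
        by (metis Cauchy_Schwarz_ineq2 inner_diff_left)
      ultimately have "\<bar>q s \<bullet> \<psi> - q t \<bullet> \<psi>\<bar> \<le> e * norm \<psi>"
        by (meson mult_right_mono norm_ge_zero order_trans)
      then show "onorm (\<lambda>h. h * (q s \<bullet> \<psi> - q t \<bullet> \<psi>)) \<le> e * norm \<psi>"
        by (intro onorm_bound) (use e in \<open>auto simp: abs_mult mult.commute mult_left_mono\<close>)
    qed
    moreover have "(\<lambda>s. p s \<bullet> \<psi> - s * (q t \<bullet> \<psi>)) y - (\<lambda>s. p s \<bullet> \<psi> - s * (q t \<bullet> \<psi>)) t = \<psi> \<bullet> \<psi>"
      unfolding \<psi>_def by (simp add: inner_diff_left inner_diff_right algebra_simps)
    ultimately have "norm \<psi> * norm \<psi> \<le> norm \<psi> * (e * norm (y - t))"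
      by (simp add: power2_norm_eq_inner ac_simps flip: power2_eq_square)
    then show ?thesis unfolding \<psi>_def[symmetric]
      by (cases "\<psi> = 0") (use e in auto)
  qed
  then show "\<exists>d>0. \<forall>y\<in>{a..b}. norm (y - t) < d \<longrightarrow>
      norm (p y - p t - (y - t) *\<^sub>R q t) \<le> e * norm (y - t)"
    using d(1) by blast
qed

lemma bounded_linear_integral_inner:
  fixes q :: "real \<Rightarrow> 'a::real_inner"
  assumes q: "continuous_on {a..b} q"
  shows "bounded_linear (\<lambda>\<psi>. integral {a..b} (\<lambda>r. q r \<bullet> \<psi>))"
proof (cases "a \<le> b")
  case True
  obtain K where K: "K > 0" "\<forall>r\<in>{a..b}. norm (q r) \<le> K"
    using continuous_on_Icc_bounded[OF q] by blast
  have cq: "continuous_on {a..b} (\<lambda>r. q r \<bullet> \<psi>)" for \<psi>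
    by (intro continuous_intros q)
  show ?thesis
  proof (rule bounded_linear_intro[of _ "K * (b - a)"])
    show "integral {a..b} (\<lambda>r. q r \<bullet> (x + y))
        = integral {a..b} (\<lambda>r. q r \<bullet> x) + integral {a..b} (\<lambda>r. q r \<bullet> y)" for x y
      unfolding inner_add_right by (intro integral_add integrable_continuous_interval cq)
    show "norm (integral {a..b} (\<lambda>r. q r \<bullet> \<psi>)) \<le> norm \<psi> * (K * (b - a))" for \<psi>
    proof -
      have "norm (integral {a..b} (\<lambda>r. q r \<bullet> \<psi>)) \<le> (norm \<psi> * K) * (b - a)"
      proof (rule integral_bound[OF True cq])
        show "norm (q r \<bullet> \<psi>) \<le> norm \<psi> * K" if "r \<in> {a..b}" for r
        proof -
          have "norm (q r) * norm \<psi> \<le> K * norm \<psi>"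
            using K(2) that by (intro mult_right_mono) auto
          then show ?thesis
            using Cauchy_Schwarz_ineq2[of "q r" \<psi>] by (simp add: mult.commute)
        qed
      qed
      then show ?thesis by (simp add: ac_simps)
    qed
  qed simp
qed (simp add: bounded_linear_zero)

text \<open>Both sides of the weak identity are continuous in \<psi>, so a dense set of tests is
  enough. This turns an equation tested only on a dense subspace into a derivative in norm.\<close>

lemma weak_integral_imp_vector_derivative:
  fixes p q :: "real \<Rightarrow> 'a::real_inner"
  assumes q: "continuous_on {a..b} q" and t: "t \<in> {a..b}" and S: "closure S = UNIV"
    and weak: "\<And>s \<psi>. s \<in> {a..b} \<Longrightarrow> \<psi> \<in> S \<Longrightarrow>
      p s \<bullet> \<psi> - p a \<bullet> \<psi> = integral {a..s} (\<lambda>r. q r \<bullet> \<psi>)"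
  shows "(p has_vector_derivative q t) (at t within {a..b})"
proof (rule weak_imp_vector_derivative[OF q t])
  have all: "p s \<bullet> \<psi> - p a \<bullet> \<psi> = integral {a..s} (\<lambda>r. q r \<bullet> \<psi>)" if s: "s \<in> {a..b}" for s \<psi>
  proof -
    have bl: "bounded_linear (\<lambda>\<psi>. integral {a..s} (\<lambda>r. q r \<bullet> \<psi>))"
      by (rule bounded_linear_integral_inner[OF continuous_on_subset[OF q]]) (use s in auto)
    have "closed {\<psi>. p s \<bullet> \<psi> - p a \<bullet> \<psi> = integral {a..s} (\<lambda>r. q r \<bullet> \<psi>)}"
      by (intro closed_Collect_eq continuous_intros linear_continuous_on bl)
    then have "closure S \<subseteq> {\<psi>. p s \<bullet> \<psi> - p a \<bullet> \<psi> = integral {a..s} (\<lambda>r. q r \<bullet> \<psi>)}"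
      by (intro closure_minimal) (use weak s in auto)
    with S show ?thesis by blast
  qed
  fix s \<psi> assume s: "s \<in> {a..b}"
  have "((\<lambda>s. integral {a..s} (\<lambda>r. q r \<bullet> \<psi>)) has_vector_derivative q s \<bullet> \<psi>) (at s within {a..b})"
    by (rule integral_has_vector_derivative) (use s in \<open>auto intro!: continuous_intros q\<close>)
  then have "((\<lambda>s. p a \<bullet> \<psi> + integral {a..s} (\<lambda>r. q r \<bullet> \<psi>)) has_vector_derivative 0 + q s \<bullet> \<psi>)
      (at s within {a..b})"
    by (intro has_vector_derivative_add) auto
  then show "((\<lambda>s. p s \<bullet> \<psi>) has_vector_derivative q s \<bullet> \<psi>) (at s within {a..b})"
    unfolding add_0
    by (rule has_vector_derivative_transform[OF s, rotated]) (simp add: all[symmetric])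
qed

text \<open>
  The sort of a Hilbert space is not contained in the sort \<open>banach\<close>, on which the library proves
  that continuous functions are integrable. The Riesz representation of the weak integral replaces this.
\<close>

lemma antiderivative_continuous:
  fixes f :: "real \<Rightarrow> 'h::{real_inner,complete_space}"
  assumes f: "continuous_on {a..b} f"
  shows "\<exists>F. F a = 0 \<and> (\<forall>t\<in>{a..b}. (F has_vector_derivative f t) (at t within {a..b}))"
proof -
  have "\<exists>F. \<forall>\<psi>. integral {a..t} (\<lambda>r. f r \<bullet> \<psi>) = F \<bullet> \<psi>" if t: "t \<in> {a..b}" for t
  proof -
    have "bounded_linear (\<lambda>\<psi>. integral {a..t} (\<lambda>r. f r \<bullet> \<psi>))"
      by (rule bounded_linear_integral_inner[OF continuous_on_subset[OF f]]) (use t in auto)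
    from riesz_representation[OF this] show ?thesis .
  qed
  then have "\<forall>t\<in>{a..b}. \<exists>F. \<forall>\<psi>. integral {a..t} (\<lambda>r. f r \<bullet> \<psi>) = F \<bullet> \<psi>" by blast
  from bchoice[OF this] obtain F where
    F: "\<forall>t\<in>{a..b}. \<forall>\<psi>. integral {a..t} (\<lambda>r. f r \<bullet> \<psi>) = F t \<bullet> \<psi>" ..
  show ?thesis
  proof (cases "a \<le> b")
    case True
    have Fa: "F a \<bullet> \<psi> = 0" for \<psi>
      using F[rule_format, of a \<psi>] True by simp
    have "(F has_vector_derivative f t) (at t within {a..b})" if "t \<in> {a..b}" for t
      by (rule weak_integral_imp_vector_derivative[OF f that closure_UNIV])
         (simp add: F[rule_format] Fa)
    moreover have "F a = 0" using Fa[of "F a"] by simp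
    ultimately show ?thesis by blast
  qed auto
qed


section \<open>Spectral decomposition\<close>

lemma norm_sum_orthogonal:
  fixes f :: "'i \<Rightarrow> 'a::real_inner"
  assumes "finite F" "\<And>i j. i \<in> F \<Longrightarrow> j \<in> F \<Longrightarrow> i \<noteq> j \<Longrightarrow> f i \<bullet> f j = 0"
  shows "(norm (\<Sum>i\<in>F. f i))\<^sup>2 = (\<Sum>i\<in>F. (norm (f i))\<^sup>2)"
  using assms
proof (induction F rule: finite_induct)
  case (insert x F)
  have "f x \<bullet> sum f F = 0"
    unfolding inner_sum_right by (rule sum.neutral) (use insert in auto)
  then show ?case using insert
    by (simp add: power2_norm_eq_inner inner_add_left inner_add_right inner_commute)
qed simp

section \<open>Eigenspaces of a positive operator with compact resolvent\<close>

locale positive_operator =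
  fixes D :: "'h::{real_inner,complete_space} set" and A :: "'h \<Rightarrow> 'h"
  assumes setting: "abstract_setting D A"
begin

abbreviation "\<Lambda> \<equiv> eigenvalues D A"
abbreviation "E \<equiv> eigenspace D A"
abbreviation "P \<mu> \<equiv> orth_proj (E \<mu>)"

lemma subspace_D: "subspace D"
  and dense_D: "closure D = UNIV"
  and adj_graph: "(\<forall>u\<in>D. A u \<bullet> v = u \<bullet> z) \<longleftrightarrow> v \<in> D \<and> A v = z"
  and A_add: "x \<in> D \<Longrightarrow> y \<in> D \<Longrightarrow> A (x + y) = A x + A y"
  and A_scale: "x \<in> D \<Longrightarrow> A (c *\<^sub>R x) = c *\<^sub>R A x"
  and A_nonneg: "x \<in> D \<Longrightarrow> 0 \<le> A x \<bullet> x"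
  using setting unfolding abstract_setting_def self_adjoint_operator_def linear_on_set_def by auto

lemma A_symmetric: "x \<in> D \<Longrightarrow> y \<in> D \<Longrightarrow> A x \<bullet> y = x \<bullet> A y"
  using adj_graph[of y "A y"] by blast

definition \<omega> :: real where "\<omega> = (SOME w. w > 0 \<and> (\<forall>u\<in>D. w * norm u \<le> norm (A u)))"

lemma omega_pos: "\<omega> > 0" and omega_le: "u \<in> D \<Longrightarrow> \<omega> * norm u \<le> norm (A u)"
proof -
  have "\<exists>w>0. \<forall>u\<in>D. w * norm u \<le> norm (A u)"
    using setting unfolding abstract_setting_def by blast
  then have "\<omega> > 0 \<and> (\<forall>u\<in>D. \<omega> * norm u \<le> norm (A u))"
    unfolding \<omega>_def by (rule someI_ex)
  then show "\<omega> > 0" "u \<in> D \<Longrightarrow> \<omega> * norm u \<le> norm (A u)" by auto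
qed

text \<open>Adjoints are closed, and \<open>A\<close> is its own adjoint: the symmetry relation
  survives both limits and puts the limit pair into the graph.\<close>

lemma closed_graph:
  assumes "\<And>k. u k \<in> D" "u \<longlonglongrightarrow> x" "(\<lambda>k. A (u k)) \<longlonglongrightarrow> y"
  shows "x \<in> D \<and> A x = y"
proof -
  have "A v \<bullet> x = v \<bullet> y" if v: "v \<in> D" for v
  proof (rule LIMSEQ_unique)
    show "(\<lambda>k. A v \<bullet> u k) \<longlonglongrightarrow> A v \<bullet> x" by (intro tendsto_intros assms)
    have "(\<lambda>k. v \<bullet> A (u k)) \<longlonglongrightarrow> v \<bullet> y" by (intro tendsto_intros assms)
    then show "(\<lambda>k. A v \<bullet> u k) \<longlonglongrightarrow> v \<bullet> y" using A_symmetric[OF v assms(1)] by simp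
  qed
  then show ?thesis using adj_graph by blast
qed

lemma subspace_E: "subspace (E \<mu>)"
  using subspace_D unfolding eigenspace_def subspace_def
  by (auto simp: A_add A_scale scaleR_add_right) (metis A_scale scaleR_zero_left)

lemma closed_E: "closed (E \<mu>)"
  unfolding closed_sequential_limits
proof (intro allI impI)
  fix u x assume u: "(\<forall>n. u n \<in> E \<mu>) \<and> u \<longlonglongrightarrow> x"
  then have "(\<lambda>n. A (u n)) \<longlonglongrightarrow> \<mu> *\<^sub>R x"
    by (auto simp: eigenspace_def intro!: tendsto_intros)
  with closed_graph[of u x] u show "x \<in> E \<mu>" by (auto simp: eigenspace_def)
qed

lemmas P_in = orth_proj_in[OF subspace_E closed_E]
  and P_inner = orth_proj_inner[OF subspace_E closed_E]
  and P_self = orth_proj_self[OF subspace_E closed_E]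
  and P_bounded_linear = bounded_linear_orth_proj[OF subspace_E closed_E]
  and P_symmetric = orth_proj_symmetric[OF subspace_E closed_E]

lemma P_in_D: "P \<mu> x \<in> D" and A_P: "A (P \<mu> x) = \<mu> *\<^sub>R P \<mu> x"
  using P_in[of \<mu> x] by (auto simp: eigenspace_def)

lemma E_orthogonal: "x \<in> E \<mu> \<Longrightarrow> y \<in> E \<nu> \<Longrightarrow> \<mu> \<noteq> \<nu> \<Longrightarrow> x \<bullet> y = 0"
  using A_symmetric[of x y] by (auto simp: eigenspace_def)

lemma P_P: "P \<mu> (P \<nu> x) = (if \<mu> = \<nu> then P \<nu> x else 0)"
proof (cases "\<mu> = \<nu>")
  case False
  then have "P \<mu> (P \<nu> x) = 0"
    using E_orthogonal[OF P_in P_in, of \<nu> \<mu>]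
    by (intro orth_proj_unique[OF subspace_E])
      (use E_orthogonal[OF P_in, of _ \<mu> \<nu> x] subspace_0[OF subspace_E] in \<open>auto simp: inner_commute\<close>)
  with False show ?thesis by simp
qed (simp add: P_self P_in)

text \<open>Positivity fixes the sign of the eigenvalue, the lower bound on \<open>A\<close> its
  modulus.\<close>

lemma eigenvalue_ge: "\<mu> \<in> \<Lambda> \<Longrightarrow> \<omega> \<le> \<mu>"
proof -
  assume "\<mu> \<in> \<Lambda>"
  then obtain e where e: "e \<in> D" "A e = \<mu> *\<^sub>R e" "e \<noteq> 0"
    by (auto simp: eigenvalues_def eigenspace_def)
  have "0 \<le> \<mu> * (e \<bullet> e)" using A_nonneg[OF e(1)] e(2) by simp
  moreover have "e \<bullet> e > 0" using e(3) by simp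
  ultimately have "\<mu> \<ge> 0" by (simp add: zero_le_mult_iff)
  moreover have "\<omega> * norm e \<le> \<bar>\<mu>\<bar> * norm e" using omega_le[OF e(1)] e(2) by simp
  ultimately show ?thesis using e(3) by simp
qed

lemma eigenvalue_pos: "\<mu> \<in> \<Lambda> \<Longrightarrow> 0 < \<mu>"
  using eigenvalue_ge omega_pos by fastforce

lemma P_zero: "\<mu> \<notin> \<Lambda> \<Longrightarrow> P \<mu> x = 0"
  using P_in[of \<mu> x] by (auto simp: eigenvalues_def)

text \<open>These sets are finite and exhaust the spectrum, so that sequences indexed by
  \<open>N\<close> can replace unordered sums.\<close>

definition \<Lambda>N :: "nat \<Rightarrow> real set" where "\<Lambda>N N = {\<mu>\<in>\<Lambda>. \<mu> \<le> real N}"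

text \<open>Infinitely many eigenvalues below \<open>N\<close> would give an orthonormal sequence of
  eigenvectors. Suitably scaled, it lies in the relatively compact image of the unit ball under the
  resolvent, yet its terms keep a fixed distance from each other.\<close>

lemma finite_\<Lambda>N: "finite (\<Lambda>N N)"
proof (rule ccontr)
  assume inf: "infinite (\<Lambda>N N)"
  obtain m where c: "compact (closure {u \<in> D. norm (A u - m *\<^sub>R u) \<le> 1})"
    using setting unfolding abstract_setting_def compact_resolvent_def by blast
  obtain l :: "nat \<Rightarrow> real" where l: "inj l" "range l \<subseteq> \<Lambda>N N"
    using infinite_countable_subset[OF inf] by blast
  have lN: "l k \<in> \<Lambda>" "l k \<le> real N" for k using l(2) unfolding \<Lambda>N_def by auto
  have "\<forall>k. \<exists>e. e \<in> E (l k) \<and> norm e = 1"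
  proof
    fix k
    obtain e where e: "e \<in> E (l k)" "e \<noteq> 0" using lN(1)[of k] by (auto simp: eigenvalues_def)
    then show "\<exists>e. e \<in> E (l k) \<and> norm e = 1"
      by (intro exI[of _ "(1 / norm e) *\<^sub>R e"]) (simp add: subspace_scale[OF subspace_E])
  qed
  then obtain e where e: "\<And>k. e k \<in> E (l k)" "\<And>k. norm (e k) = 1" by metis
  \<comment> \<open>Since \<open>0 < l k \<le> N\<close>, this \<open>b\<close> dominates the
    modulus of \<open>l k - m\<close>, so the eigenvectors scaled by \<open>1 / b\<close> fall into
    the relatively compact set.\<close>
  define b where "b = real N + \<bar>m\<bar> + 1"
  have b: "b > 0" unfolding b_def by simp
  define f where "f k = (1 / b) *\<^sub>R e k" for k
  have fE: "f k \<in> E (l k)" for k unfolding f_def using e(1) by (simp add: subspace_scale[OF subspace_E])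
  have "f k \<in> {u \<in> D. norm (A u - m *\<^sub>R u) \<le> 1}" for k
  proof -
    have "A (f k) - m *\<^sub>R f k = (l k - m) *\<^sub>R f k"
      using fE[of k] by (simp add: eigenspace_def scaleR_left_diff_distrib)
    then have "norm (A (f k) - m *\<^sub>R f k) = \<bar>l k - m\<bar> / b"
      using b by (simp add: f_def e(2))
    also have "\<dots> \<le> 1"
      using lN(2)[of k] eigenvalue_pos[OF lN(1)[of k]] b by (simp add: b_def)
    finally show ?thesis using fE[of k] by (simp add: eigenspace_def)
  qed
  then have "f k \<in> closure {u \<in> D. norm (A u - m *\<^sub>R u) \<le> 1}" for k
    using closure_subset by blast
  then obtain r x where r: "strict_mono r" "(f \<circ> r) \<longlonglongrightarrow> x"
    using c unfolding compact_def by meson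
  then have "Cauchy (f \<circ> r)" by (simp add: LIMSEQ_imp_Cauchy)
  then obtain M where M: "\<And>i j. i \<ge> M \<Longrightarrow> j \<ge> M \<Longrightarrow> dist ((f \<circ> r) i) ((f \<circ> r) j) < 1 / b"
    using b unfolding Cauchy_def by (metis divide_pos_pos zero_less_one)
  have ne: "l (r M) \<noteq> l (r (Suc M))"
    using l(1) r(1) by (metis injD lessI less_irrefl strict_mono_eq)
  have "e (r M) \<bullet> e (r (Suc M)) = 0" by (rule E_orthogonal[OF e(1) e(1) ne])
  then have "(norm (e (r M) - e (r (Suc M))))\<^sup>2 = 2"
    using e(2) by (simp add: power2_norm_eq_inner inner_diff_left inner_diff_right inner_commute
        norm_eq_1)
  moreover have "norm (e (r M) - e (r (Suc M))) < 1"
    using M[of M "Suc M"] b by (simp add: f_def dist_norm flip: scaleR_diff_right) (simp add: field_simps)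
  ultimately show False by (smt (verit) norm_ge_zero power2_less_imp_less one_power2)
qed

definition PN :: "nat \<Rightarrow> 'h \<Rightarrow> 'h" where "PN N x = (\<Sum>\<mu>\<in>\<Lambda>N N. P \<mu> x)"

text \<open>
  The resolvent leaves the orthogonal complement of the eigenvectors invariant. If this complement
  were nonzero, the resolvent would attain its norm there, hence have an eigenvector in it.
\<close>

lemma orthogonal_to_eigenvectors:
  assumes x: "\<And>\<mu> e. e \<in> E \<mu> \<Longrightarrow> x \<bullet> e = 0"
  shows "x = 0"
proof (rule ccontr)
  assume x0: "x \<noteq> 0"
  obtain m where m: "bij_betw (\<lambda>u. A u - m *\<^sub>R u) D UNIV"
    and c: "compact (closure {u \<in> D. norm (A u - m *\<^sub>R u) \<le> 1})"
    using setting unfolding abstract_setting_def compact_resolvent_def by blast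
  define R where "R = the_inv_into D (\<lambda>u. A u - m *\<^sub>R u)"
  have inj: "inj_on (\<lambda>u. A u - m *\<^sub>R u) D" and im: "(\<lambda>u. A u - m *\<^sub>R u) ` D = UNIV"
    using m by (auto simp: bij_betw_def)
  have RD: "R y \<in> D" for y unfolding R_def by (rule the_inv_into_into[OF inj]) (use im in auto)
  have AR: "A (R y) - m *\<^sub>R R y = y" for y
    unfolding R_def by (rule f_the_inv_into_f[OF inj]) (use im in auto)
  have RA: "R (A u - m *\<^sub>R u) = u" if "u \<in> D" for u
    unfolding R_def by (rule the_inv_into_f_f[OF inj that])
  have Radd: "R (y + z) = R y + R z" for y z
  proof -
    have "A (R y + R z) - m *\<^sub>R (R y + R z) = y + z"
      using AR[of y] AR[of z] by (simp add: A_add RD algebra_simps)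
    then show ?thesis using RA[of "R y + R z"] RD subspace_D by (simp add: subspace_add)
  qed
  have Rscale: "R (t *\<^sub>R y) = t *\<^sub>R R y" for t y
  proof -
    have "A (t *\<^sub>R R y) - m *\<^sub>R (t *\<^sub>R R y) = t *\<^sub>R y"
      unfolding arg_cong[OF AR[of y], of "scaleR t", symmetric]
      by (simp add: A_scale RD algebra_simps)
    then show ?thesis using RA[of "t *\<^sub>R R y"] RD subspace_D by (simp add: subspace_scale)
  qed
  have Rin: "R y \<in> closure {u \<in> D. norm (A u - m *\<^sub>R u) \<le> 1}" if "norm y \<le> 1" for y
    using closure_subset RD AR that by fastforce
  obtain K where K: "\<And>y. norm y \<le> 1 \<Longrightarrow> norm (R y) \<le> K"
    using compact_imp_bounded[OF c] Rin unfolding bounded_iff by metis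
  have "norm (R y) \<le> norm y * K" for y
  proof (cases "y = 0")
    case True
    then show ?thesis using Rscale[of 0 y] by simp
  next
    case False
    have "norm (R ((1 / norm y) *\<^sub>R y)) \<le> K" by (rule K) (use False in simp)
    then show ?thesis using False unfolding Rscale by (simp add: field_simps)
  qed
  then have Rbl: "bounded_linear R" by (intro bounded_linear_intro Radd Rscale)
  have Rsym: "R y \<bullet> z = y \<bullet> R z" for y z
  proof -
    have "R y \<bullet> z = R y \<bullet> (A (R z) - m *\<^sub>R R z)" by (simp add: AR)
    also have "\<dots> = (A (R y) - m *\<^sub>R R y) \<bullet> R z"
      using A_symmetric[OF RD RD, of y z] by (simp add: inner_diff_left inner_diff_right)
    finally show ?thesis by (simp add: AR)
  qed
  define V where "V = {x. \<forall>\<mu> e. e \<in> E \<mu> \<longrightarrow> x \<bullet> e = 0}"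
  have Vsub: "subspace V" unfolding V_def subspace_def by (simp add: inner_add_left)
  have Vcl: "closed V"
    unfolding V_def by (intro closed_Collect_all closed_Collect_imp closed_Collect_eq
      open_Collect_const continuous_intros)
  have VR: "R y \<in> V" if y: "y \<in> V" for y
    unfolding V_def
  proof (intro CollectI allI impI)
    fix \<mu> e assume e: "e \<in> E \<mu>"
    show "R y \<bullet> e = 0"
    proof (cases "e = 0")
      case False
      have eq: "A e - m *\<^sub>R e = (\<mu> - m) *\<^sub>R e" and eD: "e \<in> D"
        using e by (auto simp: eigenspace_def scaleR_left_diff_distrib)
      have "\<mu> \<noteq> m"
      proof
        assume "\<mu> = m"
        then have "e = R 0" using RA[OF eD] eq by simp
        then show False using Rscale[of 0 0] False by simp
      qed
      moreover have "(\<mu> - m) *\<^sub>R R e = e" using RA[OF eD] eq Rscale by metis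
      then have "(\<mu> - m) * (R y \<bullet> e) = y \<bullet> e" by (metis Rsym inner_scaleR_right)
      then have "(\<mu> - m) * (R y \<bullet> e) = 0" using y e unfolding V_def by auto
      ultimately show ?thesis by simp
    qed simp
  qed
  \<comment> \<open>An eigenvector of \<open>R\<close> for \<nu> is one of \<open>A\<close> for
    \<open>m + 1/\<nu>\<close>; lying in \<open>V\<close>, it is orthogonal to itself.\<close>
  have no_eig: "y = 0" if y: "y \<in> V" "R y = \<nu> *\<^sub>R y" "\<nu> \<noteq> 0" for y \<nu>
  proof -
    have "R ((1/\<nu>) *\<^sub>R y) = y" using y by (simp add: Rscale)
    then have "y \<in> D" "A y - m *\<^sub>R y = (1/\<nu>) *\<^sub>R y" using RD AR by metis+
    then have "y \<in> E (m + 1/\<nu>)" by (simp add: eigenspace_def algebra_simps)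
    then have "y \<bullet> y = 0" using y(1) unfolding V_def by blast
    then show "y = 0" by simp
  qed
  have R0: "R y \<noteq> 0" if "y \<noteq> 0" for y
  proof
    assume "R y = 0"
    then show False using AR[of y] A_scale[of "R y" 0] RD[of y] that by auto
  qed
  have xV: "x \<in> V" using x unfolding V_def by blast
  define Q where "Q = {norm (R y) |y. y \<in> V \<and> norm y \<le> 1}"
  \<comment> \<open>The norm of the resolvent on \<open>V\<close>: finite because the image of the
    ball is bounded, positive because \<open>R\<close> is injective.\<close>
  define s where "s = Sup Q"
  have Qbd: "bdd_above Q" unfolding Q_def by (rule bdd_aboveI[of _ K]) (use K in auto)
  have upper: "norm (R y) \<le> s" if "y \<in> V" "norm y \<le> 1" for y
    unfolding s_def by (rule cSup_upper[OF _ Qbd]) (use that in \<open>auto simp: Q_def\<close>)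
  have s_pos: "s > 0"
  proof -
    have "0 < norm (R ((1 / norm x) *\<^sub>R x))" using R0 x0 by simp
    also have "\<dots> \<le> s" by (rule upper) (use x0 xV Vsub in \<open>auto simp: subspace_scale\<close>)
    finally show ?thesis .
  qed
  have Rle: "norm (R y) \<le> s * norm y" if y: "y \<in> V" for y
  proof (cases "y = 0")
    case True
    then show ?thesis using Rscale[of 0 y] by simp
  next
    case False
    have "norm (R ((1 / norm y) *\<^sub>R y)) \<le> s"
      by (rule upper) (use False y Vsub in \<open>auto simp: subspace_scale\<close>)
    then show ?thesis using False unfolding Rscale by (simp add: field_simps)
  qed
  have "\<exists>y\<in>V. norm y \<le> 1 \<and> s - 1 / real (Suc k) < norm (R y)" for k
  proof -
    have "Q \<noteq> {}" using xV Vsub subspace_0 unfolding Q_def by fastforce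
    moreover have "s - 1 / real (Suc k) < Sup Q" unfolding s_def by simp
    ultimately obtain q where "q \<in> Q" "s - 1 / real (Suc k) < q" by (meson less_cSupD)
    then show ?thesis unfolding Q_def by blast
  qed
  then obtain Y where Y: "\<And>k. Y k \<in> V" "\<And>k. norm (Y k) \<le> 1"
      "\<And>k. s - 1 / real (Suc k) < norm (R (Y k))" by metis
  obtain r y where r: "strict_mono r" "((\<lambda>k. R (Y k)) \<circ> r) \<longlonglongrightarrow> y"
    using c Rin[OF Y(2)] unfolding compact_def by meson
  define Z where "Z k = Y (r k)" for k
  have RZ: "(\<lambda>k. R (Z k)) \<longlonglongrightarrow> y" using r(2) by (simp add: Z_def o_def)
  have Z: "Z k \<in> V" "norm (Z k) \<le> 1" for k unfolding Z_def using Y by auto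
  have yV: "y \<in> V" by (rule closed_sequentially[OF Vcl _ RZ]) (use VR Z in auto)
  have RRZ: "(\<lambda>k. R (R (Z k))) \<longlonglongrightarrow> R y" by (rule bounded_linear.tendsto[OF Rbl RZ])
  have low: "s - 1 / real (Suc k) \<le> norm (R (Z k))" for k
  proof -
    have "1 / real (Suc (r k)) \<le> 1 / real (Suc k)"
      using seq_suble[OF r(1), of k] by (intro divide_left_mono) auto
    then show ?thesis using Y(3)[of "r k"] unfolding Z_def by simp
  qed
  have nZ: "(\<lambda>k. norm (R (Z k))) \<longlonglongrightarrow> s"
  proof (rule tendsto_sandwich[OF always_eventually always_eventually])
    show "\<forall>k. s - 1 / real (Suc k) \<le> norm (R (Z k))" using low by blast
    show "\<forall>k. norm (R (Z k)) \<le> s" using upper Z by blast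
    have "(\<lambda>k. s - 1 / real (Suc k)) \<longlonglongrightarrow> s - 0"
      by (intro tendsto_intros LIMSEQ_Suc[OF lim_const_over_n])
    then show "(\<lambda>k. s - 1 / real (Suc k)) \<longlonglongrightarrow> s" by simp
  qed simp
  then have ny: "norm y = s" using tendsto_norm[OF RZ] LIMSEQ_unique by blast
  \<comment> \<open>The defect vanishes as \<open>norm (R (Z k))\<close> tends to \<open>s\<close>.
    So \<open>Z\<close> converges together with \<open>R (R Z)\<close>, and the limit satisfies
    \<open>R (R y) = s\<^sup>2 *\<^sub>R y\<close>.\<close>
  have sq: "(norm (R (R (Z k)) - s\<^sup>2 *\<^sub>R Z k))\<^sup>2 \<le> s\<^sup>2 * (s\<^sup>2 - (norm (R (Z k)))\<^sup>2)" for k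
  proof -
    have a: "(norm (R (R (Z k)) - s\<^sup>2 *\<^sub>R Z k))\<^sup>2
        = (norm (R (R (Z k))))\<^sup>2 - 2 * s\<^sup>2 * (norm (R (Z k)))\<^sup>2 + s^4 * (norm (Z k))\<^sup>2"
      unfolding power2_norm_eq_inner
      using Rsym[of "R (Z k)" "Z k"]
      by (simp add: inner_diff_left inner_diff_right inner_commute algebra_simps power2_eq_square
          power4_eq_xxxx)
    have b: "(norm (R (R (Z k))))\<^sup>2 \<le> (s * norm (R (Z k)))\<^sup>2"
      by (intro power_mono Rle VR Z) auto
    have "(norm (Z k))\<^sup>2 \<le> 1" using Z(2)[of k] by (simp add: power_le_one)
    then have d: "s^4 * (norm (Z k))\<^sup>2 \<le> s^4 * 1" by (intro mult_left_mono) auto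
    show ?thesis using a b d by (simp add: power_mult_distrib algebra_simps power4_eq_xxxx power2_eq_square)
  qed
  have "(\<lambda>k. (norm (R (R (Z k)) - s\<^sup>2 *\<^sub>R Z k))\<^sup>2) \<longlonglongrightarrow> 0"
  proof (rule tendsto_sandwich[where f = "\<lambda>_. 0", OF always_eventually always_eventually])
    show "\<forall>k. (norm (R (R (Z k)) - s\<^sup>2 *\<^sub>R Z k))\<^sup>2 \<le> s\<^sup>2 * (s\<^sup>2 - (norm (R (Z k)))\<^sup>2)" using sq by blast
    have "(\<lambda>k. s\<^sup>2 * (s\<^sup>2 - (norm (R (Z k)))\<^sup>2)) \<longlonglongrightarrow> s\<^sup>2 * (s\<^sup>2 - s\<^sup>2)" by (intro tendsto_intros nZ)
    then show "(\<lambda>k. s\<^sup>2 * (s\<^sup>2 - (norm (R (Z k)))\<^sup>2)) \<longlonglongrightarrow> 0" by simp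
  qed auto
  then have d0: "(\<lambda>k. R (R (Z k)) - s\<^sup>2 *\<^sub>R Z k) \<longlonglongrightarrow> 0"
    by (simp add: tendsto_norm_zero_iff power_tendsto_0_iff)
  have "(\<lambda>k. (1 / s\<^sup>2) *\<^sub>R (R (R (Z k)) - (R (R (Z k)) - s\<^sup>2 *\<^sub>R Z k))) \<longlonglongrightarrow> (1 / s\<^sup>2) *\<^sub>R (R y - 0)"
    by (intro tendsto_intros RRZ d0)
  then have "Z \<longlonglongrightarrow> (1 / s\<^sup>2) *\<^sub>R R y" using s_pos by (simp add: Z_def[abs_def])
  then have "(\<lambda>k. R (Z k)) \<longlonglongrightarrow> R ((1 / s\<^sup>2) *\<^sub>R R y)" by (rule bounded_linear.tendsto[OF Rbl])
  then have "y = R ((1 / s\<^sup>2) *\<^sub>R R y)" using RZ LIMSEQ_unique by blast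
  then have "s\<^sup>2 *\<^sub>R y = s\<^sup>2 *\<^sub>R ((1 / s\<^sup>2) *\<^sub>R R (R y))" unfolding Rscale by metis
  then have RRy: "R (R y) = s\<^sup>2 *\<^sub>R y" using s_pos by simp
  \<comment> \<open>Factor \<open>R^2 - s^2\<close> as \<open>(R - s) (R + s)\<close>: either
    \<open>z\<close> is an eigenvector for \<open>s\<close>, or it vanishes and \<open>y\<close> is
    one for \<open>- s\<close>.\<close>
  define z where "z = R y + s *\<^sub>R y"
  have zV: "z \<in> V" unfolding z_def using VR yV Vsub by (simp add: subspace_add subspace_scale)
  have "R z = s *\<^sub>R z" unfolding z_def Radd Rscale RRy by (simp add: scaleR_add_right power2_eq_square)
  then have "z = 0" using no_eig[OF zV] s_pos by blast
  then have "R y = (- s) *\<^sub>R y" unfolding z_def by (simp add: add_eq_0_iff)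
  then have "y = 0" using no_eig[OF yV, of "- s"] s_pos by simp
  then show False using ny s_pos by simp
qed

end


section \<open>Functional calculus\<close>

lemmas bl_add = linear_add[OF bounded_linear.linear]
  and bl_diff = linear_diff[OF bounded_linear.linear]
  and bl_scale = linear_scale[OF bounded_linear.linear]
  and bl_zero = linear_0[OF bounded_linear.linear]
  and bl_neg = linear_neg[OF bounded_linear.linear]
  and bl_sum = linear_sum[OF bounded_linear.linear]

context positive_operator
begin

text \<open>Completeness of the eigenvectors, in the form in which it is used: identities between
  vectors are checked on one eigenspace at a time.\<close>

lemma P_ext:
  assumes "\<And>\<mu>. \<mu> \<in> \<Lambda> \<Longrightarrow> P \<mu> x = P \<mu> y"
  shows "x = y"
proof -
  have "(x - y) \<bullet> e = 0" if e: "e \<in> E \<mu>" for \<mu> e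
  proof -
    have "P \<mu> x = P \<mu> y" using assms P_zero by metis
    then show ?thesis using P_inner[OF e, of x] P_inner[OF e, of y] by (simp add: inner_diff_left)
  qed
  then have "x - y = 0" by (rule orthogonal_to_eigenvectors)
  then show ?thesis by simp
qed

lemma \<Lambda>N_subset: "\<Lambda>N N \<subseteq> \<Lambda>" and \<Lambda>N_mono: "M \<le> N \<Longrightarrow> \<Lambda>N M \<subseteq> \<Lambda>N N"
  unfolding \<Lambda>N_def by auto

lemma \<Lambda>N_exhaust: "finite F \<Longrightarrow> F \<subseteq> \<Lambda> \<Longrightarrow> \<exists>N. F \<subseteq> \<Lambda>N N"
proof (induction F rule: finite_induct)
  case (insert x F)
  then obtain N where "F \<subseteq> \<Lambda>N N" by auto
  moreover obtain M where "x \<le> real M" using real_arch_simple by blast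
  ultimately have "insert x F \<subseteq> \<Lambda>N (max M N)"
    using insert.prems \<Lambda>N_mono[of N "max M N"] by (auto simp: \<Lambda>N_def)
  then show ?case by blast
qed simp

text \<open>Riesz-Fischer for the eigenspace decomposition: by orthogonality, squared distances
  between partial sums are increments of the bounded monotone sequence \<open>q\<close>.\<close>

lemma coefficients_realized:
  assumes a: "\<And>\<mu>. a \<mu> \<in> E \<mu>" and bd: "\<And>N. (\<Sum>\<mu>\<in>\<Lambda>N N. (norm (a \<mu>))\<^sup>2) \<le> K"
  shows "\<exists>y. (\<lambda>N. \<Sum>\<mu>\<in>\<Lambda>N N. a \<mu>) \<longlonglongrightarrow> y \<and> (\<forall>\<mu>\<in>\<Lambda>. P \<mu> y = a \<mu>)"
proof -
  define s where "s N = (\<Sum>\<mu>\<in>\<Lambda>N N. a \<mu>)" for N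
  define q where "q N = (\<Sum>\<mu>\<in>\<Lambda>N N. (norm (a \<mu>))\<^sup>2)" for N
  have "incseq q" unfolding q_def incseq_def
    by (auto intro!: sum_mono2 finite_\<Lambda>N \<Lambda>N_mono)
  moreover have "Bseq q"
    by (rule BseqI'[of _ K]) (use bd in \<open>auto simp: q_def sum_nonneg\<close>)
  ultimately have "Cauchy q"
    by (simp add: Bseq_monoseq_convergent convergent_Cauchy incseq_imp_monoseq)
  have diff: "(norm (s N - s M))\<^sup>2 = q N - q M" if "M \<le> N" for M N
  proof -
    have "s N - s M = (\<Sum>\<mu>\<in>\<Lambda>N N - \<Lambda>N M. a \<mu>)"
      unfolding s_def using \<Lambda>N_mono[OF that] finite_\<Lambda>N by (simp add: sum_diff)
    moreover have "(norm (\<Sum>\<mu>\<in>\<Lambda>N N - \<Lambda>N M. a \<mu>))\<^sup>2 = (\<Sum>\<mu>\<in>\<Lambda>N N - \<Lambda>N M. (norm (a \<mu>))\<^sup>2)"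
      by (rule norm_sum_orthogonal) (auto intro: finite_\<Lambda>N E_orthogonal[OF a a])
    ultimately show ?thesis unfolding q_def using \<Lambda>N_mono[OF that] finite_\<Lambda>N by (simp add: sum_diff)
  qed
  have "Cauchy s"
  proof (rule CauchyI')
    fix e :: real assume e: "e > 0"
    then obtain M where M: "\<And>m n. m \<ge> M \<Longrightarrow> n \<ge> M \<Longrightarrow> dist (q m) (q n) < e\<^sup>2"
      using \<open>Cauchy q\<close> unfolding Cauchy_def by (meson zero_less_power)
    have "dist (s m) (s n) < e" if "m \<ge> M" "n > m" for m n
    proof -
      have "(norm (s n - s m))\<^sup>2 < e\<^sup>2"
        using diff[of m n] M[of m n] that by (simp add: dist_real_def)
      then show ?thesis using e by (simp add: dist_norm norm_minus_commute power2_less_imp_less)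
    qed
    then show "\<exists>M. \<forall>m\<ge>M. \<forall>n>m. dist (s m) (s n) < e" by blast
  qed
  then obtain y where y: "s \<longlonglongrightarrow> y" using Cauchy_convergent convergent_def by blast
  have "P \<mu> y = a \<mu>" if \<mu>: "\<mu> \<in> \<Lambda>" for \<mu>
  proof -
    obtain N0 where N0: "{\<mu>} \<subseteq> \<Lambda>N N0" using \<Lambda>N_exhaust[of "{\<mu>}"] \<mu> by auto
    have "P \<mu> (s N) = a \<mu>" if "N \<ge> N0" for N
    proof -
      have "P \<mu> (s N) = (\<Sum>\<nu>\<in>\<Lambda>N N. P \<mu> (a \<nu>))"
        unfolding s_def by (rule bl_sum[OF P_bounded_linear])
      also have "\<dots> = (\<Sum>\<nu>\<in>\<Lambda>N N. if \<nu> = \<mu> then a \<mu> else 0)"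
        by (rule sum.cong[OF refl]) (metis P_P P_self a)
      also have "\<dots> = a \<mu>" using N0 \<Lambda>N_mono[OF that] finite_\<Lambda>N by auto
      finally show ?thesis .
    qed
    then have "(\<lambda>N. P \<mu> (s N)) \<longlonglongrightarrow> a \<mu>"
      by (intro tendsto_eventually) (auto simp: eventually_sequentially)
    moreover have "(\<lambda>N. P \<mu> (s N)) \<longlonglongrightarrow> P \<mu> y"
      by (rule bounded_linear.tendsto[OF P_bounded_linear y])
    ultimately show ?thesis using LIMSEQ_unique by blast
  qed
  with y show ?thesis unfolding s_def by blast
qed

lemma PN_bounded_linear: "bounded_linear (PN N)"
  unfolding PN_def[abs_def] by (intro bounded_linear_sum P_bounded_linear)

lemma P_PN: "P \<mu> (PN N x) = (if \<mu> \<in> \<Lambda>N N then P \<mu> x else 0)"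
proof -
  have "P \<mu> (PN N x) = (\<Sum>\<nu>\<in>\<Lambda>N N. P \<mu> (P \<nu> x))"
    unfolding PN_def by (rule bl_sum[OF P_bounded_linear])
  also have "\<dots> = (\<Sum>\<nu>\<in>\<Lambda>N N. if \<nu> = \<mu> then P \<mu> x else 0)"
    by (rule sum.cong[OF refl]) (auto simp: P_P)
  also have "\<dots> = (if \<mu> \<in> \<Lambda>N N then P \<mu> x else 0)" using finite_\<Lambda>N by simp
  finally show ?thesis .
qed

lemma PN_symmetric: "PN N x \<bullet> y = x \<bullet> PN N y"
  unfolding PN_def by (simp add: inner_sum_left inner_sum_right P_symmetric)

lemma PN_PN: "PN N (PN N x) = PN N x"
  by (rule P_ext) (simp add: P_PN)

lemma PN_norm_le: "norm (PN N x) \<le> norm x"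
proof -
  have "norm (PN N x) * norm (PN N x) = x \<bullet> PN N x"
    using PN_symmetric[of N x "PN N x"] by (simp add: PN_PN power2_norm_eq_inner flip: power2_eq_square)
  also have "\<dots> \<le> norm x * norm (PN N x)" by (rule norm_cauchy_schwarz)
  finally show ?thesis by (cases "PN N x = 0") auto
qed

lemma norm_PN: "(norm (PN N x))\<^sup>2 = (\<Sum>\<mu>\<in>\<Lambda>N N. (norm (P \<mu> x))\<^sup>2)"
  unfolding PN_def by (rule norm_sum_orthogonal) (auto intro: finite_\<Lambda>N E_orthogonal[OF P_in P_in])

lemma bessel: "(\<Sum>\<mu>\<in>\<Lambda>N N. (norm (P \<mu> x))\<^sup>2) \<le> (norm x)\<^sup>2"
  using norm_PN[of N x] PN_norm_le[of N x] by (metis norm_ge_zero power_mono)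

lemma PN_tendsto: "(\<lambda>N. PN N x) \<longlonglongrightarrow> x"
proof -
  obtain y where y: "(\<lambda>N. \<Sum>\<mu>\<in>\<Lambda>N N. P \<mu> x) \<longlonglongrightarrow> y" "\<forall>\<mu>\<in>\<Lambda>. P \<mu> y = P \<mu> x"
    using coefficients_realized[of "\<lambda>\<mu>. P \<mu> x", OF P_in bessel] by blast
  have "y = x" by (rule P_ext) (use y in auto)
  with y(1) show ?thesis unfolding PN_def by simp
qed

text \<open>\<open>op_powr\<close> sums over the unordered spectrum, so convergence along
  \<open>\<Lambda>N\<close> is not enough. A finite sum over a larger set of eigenvalues is an
  orthogonal projection onto a larger space, hence at least as close to \<open>x\<close> as
  \<open>PN N x\<close>.\<close>

lemma has_sum_P: "((\<lambda>\<mu>. P \<mu> x) has_sum x) \<Lambda>"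
  unfolding has_sum_def tendsto_iff eventually_finite_subsets_at_top
proof (intro allI impI)
  fix e :: real assume "e > 0"
  then obtain N where N: "dist (PN N x) x < e"
    using PN_tendsto[of x] unfolding lim_sequentially by blast
  have "dist (\<Sum>\<mu>\<in>F. P \<mu> x) x < e" if F: "finite F" "\<Lambda>N N \<subseteq> F" "F \<subseteq> \<Lambda>" for F
  proof -
    define z where "z = (\<Sum>\<mu>\<in>F. P \<mu> x)"
    have Pz: "P \<mu> z = (if \<mu> \<in> F then P \<mu> x else 0)" for \<mu>
    proof -
      have "P \<mu> z = (\<Sum>\<nu>\<in>F. P \<mu> (P \<nu> x))"
        unfolding z_def by (rule bl_sum[OF P_bounded_linear])
      also have "\<dots> = (\<Sum>\<nu>\<in>F. if \<nu> = \<mu> then P \<mu> x else 0)"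
        by (rule sum.cong[OF refl]) (auto simp: P_P)
      finally show ?thesis using F by simp
    qed
    have orth: "(x - z) \<bullet> P \<mu> y = 0" if "\<mu> \<in> F" for \<mu> y
    proof -
      have "(x - z) \<bullet> P \<mu> y = P \<mu> (x - z) \<bullet> y" by (simp add: P_symmetric)
      also have "P \<mu> (x - z) = 0"
        using Pz that by (simp add: bl_diff[OF P_bounded_linear])
      finally show ?thesis by simp
    qed
    have "(x - z) \<bullet> (z - PN N x) = 0"
      using orth F unfolding z_def[THEN eq_reflection] PN_def
      by (simp add: inner_diff_right inner_sum_right subset_iff)
    then have "(norm (x - PN N x))\<^sup>2 = (norm (x - z))\<^sup>2 + (norm (z - PN N x))\<^sup>2"
      unfolding power2_norm_eq_inner
      by (simp add: inner_diff_left inner_diff_right inner_commute algebra_simps)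
    then have "(norm (x - z))\<^sup>2 \<le> (norm (x - PN N x))\<^sup>2" by simp
    then have "norm (x - z) \<le> norm (x - PN N x)" by simp
    then show ?thesis using N unfolding z_def[symmetric] by (simp add: dist_norm norm_minus_commute)
  qed
  then show "\<exists>X. finite X \<and> X \<subseteq> \<Lambda> \<and> (\<forall>Y. finite Y \<and> X \<subseteq> Y \<and> Y \<subseteq> \<Lambda> \<longrightarrow>
      dist (sum (\<lambda>\<mu>. P \<mu> x) Y) x < e)"
    by (intro exI[of _ "\<Lambda>N N"] conjI finite_\<Lambda>N \<Lambda>N_subset) auto
qed

section \<open>Powers of the operator and the scale of spaces, through spectral coefficients\<close>

lemma op_powr_eqI:
  assumes "\<And>\<mu>. \<mu> \<in> \<Lambda> \<Longrightarrow> P \<mu> y = (\<mu> powr s) *\<^sub>R P \<mu> x"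
  shows "op_powr D A s x = y"
proof -
  have "((\<lambda>\<mu>. (\<mu> powr s) *\<^sub>R P \<mu> x) has_sum y) \<Lambda>"
    using has_sum_P[of y] assms by (simp cong: has_sum_cong)
  then show ?thesis unfolding op_powr_def by (rule infsumI)
qed

lemma scaled_P_in: "c *\<^sub>R P \<mu> x \<in> E \<mu>"
  by (rule subspace_scale[OF subspace_E P_in])

text \<open>Square-summability of the scaled coefficients is exactly what lets a vector with these
  coefficients exist: \<open>coefficients_realized\<close> in one direction, Bessel's inequality in
  the other.\<close>

lemma dom_powr_iff: "x \<in> dom_powr D A s \<longleftrightarrow> (\<exists>y. \<forall>\<mu>\<in>\<Lambda>. P \<mu> y = (\<mu> powr s) *\<^sub>R P \<mu> x)"
proof
  assume "x \<in> dom_powr D A s"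
  then have sum: "(\<lambda>\<mu>. (\<mu> powr s * norm (P \<mu> x))\<^sup>2) summable_on \<Lambda>"
    unfolding dom_powr_def mem_Collect_eq .
  have "(\<Sum>\<mu>\<in>\<Lambda>N N. (norm ((\<mu> powr s) *\<^sub>R P \<mu> x))\<^sup>2) \<le> infsum (\<lambda>\<mu>. (\<mu> powr s * norm (P \<mu> x))\<^sup>2) \<Lambda>" for N
    using finite_sum_le_infsum[OF sum finite_\<Lambda>N[of N] \<Lambda>N_subset[of N]] by simp
  from coefficients_realized[OF scaled_P_in this]
  show "\<exists>y. \<forall>\<mu>\<in>\<Lambda>. P \<mu> y = (\<mu> powr s) *\<^sub>R P \<mu> x" by blast
next
  assume "\<exists>y. \<forall>\<mu>\<in>\<Lambda>. P \<mu> y = (\<mu> powr s) *\<^sub>R P \<mu> x"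
  then obtain y where y: "\<forall>\<mu>\<in>\<Lambda>. P \<mu> y = (\<mu> powr s) *\<^sub>R P \<mu> x" by blast
  have "(\<lambda>\<mu>. (norm (P \<mu> y))\<^sup>2) summable_on \<Lambda>"
  proof (rule nonneg_bdd_above_summable_on)
    show "bdd_above (sum (\<lambda>\<mu>. (norm (P \<mu> y))\<^sup>2) ` {F. F \<subseteq> \<Lambda> \<and> finite F})"
    proof (rule bdd_aboveI2)
      fix F assume F: "F \<in> {F. F \<subseteq> \<Lambda> \<and> finite F}"
      then obtain N where "F \<subseteq> \<Lambda>N N" using \<Lambda>N_exhaust by blast
      then have "(\<Sum>\<mu>\<in>F. (norm (P \<mu> y))\<^sup>2) \<le> (\<Sum>\<mu>\<in>\<Lambda>N N. (norm (P \<mu> y))\<^sup>2)"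
        by (intro sum_mono2 finite_\<Lambda>N) auto
      with bessel[where N = N and x = y] show "(\<Sum>\<mu>\<in>F. (norm (P \<mu> y))\<^sup>2) \<le> (norm y)\<^sup>2" by simp
    qed
  qed simp
  then show "x \<in> dom_powr D A s"
    using y unfolding dom_powr_def by (simp cong: summable_on_cong)
qed

definition G :: "'h \<Rightarrow> 'h" where "G = op_powr D A (- 1 / 2)"
text \<open>Meaningful on the range of \<open>G\<close>, where it inverts \<open>G\<close>;
  elsewhere the \<open>infsum\<close> takes its default value.\<close>

definition L :: "'h \<Rightarrow> 'h" where "L = op_powr D A (1 / 2)"

text \<open>A bound for the norm of \<open>G\<close>, as no eigenvalue lies below \<omega>.\<close>

definition cG :: real where "cG = \<omega> powr (- 1 / 2)"

lemma cG_pos: "cG > 0" unfolding cG_def using omega_pos by simp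

text \<open>Convergence of the defining \<open>infsum\<close> has to be secured first: since the
  eigenvalues stay above \<omega>, the scaled coefficients remain square-summable and belong to an
  actual vector.\<close>

lemma P_G: assumes "\<mu> \<in> \<Lambda>" shows "P \<mu> (G x) = (\<mu> powr (- 1 / 2)) *\<^sub>R P \<mu> x"
proof -
  have "(\<Sum>\<mu>\<in>\<Lambda>N N. (norm ((\<mu> powr (- 1 / 2)) *\<^sub>R P \<mu> x))\<^sup>2) \<le> cG\<^sup>2 * (norm x)\<^sup>2" for N
  proof -
    have "(norm ((\<mu> powr (- 1 / 2)) *\<^sub>R P \<mu> x))\<^sup>2 \<le> cG\<^sup>2 * (norm (P \<mu> x))\<^sup>2" if "\<mu> \<in> \<Lambda>N N" for \<mu>
    proof -
      have "\<omega> \<le> \<mu>" using that \<Lambda>N_subset eigenvalue_ge by blast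
      then have "\<mu> powr (- 1 / 2) \<le> cG"
        unfolding cG_def using omega_pos by (intro powr_mono2') auto
      then have "norm ((\<mu> powr (- 1 / 2)) *\<^sub>R P \<mu> x) \<le> cG * norm (P \<mu> x)"
        by (simp add: mult_right_mono)
      then show ?thesis by (metis norm_ge_zero power_mono power_mult_distrib)
    qed
    then have "(\<Sum>\<mu>\<in>\<Lambda>N N. (norm ((\<mu> powr (- 1 / 2)) *\<^sub>R P \<mu> x))\<^sup>2)
        \<le> cG\<^sup>2 * (\<Sum>\<mu>\<in>\<Lambda>N N. (norm (P \<mu> x))\<^sup>2)"
      unfolding sum_distrib_left by (rule sum_mono)
    also have "\<dots> \<le> cG\<^sup>2 * (norm x)\<^sup>2" by (intro mult_left_mono bessel) simp
    finally show ?thesis .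
  qed
  from coefficients_realized[OF scaled_P_in this] obtain y where
    y: "\<forall>\<mu>\<in>\<Lambda>. P \<mu> y = (\<mu> powr (- 1 / 2)) *\<^sub>R P \<mu> x" by blast
  have "G x = y" unfolding G_def by (rule op_powr_eqI) (use y in auto)
  with y assms show ?thesis by auto
qed

lemma G_bounded_linear: "bounded_linear G" and norm_G_le: "norm (G x) \<le> cG * norm x"
proof -
  have le: "norm (G x) \<le> cG * norm x" for x
  proof (rule Lim_bounded)
    show "(\<lambda>N. norm (PN N (G x))) \<longlonglongrightarrow> norm (G x)" by (intro tendsto_norm PN_tendsto)
    have "norm (PN N (G x)) \<le> cG * norm x" for N
    proof -
      have "(norm (PN N (G x)))\<^sup>2 \<le> (\<Sum>\<mu>\<in>\<Lambda>N N. cG\<^sup>2 * (norm (P \<mu> x))\<^sup>2)"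
        unfolding norm_PN
      proof (rule sum_mono)
        fix \<mu> assume "\<mu> \<in> \<Lambda>N N"
        then have \<mu>: "\<mu> \<in> \<Lambda>" "\<omega> \<le> \<mu>" using \<Lambda>N_subset eigenvalue_ge by blast+
        then have "\<mu> powr (- 1 / 2) \<le> cG"
          unfolding cG_def using omega_pos by (intro powr_mono2') auto
        then have "norm (P \<mu> (G x)) \<le> cG * norm (P \<mu> x)"
          by (simp add: P_G[OF \<mu>(1)] mult_right_mono)
        then show "(norm (P \<mu> (G x)))\<^sup>2 \<le> cG\<^sup>2 * (norm (P \<mu> x))\<^sup>2"
          by (metis norm_ge_zero power_mono power_mult_distrib)
      qed
      also have "\<dots> \<le> cG\<^sup>2 * (norm x)\<^sup>2"
        unfolding sum_distrib_left[symmetric] by (intro mult_left_mono bessel) simp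
      finally have "(norm (PN N (G x)))\<^sup>2 \<le> (cG * norm x)\<^sup>2" by (simp add: power_mult_distrib)
      then show ?thesis by (rule power2_le_imp_le) (use cG_pos in simp)
    qed
    then show "\<forall>N\<ge>0. norm (PN N (G x)) \<le> cG * norm x" by blast
  qed
  show "norm (G x) \<le> cG * norm x" by (rule le)
  show "bounded_linear G"
  proof (rule bounded_linear_intro[of _ cG])
    show "G (x + y) = G x + G y" for x y
      by (rule P_ext) (simp add: P_G bl_add[OF P_bounded_linear] scaleR_add_right)
    show "G (c *\<^sub>R x) = c *\<^sub>R G x" for c x
      by (rule P_ext) (simp add: P_G bl_scale[OF P_bounded_linear])
    show "norm (G x) \<le> norm x * cG" for x using le[of x] by (simp add: mult.commute)
  qed
qed

lemmas G_add = bl_add[OF G_bounded_linear]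
  and G_diff = bl_diff[OF G_bounded_linear]
  and G_scale = bl_scale[OF G_bounded_linear]
  and G_zero = bl_zero[OF G_bounded_linear]
  and G_minus = bl_neg[OF G_bounded_linear]

lemma G_PN: "G (PN N x) = PN N (G x)"
  by (rule P_ext) (simp add: P_G P_PN)

lemma PN_weak: "(\<lambda>N. PN N x \<bullet> y) \<longlonglongrightarrow> x \<bullet> y"
  by (intro tendsto_intros PN_tendsto)

lemma G_symmetric: "G x \<bullet> y = x \<bullet> G y"
proof (rule LIMSEQ_unique)
  show "(\<lambda>N. PN N (G x) \<bullet> y) \<longlonglongrightarrow> G x \<bullet> y" by (rule PN_weak)
  have "P \<mu> (G x) \<bullet> y = P \<mu> x \<bullet> G y" if "\<mu> \<in> \<Lambda>N N" for \<mu> N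
  proof -
    have \<mu>: "\<mu> \<in> \<Lambda>" using that \<Lambda>N_subset by blast
    have "P \<mu> x \<bullet> G y = P \<mu> x \<bullet> P \<mu> (G y)" by (metis P_P P_symmetric)
    also have "\<dots> = (\<mu> powr (- 1 / 2)) * (P \<mu> x \<bullet> P \<mu> y)" by (simp add: P_G[OF \<mu>])
    also have "P \<mu> x \<bullet> P \<mu> y = P \<mu> x \<bullet> y" by (metis P_P P_symmetric)
    finally show ?thesis by (simp add: P_G[OF \<mu>])
  qed
  then have "PN N (G x) \<bullet> y = PN N x \<bullet> G y" for N
    unfolding PN_def inner_sum_left by (intro sum.cong) auto
  then show "(\<lambda>N. PN N (G x) \<bullet> y) \<longlonglongrightarrow> x \<bullet> G y" using PN_weak[of x "G y"] by simp
qed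

lemma P_Gpow: "\<mu> \<in> \<Lambda> \<Longrightarrow> P \<mu> ((G ^^ k) x) = (\<mu> powr (- (real k / 2))) *\<^sub>R P \<mu> x"
proof (induction k)
  case 0
  then show ?case using eigenvalue_pos by fastforce
next
  case (Suc k)
  have "\<mu> powr (- 1 / 2) * \<mu> powr (- (real k / 2)) = \<mu> powr (- (real (Suc k) / 2))"
    unfolding powr_add[symmetric] by (rule arg_cong[of _ _ "(powr) \<mu>"]) (simp add: field_simps)
  then show ?case using Suc by (simp add: P_G)
qed

lemma Gpow_bounded_linear: "bounded_linear (G ^^ k)"
proof (induction k)
  case 0
  then show ?case using bounded_linear_ident by (simp add: id_def)
next
  case (Suc k)
  then show ?case using bounded_linear_compose[OF G_bounded_linear Suc] by (simp add: o_def)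
qed

lemma Gpow_symmetric: "(G ^^ k) x \<bullet> y = x \<bullet> (G ^^ k) y"
proof (induction k arbitrary: x y)
  case (Suc k)
  have "(G ^^ Suc k) x \<bullet> y = x \<bullet> (G ^^ k) (G y)"
    using Suc[of x "G y"] by (simp add: G_symmetric)
  then show ?case by (simp add: funpow_swap1)
qed simp

lemma op_powr_Gpow: "op_powr D A (real k / 2) ((G ^^ k) x) = x"
proof (rule op_powr_eqI)
  fix \<mu> assume \<mu>: "\<mu> \<in> \<Lambda>"
  have "\<mu> powr (real k / 2) * \<mu> powr (- (real k / 2)) = 1"
    unfolding powr_add[symmetric] using eigenvalue_pos[OF \<mu>] by simp
  then show "P \<mu> x = (\<mu> powr (real k / 2)) *\<^sub>R P \<mu> ((G ^^ k) x)" by (simp add: P_Gpow[OF \<mu>])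
qed

text \<open>The spaces of nonnegative index become ranges of powers of a bounded operator, and their
  norms become norms of the preimage. Domain conditions are handled in this form from here
  on.\<close>

lemma Hspace_iff: "x \<in> Hspace D A k \<longleftrightarrow> (\<exists>y. x = (G ^^ k) y)"
proof
  assume "x \<in> Hspace D A k"
  then obtain y where y: "\<forall>\<mu>\<in>\<Lambda>. P \<mu> y = (\<mu> powr (real k / 2)) *\<^sub>R P \<mu> x"
    unfolding Hspace_def dom_powr_iff by blast
  have "x = (G ^^ k) y"
  proof (rule P_ext)
    fix \<mu> assume \<mu>: "\<mu> \<in> \<Lambda>"
    have "\<mu> powr (- (real k / 2)) * \<mu> powr (real k / 2) = 1"
      unfolding powr_add[symmetric] using eigenvalue_pos[OF \<mu>] by simp
    then show "P \<mu> x = P \<mu> ((G ^^ k) y)" using y \<mu> by (simp add: P_Gpow)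
  qed
  then show "\<exists>y. x = (G ^^ k) y" by blast
next
  assume "\<exists>y. x = (G ^^ k) y"
  then obtain y where x: "x = (G ^^ k) y" by blast
  show "x \<in> Hspace D A k"
    unfolding Hspace_def dom_powr_iff
  proof (intro exI ballI)
    fix \<mu> assume \<mu>: "\<mu> \<in> \<Lambda>"
    have "\<mu> powr (real k / 2) * \<mu> powr (- (real k / 2)) = 1"
      unfolding powr_add[symmetric] using eigenvalue_pos[OF \<mu>] by simp
    then show "P \<mu> y = (\<mu> powr (real k / 2)) *\<^sub>R P \<mu> x" by (simp add: x P_Gpow[OF \<mu>])
  qed
qed

lemma Hnorm_Gpow: "Hnorm D A (int k) ((G ^^ k) x) = norm x"
  unfolding Hnorm_def using op_powr_Gpow[of k x] by simp

lemma Hnorm_neg: "Hnorm D A (- int k) x = norm ((G ^^ k) x)"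
proof -
  have "op_powr D A (- (real k / 2)) x = (G ^^ k) x"
    by (rule op_powr_eqI) (simp add: P_Gpow)
  then show ?thesis unfolding Hnorm_def by simp
qed

lemma L_G [simp]: "L (G x) = x"
  unfolding L_def using op_powr_Gpow[of 1 x] by simp

lemma Hspace1_iff: "x \<in> Hspace D A 1 \<longleftrightarrow> (\<exists>y. x = G y)"
  using Hspace_iff[of x 1] by simp

lemma Hspace2_iff: "x \<in> Hspace D A 2 \<longleftrightarrow> (\<exists>y. x = G (G y))"
  using Hspace_iff[of x 2] by (simp add: numeral_2_eq_2)

lemma G_L: "x \<in> Hspace D A 1 \<Longrightarrow> G (L x) = x"
  using Hspace1_iff by auto

lemma Hnorm_1: "Hnorm D A 1 (G x) = norm x"
  using Hnorm_Gpow[of 1 x] by simp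

lemma Hnorm_2: "Hnorm D A 2 (G (G x)) = norm x"
  using Hnorm_Gpow[of 2 x] by (simp add: numeral_2_eq_2)

definition en :: "nat \<Rightarrow> 'h \<Rightarrow> 'h \<Rightarrow> real" where
  "en m z y = (norm ((G ^^ m) z))\<^sup>2 / 2 + (norm ((G ^^ m) y))\<^sup>2 / 2"

lemma energy_eq: "energy D A (1 - int m) (G z) y = en m z y"
proof -
  have "Hnorm D A (1 - int m) (G z) = norm ((G ^^ m) z)"
  proof (cases m)
    case (Suc k)
    then show ?thesis using Hnorm_neg[of k "G z"] by (simp add: funpow_swap1)
  qed (simp add: Hnorm_1)
  then show ?thesis unfolding energy_def en_def using Hnorm_neg[of m y] by (simp add: field_simps)
qed

lemma GG_A: "u \<in> D \<Longrightarrow> G (G (A u)) = u"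
proof (rule P_ext)
  fix \<mu> assume u: "u \<in> D" and \<mu>: "\<mu> \<in> \<Lambda>"
  have "P \<mu> (A u) = \<mu> *\<^sub>R P \<mu> u"
  proof (rule inner_ext)
    fix z
    have "P \<mu> (A u) \<bullet> z = u \<bullet> A (P \<mu> z)" by (simp add: P_symmetric A_symmetric u P_in_D)
    also have "\<dots> = (\<mu> *\<^sub>R P \<mu> u) \<bullet> z" by (simp add: A_P P_symmetric)
    finally show "P \<mu> (A u) \<bullet> z = (\<mu> *\<^sub>R P \<mu> u) \<bullet> z" .
  qed
  moreover have "\<mu> powr (- 1 / 2) * (\<mu> powr (- 1 / 2) * \<mu>) = 1"
    using eigenvalue_pos[OF \<mu>] by (simp add: powr_minus powr_half_sqrt field_simps)
  ultimately show "P \<mu> (G (G (A u))) = P \<mu> u" using \<mu> by (simp add: P_G)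
qed

text \<open>On truncations \<open>A\<close> acts on a finite sum of eigenvectors, and the closed
  graph passes to the limit. Together with \<open>GG_A\<close> this identifies \<open>D\<close> with
  the range of \<open>G\<close> applied twice, so test vectors can be written \<open>G (G x)\<close>
  and \<open>A\<close> disappears from the weak equation.\<close>

lemma GG_in_D: "G (G x) \<in> D" and A_GG: "A (G (G x)) = x"
proof -
  have PN_D: "PN N y \<in> D" for N y
    unfolding PN_def by (intro subspace_sum subspace_D P_in_D)
  have A_PN: "A (PN N (G (G x))) = PN N x" for N
  proof -
    have "A (\<Sum>\<mu>\<in>F. P \<mu> (G (G x))) = (\<Sum>\<mu>\<in>F. P \<mu> x)" if "finite F" "F \<subseteq> \<Lambda>" for F
      using that
    proof (induction F rule: finite_induct)
      case empty
      then show ?case using A_scale[of 0 0] subspace_0[OF subspace_D] by simp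
    next
      case (insert \<mu> F)
      have "\<mu> * (\<mu> powr (- 1 / 2) * \<mu> powr (- 1 / 2)) = 1"
        using eigenvalue_pos[of \<mu>] insert.prems by (simp add: powr_minus powr_half_sqrt field_simps)
      moreover have "A (P \<mu> (G (G x)) + (\<Sum>\<mu>\<in>F. P \<mu> (G (G x))))
          = A (P \<mu> (G (G x))) + A (\<Sum>\<mu>\<in>F. P \<mu> (G (G x)))"
        by (intro A_add P_in_D subspace_sum subspace_D)
      ultimately show ?case using insert by (simp add: A_P P_G mult.assoc)
    qed
    from this[OF finite_\<Lambda>N \<Lambda>N_subset] show ?thesis unfolding PN_def .
  qed
  have "(\<lambda>N. A (PN N (G (G x)))) \<longlonglongrightarrow> x" unfolding A_PN by (rule PN_tendsto)
  from closed_graph[OF PN_D PN_tendsto this] show "G (G x) \<in> D" "A (G (G x)) = x" by auto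
qed

text \<open>A bounded stand-in for the square root of \<open>A\<close>: composed with
  \<open>G\<close> on either side it gives the truncation \<open>PN N\<close>. It lets truncated
  waves be differentiated in \<open>H\<close>.\<close>

definition LN :: "nat \<Rightarrow> 'h \<Rightarrow> 'h" where "LN N x = (\<Sum>\<mu>\<in>\<Lambda>N N. (\<mu> powr (1 / 2)) *\<^sub>R P \<mu> x)"

lemma LN_bounded_linear: "bounded_linear (LN N)"
  unfolding LN_def[abs_def]
  by (intro bounded_linear_sum bounded_linear_compose[OF bounded_linear_scaleR_right] P_bounded_linear)

lemma LN_symmetric: "LN N x \<bullet> y = x \<bullet> LN N y"
  unfolding LN_def by (simp add: inner_sum_left inner_sum_right P_symmetric)

lemma LN_G: "LN N (G x) = PN N x"
  unfolding LN_def PN_def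
proof (rule sum.cong[OF refl])
  fix \<mu> assume "\<mu> \<in> \<Lambda>N N"
  then have \<mu>: "\<mu> \<in> \<Lambda>" using \<Lambda>N_subset by blast
  have "\<mu> powr (1 / 2) * \<mu> powr (- 1 / 2) = 1"
    unfolding powr_add[symmetric] using eigenvalue_pos[OF \<mu>] by simp
  then show "(\<mu> powr (1 / 2)) *\<^sub>R P \<mu> (G x) = P \<mu> x" by (simp add: P_G[OF \<mu>])
qed

lemma G_LN: "G (LN N x) = PN N x"
  by (rule inner_ext) (simp add: G_symmetric LN_symmetric LN_G PN_symmetric)

lemma en_nonneg: "en m z y \<ge> 0" unfolding en_def by simp

lemma range_G_dense: "closure (range (\<lambda>x. G (G x))) = UNIV"
proof -
  have "D = range (\<lambda>x. G (G x))" by (auto simp: GG_in_D) (metis GG_A rangeI)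
  then show ?thesis using dense_D by simp
qed

end


section \<open>The wave equation as a first-order system\<close>

lemma continuous_on_bl:
  "bounded_linear S \<Longrightarrow> continuous_on T f \<Longrightarrow> continuous_on T (\<lambda>t. S (f t))"
  by (rule continuous_on_compose2[OF linear_continuous_on[of S UNIV]]) auto

lemma real_integral_FTC:
  fixes f f' :: "real \<Rightarrow> real"
  assumes "\<And>s. s \<in> {0..T} \<Longrightarrow> (f has_vector_derivative f' s) (at s within {0..T})" "t \<in> {0..T}"
  shows "f t - f 0 = integral {0..t} f'"
proof -
  have "(f' has_integral (f t - f 0)) {0..t}"
  proof (rule fundamental_theorem_of_calculus)
    fix s assume "s \<in> {0..t}"
    then show "(f has_vector_derivative f' s) (at s within {0..t})"
      using assms by (intro has_vector_derivative_within_subset[OF assms(1)]) auto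
  qed (use assms in auto)
  then show ?thesis by (simp add: integral_unique)
qed

text \<open>In place of Gronwall, the identity is read at the time \<open>r\<close> where the energy
  is largest, and half of the maximum is absorbed. The statement is detached from the wave equation
  because it serves both continuous and merely square-integrable forcing.\<close>

lemma energy_bound:
  fixes y f :: "real \<Rightarrow> 'a::real_inner"
  assumes T: "T > 0" and ce: "continuous_on {0..T} e"
    and ye: "\<And>t. t \<in> {0..T} \<Longrightarrow> (norm (y t))\<^sup>2 \<le> 2 * e t"
    and ident: "\<And>t. t \<in> {0..T} \<Longrightarrow> e t = e 0 + integral {0..t} (\<lambda>s. y s \<bullet> f s)"
    and int: "(\<lambda>s. y s \<bullet> f s) integrable_on {0..T}" "(\<lambda>s. (norm (f s))\<^sup>2) integrable_on {0..T}"
    and t: "t \<in> {0..T}"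
  shows "e t \<le> 2 * e 0 + 2 * T * integral {0..T} (\<lambda>s. (norm (f s))\<^sup>2)"
proof -
  define J where "J = integral {0..T} (\<lambda>s. (norm (f s))\<^sup>2)"
  obtain r where r: "r \<in> {0..T}" "\<And>t. t \<in> {0..T} \<Longrightarrow> e t \<le> e r"
    using continuous_attains_sup[of "{0..T}" e] T ce by auto
  define M where "M = e r"
  have M0: "M \<ge> 0" using order_trans[OF zero_le_power2 ye[OF r(1)]] unfolding M_def by simp
  have int_r: "(\<lambda>s. M / (2 * T) + T * (norm (f s))\<^sup>2) integrable_on {0..T}"
    by (intro integrable_add integrable_on_mult_right int(2)) (simp add: integrable_on_const)
  have "integral {0..r} (\<lambda>s. y s \<bullet> f s) \<le> integral {0..r} (\<lambda>s. M / (2 * T) + T * (norm (f s))\<^sup>2)"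
  proof (rule integral_le)
    show "(\<lambda>s. y s \<bullet> f s) integrable_on {0..r}" "(\<lambda>s. M / (2 * T) + T * (norm (f s))\<^sup>2) integrable_on {0..r}"
      using r(1) by (auto intro: integrable_subinterval_real[OF int(1)] integrable_subinterval_real[OF int_r])
    fix s assume "s \<in> {0..r}"
    then have y: "(norm (y s))\<^sup>2 \<le> 2 * M" using r ye[of s] unfolding M_def by force
    \<comment> \<open>Young's inequality, weighted so that the energy part integrates over
      \<open>{0..T}\<close> to at most \<open>M / 2\<close>.\<close>
    have "0 \<le> (norm (y s) / (2 * sqrt T) - sqrt T * norm (f s))\<^sup>2" by simp
    also have "\<dots> = (norm (y s))\<^sup>2 / (4 * T) + T * (norm (f s))\<^sup>2 - norm (y s) * norm (f s)"
      using T by (simp add: power2_diff power_divide power_mult_distrib)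
    finally have "norm (y s) * norm (f s) \<le> (norm (y s))\<^sup>2 / (4 * T) + T * (norm (f s))\<^sup>2" by simp
    moreover have "(norm (y s))\<^sup>2 / (4 * T) \<le> (2 * M) / (4 * T)"
      using y T by (intro divide_right_mono) auto
    moreover have "y s \<bullet> f s \<le> norm (y s) * norm (f s)" by (rule norm_cauchy_schwarz)
    ultimately show "y s \<bullet> f s \<le> M / (2 * T) + T * (norm (f s))\<^sup>2" by simp
  qed
  also have "\<dots> \<le> integral {0..T} (\<lambda>s. M / (2 * T) + T * (norm (f s))\<^sup>2)"
    using r T M0 by (intro integral_subset_le integrable_subinterval_real[OF int_r] int_r) auto
  also have "\<dots> = integral {0..T} (\<lambda>s. M / (2 * T)) + integral {0..T} (\<lambda>s. T * (norm (f s))\<^sup>2)"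
    by (intro integral_add integrable_on_mult_right int(2)) (simp add: integrable_on_const)
  also have "\<dots> = M / 2 + T * J" using T unfolding J_def by simp
  finally have "M \<le> e 0 + (M / 2 + T * J)"
    using ident[OF r(1)] unfolding M_def by simp
  then show ?thesis using r(2)[OF t] unfolding M_def[symmetric] J_def[symmetric] by argo
qed

context positive_operator
begin

text \<open>
  \<open>w'' + A w = f\<close> in the variables \<open>z = A\<^bsup>1/2\<^esup> w\<close> and \<open>y = w'\<close>. Both first-order equations are
  multiplied by \<open>G = A\<^bsup>-1/2\<^esup>\<close>, so that they hold with derivatives in the norm of \<open>H\<close>.
\<close>

definition sol :: "real \<Rightarrow> (real \<Rightarrow> 'h) \<Rightarrow> (real \<Rightarrow> 'h) \<Rightarrow> (real \<Rightarrow> 'h) \<Rightarrow> bool" where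
  "sol T f z y \<longleftrightarrow> continuous_on {0..T} f \<and> continuous_on {0..T} z \<and> continuous_on {0..T} y \<and>
     (\<forall>t\<in>{0..T}. ((\<lambda>s. G (z s)) has_vector_derivative y t) (at t within {0..T}) \<and>
                 ((\<lambda>s. G (y s)) has_vector_derivative (G (f t) - z t)) (at t within {0..T}))"

lemma solD:
  assumes "sol T f z y"
  shows sol_cont_f: "continuous_on {0..T} f" and sol_cont_z: "continuous_on {0..T} z"
    and sol_cont_y: "continuous_on {0..T} y"
    and sol_dz: "t \<in> {0..T} \<Longrightarrow> ((\<lambda>s. G (z s)) has_vector_derivative y t) (at t within {0..T})"
    and sol_dy: "t \<in> {0..T} \<Longrightarrow>
      ((\<lambda>s. G (y s)) has_vector_derivative (G (f t) - z t)) (at t within {0..T})"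
  using assms unfolding sol_def by auto

lemma sol_add:
  assumes "sol T f z y" "sol T f' z' y'"
  shows "sol T (\<lambda>t. f t + f' t) (\<lambda>t. z t + z' t) (\<lambda>t. y t + y' t)"
  unfolding sol_def
proof (intro conjI ballI)
  fix t assume t: "t \<in> {0..T}"
  show "((\<lambda>s. G (z s + z' s)) has_vector_derivative y t + y' t) (at t within {0..T})"
    unfolding G_add
    by (rule has_vector_derivative_add[OF sol_dz[OF assms(1) t] sol_dz[OF assms(2) t]])
  have "((\<lambda>s. G (y s) + G (y' s)) has_vector_derivative (G (f t) - z t) + (G (f' t) - z' t))
      (at t within {0..T})"
    by (rule has_vector_derivative_add[OF sol_dy[OF assms(1) t] sol_dy[OF assms(2) t]])
  then show "((\<lambda>s. G (y s + y' s)) has_vector_derivative G (f t + f' t) - (z t + z' t))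
      (at t within {0..T})"
    by (simp add: G_add algebra_simps)
qed (intro continuous_intros sol_cont_f[OF assms(1)] sol_cont_z[OF assms(1)] sol_cont_y[OF assms(1)]
    sol_cont_f[OF assms(2)] sol_cont_z[OF assms(2)] sol_cont_y[OF assms(2)])+

text \<open>Applied to powers of \<open>G\<close>, which lower the level at which energies are read,
  and to the truncations \<open>PN N\<close>, which make waves smooth.\<close>

lemma sol_map:
  assumes "sol T f z y" and S: "bounded_linear S" and comm: "\<And>x. S (G x) = G (S x)"
  shows "sol T (\<lambda>t. S (f t)) (\<lambda>t. S (z t)) (\<lambda>t. S (y t))"
  unfolding sol_def
proof (intro conjI ballI)
  fix t assume t: "t \<in> {0..T}"
  show "((\<lambda>s. G (S (z s))) has_vector_derivative S (y t)) (at t within {0..T})"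
    using bounded_linear.has_vector_derivative[OF S sol_dz[OF assms(1) t]] by (simp add: comm)
  show "((\<lambda>s. G (S (y s))) has_vector_derivative G (S (f t)) - S (z t)) (at t within {0..T})"
    using bounded_linear.has_vector_derivative[OF S sol_dy[OF assms(1) t]]
    by (simp add: comm bl_diff[OF S])
qed (intro continuous_on_bl[OF S] sol_cont_f[OF assms(1)] sol_cont_z[OF assms(1)]
    sol_cont_y[OF assms(1)])+

lemma sol_minus: "sol T f z y \<Longrightarrow> sol T (\<lambda>t. - f t) (\<lambda>t. - z t) (\<lambda>t. - y t)"
  by (rule sol_map[of T f z y uminus])
    (use bounded_linear_minus[OF bounded_linear_ident] in \<open>auto simp: G_minus\<close>)

lemma sol_diff:
  assumes "sol T f z y" "sol T f' z' y'"
  shows "sol T (\<lambda>t. f t - f' t) (\<lambda>t. z t - z' t) (\<lambda>t. y t - y' t)"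
  using sol_add[OF assms(1) sol_minus[OF assms(2)]] by simp

lemma sol_Gpow: "sol T f z y \<Longrightarrow> sol T (\<lambda>t. (G ^^ k) (f t)) (\<lambda>t. (G ^^ k) (z t)) (\<lambda>t. (G ^^ k) (y t))"
  by (rule sol_map[OF _ Gpow_bounded_linear]) (simp_all add: funpow_swap1)

lemma sol_PN: "sol T f z y \<Longrightarrow> sol T (\<lambda>t. PN N (f t)) (\<lambda>t. PN N (z t)) (\<lambda>t. PN N (y t))"
  by (rule sol_map[OF _ PN_bounded_linear]) (simp_all add: G_PN)

lemma sol_shift:
  assumes "sol T f z y" "0 \<le> s" "s + T' \<le> T"
  shows "sol T' (\<lambda>t. f (s + t)) (\<lambda>t. z (s + t)) (\<lambda>t. y (s + t))"
  unfolding sol_def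
proof (intro conjI ballI)
  have sub: "(\<lambda>t. s + t) ` {0..T'} \<subseteq> {0..T}" using assms by auto
  have c: "continuous_on {0..T'} (\<lambda>t. s + t)" by (intro continuous_intros)
  show "continuous_on {0..T'} (\<lambda>t. f (s + t))" "continuous_on {0..T'} (\<lambda>t. z (s + t))"
    "continuous_on {0..T'} (\<lambda>t. y (s + t))"
    by (rule continuous_on_compose2[OF _ c sub], use solD[OF assms(1)] in blast)+
  fix t assume t: "t \<in> {0..T'}"
  then have st: "s + t \<in> {0..T}" using assms by auto
  have sh: "((\<lambda>t. s + t) has_vector_derivative 1) (at t within {0..T'})"
    by (auto intro!: derivative_eq_intros)
  have comp: "((\<lambda>t. p (s + t)) has_vector_derivative q) (at t within {0..T'})"
    if "(p has_vector_derivative q) (at (s + t) within {0..T})" for p q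
    using vector_diff_chain_within[OF sh has_vector_derivative_within_subset[OF that sub]]
    by (simp add: o_def)
  show "((\<lambda>t. G (z (s + t))) has_vector_derivative y (s + t)) (at t within {0..T'})"
    by (rule comp[of "\<lambda>t. G (z t)"], rule sol_dz[OF assms(1) st])
  show "((\<lambda>t. G (y (s + t))) has_vector_derivative G (f (s + t)) - z (s + t)) (at t within {0..T'})"
    by (rule comp[of "\<lambda>t. G (y t)"], rule sol_dy[OF assms(1) st])
qed

lemma sol_restrict: "sol T f z y \<Longrightarrow> T' \<le> T \<Longrightarrow> sol T' f z y"
  using sol_shift[of T f z y 0 T'] by simp

lemma sol_cong:
  assumes "sol T f z y" "\<And>t. t \<in> {0..T} \<Longrightarrow> f t = f' t" "\<And>t. t \<in> {0..T} \<Longrightarrow> z t = z' t"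
    "\<And>t. t \<in> {0..T} \<Longrightarrow> y t = y' t"
  shows "sol T f' z' y'"
  unfolding sol_def
proof (intro conjI ballI)
  show "continuous_on {0..T} f'" "continuous_on {0..T} z'" "continuous_on {0..T} y'"
    using solD(1-3)[OF assms(1)] assms(2-) by (metis continuous_on_cong)+
  fix t assume t: "t \<in> {0..T}"
  show "((\<lambda>s. G (z' s)) has_vector_derivative y' t) (at t within {0..T})"
    by (rule has_vector_derivative_transform[OF t, of _ "\<lambda>s. G (z s)"])
      (use assms sol_dz[OF assms(1) t] t in auto)
  show "((\<lambda>s. G (y' s)) has_vector_derivative G (f' t) - z' t) (at t within {0..T})"
    by (rule has_vector_derivative_transform[OF t, of _ "\<lambda>s. G (y s)"])
      (use assms sol_dy[OF assms(1) t] t in auto)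
qed

lemma sol_zero: "sol T (\<lambda>_. 0) (\<lambda>_. 0) (\<lambda>_. 0)"
  unfolding sol_def by (auto simp: G_zero)

lemma en_0: "en 0 z y = (norm z)\<^sup>2 / 2 + (norm y)\<^sup>2 / 2"
  unfolding en_def by simp

lemma en_Gpow: "en m z y = en 0 ((G ^^ m) z) ((G ^^ m) y)"
  unfolding en_def by simp

lemma PN_LN: "PN N (LN N x) = LN N x"
proof -
  have "PN N (P \<mu> x) = P \<mu> x" if "\<mu> \<in> \<Lambda>N N" for \<mu>
    by (rule P_ext) (use that in \<open>auto simp: P_PN P_P\<close>)
  then show ?thesis
    unfolding LN_def by (simp add: bl_sum[OF PN_bounded_linear] bl_scale[OF PN_bounded_linear])
qed

lemma LN_PN: "LN N (PN N x) = LN N x"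
  by (rule inner_ext) (simp add: PN_symmetric LN_symmetric PN_LN)

text \<open>Applying \<open>LN\<close> to the equations multiplied by \<open>G\<close> recovers the
  time derivatives of the truncated components themselves, which the untruncated ones need not have
  in \<open>H\<close>.\<close>

lemma sol_dPNz:
  assumes "sol T f z y" "t \<in> {0..T}"
  shows "((\<lambda>s. PN N (z s)) has_vector_derivative LN N (y t)) (at t within {0..T})"
  using bounded_linear.has_vector_derivative[OF LN_bounded_linear sol_dz[OF assms]]
  by (simp add: LN_G)

lemma sol_dPNy:
  assumes "sol T f z y" "t \<in> {0..T}"
  shows "((\<lambda>s. PN N (y s)) has_vector_derivative (PN N (f t) - LN N (z t))) (at t within {0..T})"
  using bounded_linear.has_vector_derivative[OF LN_bounded_linear sol_dy[OF assms]]
  by (simp add: LN_G bl_diff[OF LN_bounded_linear])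

lemma PN_inner_integral_tendsto:
  fixes p q :: "real \<Rightarrow> 'h"
  assumes "continuous_on {a..b} p" "continuous_on {a..b} q"
  shows "(\<lambda>N. integral {a..b} (\<lambda>s. PN N (p s) \<bullet> q s)) \<longlonglongrightarrow> integral {a..b} (\<lambda>s. p s \<bullet> q s)"
proof (rule dominated_convergence(2))
  show "(\<lambda>s. PN N (p s) \<bullet> q s) integrable_on {a..b}" for N
    by (intro integrable_continuous_interval continuous_on_inner
      continuous_on_bl[OF PN_bounded_linear assms(1)] assms(2))
  show "(\<lambda>s. norm (p s) * norm (q s)) integrable_on {a..b}"
    by (intro integrable_continuous_interval continuous_intros assms)
  show "norm (PN N (p s) \<bullet> q s) \<le> norm (p s) * norm (q s)" for N s
    using Cauchy_Schwarz_ineq2[of "PN N (p s)" "q s"] PN_norm_le[of N "p s"]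
    by (metis mult_right_mono norm_ge_zero order_trans real_norm_def)
qed (rule PN_weak)

text \<open>The energy cannot be differentiated directly, because \<open>z\<close> and
  \<open>y\<close> are only continuous in \<open>H\<close>. It is differentiated on truncations, and
  the integrated identity is passed to the limit.\<close>

lemma energy_identity:
  assumes s: "sol T f z y" and t: "t \<in> {0..T}"
  shows "en 0 (z t) (y t) = en 0 (z 0) (y 0) + integral {0..t} (\<lambda>s. y s \<bullet> f s)"
proof -
  have "en 0 (PN N (z t)) (PN N (y t)) - en 0 (PN N (z 0)) (PN N (y 0))
      = integral {0..t} (\<lambda>s. PN N (y s) \<bullet> f s)" for N
  proof (rule real_integral_FTC[OF _ t])
    fix r assume r: "r \<in> {0..T}"
    have d: "((\<lambda>s. PN N (z s) \<bullet> PN N (z s) / 2 + PN N (y s) \<bullet> PN N (y s) / 2) has_vector_derivative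
        (PN N (z r) \<bullet> LN N (y r) + LN N (y r) \<bullet> PN N (z r)) / 2
         + (PN N (y r) \<bullet> (PN N (f r) - LN N (z r)) + (PN N (f r) - LN N (z r)) \<bullet> PN N (y r)) / 2)
        (at r within {0..T})"
      by (intro has_vector_derivative_divide has_vector_derivative_add
        bounded_bilinear.has_vector_derivative[OF bounded_bilinear_inner]
        sol_dPNz[OF s r] sol_dPNy[OF s r])
    \<comment> \<open>The exchange between potential and kinetic energy cancels because
      \<open>LN\<close> is symmetric and absorbs \<open>PN\<close>.\<close>
    have "PN N (z r) \<bullet> LN N (y r) = PN N (y r) \<bullet> LN N (z r)"
      by (metis LN_PN LN_symmetric inner_commute)
    moreover have "PN N (y r) \<bullet> PN N (f r) = PN N (y r) \<bullet> f r"
      by (metis PN_PN PN_symmetric)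
    ultimately have e: "(PN N (z r) \<bullet> LN N (y r) + LN N (y r) \<bullet> PN N (z r)) / 2
         + (PN N (y r) \<bullet> (PN N (f r) - LN N (z r)) + (PN N (f r) - LN N (z r)) \<bullet> PN N (y r)) / 2
         = PN N (y r) \<bullet> f r"
      by (simp add: inner_diff_right inner_diff_left inner_commute add_divide_distrib diff_divide_distrib)
    show "((\<lambda>s. en 0 (PN N (z s)) (PN N (y s))) has_vector_derivative PN N (y r) \<bullet> f r)
        (at r within {0..T})"
      using d unfolding e en_0 power2_norm_eq_inner .
  qed
  moreover have "(\<lambda>N. integral {0..t} (\<lambda>s. PN N (y s) \<bullet> f s)) \<longlonglongrightarrow> integral {0..t} (\<lambda>s. y s \<bullet> f s)"
    using t by (intro PN_inner_integral_tendsto continuous_on_subset[OF sol_cont_y[OF s]]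
      continuous_on_subset[OF sol_cont_f[OF s]]) auto
  moreover have "(\<lambda>N. en 0 (PN N (z t)) (PN N (y t)) - en 0 (PN N (z 0)) (PN N (y 0)))
      \<longlonglongrightarrow> en 0 (z t) (y t) - en 0 (z 0) (y 0)"
    unfolding en_0 by (intro tendsto_intros PN_tendsto) auto
  ultimately have "en 0 (z t) (y t) - en 0 (z 0) (y 0) = integral {0..t} (\<lambda>s. y s \<bullet> f s)"
    by (simp add: LIMSEQ_unique)
  then show ?thesis by simp
qed

lemma energy_conserved:
  assumes s: "sol T (\<lambda>_. 0) z y" and t: "t \<in> {0..T}"
  shows "en m (z t) (y t) = en m (z 0) (y 0)"
  using energy_identity[OF sol_Gpow[OF s, of m] t]
  by (simp add: en_Gpow[of m] bl_zero[OF Gpow_bounded_linear])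

lemma energy_estimate_0:
  assumes s: "sol T f z y" and t: "t \<in> {0..T}" and T: "T > 0"
  shows "en 0 (z t) (y t) \<le> 2 * en 0 (z 0) (y 0) + 2 * T * integral {0..T} (\<lambda>s. (norm (f s))\<^sup>2)"
proof (rule energy_bound[OF T _ _ energy_identity[OF s] _ _ t])
  note cont = sol_cont_f[OF s] sol_cont_z[OF s] sol_cont_y[OF s]
  show "continuous_on {0..T} (\<lambda>t. en 0 (z t) (y t))"
    unfolding en_0 by (intro continuous_intros cont) auto
  show "(norm (y r))\<^sup>2 \<le> 2 * en 0 (z r) (y r)" for r
    using zero_le_power2[of "norm (z r)"] unfolding en_0 by argo
  show "(\<lambda>s. y s \<bullet> f s) integrable_on {0..T}" "(\<lambda>s. (norm (f s))\<^sup>2) integrable_on {0..T}"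
    by (intro integrable_continuous_interval continuous_intros cont)+
qed

lemma energy_estimate:
  assumes s: "sol T f z y" and t: "t \<in> {0..T}" and T: "T > 0"
  shows "en m (z t) (y t) \<le> 2 * en m (z 0) (y 0) + 2 * T * integral {0..T} (\<lambda>s. (norm ((G ^^ m) (f s)))\<^sup>2)"
  using energy_estimate_0[OF sol_Gpow[OF s, of m] t T] by (simp add: en_Gpow[of m])

text \<open>If \<open>W\<close> is a primitive of \<open>w = G z\<close> solving
  \<open>W'' + A W = \<Phi>\<close>, then \<open>W'' = y\<close> forces
  \<open>A W = \<Phi> - y\<close>, that is, the new first component is
  \<open>G (\<Phi> - y)\<close>. The equation itself fixes the constant of integration, so no
  integral from 0 appears, and any primitive \<Phi> of the forcing is allowed.\<close>

lemma sol_primitive: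
  assumes s: "sol T f z y"
    and Phi: "\<And>t. t \<in> {0..T} \<Longrightarrow> (\<Phi> has_vector_derivative f t) (at t within {0..T})"
  shows "sol T \<Phi> (\<lambda>t. G (\<Phi> t - y t)) (\<lambda>t. G (z t))"
proof -
  have c: "continuous_on {0..T} \<Phi>"
    using Phi by (meson continuous_on_eq_continuous_within has_vector_derivative_continuous)
  show ?thesis
    unfolding sol_def
  proof (intro conjI ballI)
    show "continuous_on {0..T} (\<lambda>t. G (\<Phi> t - y t))" "continuous_on {0..T} (\<lambda>t. G (z t))"
      by (intro continuous_on_bl[OF G_bounded_linear] continuous_intros c solD(1-3)[OF s])+
    fix t assume t: "t \<in> {0..T}"
    have "((\<lambda>s. G (G (\<Phi> s)) - G (G (y s))) has_vector_derivative G (G (f t)) - G (G (f t) - z t))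
        (at t within {0..T})"
      by (intro has_vector_derivative_diff bounded_linear.has_vector_derivative[OF G_bounded_linear]
        Phi t sol_dy[OF s])
    then show "((\<lambda>s. G (G (\<Phi> s - y s))) has_vector_derivative G (z t)) (at t within {0..T})"
      by (simp add: G_diff)
    have "((\<lambda>s. G (G (z s))) has_vector_derivative G (y t)) (at t within {0..T})"
      by (intro bounded_linear.has_vector_derivative[OF G_bounded_linear] sol_dz[OF s t])
    then show "((\<lambda>s. G (G (z s))) has_vector_derivative G (\<Phi> t) - G (\<Phi> t - y t)) (at t within {0..T})"
      by (simp add: G_diff)
  qed (rule c)
qed

lemma sol_primitive_free:
  assumes "sol T (\<lambda>_. 0) z y"
  shows "sol T (\<lambda>_. 0) (\<lambda>t. - G (y t)) (\<lambda>t. G (z t))"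
  using sol_primitive[OF assms, of "\<lambda>_. 0"] by (simp add: G_minus)

text \<open>With \<open>w = G z\<close>, the time derivative of
  \<open>w1' \<bullet> w2 - w1 \<bullet> w2'\<close> is \<open>- (w1 \<bullet> f)\<close>: the two
  terms with \<open>A\<close> cancel by symmetry. Truncation makes the differentiation
  legitimate.\<close>

lemma pairing:
  assumes p: "sol T (\<lambda>_. 0) z1 y1" and q: "sol T f z2 y2" and T: "0 \<le> T"
  shows "(y1 T \<bullet> G (z2 T) - G (z1 T) \<bullet> y2 T) - (y1 0 \<bullet> G (z2 0) - G (z1 0) \<bullet> y2 0)
    = - integral {0..T} (\<lambda>t. G (z1 t) \<bullet> f t)"
proof -
  define X where "X N t = PN N (y1 t) \<bullet> G (z2 t) - G (z1 t) \<bullet> PN N (y2 t)" for N t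
  have "X N T - X N 0 = integral {0..T} (\<lambda>t. - (PN N (G (z1 t)) \<bullet> f t))" for N
  proof (rule real_integral_FTC[where T = T])
    fix t assume t: "t \<in> {0..T}"
    have "((\<lambda>t. PN N (y1 t) \<bullet> G (z2 t) - G (z1 t) \<bullet> PN N (y2 t)) has_vector_derivative
       (PN N (y1 t) \<bullet> y2 t + (PN N 0 - LN N (z1 t)) \<bullet> G (z2 t))
        - (G (z1 t) \<bullet> (PN N (f t) - LN N (z2 t)) + y1 t \<bullet> PN N (y2 t))) (at t within {0..T})"
      by (intro has_vector_derivative_diff
        bounded_bilinear.has_vector_derivative[OF bounded_bilinear_inner]
        sol_dPNy[OF p t] sol_dPNy[OF q t] sol_dz[OF p t] sol_dz[OF q t])
    moreover have "(PN N (y1 t) \<bullet> y2 t + (PN N 0 - LN N (z1 t)) \<bullet> G (z2 t))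
        - (G (z1 t) \<bullet> (PN N (f t) - LN N (z2 t)) + y1 t \<bullet> PN N (y2 t)) = - (PN N (G (z1 t)) \<bullet> f t)"
      by (simp add: bl_zero[OF PN_bounded_linear] inner_diff_right inner_diff_left PN_symmetric
          LN_symmetric LN_G) (simp add: LN_symmetric[symmetric] LN_G PN_symmetric)
    ultimately show "(X N has_vector_derivative - (PN N (G (z1 t)) \<bullet> f t)) (at t within {0..T})"
      unfolding X_def[abs_def] by simp
  qed (use T in auto)
  then have "X N T - X N 0 = - integral {0..T} (\<lambda>t. PN N (G (z1 t)) \<bullet> f t)" for N by simp
  moreover have "(\<lambda>N. - integral {0..T} (\<lambda>t. PN N (G (z1 t)) \<bullet> f t)) \<longlonglongrightarrow>
      - integral {0..T} (\<lambda>t. G (z1 t) \<bullet> f t)"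
    by (intro tendsto_minus PN_inner_integral_tendsto continuous_on_bl[OF G_bounded_linear]
      sol_cont_z[OF p] sol_cont_f[OF q])
  moreover have "(\<lambda>N. X N T - X N 0) \<longlonglongrightarrow>
      (y1 T \<bullet> G (z2 T) - G (z1 T) \<bullet> y2 T) - (y1 0 \<bullet> G (z2 0) - G (z1 0) \<bullet> y2 0)"
    unfolding X_def by (intro tendsto_intros PN_tendsto)
  ultimately show ?thesis by (simp add: LIMSEQ_unique)
qed

end


section \<open>Well-posedness\<close>

lemma norm_diff_sq_le: "(norm (x - y))\<^sup>2 \<le> 2 * (norm x)\<^sup>2 + 2 * (norm y)\<^sup>2" for x y :: "'a::real_normed_vector"
proof -
  have "(norm (x - y))\<^sup>2 \<le> (norm x + norm y)\<^sup>2"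
    by (intro power_mono norm_triangle_ineq4) auto
  also have "\<dots> \<le> 2 * (norm x)\<^sup>2 + 2 * (norm y)\<^sup>2"
    using zero_le_power2[of "norm x - norm y"] by (simp add: power2_sum power2_diff)
  finally show ?thesis .
qed

text \<open>Only the weak integral identity has to pass to the limit, so pointwise convergence of
  the derivatives with a common bound suffices; the derivative in norm is recovered from continuity
  of \<open>q\<close>.\<close>

lemma limit_vector_derivative:
  fixes a b :: "nat \<Rightarrow> real \<Rightarrow> 'a::real_inner"
  assumes der: "\<And>N t. t \<in> {0..T} \<Longrightarrow> (a N has_vector_derivative b N t) (at t within {0..T})"
    and cont: "\<And>N. continuous_on {0..T} (b N)" "continuous_on {0..T} q"
    and lim: "\<And>t. t \<in> {0..T} \<Longrightarrow> (\<lambda>N. a N t) \<longlonglongrightarrow> p t" "\<And>t. t \<in> {0..T} \<Longrightarrow> (\<lambda>N. b N t) \<longlonglongrightarrow> q t"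
    and bd: "\<And>N t. t \<in> {0..T} \<Longrightarrow> norm (b N t) \<le> K"
    and t: "t \<in> {0..T}"
  shows "(p has_vector_derivative q t) (at t within {0..T})"
proof (rule weak_integral_imp_vector_derivative[OF cont(2) t closure_UNIV])
  fix s \<psi> assume s: "s \<in> {0..T}"
  have cs: "continuous_on {0..s} (\<lambda>r. b N r \<bullet> \<psi>)" for N
    by (intro continuous_intros continuous_on_subset[OF cont(1)]) (use s in auto)
  have "(\<lambda>N. integral {0..s} (\<lambda>r. b N r \<bullet> \<psi>)) \<longlonglongrightarrow> integral {0..s} (\<lambda>r. q r \<bullet> \<psi>)"
  proof (rule dominated_convergence(2))
    show "(\<lambda>r. b N r \<bullet> \<psi>) integrable_on {0..s}" for N by (intro integrable_continuous_interval cs)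
    show "(\<lambda>r::real. K * norm \<psi>) integrable_on {0..s}" by (intro integrable_continuous_interval continuous_intros)
    show "norm (b N r \<bullet> \<psi>) \<le> K * norm \<psi>" if "r \<in> {0..s}" for N r
      using Cauchy_Schwarz_ineq2[of "b N r" \<psi>] mult_right_mono[OF bd[of r N], of "norm \<psi>"] that s by auto
    show "(\<lambda>N. b N r \<bullet> \<psi>) \<longlonglongrightarrow> q r \<bullet> \<psi>" if "r \<in> {0..s}" for r
      by (intro tendsto_intros lim) (use that s in auto)
  qed
  moreover have "integral {0..s} (\<lambda>r. b N r \<bullet> \<psi>) = a N s \<bullet> \<psi> - a N 0 \<bullet> \<psi>" for N
    by (rule real_integral_FTC[symmetric, OF bounded_linear.has_vector_derivative[OF bounded_linear_inner_left der] s])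
  ultimately have "(\<lambda>N. a N s \<bullet> \<psi> - a N 0 \<bullet> \<psi>) \<longlonglongrightarrow> integral {0..s} (\<lambda>r. q r \<bullet> \<psi>)" by simp
  moreover have "(\<lambda>N. a N s \<bullet> \<psi> - a N 0 \<bullet> \<psi>) \<longlonglongrightarrow> p s \<bullet> \<psi> - p 0 \<bullet> \<psi>"
    by (intro tendsto_intros lim) (use s in auto)
  ultimately show "p s \<bullet> \<psi> - p 0 \<bullet> \<psi> = integral {0..s} (\<lambda>r. q r \<bullet> \<psi>)" using LIMSEQ_unique by blast
qed

text \<open>A bound of the form \<open>d N + d M\<close> is what comparing two approximations with a
  common limit of their data produces.\<close>

lemma uniform_limit_of_square_Cauchy:
  fixes s :: "nat \<Rightarrow> 'b \<Rightarrow> 'a::{real_normed_vector,complete_space}"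
  assumes le: "\<And>N M t. t \<in> X \<Longrightarrow> (norm (s N t - s M t))\<^sup>2 \<le> d N + d M" and d: "d \<longlonglongrightarrow> 0"
  shows "\<exists>l. uniform_limit X s l sequentially"
proof -
  have "uniformly_Cauchy_on X s"
  proof (rule uniformly_Cauchy_onI)
    fix e :: real assume e: "e > 0"
    then have "e\<^sup>2 / 2 > 0" by simp
    then have "eventually (\<lambda>N. d N < e\<^sup>2 / 2) sequentially" using d by (rule order_tendstoD(2)[rotated])
    then obtain M where M: "\<And>N. N \<ge> M \<Longrightarrow> d N < e\<^sup>2 / 2" unfolding eventually_sequentially by blast
    have "dist (s m t) (s n t) < e" if "t \<in> X" "m \<ge> M" "n \<ge> M" for t m n
    proof -
      have "(norm (s m t - s n t))\<^sup>2 < e\<^sup>2" using le[OF that(1), of m n] M[OF that(2)] M[OF that(3)] by simp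
      then show ?thesis using e by (simp add: dist_norm power2_less_imp_less)
    qed
    then show "\<exists>M. \<forall>x\<in>X. \<forall>m\<ge>M. \<forall>n\<ge>M. dist (s m x) (s n x) < e" by blast
  qed
  then have "uniformly_convergent_on X s" by (rule Cauchy_uniformly_convergent)
  then show ?thesis unfolding uniformly_convergent_on_def .
qed

context positive_operator
begin

lemma G_P: "\<mu> \<in> \<Lambda> \<Longrightarrow> G (P \<mu> x) = (\<mu> powr (- 1 / 2)) *\<^sub>R P \<mu> x"
  by (rule P_ext) (auto simp: P_G P_P bl_scale[OF P_bounded_linear])

text \<open>On one eigenspace the system is a harmonic oscillator, \<open>z' = w y\<close> and
  \<open>y' = f - w z\<close> with \<open>w\<close> the square root of \<mu>, solved by variation of
  constants.\<close>

lemma sol_mode: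
  assumes \<mu>: "\<mu> \<in> \<Lambda>" and f: "continuous_on {0..T} f"
  shows "\<exists>z y. sol T (\<lambda>t. P \<mu> (f t)) z y \<and> z 0 = P \<mu> z0 \<and> y 0 = P \<mu> y0"
proof -
  define w where "w = sqrt \<mu>"
  have w: "w > 0" "\<mu> powr (- 1 / 2) = 1 / w"
    using eigenvalue_pos[OF \<mu>] powr_minus_divide[of \<mu> "1 / 2"] by (simp_all add: w_def powr_half_sqrt)
  have cf: "continuous_on {0..T} (\<lambda>t. cos (w * t) *\<^sub>R f t)" "continuous_on {0..T} (\<lambda>t. sin (w * t) *\<^sub>R f t)"
    by (intro continuous_intros f)+
  obtain F1 where F1: "F1 0 = 0"
    "\<forall>t\<in>{0..T}. (F1 has_vector_derivative cos (w * t) *\<^sub>R f t) (at t within {0..T})"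
    using antiderivative_continuous[of 0 T "\<lambda>t. cos (w * t) *\<^sub>R f t"] cf by blast
  obtain F2 where F2: "F2 0 = 0"
    "\<forall>t\<in>{0..T}. (F2 has_vector_derivative sin (w * t) *\<^sub>R f t) (at t within {0..T})"
    using antiderivative_continuous[of 0 T "\<lambda>t. sin (w * t) *\<^sub>R f t"] cf by blast
  \<comment> \<open>Variation of constants for unprojected data; the projection onto the eigenspace
    is applied only at the end, since it commutes with the formula.\<close>
  define z where "z t = cos (w * t) *\<^sub>R (z0 - F2 t) + sin (w * t) *\<^sub>R (y0 + F1 t)" for t
  define y where "y t = cos (w * t) *\<^sub>R (y0 + F1 t) - sin (w * t) *\<^sub>R (z0 - F2 t)" for t
  have dc: "((\<lambda>t. cos (w * t)) has_field_derivative - sin (w * t) * w) (at t within {0..T})"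
    and ds: "((\<lambda>t. sin (w * t)) has_field_derivative cos (w * t) * w) (at t within {0..T})" for t
    by (auto intro!: derivative_eq_intros)
  have dz: "(z has_vector_derivative w *\<^sub>R y t) (at t within {0..T})" if t: "t \<in> {0..T}" for t
  proof -
    have "(z has_vector_derivative
        (cos (w * t) *\<^sub>R (0 - sin (w * t) *\<^sub>R f t) + (- sin (w * t) * w) *\<^sub>R (z0 - F2 t))
        + (sin (w * t) *\<^sub>R (0 + cos (w * t) *\<^sub>R f t) + (cos (w * t) * w) *\<^sub>R (y0 + F1 t)))
        (at t within {0..T})"
      unfolding z_def[abs_def]
      by (intro has_vector_derivative_add has_vector_derivative_scaleR dc ds
        has_vector_derivative_diff has_vector_derivative_const F1(2)[rule_format, OF t] F2(2)[rule_format, OF t])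
    then show ?thesis unfolding y_def by (simp add: algebra_simps)
  qed
  have dy: "(y has_vector_derivative f t - w *\<^sub>R z t) (at t within {0..T})" if t: "t \<in> {0..T}" for t
  proof -
    have "(y has_vector_derivative
        (cos (w * t) *\<^sub>R (0 + cos (w * t) *\<^sub>R f t) + (- sin (w * t) * w) *\<^sub>R (y0 + F1 t))
        - (sin (w * t) *\<^sub>R (0 - sin (w * t) *\<^sub>R f t) + (cos (w * t) * w) *\<^sub>R (z0 - F2 t)))
        (at t within {0..T})"
      unfolding y_def[abs_def]
      by (intro has_vector_derivative_add has_vector_derivative_scaleR dc ds
        has_vector_derivative_diff has_vector_derivative_const F1(2)[rule_format, OF t] F2(2)[rule_format, OF t])
    moreover have "cos (w * t) *\<^sub>R cos (w * t) *\<^sub>R f t + sin (w * t) *\<^sub>R sin (w * t) *\<^sub>R f t = f t"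
      by (simp add: scaleR_add_left[symmetric] power2_eq_square[symmetric])
    ultimately show ?thesis unfolding z_def by (simp add: algebra_simps)
  qed
  have "continuous_on {0..T} z" "continuous_on {0..T} y"
    using dz dy by (meson continuous_on_eq_continuous_within has_vector_derivative_continuous)+
  moreover have "((\<lambda>s. G (P \<mu> (z s))) has_vector_derivative P \<mu> (y t)) (at t within {0..T})"
    if t: "t \<in> {0..T}" for t
  proof -
    have "((\<lambda>s. (1 / w) *\<^sub>R P \<mu> (z s)) has_vector_derivative (1 / w) *\<^sub>R P \<mu> (w *\<^sub>R y t)) (at t within {0..T})"
      by (intro bounded_linear.has_vector_derivative[OF bounded_linear_scaleR_right]
        bounded_linear.has_vector_derivative[OF P_bounded_linear] dz t)
    then show ?thesis using w by (simp add: G_P[OF \<mu>] bl_scale[OF P_bounded_linear])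
  qed
  moreover have "((\<lambda>s. G (P \<mu> (y s))) has_vector_derivative G (P \<mu> (f t)) - P \<mu> (z t)) (at t within {0..T})"
    if t: "t \<in> {0..T}" for t
  proof -
    have "((\<lambda>s. (1 / w) *\<^sub>R P \<mu> (y s)) has_vector_derivative (1 / w) *\<^sub>R P \<mu> (f t - w *\<^sub>R z t)) (at t within {0..T})"
      by (intro bounded_linear.has_vector_derivative[OF bounded_linear_scaleR_right]
        bounded_linear.has_vector_derivative[OF P_bounded_linear] dy t)
    then show ?thesis using w
      by (simp add: G_P[OF \<mu>] bl_scale[OF P_bounded_linear] bl_diff[OF P_bounded_linear] scaleR_diff_right)
  qed
  ultimately have "sol T (\<lambda>t. P \<mu> (f t)) (\<lambda>t. P \<mu> (z t)) (\<lambda>t. P \<mu> (y t))"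
    unfolding sol_def by (simp add: continuous_on_bl[OF P_bounded_linear] f)
  moreover have "z 0 = z0" "y 0 = y0" unfolding z_def y_def using F1 F2 by auto
  ultimately show ?thesis by (intro exI[of _ "\<lambda>t. P \<mu> (z t)"] exI[of _ "\<lambda>t. P \<mu> (y t)"]) simp
qed

lemma sol_modes:
  assumes "finite F" "F \<subseteq> \<Lambda>" and f: "continuous_on {0..T} f"
  shows "\<exists>z y. sol T (\<lambda>t. \<Sum>\<mu>\<in>F. P \<mu> (f t)) z y \<and> z 0 = (\<Sum>\<mu>\<in>F. P \<mu> z0) \<and> y 0 = (\<Sum>\<mu>\<in>F. P \<mu> y0)"
  using assms(1,2)
proof (induction F rule: finite_induct)
  case empty
  show ?case using sol_zero by (intro exI[of _ "\<lambda>_. 0"]) simp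
next
  case (insert \<mu> F)
  then obtain z y where 1: "sol T (\<lambda>t. \<Sum>\<mu>\<in>F. P \<mu> (f t)) z y" "z 0 = (\<Sum>\<mu>\<in>F. P \<mu> z0)" "y 0 = (\<Sum>\<mu>\<in>F. P \<mu> y0)"
    by auto
  obtain z' y' where 2: "sol T (\<lambda>t. P \<mu> (f t)) z' y'" "z' 0 = P \<mu> z0" "y' 0 = P \<mu> y0"
    using sol_mode[OF _ f, of \<mu> z0 y0] insert.prems by auto
  show ?case
    by (intro exI[of _ "\<lambda>t. z' t + z t"] exI[of _ "\<lambda>t. y' t + y t"])
      (use sol_add[OF 2(1) 1(1)] 1 2 insert.hyps in simp)
qed

lemma PN_sq_integral_tendsto_0:
  fixes f :: "real \<Rightarrow> 'h"
  assumes f: "continuous_on {a..b} f"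
  shows "(\<lambda>N. integral {a..b} (\<lambda>t. (norm (PN N (f t) - f t))\<^sup>2)) \<longlonglongrightarrow> 0"
proof -
  have "(\<lambda>N. integral {a..b} (\<lambda>t. (norm (PN N (f t) - f t))\<^sup>2)) \<longlonglongrightarrow> integral {a..b} (\<lambda>t. 0)"
  proof (rule dominated_convergence(2))
    show "(\<lambda>t. (norm (PN N (f t) - f t))\<^sup>2) integrable_on {a..b}" for N
      by (intro integrable_continuous_interval continuous_intros continuous_on_bl[OF PN_bounded_linear] f)
    show "(\<lambda>t. 4 * (norm (f t))\<^sup>2) integrable_on {a..b}"
      by (intro integrable_continuous_interval continuous_intros f)
    show "norm ((norm (PN N (f t) - f t))\<^sup>2) \<le> 4 * (norm (f t))\<^sup>2" for N t
    proof -
      have "(norm (PN N (f t)))\<^sup>2 \<le> (norm (f t))\<^sup>2" by (intro power_mono PN_norm_le) auto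
      then show ?thesis using norm_diff_sq_le[of "PN N (f t)" "f t"] unfolding real_norm_def abs_power2 by argo
    qed
    show "(\<lambda>N. (norm (PN N (f t) - f t))\<^sup>2) \<longlonglongrightarrow> 0" for t
    proof -
      have "(\<lambda>N. (norm (PN N (f t) - f t))\<^sup>2) \<longlonglongrightarrow> (norm (f t - f t))\<^sup>2"
        by (intro tendsto_intros PN_tendsto)
      then show ?thesis by simp
    qed
  qed
  then show ?thesis by simp
qed

lemma en0_diff_le: "en 0 (a - b) (c - d) \<le> 2 * en 0 a c + 2 * en 0 b d"
  unfolding en_0 using norm_diff_sq_le[of a b] norm_diff_sq_le[of c d] by argo

text \<open>Galerkin approximation: solutions with truncated data are finite sums of modes, the
  energy estimate for their differences makes them uniformly Cauchy, and the equations survive the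
  limit.\<close>

lemma sol_exists:
  assumes f: "continuous_on {0..T} f" and T: "T > 0"
  shows "\<exists>z y. sol T f z y \<and> z 0 = z0 \<and> y 0 = y0"
proof -
  have "\<forall>N. \<exists>z y. sol T (\<lambda>t. PN N (f t)) z y \<and> z 0 = PN N z0 \<and> y 0 = PN N y0"
    unfolding PN_def by (intro allI sol_modes finite_\<Lambda>N \<Lambda>N_subset f)
  then obtain z y where sol: "\<And>N. sol T (\<lambda>t. PN N (f t)) (z N) (y N)"
    and init: "\<And>N. z N 0 = PN N z0" "\<And>N. y N 0 = PN N y0" by metis
  define J where "J N = integral {0..T} (\<lambda>t. (norm (PN N (f t) - f t))\<^sup>2)" for N
  define r where "r N = en 0 (PN N z0 - z0) (PN N y0 - y0)" for N
  \<comment> \<open>From twice the energy estimate for the difference of two truncated solutions,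
    both the data and the forcing being split at their limits.\<close>
  define d where "d N = 8 * r N + 8 * T * J N" for N
  have J: "J \<longlonglongrightarrow> 0" unfolding J_def by (rule PN_sq_integral_tendsto_0[OF f])
  have "r \<longlonglongrightarrow> en 0 (z0 - z0) (y0 - y0)"
    unfolding r_def en_0 by (intro tendsto_intros PN_tendsto) auto
  then have r: "r \<longlonglongrightarrow> 0" by (simp add: en_0)
  have "d \<longlonglongrightarrow> 8 * 0 + 8 * T * 0" unfolding d_def by (intro tendsto_intros r J)
  then have d: "d \<longlonglongrightarrow> 0" by simp
  have est: "2 * en 0 (z N t - z M t) (y N t - y M t) \<le> d N + d M" if t: "t \<in> {0..T}" for N M t
  proof -
    have cP: "continuous_on {0..T} (\<lambda>t. PN N (f t))" for N
      by (rule continuous_on_bl[OF PN_bounded_linear f])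
    have "integral {0..T} (\<lambda>t. (norm (PN N (f t) - PN M (f t)))\<^sup>2)
        \<le> integral {0..T} (\<lambda>t. 2 * (norm (PN N (f t) - f t))\<^sup>2 + 2 * (norm (PN M (f t) - f t))\<^sup>2)"
    proof (intro integral_le integrable_continuous_interval continuous_intros cP f)
      show "(norm (PN N (f t) - PN M (f t)))\<^sup>2
          \<le> 2 * (norm (PN N (f t) - f t))\<^sup>2 + 2 * (norm (PN M (f t) - f t))\<^sup>2" for t
        using norm_diff_sq_le[of "PN N (f t) - f t" "PN M (f t) - f t"] by simp
    qed
    also have "\<dots> = 2 * J N + 2 * J M"
      unfolding J_def integral_mult_right[symmetric]
      by (intro integral_add integrable_continuous_interval continuous_intros cP f)
    finally have I: "T * integral {0..T} (\<lambda>t. (norm (PN N (f t) - PN M (f t)))\<^sup>2) \<le> T * (2 * J N + 2 * J M)"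
      using T by (intro mult_left_mono) auto
    have "en 0 (PN N z0 - PN M z0) (PN N y0 - PN M y0) \<le> 2 * r N + 2 * r M"
      using en0_diff_le[of "PN N z0 - z0" "PN M z0 - z0" "PN N y0 - y0" "PN M y0 - y0"]
      unfolding r_def by simp
    then show ?thesis
      using energy_estimate_0[OF sol_diff[OF sol[of N] sol[of M]] t T] I
      unfolding init d_def by (simp add: algebra_simps)
  qed
  have "(norm (z N t - z M t))\<^sup>2 \<le> d N + d M" "(norm (y N t - y M t))\<^sup>2 \<le> d N + d M"
    if t: "t \<in> {0..T}" for N M t
    using est[OF t, of N M] zero_le_power2[of "norm (z N t - z M t)"] zero_le_power2[of "norm (y N t - y M t)"]
    unfolding en_0 by argo+
  then obtain zl yl where zl: "uniform_limit {0..T} z zl sequentially"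
    and yl: "uniform_limit {0..T} y yl sequentially"
    using uniform_limit_of_square_Cauchy[OF _ d] by meson
  have zt: "(\<lambda>N. z N t) \<longlonglongrightarrow> zl t" and yt: "(\<lambda>N. y N t) \<longlonglongrightarrow> yl t" if "t \<in> {0..T}" for t
    using tendsto_uniform_limitI[OF zl that] tendsto_uniform_limitI[OF yl that] by auto
  have cz: "continuous_on {0..T} zl" and cy: "continuous_on {0..T} yl"
    using uniform_limit_theorem[OF _ zl] uniform_limit_theorem[OF _ yl] solD(2,3)[OF sol] by auto
  obtain Kf where Kf: "\<forall>t\<in>{0..T}. norm (f t) \<le> Kf" using continuous_on_Icc_bounded[OF f] by blast
  \<comment> \<open>An energy bound uniform in \<open>N\<close> and \<open>t\<close>, the majorant
    when the derivatives pass to the limit.\<close>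
  define K where "K = 2 * (2 * en 0 z0 y0 + 2 * T * (T * Kf\<^sup>2))"
  have bd: "(norm (z N t))\<^sup>2 \<le> K" "(norm (y N t))\<^sup>2 \<le> K" if t: "t \<in> {0..T}" for N t
  proof -
    have "(norm (PN N (f s)))\<^sup>2 \<le> Kf\<^sup>2" if "s \<in> {0..T}" for s
      using order_trans[OF PN_norm_le[of N "f s"]] Kf that by (intro power_mono) auto
    then have "integral {0..T} (\<lambda>t. (norm (PN N (f t)))\<^sup>2) \<le> integral {0..T} (\<lambda>_. Kf\<^sup>2)"
      by (intro integral_le integrable_continuous_interval continuous_intros
        continuous_on_bl[OF PN_bounded_linear f]) auto
    then have "T * integral {0..T} (\<lambda>t. (norm (PN N (f t)))\<^sup>2) \<le> T * (T * Kf\<^sup>2)"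
      using T by (intro mult_left_mono) auto
    moreover have "en 0 (PN N z0) (PN N y0) \<le> en 0 z0 y0"
      unfolding en_0 by (intro divide_right_mono add_mono power_mono PN_norm_le) auto
    ultimately have "2 * en 0 (z N t) (y N t) \<le> K"
      using energy_estimate_0[OF sol[of N] t T] unfolding init K_def by simp
    then show "(norm (z N t))\<^sup>2 \<le> K" "(norm (y N t))\<^sup>2 \<le> K"
      using zero_le_power2[of "norm (z N t)"] zero_le_power2[of "norm (y N t)"]
      unfolding en_0 by argo+
  qed
  then have bd': "norm (z N t) \<le> sqrt K" "norm (y N t) \<le> sqrt K" if t: "t \<in> {0..T}" for N t
    using t by (auto intro: real_le_rsqrt)
  have "sol T f zl yl"
    unfolding sol_def
  proof (intro conjI ballI f cz cy)
    fix t assume t: "t \<in> {0..T}"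
    show "((\<lambda>s. G (zl s)) has_vector_derivative yl t) (at t within {0..T})"
      by (rule limit_vector_derivative[where a = "\<lambda>N s. G (z N s)" and b = y and K = "sqrt K"])
        (use sol_dz[OF sol] solD(3)[OF sol] cy yt bd' t bounded_linear.tendsto[OF G_bounded_linear zt] in auto)
    show "((\<lambda>s. G (yl s)) has_vector_derivative G (f t) - zl t) (at t within {0..T})"
    proof (rule limit_vector_derivative[where a = "\<lambda>N s. G (y N s)"
          and b = "\<lambda>N s. G (PN N (f s)) - z N s" and K = "cG * Kf + sqrt K"])
      fix N s assume s: "s \<in> {0..T}"
      have "norm (G (PN N (f s))) \<le> cG * norm (PN N (f s))" by (rule norm_G_le)
      also have "\<dots> \<le> cG * Kf"
        using order_trans[OF PN_norm_le[of N "f s"]] Kf s cG_pos by (intro mult_left_mono) auto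
      finally show "norm (G (PN N (f s)) - z N s) \<le> cG * Kf + sqrt K"
        using bd'(1)[OF s, of N] norm_triangle_ineq4[of "G (PN N (f s))" "z N s"] by simp
    qed (use sol_dy[OF sol] t in \<open>auto intro!: continuous_intros tendsto_intros zt
        continuous_on_bl[OF G_bounded_linear] continuous_on_bl[OF PN_bounded_linear] f cz
        solD(2)[OF sol] bounded_linear.tendsto[OF G_bounded_linear] PN_tendsto yt\<close>)
  qed
  moreover have "zl 0 = z0" "yl 0 = y0"
    using zt[of 0] yt[of 0] PN_tendsto[of z0] PN_tendsto[of y0] T LIMSEQ_unique unfolding init by auto
  ultimately show ?thesis by blast
qed

end


section \<open>Square-integrable functions with values in a normed space\<close>

text \<open>The values at rational interior times are dense in the range, by continuity.\<close>

lemma strongly_measurable_continuous: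
  fixes f :: "real \<Rightarrow> 'b::real_normed_vector"
  assumes f: "continuous_on {0..T} f" and T: "T > 0"
  shows "strongly_measurable (lebesgue_on {0..T}) f"
  unfolding strongly_measurable_def
proof (intro conjI exI)
  show "f \<in> borel_measurable (lebesgue_on {0..T})"
    by (rule continuous_imp_measurable_on_sets_lebesgue[OF f]) simp
  show "countable (f ` ({0<..<T} \<inter> \<rat>))" by (intro countable_image countable_Int2 countable_rat)
  have "{0<..<T} \<subseteq> closure ({0<..<T} \<inter> \<rat>)"
    using open_Int_closure_subset[of "{0<..<T}" \<rat>] by (simp add: Rats_closure_real)
  then have "closure {0<..<T} \<subseteq> closure ({0<..<T} \<inter> \<rat>)" by (rule closure_minimal) simp
  moreover have "closure ({0<..<T} \<inter> \<rat>) \<subseteq> {0..T}" by (rule closure_minimal) auto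
  ultimately have eq: "closure ({0<..<T} \<inter> \<rat>) = {0..T}" using T by auto
  have "f ` {0..T} \<subseteq> closure (f ` ({0<..<T} \<inter> \<rat>))"
    using continuous_image_closure_subset[OF f, of "{0<..<T} \<inter> \<rat>"] unfolding eq by simp
  then show "AE t in lebesgue_on {0..T}. f t \<in> closure (f ` ({0<..<T} \<inter> \<rat>))"
    by (intro AE_I2) auto
qed

lemma null_subset_measurable:
  assumes "N \<in> null_sets (lebesgue_on S)" "A \<subseteq> N" "S \<in> sets lebesgue"
  shows "A \<in> sets (lebesgue_on S)"
proof -
  have "N \<in> null_sets lebesgue" "N \<subseteq> S" using assms by (auto simp: null_sets_restrict_space)
  then have "A \<in> sets lebesgue"
    using completion.complete2[OF assms(2)] by (simp add: null_setsD2)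
  then show ?thesis using assms \<open>N \<subseteq> S\<close> by (auto simp: sets_restrict_space_iff)
qed

text \<open>In a nonseparable product an open set need not be a countable union of open rectangles,
  so measurable components do not directly give a measurable pair. Almost separable values repair
  this: off a null set, countably many balls around points of \<open>S\<close> and \<open>S'\<close>
  cover the preimage, and completeness of Lebesgue measure takes care of the null set.\<close>

lemma strongly_measurable_pair:
  fixes f :: "real \<Rightarrow> 'a::real_normed_vector" and g :: "real \<Rightarrow> 'b::real_normed_vector"
    and h :: "'a \<times> 'b \<Rightarrow> 'c::real_normed_vector"
  assumes f: "strongly_measurable (lebesgue_on X) f" and g: "strongly_measurable (lebesgue_on X) g"
    and X: "X \<in> sets lebesgue" and h: "continuous_on UNIV h"
  shows "strongly_measurable (lebesgue_on X) (\<lambda>t. h (f t, g t))"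
proof -
  let ?M = "lebesgue_on X"
  obtain S S' where S: "countable S" "AE t in ?M. f t \<in> closure S" "countable S'" "AE t in ?M. g t \<in> closure S'"
    using f g unfolding strongly_measurable_def by blast
  have fg[measurable]: "f \<in> borel_measurable ?M" "g \<in> borel_measurable ?M"
    using f g unfolding strongly_measurable_def by auto
  have ae: "AE t in ?M. f t \<in> closure S \<and> g t \<in> closure S'" using S by auto
  obtain N where N: "N \<in> null_sets ?M" "{t \<in> space ?M. \<not> (f t \<in> closure S \<and> g t \<in> closure S')} \<subseteq> N"
    using ae unfolding eventually_ae_filter by blast
  have inS: "f t \<in> closure S" "g t \<in> closure S'" if "t \<in> space ?M" "t \<notin> N" for t using N that by auto
  show ?thesis
    unfolding strongly_measurable_def
  proof (intro conjI exI)
    show "countable (h ` (S \<times> S'))" using S by (intro countable_image countable_SIGMA) auto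
    have "h (f t, g t) \<in> closure (h ` (S \<times> S'))" if "f t \<in> closure S \<and> g t \<in> closure S'" for t
    proof -
      have "(f t, g t) \<in> closure (S \<times> S')" using that by (simp add: closure_Times)
      moreover have "h ` closure (S \<times> S') \<subseteq> closure (h ` (S \<times> S'))"
        by (rule continuous_image_closure_subset[OF h]) simp
      ultimately show ?thesis by blast
    qed
    then show "AE t in ?M. h (f t, g t) \<in> closure (h ` (S \<times> S'))" using ae by auto
    show "(\<lambda>t. h (f t, g t)) \<in> borel_measurable ?M"
    proof (rule borel_measurableI)
      fix U :: "'c set" assume "open U"
      then have V: "open (h -` U)" using h by (simp add: open_vimage)
      \<comment> \<open>Only products of balls contained in the open set are used, so each
        \<open>R i\<close> lies in the preimage; the index set is countable.\<close>
      define I where "I = {(s, s', k::nat). s \<in> S \<and> s' \<in> S' \<and>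
        ball s (1 / real (Suc k)) \<times> ball s' (1 / real (Suc k)) \<subseteq> h -` U}"
      define R where "R = (\<lambda>(s, s', k). {t \<in> space ?M. f t \<in> ball s (1 / real (Suc k)) \<and> g t \<in> ball s' (1 / real (Suc k))})"
      have "countable (S \<times> S' \<times> (UNIV :: nat set))" using S by (intro countable_SIGMA) auto
      then have cI: "countable I" by (rule countable_subset[rotated]) (auto simp: I_def)
      have R: "R i \<in> sets ?M" for i
      proof (cases i)
        case (fields s s' k)
        have "R i = (f -` ball s (1 / real (Suc k)) \<inter> space ?M) \<inter> (g -` ball s' (1 / real (Suc k)) \<inter> space ?M)"
          unfolding fields R_def by auto
        then show ?thesis using measurable_sets[OF fg(1)] measurable_sets[OF fg(2)] by simp
      qed
      have sub: "R i \<subseteq> (\<lambda>t. h (f t, g t)) -` U \<inter> space ?M" if "i \<in> I" for i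
      proof (cases i)
        case (fields s s' k)
        show ?thesis
        proof
          fix t assume t: "t \<in> R i"
          then have "(f t, g t) \<in> ball s (1 / real (Suc k)) \<times> ball s' (1 / real (Suc k))"
            unfolding fields R_def by simp
          moreover have "ball s (1 / real (Suc k)) \<times> ball s' (1 / real (Suc k)) \<subseteq> h -` U"
            using that unfolding fields I_def by simp
          ultimately have "(f t, g t) \<in> h -` U" by blast
          then show "t \<in> (\<lambda>t. h (f t, g t)) -` U \<inter> space ?M" using t unfolding fields R_def by simp
        qed
      qed
      have cover: "t \<in> (\<Union>i\<in>I. R i)" if t: "t \<in> space ?M" "t \<notin> N" "h (f t, g t) \<in> U" for t
      proof -
        have "(f t, g t) \<in> h -` U" using t by simp
        then obtain e where e: "e > 0" "ball (f t) e \<times> ball (g t) e \<subseteq> h -` U"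
        proof -
          assume *: "(f t, g t) \<in> h -` U"
          obtain A B where AB: "open A" "open B" "f t \<in> A" "g t \<in> B" "A \<times> B \<subseteq> h -` U"
            by (rule open_prod_elim[OF V *]) auto
          obtain e1 e2 where "e1 > 0" "ball (f t) e1 \<subseteq> A" "e2 > 0" "ball (g t) e2 \<subseteq> B"
            using AB open_contains_ball by meson
          then show thesis using AB(5) by (intro that[of "min e1 e2"]) fastforce+
        qed
        obtain k where k: "1 / real (Suc k) < e / 2" using e(1) nat_approx_posE half_gt_zero by blast
        have kp: "1 / real (Suc k) > 0" by simp
        obtain s where s: "s \<in> S" "dist s (f t) < 1 / real (Suc k)"
          using inS(1)[OF t(1,2)] kp unfolding closure_approachable by blast
        obtain s' where s': "s' \<in> S'" "dist s' (g t) < 1 / real (Suc k)"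
          using inS(2)[OF t(1,2)] kp unfolding closure_approachable by blast
        have "ball s (1 / real (Suc k)) \<subseteq> ball (f t) e"
        proof
          fix x assume "x \<in> ball s (1 / real (Suc k))"
          then have "dist (f t) x < 1 / real (Suc k) + 1 / real (Suc k)"
            using s dist_triangle[of "f t" x s] by (simp add: dist_commute)
          then show "x \<in> ball (f t) e" using k by simp
        qed
        moreover have "ball s' (1 / real (Suc k)) \<subseteq> ball (g t) e"
        proof
          fix x assume "x \<in> ball s' (1 / real (Suc k))"
          then have "dist (g t) x < 1 / real (Suc k) + 1 / real (Suc k)"
            using s' dist_triangle[of "g t" x s'] by (simp add: dist_commute)
          then show "x \<in> ball (g t) e" using k by simp
        qed
        ultimately have "(s, s', k) \<in> I" unfolding I_def using s s' e(2) by blast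
        moreover have "t \<in> R (s, s', k)" unfolding R_def using t s s' by simp
        ultimately show ?thesis by blast
      qed
      define Z where "Z = ((\<lambda>t. h (f t, g t)) -` U \<inter> space ?M) \<inter> N"
      have "Z \<in> sets ?M" by (rule null_subset_measurable[OF N(1) _ X]) (auto simp: Z_def)
      moreover have "(\<Union>i\<in>I. R i) \<in> sets ?M" using cI R by (intro sets.countable_UN'') auto
      moreover have "(\<lambda>t. h (f t, g t)) -` U \<inter> space ?M = (\<Union>i\<in>I. R i) \<union> Z"
      proof (rule set_eqI, rule iffI)
        fix t assume t: "t \<in> (\<lambda>t. h (f t, g t)) -` U \<inter> space ?M"
        show "t \<in> (\<Union>i\<in>I. R i) \<union> Z"
          using cover[of t] t by (cases "t \<in> N") (auto simp: Z_def)
      next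
        fix t assume "t \<in> (\<Union>i\<in>I. R i) \<union> Z"
        then show "t \<in> (\<lambda>t. h (f t, g t)) -` U \<inter> space ?M"
        proof
          assume "t \<in> (\<Union>i\<in>I. R i)"
          then obtain i where "i \<in> I" "t \<in> R i" by blast
          with sub[OF \<open>i \<in> I\<close>] show ?thesis by blast
        qed (simp add: Z_def)
      qed
      ultimately show "(\<lambda>t. h (f t, g t)) -` U \<inter> space ?M \<in> sets ?M" by auto
    qed
  qed
qed

section \<open>Operations on square-integrable functions and completeness\<close>

lemma L2_fun_pair:
  fixes f :: "real \<Rightarrow> 'a::real_normed_vector" and g :: "real \<Rightarrow> 'b::real_normed_vector"
    and h :: "'a \<times> 'b \<Rightarrow> 'c::real_normed_vector"
  assumes f: "L2_fun T f" and g: "L2_fun T g" and h: "continuous_on UNIV h"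
    and le: "\<And>x y. (norm (h (x, y)))\<^sup>2 \<le> K * (norm x)\<^sup>2 + K' * (norm y)\<^sup>2"
  shows "L2_fun T (\<lambda>t. h (f t, g t))"
  unfolding L2_fun_def
proof
  show s: "strongly_measurable (lebesgue_on {0..T}) (\<lambda>t. h (f t, g t))"
    using f g h unfolding L2_fun_def by (intro strongly_measurable_pair) auto
  show "integrable (lebesgue_on {0..T}) (\<lambda>t. (norm (h (f t, g t)))\<^sup>2)"
  proof (rule Bochner_Integration.integrable_bound)
    show "integrable (lebesgue_on {0..T}) (\<lambda>t. K * (norm (f t))\<^sup>2 + K' * (norm (g t))\<^sup>2)"
      using f g unfolding L2_fun_def by auto
    show "(\<lambda>t. (norm (h (f t, g t)))\<^sup>2) \<in> borel_measurable (lebesgue_on {0..T})"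
      using s[unfolded strongly_measurable_def, THEN conjunct1] by measurable
    show "AE t in lebesgue_on {0..T}. norm ((norm (h (f t, g t)))\<^sup>2) \<le> norm (K * (norm (f t))\<^sup>2 + K' * (norm (g t))\<^sup>2)"
      using le by (intro AE_I2) (simp add: order_trans[OF le])
  qed
qed

lemma L2_fun_diff:
  assumes "L2_fun T f" "L2_fun T g"
  shows "L2_fun T (\<lambda>t. f t - g t)"
proof -
  have "L2_fun T (\<lambda>t. (\<lambda>p. fst p - snd p) (f t, g t))"
    by (rule L2_fun_pair[OF assms, where K = 2 and K' = 2])
      (auto intro!: continuous_intros norm_diff_sq_le)
  then show ?thesis by simp
qed

lemma L2_fun_map:
  assumes f: "L2_fun T f" and S: "bounded_linear S"
  shows "L2_fun T (\<lambda>t. S (f t))"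
proof -
  obtain K where K: "\<And>x. norm (S x) \<le> norm x * K" using bounded_linear.bounded[OF S] by blast
  have "(norm (S x))\<^sup>2 \<le> K\<^sup>2 * (norm x)\<^sup>2 + 0 * (norm y)\<^sup>2" for x y
    using power_mono[OF K[of x], of 2] by (simp add: power_mult_distrib mult.commute)
  then have "L2_fun T (\<lambda>t. (\<lambda>p. S (fst p)) (f t, f t))"
    by (intro L2_fun_pair[OF f f, where K = "K\<^sup>2" and K' = 0] continuous_on_bl[OF S] continuous_intros) auto
  then show ?thesis by simp
qed

lemma L2_fun_continuous:
  fixes f :: "real \<Rightarrow> 'b::real_normed_vector"
  assumes f: "continuous_on {0..T} f" and T: "T > 0"
  shows "L2_fun T f"
  unfolding L2_fun_def
  by (intro conjI strongly_measurable_continuous assms continuous_imp_integrable_real continuous_intros)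

lemma L2_fun_measurable_norm: "L2_fun T f \<Longrightarrow> (\<lambda>t. norm (f t)) \<in> borel_measurable (lebesgue_on {0..T})"
  unfolding L2_fun_def strongly_measurable_def
  by (rule measurable_compose[OF _ borel_measurable_norm]) auto

lemma L2_fun_integrable_mult:
  assumes f: "L2_fun T f" and g: "L2_fun T g"
    and h: "h \<in> borel_measurable (lebesgue_on {0..T})"
    and le: "\<And>t. \<bar>h t\<bar> \<le> norm (f t) * norm (g t)"
  shows "integrable (lebesgue_on {0..T}) h"
proof (rule Bochner_Integration.integrable_bound)
  show "integrable (lebesgue_on {0..T}) (\<lambda>t. (norm (f t))\<^sup>2 + (norm (g t))\<^sup>2)"
    using f g unfolding L2_fun_def by auto
  have "\<bar>h t\<bar> \<le> (norm (f t))\<^sup>2 + (norm (g t))\<^sup>2" for t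
    using le[of t] zero_le_power2[of "norm (f t) - norm (g t)"]
      zero_le_power2[of "norm (f t)"] zero_le_power2[of "norm (g t)"]
    unfolding power2_diff by argo
  then show "AE t in lebesgue_on {0..T}. norm (h t) \<le> norm ((norm (f t))\<^sup>2 + (norm (g t))\<^sup>2)"
    by (intro AE_I2) simp
qed (rule h)

lemma L2_fun_integrable_inner:
  fixes f g :: "real \<Rightarrow> 'a::real_inner"
  assumes f: "L2_fun T f" and g: "L2_fun T g"
  shows "integrable (lebesgue_on {0..T}) (\<lambda>t. f t \<bullet> g t)"
proof (rule L2_fun_integrable_mult[OF f g])
  have "strongly_measurable (lebesgue_on {0..T}) (\<lambda>t. (\<lambda>(x, y). x \<bullet> y) (f t, g t))"
    using f g unfolding L2_fun_def
    by (intro strongly_measurable_pair) (auto simp: case_prod_unfold intro!: continuous_intros)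
  then show "(\<lambda>t. f t \<bullet> g t) \<in> borel_measurable (lebesgue_on {0..T})"
    unfolding strongly_measurable_def by simp
qed (rule Cauchy_Schwarz_ineq2)

lemma L2_diff_integral_le:
  assumes f: "L2_fun T f" and g: "L2_fun T g"
  shows "(LINT t|lebesgue_on {0..T}. (norm (f t - g t))\<^sup>2)
    \<le> 2 * (LINT t|lebesgue_on {0..T}. (norm (f t))\<^sup>2) + 2 * (LINT t|lebesgue_on {0..T}. (norm (g t))\<^sup>2)"
proof -
  have i: "integrable (lebesgue_on {0..T}) (\<lambda>t. (norm (f t))\<^sup>2)" "integrable (lebesgue_on {0..T}) (\<lambda>t. (norm (g t))\<^sup>2)"
    using f g unfolding L2_fun_def by auto
  have "(LINT t|lebesgue_on {0..T}. (norm (f t - g t))\<^sup>2)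
    \<le> (LINT t|lebesgue_on {0..T}. 2 * (norm (f t))\<^sup>2 + 2 * (norm (g t))\<^sup>2)"
    using L2_fun_diff[OF f g] i unfolding L2_fun_def
    by (intro integral_mono norm_diff_sq_le) auto
  also have "\<dots> = 2 * (LINT t|lebesgue_on {0..T}. (norm (f t))\<^sup>2) + 2 * (LINT t|lebesgue_on {0..T}. (norm (g t))\<^sup>2)"
    using i by simp
  finally show ?thesis .
qed

text \<open>Pointwise, the difference of the squares is at most \<open>(1 + 1 / \<delta>)\<close>
  times the squared error plus \<delta> times the squared limit, which replaces Minkowski's
  inequality; \<delta> is fixed first, then \<open>N\<close>.\<close>

lemma L2_norm_tendsto:
  assumes b: "\<And>N::nat. L2_fun T (b N)" and g: "L2_fun T g"
    and lim: "(\<lambda>N. LINT t|lebesgue_on {0..T}. (norm (b N t - g t))\<^sup>2) \<longlonglongrightarrow> 0"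
  shows "(\<lambda>N. LINT t|lebesgue_on {0..T}. (norm (b N t))\<^sup>2) \<longlonglongrightarrow> (LINT t|lebesgue_on {0..T}. (norm (g t))\<^sup>2)"
proof -
  let ?M = "lebesgue_on {0..T}"
  define e where "e N = (LINT t|?M. (norm (b N t - g t))\<^sup>2)" for N
  define I where "I = (LINT t|?M. (norm (g t))\<^sup>2)"
  have ib: "integrable ?M (\<lambda>t. (norm (b N t))\<^sup>2)" and ig: "integrable ?M (\<lambda>t. (norm (g t))\<^sup>2)"
    and id: "integrable ?M (\<lambda>t. (norm (b N t - g t))\<^sup>2)" for N
    using b[of N] g L2_fun_diff[OF b[of N] g] unfolding L2_fun_def by auto
  have I0: "I \<ge> 0" unfolding I_def by simp
  have main: "\<bar>(LINT t|?M. (norm (b N t))\<^sup>2) - I\<bar> \<le> (1 + 1 / \<delta>) * e N + \<delta> * I" if d: "\<delta> > 0" for \<delta> N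
  proof -
    have pt: "\<bar>(norm (b N t))\<^sup>2 - (norm (g t))\<^sup>2\<bar> \<le> (1 + 1 / \<delta>) * (norm (b N t - g t))\<^sup>2 + \<delta> * (norm (g t))\<^sup>2" for t
    proof -
      define x where "x = norm (b N t)" define y where "y = norm (g t)" define u where "u = norm (b N t - g t)"
      have xy: "\<bar>x - y\<bar> \<le> u" unfolding x_def y_def u_def by (rule norm_triangle_ineq3)
      have nn: "0 \<le> y" "0 \<le> u" "0 \<le> x" unfolding x_def y_def u_def by auto
      have "x\<^sup>2 - y\<^sup>2 = (x - y) * (x + y)" by (simp add: power2_eq_square algebra_simps)
      then have "\<bar>x\<^sup>2 - y\<^sup>2\<bar> = \<bar>x - y\<bar> * (x + y)" using nn by (simp add: abs_mult)
      also have "\<dots> \<le> u * (u + 2 * y)" using xy nn by (intro mult_mono) auto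
      also have "\<dots> = u\<^sup>2 + 2 * (u * y)" by (simp add: power2_eq_square algebra_simps)
      also have "2 * (u * y) \<le> u\<^sup>2 / \<delta> + \<delta> * y\<^sup>2"
      proof -
        have "0 \<le> (u / sqrt \<delta> - sqrt \<delta> * y)\<^sup>2" by simp
        also have "\<dots> = u\<^sup>2 / \<delta> + \<delta> * y\<^sup>2 - 2 * (u * y)"
          using d by (simp add: power2_diff power_divide power_mult_distrib)
        finally show ?thesis by simp
      qed
      finally show ?thesis unfolding x_def y_def u_def by (simp add: algebra_simps)
    qed
    have "\<bar>(LINT t|?M. (norm (b N t))\<^sup>2) - I\<bar> = \<bar>LINT t|?M. (norm (b N t))\<^sup>2 - (norm (g t))\<^sup>2\<bar>"
      unfolding I_def using ib ig by simp
    also have "\<dots> \<le> (LINT t|?M. \<bar>(norm (b N t))\<^sup>2 - (norm (g t))\<^sup>2\<bar>)" by (rule integral_abs_bound)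
    also have "\<dots> \<le> (LINT t|?M. (1 + 1 / \<delta>) * (norm (b N t - g t))\<^sup>2 + \<delta> * (norm (g t))\<^sup>2)"
      using ib ig id pt by (intro integral_mono) auto
    also have "\<dots> = (1 + 1 / \<delta>) * e N + \<delta> * I" unfolding e_def I_def using ig id by simp
    finally show ?thesis .
  qed
  show ?thesis
    unfolding I_def[symmetric]
  proof (rule metric_LIMSEQ_I)
    fix r :: real assume r: "r > 0"
    define \<delta> where "\<delta> = r / (2 * (I + 1))"
    have d: "\<delta> > 0" unfolding \<delta>_def using r I0 by simp
    have dI: "\<delta> * I < r / 2" unfolding \<delta>_def using r I0 by (simp add: field_simps)
    have "(\<lambda>N. (1 + 1 / \<delta>) * e N) \<longlonglongrightarrow> (1 + 1 / \<delta>) * 0"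
      using lim unfolding e_def by (intro tendsto_intros)
    then have "eventually (\<lambda>N. (1 + 1 / \<delta>) * e N < r / 2) sequentially"
      using r by (intro order_tendstoD(2)) auto
    then obtain N0 where N0: "\<And>N. N \<ge> N0 \<Longrightarrow> (1 + 1 / \<delta>) * e N < r / 2"
      unfolding eventually_sequentially by blast
    then have "dist (LINT t|?M. (norm (b N t))\<^sup>2) I < r" if "N \<ge> N0" for N
      using main[OF d, of N] dI N0[OF that] unfolding dist_real_def by linarith
    then show "\<exists>N0. \<forall>N\<ge>N0. dist (LINT t|?M. (norm (b N t))\<^sup>2) I < r" by blast
  qed
qed

text \<open>The usual completeness argument: a rapidly converging subsequence converges almost
  everywhere, and Fatou's lemma upgrades this to convergence in square mean. The limit stays almost
  separably valued because it lies in the closure of the union of the countable sets.\<close>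

lemma riesz_fischer:
  fixes b :: "nat \<Rightarrow> real \<Rightarrow> 'g::{real_normed_vector,complete_space}"
  assumes b: "\<And>N. L2_fun T (b N)" and T: "T > 0"
    and Cauchy: "\<And>N M. (LINT t|lebesgue_on {0..T}. (norm (b N t - b M t))\<^sup>2) \<le> d N + d M" "d \<longlonglongrightarrow> 0"
  shows "\<exists>g. L2_fun T g \<and> (\<lambda>N. LINT t|lebesgue_on {0..T}. (norm (b N t - g t))\<^sup>2) \<longlonglongrightarrow> 0"
proof -
  let ?M = "lebesgue_on {0..T}"
  \<comment> \<open>The factor 2 lets the contributions of two consecutive members add up to
    \<open>1 / 4 ^ k\<close>.\<close>
  have "\<exists>n\<ge>m. \<forall>N\<ge>n. d N < 1 / (2 * 4 ^ k)" for k m :: nat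
  proof -
    have "eventually (\<lambda>N. d N < 1 / (2 * 4 ^ k)) sequentially"
      using Cauchy(2) by (intro order_tendstoD(2)) auto
    then show ?thesis unfolding eventually_sequentially by (metis le_trans nat_le_linear)
  qed
  then have "\<exists>r. \<forall>k. (\<forall>N\<ge>r k. d N < 1 / (2 * 4 ^ k)) \<and> r k < r (Suc k)"
    by (intro dependent_nat_choice) (meson, metis Suc_le_eq)
  then obtain r where r: "\<And>k N. N \<ge> r k \<Longrightarrow> d N < 1 / (2 * 4 ^ k)" "\<And>k. r k < r (Suc k)" by blast
  have r_mono: "strict_mono r" using r(2) by (simp add: strict_mono_Suc_iff)
  define \<Delta> where "\<Delta> k t = norm (b (r (Suc k)) t - b (r k) t)" for k t
  have \<Delta>m[measurable]: "\<Delta> k \<in> borel_measurable ?M" for k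
    unfolding \<Delta>_def[abs_def] by (rule L2_fun_measurable_norm[OF L2_fun_diff[OF b b]])
  have \<Delta>2: "integrable ?M (\<lambda>t. (\<Delta> k t)\<^sup>2)" "(LINT t|?M. (\<Delta> k t)\<^sup>2) \<le> 1 / 4 ^ k" for k
  proof -
    show "integrable ?M (\<lambda>t. (\<Delta> k t)\<^sup>2)"
      using L2_fun_diff[OF b b] unfolding L2_fun_def \<Delta>_def by auto
    have "d (r (Suc k)) < 1 / (2 * 4 ^ k)" "d (r k) < 1 / (2 * 4 ^ k)"
      using r(1)[of k "r (Suc k)"] r(1)[of k "r k"] r(2)[of k] by auto
    moreover have "1 / (2 * 4 ^ k) + 1 / (2 * 4 ^ k) = 1 / (4 ^ k :: real)" by simp
    ultimately show "(LINT t|?M. (\<Delta> k t)\<^sup>2) \<le> 1 / 4 ^ k"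
      using Cauchy(1)[of "r (Suc k)" "r k"] unfolding \<Delta>_def by linarith
  qed
  \<comment> \<open>Young's inequality with weight \<open>2 ^ k\<close>: a square integral of order
    \<open>1 / 4 ^ k\<close> becomes a bound of order \<open>1 / 2 ^ k\<close> on the integral,
    which is summable.\<close>
  have pt: "\<Delta> k t \<le> 1 / 2 ^ k + 2 ^ k * (\<Delta> k t)\<^sup>2" for k t
  proof -
    have "0 \<le> (1 / sqrt (2 ^ k) - sqrt (2 ^ k) * \<Delta> k t)\<^sup>2" by simp
    also have "\<dots> = 1 / 2 ^ k + 2 ^ k * (\<Delta> k t)\<^sup>2 - 2 * \<Delta> k t"
      by (simp add: power2_diff power_divide power_mult_distrib)
    finally have "2 * \<Delta> k t \<le> 1 / 2 ^ k + 2 ^ k * (\<Delta> k t)\<^sup>2" by simp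
    moreover have "0 \<le> \<Delta> k t" unfolding \<Delta>_def by simp
    ultimately show ?thesis by linarith
  qed
  have int\<Delta>: "integrable ?M (\<Delta> k)" "(LINT t|?M. \<Delta> k t) \<le> (T + 1) * (1 / 2) ^ k" for k
  proof -
    have i: "integrable ?M (\<lambda>t. 1 / 2 ^ k + 2 ^ k * (\<Delta> k t)\<^sup>2)"
      using \<Delta>2(1)[of k] by (intro Bochner_Integration.integrable_add) auto
    show i1: "integrable ?M (\<Delta> k)"
      by (rule Bochner_Integration.integrable_bound[OF i \<Delta>m])
        (intro AE_I2, use pt[of k] in \<open>auto simp: \<Delta>_def intro: order_trans[OF _ abs_ge_self]\<close>)
    have "(LINT t|?M. \<Delta> k t) \<le> (LINT t|?M. 1 / 2 ^ k + 2 ^ k * (\<Delta> k t)\<^sup>2)"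
      by (rule integral_mono[OF i1 i]) (rule pt)
    also have "\<dots> = (LINT t|?M. 1 / 2 ^ k) + 2 ^ k * (LINT t|?M. (\<Delta> k t)\<^sup>2)"
      using \<Delta>2(1)[of k] by (subst Bochner_Integration.integral_add) auto
    also have "(LINT t|?M. 1 / 2 ^ k) = T * (1 / 2 ^ k :: real)"
      using T by (simp add: measure_restrict_space)
    also have "2 ^ k * (LINT t|?M. (\<Delta> k t)\<^sup>2) \<le> 2 ^ k * (1 / 4 ^ k)"
      by (intro mult_left_mono \<Delta>2) auto
    also have "(2::real) ^ k * (1 / 4 ^ k) = 1 / 2 ^ k"
    proof -
      have "(4::real) ^ k = 2 ^ k * 2 ^ k" by (simp flip: power_mult_distrib)
      then show ?thesis by simp
    qed
    finally show "(LINT t|?M. \<Delta> k t) \<le> (T + 1) * (1 / 2) ^ k" by (simp add: field_simps)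
  qed
  have "(\<integral>\<^sup>+ t. (\<Sum>k. ennreal (\<Delta> k t)) \<partial>?M) = (\<Sum>k. \<integral>\<^sup>+ t. ennreal (\<Delta> k t) \<partial>?M)"
    by (intro nn_integral_suminf) measurable
  also have "\<dots> \<le> (\<Sum>k. ennreal ((T + 1) * (1 / 2) ^ k))"
  proof (intro suminf_le summableI)
    fix k
    have "(\<integral>\<^sup>+ t. ennreal (\<Delta> k t) \<partial>?M) = ennreal (LINT t|?M. \<Delta> k t)"
      by (intro nn_integral_eq_integral int\<Delta> AE_I2) (simp add: \<Delta>_def)
    then show "(\<integral>\<^sup>+ t. ennreal (\<Delta> k t) \<partial>?M) \<le> ennreal ((T + 1) * (1 / 2) ^ k)"
      using int\<Delta>(2) by (simp add: ennreal_leI)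
  qed
  also have "\<dots> = ennreal (\<Sum>k. (T + 1) * (1 / 2) ^ k)"
    using T by (intro suminf_ennreal2 summable_mult summable_geometric) auto
  finally have "(\<integral>\<^sup>+ t. (\<Sum>k. ennreal (\<Delta> k t)) \<partial>?M) \<noteq> \<infinity>" by (auto simp: top_unique)
  then have "AE t in ?M. (\<Sum>k. ennreal (\<Delta> k t)) \<noteq> \<infinity>"
    by (intro nn_integral_PInf_AE) measurable
  then have "AE t in ?M. summable (\<lambda>k. \<Delta> k t)"
    by eventually_elim (auto intro!: summable_suminf_not_top simp: \<Delta>_def)
  then have aeC: "AE t in ?M. convergent (\<lambda>k. b (r k) t)"
  proof eventually_elim
    fix t assume s: "summable (\<lambda>k. \<Delta> k t)"
    define S where "S m = (\<Sum>k<m. \<Delta> k t)" for m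
    have "Cauchy S" using s unfolding S_def summable_iff_convergent by (simp add: convergent_Cauchy)
    have le: "norm (b (r n) t - b (r m) t) \<le> S n - S m" if "m \<le> n" for m n
      using that
    proof (induction n rule: dec_induct)
      case (step n)
      have "norm (b (r (Suc n)) t - b (r m) t) \<le> \<Delta> n t + norm (b (r n) t - b (r m) t)"
        unfolding \<Delta>_def by (rule order_trans[OF _ norm_triangle_ineq]) simp
      then show ?case using step by (simp add: S_def)
    qed simp
    have "Cauchy (\<lambda>k. b (r k) t)"
    proof (rule CauchyI')
      fix e :: real assume "e > 0"
      then obtain M where M: "\<And>m n. m \<ge> M \<Longrightarrow> n \<ge> M \<Longrightarrow> dist (S m) (S n) < e"
        using \<open>Cauchy S\<close> unfolding Cauchy_def by meson
      have "dist (b (r m) t) (b (r n) t) < e" if "m \<ge> M" "n > m" for m n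
        using le[of m n] M[of m n] that by (simp add: dist_norm norm_minus_commute)
      then show "\<exists>M. \<forall>m\<ge>M. \<forall>n>m. dist (b (r m) t) (b (r n) t) < e" by blast
    qed
    then show "convergent (\<lambda>k. b (r k) t)" by (rule Cauchy_convergent)
  qed
  have "\<forall>N. \<exists>S. countable S \<and> (AE t in ?M. b N t \<in> closure S)"
    using b unfolding L2_fun_def strongly_measurable_def by blast
  then obtain S where S: "\<And>N. countable (S N)" "\<And>N. AE t in ?M. b N t \<in> closure (S N)" by metis
  have "AE t in ?M. convergent (\<lambda>k. b (r k) t) \<and> (\<forall>N. b N t \<in> closure (S N))"
    using aeC S(2) by (simp add: AE_all_countable)
  then obtain N where N: "N \<in> null_sets ?M"
    "{t \<in> space ?M. \<not> (convergent (\<lambda>k. b (r k) t) \<and> (\<forall>N. b N t \<in> closure (S N)))} \<subseteq> N"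
    unfolding eventually_ae_filter by blast
  \<comment> \<open>The value 0 on the null set makes \<open>g\<close> an everywhere limit of
    measurable functions modified there.\<close>
  define g where "g t = (if t \<in> N then 0 else lim (\<lambda>k. b (r k) t))" for t
  have lim: "(\<lambda>k. b (r k) t) \<longlonglongrightarrow> g t" if "t \<in> space ?M" "t \<notin> N" for t
    using N(2) that unfolding g_def by (auto simp: convergent_LIMSEQ_iff)
  have aelim: "AE t in ?M. (\<lambda>k. b (r k) t) \<longlonglongrightarrow> g t"
    by (rule AE_I'[OF N(1)]) (use lim in auto)
  have bm[measurable]: "b k \<in> borel_measurable ?M" for k
    using b unfolding L2_fun_def strongly_measurable_def by blast
  have gm: "g \<in> borel_measurable ?M"
  proof (rule borel_measurable_LIMSEQ_metric)
    show "(\<lambda>t. if t \<in> N then 0 else b (r i) t) \<in> borel_measurable ?M" for i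
      using N(1) by (intro measurable_If_set) auto
    show "(\<lambda>i. if t \<in> N then 0 else b (r i) t) \<longlonglongrightarrow> g t" if "t \<in> space ?M" for t
      using lim[OF that] by (auto simp: g_def)
  qed
  have gs: "strongly_measurable ?M g"
    unfolding strongly_measurable_def
  proof (intro conjI exI)
    show "countable (\<Union>k. S k)" using S(1) by simp
    show "AE t in ?M. g t \<in> closure (\<Union>k. S k)"
    proof (rule AE_I'[OF N(1)], safe)
      fix t assume t: "t \<in> space ?M" "g t \<notin> closure (\<Union>k. S k)"
      show "t \<in> N"
      proof (rule ccontr)
        assume tN: "t \<notin> N"
        have "b (r k) t \<in> closure (S (r k))" for k using N(2) t(1) tN by blast
        moreover have "closure (S (r k)) \<subseteq> closure (\<Union>k. S k)" for k by (intro closure_mono) auto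
        ultimately have "b (r k) t \<in> closure (\<Union>k. S k)" for k by blast
        then have "g t \<in> closure (\<Union>k. S k)"
          using closed_sequentially[OF closed_closure _ lim[OF t(1) tN]] by blast
        with t(2) show False by blast
      qed
    qed
  qed (rule gm)
  \<comment> \<open>Fatou along the subsequence, with \<open>n\<close> fixed; integrability of the
    limit is part of what it gives.\<close>
  have fatou: "(\<integral>\<^sup>+ t. ennreal ((norm (b n t - g t))\<^sup>2) \<partial>?M) \<le> ennreal e"
    if e: "\<And>k. k \<ge> K \<Longrightarrow> d n + d (r k) \<le> e" for n e K
  proof -
    have mb: "(\<lambda>t. ennreal ((norm (b n t - b (r k) t))\<^sup>2)) \<in> borel_measurable ?M" for k
      using L2_fun_measurable_norm[OF L2_fun_diff[OF b b]] by measurable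
    have "(\<integral>\<^sup>+ t. ennreal ((norm (b n t - g t))\<^sup>2) \<partial>?M)
        = (\<integral>\<^sup>+ t. liminf (\<lambda>k. ennreal ((norm (b n t - b (r k) t))\<^sup>2)) \<partial>?M)"
    proof (rule nn_integral_cong_AE, use aelim in eventually_elim)
      fix t assume l: "(\<lambda>k. b (r k) t) \<longlonglongrightarrow> g t"
      have "(\<lambda>k. ennreal ((norm (b n t - b (r k) t))\<^sup>2)) \<longlonglongrightarrow> ennreal ((norm (b n t - g t))\<^sup>2)"
        by (intro tendsto_intros l)
      then show "ennreal ((norm (b n t - g t))\<^sup>2) = liminf (\<lambda>k. ennreal ((norm (b n t - b (r k) t))\<^sup>2))"
        by (rule lim_imp_Liminf[symmetric, rotated]) simp
    qed
    also have "\<dots> \<le> liminf (\<lambda>k. \<integral>\<^sup>+ t. ennreal ((norm (b n t - b (r k) t))\<^sup>2) \<partial>?M)"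
      by (rule nn_integral_liminf[OF mb])
    also have "\<dots> \<le> ennreal e"
    proof (rule Liminf_le)
      show "eventually (\<lambda>k. (\<integral>\<^sup>+ t. ennreal ((norm (b n t - b (r k) t))\<^sup>2) \<partial>?M) \<le> ennreal e) sequentially"
        unfolding eventually_sequentially
      proof (intro exI allI impI)
        fix k assume k: "k \<ge> K"
        have "(\<integral>\<^sup>+ t. ennreal ((norm (b n t - b (r k) t))\<^sup>2) \<partial>?M) = ennreal (LINT t|?M. (norm (b n t - b (r k) t))\<^sup>2)"
          using L2_fun_diff[OF b b] unfolding L2_fun_def by (intro nn_integral_eq_integral) auto
        also have "\<dots> \<le> ennreal e" using Cauchy(1)[of n "r k"] e[OF k] by (intro ennreal_leI) simp
        finally show "(\<integral>\<^sup>+ t. ennreal ((norm (b n t - b (r k) t))\<^sup>2) \<partial>?M) \<le> ennreal e" .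
      qed
    qed simp
    finally show ?thesis .
  qed
  have dr: "(\<lambda>k. d (r k)) \<longlonglongrightarrow> 0" using LIMSEQ_subseq_LIMSEQ[OF Cauchy(2) r_mono] by (simp add: o_def)
  have m: "(\<lambda>t. (norm (b n t - g t))\<^sup>2) \<in> borel_measurable ?M" for n
  proof -
    have "strongly_measurable ?M (\<lambda>t. (\<lambda>(x, y). x - y) (b n t, g t))"
      using b gs unfolding L2_fun_def
      by (intro strongly_measurable_pair) (auto simp: case_prod_unfold intro!: continuous_intros)
    then show ?thesis unfolding strongly_measurable_def by (auto simp: case_prod_unfold)
  qed
  have small: "integrable ?M (\<lambda>t. (norm (b n t - g t))\<^sup>2) \<and> (LINT t|?M. (norm (b n t - g t))\<^sup>2) \<le> e"
    if e: "d n < e" "e > 0" for n e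
  proof -
    have "eventually (\<lambda>k. d (r k) < e - d n) sequentially" using dr e by (intro order_tendstoD(2)) auto
    then obtain K where "\<And>k. k \<ge> K \<Longrightarrow> d n + d (r k) \<le> e"
      unfolding eventually_sequentially by fastforce
    from fatou[OF this] have le: "(\<integral>\<^sup>+ t. ennreal ((norm (b n t - g t))\<^sup>2) \<partial>?M) \<le> ennreal e" .
    then have i: "integrable ?M (\<lambda>t. (norm (b n t - g t))\<^sup>2)"
      by (intro integrableI_nonneg m) (auto intro: le_less_trans)
    have "ennreal (LINT t|?M. (norm (b n t - g t))\<^sup>2) \<le> ennreal e"
      using le by (subst (asm) nn_integral_eq_integral[OF i]) auto
    then show ?thesis using i e by (simp add: ennreal_le_iff)
  qed
  have conv: "(\<lambda>n. LINT t|?M. (norm (b n t - g t))\<^sup>2) \<longlonglongrightarrow> 0"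
  proof (rule metric_LIMSEQ_I)
    fix e :: real assume e: "e > 0"
    have "eventually (\<lambda>n. d n < e / 2) sequentially" using Cauchy(2) e by (intro order_tendstoD(2)) auto
    then obtain n0 where n0: "\<And>n. n \<ge> n0 \<Longrightarrow> d n < e / 2" unfolding eventually_sequentially by blast
    have "dist (LINT t|?M. (norm (b n t - g t))\<^sup>2) 0 < e" if "n \<ge> n0" for n
      using small[OF n0[OF that]] e by (auto simp: dist_real_def)
    then show "\<exists>n0. \<forall>n\<ge>n0. dist (LINT t|?M. (norm (b n t - g t))\<^sup>2) 0 < e" by blast
  qed
  obtain n where n: "d n < 1"
    using order_tendstoD(2)[OF Cauchy(2), of 1] unfolding eventually_sequentially by auto
  have "integrable ?M (\<lambda>t. (norm (g t))\<^sup>2)"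
  proof (rule Bochner_Integration.integrable_bound)
    show "integrable ?M (\<lambda>t. 2 * (norm (b n t))\<^sup>2 + 2 * (norm (b n t - g t))\<^sup>2)"
      using small[OF n] b[of n] unfolding L2_fun_def by auto
    show "(\<lambda>t. (norm (g t))\<^sup>2) \<in> borel_measurable ?M" using gm by measurable
    show "AE t in ?M. norm ((norm (g t))\<^sup>2) \<le> norm (2 * (norm (b n t))\<^sup>2 + 2 * (norm (b n t - g t))\<^sup>2)"
    proof (rule AE_I2)
      fix t
      show "norm ((norm (g t))\<^sup>2) \<le> norm (2 * (norm (b n t))\<^sup>2 + 2 * (norm (b n t - g t))\<^sup>2)"
        using norm_diff_sq_le[of "b n t" "b n t - g t"] by simp
    qed
  qed
  then have "L2_fun T g" using gs unfolding L2_fun_def by blast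
  with conv show ?thesis by blast
qed


section \<open>Weak solutions with square-integrable forcing\<close>

lemma lint_continuous:
  fixes f :: "real \<Rightarrow> real"
  shows "continuous_on {a..b} f \<Longrightarrow> (LINT t|lebesgue_on {a..b}. f t) = integral {a..b} f"
  by (intro lebesgue_integral_eq_integral continuous_imp_integrable_real) auto

lemma integral_diff_interval:
  fixes f :: "real \<Rightarrow> real"
  assumes "f integrable_on {0..T}" "0 \<le> s" "s \<le> t" "t \<le> T"
  shows "integral {0..t} f - integral {0..s} f = integral {s..t} f"
proof -
  have "f integrable_on {0..t}" by (rule integrable_subinterval_real[OF assms(1)]) (use assms in auto)
  from Henstock_Kurzweil_Integration.integral_combine[OF assms(2,3) this] show ?thesis by simp
qed

text \<open>Telescoping over a fine partition. This does the work of "zero derivative implies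
  constant" for functions controlled only by increments of an integral.\<close>

lemma constant_if_increments_small:
  fixes \<Phi> \<mu> :: "real \<Rightarrow> real"
  assumes T: "T > 0"
    and small: "\<And>e. e > 0 \<Longrightarrow> \<exists>d>0. \<forall>s t. 0 \<le> s \<longrightarrow> s \<le> t \<longrightarrow> t \<le> T \<longrightarrow> t - s < d \<longrightarrow>
      \<bar>\<Phi> t - \<Phi> s\<bar> \<le> e * (\<mu> t - \<mu> s)"
  shows "\<Phi> T = \<Phi> 0"
proof (rule ccontr)
  assume ne: "\<Phi> T \<noteq> \<Phi> 0"
  \<comment> \<open>Chosen so that the telescoped bound is at most half the assumed jump; the added
    1 keeps the denominator positive.\<close>
  define e where "e = \<bar>\<Phi> T - \<Phi> 0\<bar> / 2 / (\<bar>\<mu> T - \<mu> 0\<bar> + 1)"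
  have pos: "\<bar>\<mu> T - \<mu> 0\<bar> + 1 > 0" by (rule add_nonneg_pos) auto
  have e: "e > 0" unfolding e_def using ne pos by (intro divide_pos_pos) auto
  obtain d where d: "d > 0" "\<And>s t. 0 \<le> s \<Longrightarrow> s \<le> t \<Longrightarrow> t \<le> T \<Longrightarrow> t - s < d \<Longrightarrow>
      \<bar>\<Phi> t - \<Phi> s\<bar> \<le> e * (\<mu> t - \<mu> s)"
    using small[OF e] by blast
  obtain n :: nat where n: "T / d < real n" using reals_Archimedean2 by blast
  have n0: "real n > 0" using n T d(1) by (smt (verit) divide_pos_pos)
  define p where "p k = real k * (T / real n)" for k
  have h: "T / real n < d" "0 \<le> T / real n" using n d(1) n0 T by (auto simp: field_simps)
  have "\<bar>\<Phi> (p k) - \<Phi> 0\<bar> \<le> e * (\<mu> (p k) - \<mu> 0)" if "k \<le> n" for k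
    using that
  proof (induction k)
    case (Suc k)
    have "p (Suc k) = p k + T / real n" unfolding p_def
      by (simp only: of_nat_Suc distrib_right mult_1_left add.commute)
    moreover have "p (Suc k) \<le> T"
    proof -
      have "real (Suc k) * (T / real n) \<le> real n * (T / real n)"
        using Suc.prems h by (intro mult_right_mono) auto
      then show ?thesis using n0 unfolding p_def by simp
    qed
    moreover have "0 \<le> p k" unfolding p_def by (intro mult_nonneg_nonneg h) auto
    ultimately have "\<bar>\<Phi> (p (Suc k)) - \<Phi> (p k)\<bar> \<le> e * (\<mu> (p (Suc k)) - \<mu> (p k))"
      using h by (intro d(2)) auto
    moreover have "\<bar>\<Phi> (p k) - \<Phi> 0\<bar> \<le> e * (\<mu> (p k) - \<mu> 0)" using Suc by simp
    ultimately show ?case by (simp add: right_diff_distrib)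
  qed (simp add: p_def)
  from this[of n] have "\<bar>\<Phi> T - \<Phi> 0\<bar> \<le> e * (\<mu> T - \<mu> 0)" using n0 unfolding p_def by simp
  also have "\<dots> \<le> e * (\<bar>\<mu> T - \<mu> 0\<bar> + 1)" using e by (intro mult_left_mono) auto
  also have "\<dots> = \<bar>\<Phi> T - \<Phi> 0\<bar> / 2" by (metis e_def less_irrefl nonzero_eq_divide_eq pos)
  finally show False using ne by simp
qed

text \<open>A chain rule for the squared norm when \<open>b\<close> has \<alpha> as derivative only
  in the weak integrated sense. The increment of half the square equals \<open>b t - b s\<close>
  paired with the midpoint, and over a short interval the midpoint differs from \<open>b r\<close>
  by the modulus of uniform continuity.\<close>

lemma weak_square:
  fixes b \<alpha> :: "real \<Rightarrow> 'a::real_inner"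
  assumes T: "T > 0" and cb: "continuous_on {0..T} b"
    and weak: "\<And>s t x. 0 \<le> s \<Longrightarrow> s \<le> t \<Longrightarrow> t \<le> T \<Longrightarrow> (b t - b s) \<bullet> x = integral {s..t} (\<lambda>r. \<alpha> r \<bullet> x)"
    and ia: "\<And>x. (\<lambda>r. \<alpha> r \<bullet> x) integrable_on {0..T}"
    and iab: "(\<lambda>r. \<alpha> r \<bullet> b r) integrable_on {0..T}"
    and im: "m integrable_on {0..T}" and le: "\<And>r. r \<in> {0..T} \<Longrightarrow> norm (\<alpha> r) \<le> m r"
  shows "(norm (b T))\<^sup>2 / 2 = (norm (b 0))\<^sup>2 / 2 + integral {0..T} (\<lambda>r. \<alpha> r \<bullet> b r)"
proof -
  define \<Phi> where "\<Phi> t = (norm (b t))\<^sup>2 / 2 - integral {0..t} (\<lambda>r. \<alpha> r \<bullet> b r)" for t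
  define \<mu> where "\<mu> t = integral {0..t} m" for t
  have "\<Phi> T = \<Phi> 0"
  proof (rule constant_if_increments_small[OF T, of _ \<mu>])
    fix e :: real assume e: "e > 0"
    have "uniformly_continuous_on {0..T} b"
      by (rule compact_uniformly_continuous[OF cb compact_Icc])
    then obtain d where d: "d > 0" "\<And>s t. s \<in> {0..T} \<Longrightarrow> t \<in> {0..T} \<Longrightarrow> dist s t < d \<Longrightarrow> dist (b s) (b t) < e"
      unfolding uniformly_continuous_on_def using e by metis
    have "\<bar>\<Phi> t - \<Phi> s\<bar> \<le> e * (\<mu> t - \<mu> s)" if st: "0 \<le> s" "s \<le> t" "t \<le> T" "t - s < d" for s t
    proof -
      \<comment> \<open>For the midpoint, the difference of the half squares is exactly an inner
        product, so the weak identity applies without error.\<close>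
      define x where "x = (1/2) *\<^sub>R (b t + b s)"
      have i1: "(\<lambda>r. \<alpha> r \<bullet> x) integrable_on {s..t}" "(\<lambda>r. \<alpha> r \<bullet> b r) integrable_on {s..t}" "m integrable_on {s..t}"
        using st by (auto intro: integrable_subinterval_real[OF ia] integrable_subinterval_real[OF iab]
            integrable_subinterval_real[OF im])
      have "(norm (b t))\<^sup>2 / 2 - (norm (b s))\<^sup>2 / 2 = (b t - b s) \<bullet> x"
        unfolding x_def power2_norm_eq_inner
        by (simp add: inner_diff_left inner_diff_right inner_add_right inner_commute diff_divide_distrib
            add_divide_distrib)
      then have "\<Phi> t - \<Phi> s = integral {s..t} (\<lambda>r. \<alpha> r \<bullet> x) - integral {s..t} (\<lambda>r. \<alpha> r \<bullet> b r)"
        using integral_diff_interval[OF iab st(1-3)] weak[OF st(1-3), of x] unfolding \<Phi>_def by simp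
      also have "\<dots> = integral {s..t} (\<lambda>r. \<alpha> r \<bullet> (x - b r))"
        unfolding inner_diff_right by (rule integral_diff[symmetric, OF i1(1,2)])
      finally have eq: "\<Phi> t - \<Phi> s = integral {s..t} (\<lambda>r. \<alpha> r \<bullet> (x - b r))" .
      have "norm (integral {s..t} (\<lambda>r. \<alpha> r \<bullet> (x - b r))) \<le> integral {s..t} (\<lambda>r. e * m r)"
      proof (rule integral_norm_bound_integral)
        show "(\<lambda>r. \<alpha> r \<bullet> (x - b r)) integrable_on {s..t}"
          unfolding inner_diff_right by (rule integrable_diff[OF i1(1,2)])
        show "(\<lambda>r. e * m r) integrable_on {s..t}" by (rule integrable_on_mult_right[OF i1(3)])
        fix r assume r: "r \<in> {s..t}"
        have "dist (b t) (b r) < e" "dist (b s) (b r) < e"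
          using r st by (auto intro!: d(2) simp: dist_real_def)
        then have "norm (b t - b r) < e" "norm (b s - b r) < e" by (simp_all add: dist_norm)
        moreover have "x - b r = (1/2) *\<^sub>R (b t - b r) + (1/2) *\<^sub>R (b s - b r)"
        proof -
          have "b r = (1/2) *\<^sub>R (b r + b r)" by simp
          then have "x - b r = (1/2) *\<^sub>R (b t + b s) - (1/2) *\<^sub>R (b r + b r)" unfolding x_def by simp
          then show ?thesis by (simp add: scaleR_add_right scaleR_diff_right del: scaleR_half_double)
        qed
        ultimately have "norm (x - b r) \<le> e"
          using norm_triangle_ineq[of "(1/2) *\<^sub>R (b t - b r)" "(1/2) *\<^sub>R (b s - b r)"] by simp
        then have "norm (\<alpha> r) * norm (x - b r) \<le> m r * e"
          using le[of r] r st order_trans[OF norm_ge_zero le[of r]] by (intro mult_mono) auto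
        then show "norm (\<alpha> r \<bullet> (x - b r)) \<le> e * m r"
          using Cauchy_Schwarz_ineq2[of "\<alpha> r" "x - b r"] by (simp add: mult.commute)
      qed
      also have "\<dots> = e * (\<mu> t - \<mu> s)"
        unfolding \<mu>_def integral_diff_interval[OF im st(1-3)] by simp
      finally show ?thesis unfolding eq by simp
    qed
    then show "\<exists>d>0. \<forall>s t. 0 \<le> s \<longrightarrow> s \<le> t \<longrightarrow> t \<le> T \<longrightarrow> t - s < d \<longrightarrow> \<bar>\<Phi> t - \<Phi> s\<bar> \<le> e * (\<mu> t - \<mu> s)"
      using d(1) by blast
  qed
  then show ?thesis unfolding \<Phi>_def by simp
qed

section \<open>Weak solutions compared with the first-order system\<close>

context positive_operator
begin

text \<open>Continuity in the norm of the scale is ordinary continuity of the preimage under the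
  power of \<open>G\<close>; with \<open>continuous_intoI\<close> this removes the norms of the
  scale from the definitions of solutions.\<close>

lemma continuous_intoD:
  assumes "continuous_into D A k T w"
  shows "\<exists>v. continuous_on {0..T} v \<and> (\<forall>t\<in>{0..T}. w t = (G ^^ k) (v t))"
proof -
  define v where "v t = op_powr D A (real k / 2) (w t)" for t
  have w: "w t = (G ^^ k) (v t)" if "t \<in> {0..T}" for t
  proof -
    have "w t \<in> Hspace D A k" using assms that unfolding continuous_into_def by blast
    then obtain x where "w t = (G ^^ k) x" unfolding Hspace_iff ..
    then show ?thesis unfolding v_def by (simp add: op_powr_Gpow)
  qed
  have "continuous_on {0..T} v"
    unfolding continuous_on_def
  proof
    fix t assume t: "t \<in> {0..T}"
    have "((\<lambda>s. Hnorm D A (int k) (w s - w t)) \<longlongrightarrow> 0) (at t within {0..T})"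
      using assms t unfolding continuous_into_def by blast
    moreover have "\<forall>\<^sub>F s in at t within {0..T}. Hnorm D A (int k) (w s - w t) = norm (v s - v t)"
      unfolding eventually_at_filter
    proof (intro always_eventually allI impI)
      fix s assume "s \<in> {0..T}"
      then have "w s - w t = (G ^^ k) (v s - v t)"
        using w t by (simp add: bl_diff[OF Gpow_bounded_linear])
      then show "Hnorm D A (int k) (w s - w t) = norm (v s - v t)" by (simp add: Hnorm_Gpow)
    qed
    ultimately have "((\<lambda>s. norm (v s - v t)) \<longlongrightarrow> 0) (at t within {0..T})"
      by (rule tendsto_cong[THEN iffD1, rotated])
    then show "(v \<longlongrightarrow> v t) (at t within {0..T})" by (simp add: tendsto_norm_zero_iff LIM_zero_iff)
  qed
  with w show ?thesis by blast
qed

lemma continuous_intoI: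
  assumes v: "continuous_on {0..T} v" and w: "\<And>t. t \<in> {0..T} \<Longrightarrow> w t = (G ^^ k) (v t)"
  shows "continuous_into D A k T w"
  unfolding continuous_into_def
proof (intro conjI ballI)
  fix t assume t: "t \<in> {0..T}"
  show "w t \<in> Hspace D A k" using w[OF t] Hspace_iff by blast
  have "((\<lambda>s. norm (v s - v t)) \<longlongrightarrow> 0) (at t within {0..T})"
    using v t unfolding continuous_on_def by (simp add: tendsto_norm_zero_iff LIM_zero_iff)
  moreover have "\<forall>\<^sub>F s in at t within {0..T}. norm (v s - v t) = Hnorm D A (int k) (w s - w t)"
    unfolding eventually_at_filter
  proof (intro always_eventually allI impI)
    fix s assume "s \<in> {0..T}"
    then have "w s - w t = (G ^^ k) (v s - v t)"
      using w t by (simp add: bl_diff[OF Gpow_bounded_linear])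
    then show "norm (v s - v t) = Hnorm D A (int k) (w s - w t)" by (simp add: Hnorm_Gpow)
  qed
  ultimately show "((\<lambda>s. Hnorm D A (int k) (w s - w t)) \<longlongrightarrow> 0) (at t within {0..T})"
    by (rule tendsto_cong[THEN iffD1, rotated])
qed

lemma continuous_into_diff:
  assumes "continuous_into D A k T w" "continuous_into D A k T w'"
  shows "continuous_into D A k T (\<lambda>t. w t - w' t)"
proof -
  obtain v where v: "continuous_on {0..T} v" "\<forall>t\<in>{0..T}. w t = (G ^^ k) (v t)"
    using continuous_intoD[OF assms(1)] by blast
  obtain v' where v': "continuous_on {0..T} v'" "\<forall>t\<in>{0..T}. w' t = (G ^^ k) (v' t)"
    using continuous_intoD[OF assms(2)] by blast
  show ?thesis
    by (rule continuous_intoI[of T "\<lambda>t. v t - v' t"])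
      (use v v' in \<open>auto intro!: continuous_intros simp: bl_diff[OF Gpow_bounded_linear]\<close>)
qed

lemma wave_L:
  assumes "wave_solution D A T f w w'"
  shows "t \<in> {0..T} \<Longrightarrow> G (L (w t)) = w t" "continuous_on {0..T} (\<lambda>t. L (w t))"
proof -
  have c: "continuous_into D A 1 T w" using assms unfolding wave_solution_def by blast
  obtain v where v: "continuous_on {0..T} v" "\<forall>t\<in>{0..T}. w t = (G ^^ 1) (v t)"
    using continuous_intoD[OF c] by blast
  then show "t \<in> {0..T} \<Longrightarrow> G (L (w t)) = w t" by simp
  have "continuous_on {0..T} (\<lambda>t. L (w t)) \<longleftrightarrow> continuous_on {0..T} v"
    by (rule continuous_on_cong) (use v in auto)
  with v(1) show "continuous_on {0..T} (\<lambda>t. L (w t))" by blast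
qed

lemma
  assumes "wave_solution D A T f w w'"
  shows wave_L2: "L2_fun T f" and wave_cy: "continuous_on {0..T} w'"
    and wave_dw: "t \<in> {0..T} \<Longrightarrow> (w has_vector_derivative w' t) (at t within {0..T})"
    and wave_cw: "continuous_on {0..T} w"
  using assms unfolding wave_solution_def
  by (auto simp: continuous_on_eq_continuous_within intro: has_vector_derivative_continuous)

lemma wave_integrable:
  assumes s: "wave_solution D A T f w w'" and T: "T > 0"
  shows "integrable (lebesgue_on {0..T}) (\<lambda>s. f s \<bullet> \<phi> - w s \<bullet> \<psi>)"
proof -
  have "integrable (lebesgue_on {0..T}) (\<lambda>s. f s \<bullet> \<phi>)"
    by (intro L2_fun_integrable_inner wave_L2[OF s] L2_fun_continuous T continuous_intros)
  moreover have "integrable (lebesgue_on {0..T}) (\<lambda>s. w s \<bullet> \<psi>)"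
    by (intro continuous_imp_integrable_real continuous_intros wave_cw[OF s])
  ultimately show ?thesis by simp
qed

text \<open>Tests \<open>G (G x)\<close> run through \<open>D\<close> and satisfy
  \<open>A (G (G x)) = x\<close>, so no unbounded operator remains.\<close>

lemma wave_weak:
  assumes s: "wave_solution D A T f w w'" and T: "T > 0" and t: "t \<in> {0..T}"
  shows "w' t \<bullet> G (G x) = w' 0 \<bullet> G (G x) + integral {0..t} (\<lambda>s. f s \<bullet> G (G x) - w s \<bullet> x)"
proof -
  have "integrable (lebesgue_on {0..t}) (\<lambda>s. f s \<bullet> G (G x) - w s \<bullet> x)"
    by (rule Equivalence_Lebesgue_Henstock_Integration.integrable_subinterval[OF wave_integrable[OF s T]])
      (use t in auto)
  then have "(LINT s|lebesgue_on {0..t}. f s \<bullet> G (G x) - w s \<bullet> x) = integral {0..t} (\<lambda>s. f s \<bullet> G (G x) - w s \<bullet> x)"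
    by (rule lebesgue_integral_eq_integral) simp
  moreover have "w' t \<bullet> G (G x) = w' 0 \<bullet> G (G x) + (LINT s|lebesgue_on {0..t}. f s \<bullet> G (G x) - w s \<bullet> A (G (G x)))"
    using s t GG_in_D unfolding wave_solution_def by blast
  ultimately show ?thesis by (simp add: A_GG)
qed

text \<open>Moving one \<open>G\<close> across, the test \<open>G (G x)\<close> becomes
  \<open>G x\<close> paired with \<open>G w'\<close>; since the range of \<open>G\<close> is dense,
  the weak identity determines the derivative of \<open>G w'\<close> in norm, continuity of the
  forcing being used here.\<close>

lemma wave_imp_sol:
  assumes s: "wave_solution D A T f w w'" and T: "T > 0" and f: "continuous_on {0..T} f"
  shows "sol T f (\<lambda>t. L (w t)) w'"
  unfolding sol_def
proof (intro conjI ballI f wave_L(2)[OF s] wave_cy[OF s])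
  fix t assume t: "t \<in> {0..T}"
  show "((\<lambda>s. G (L (w s))) has_vector_derivative w' t) (at t within {0..T})"
    by (rule has_vector_derivative_transform[OF t _ wave_dw[OF s t]]) (simp add: wave_L(1)[OF s])
  show "((\<lambda>s. G (w' s)) has_vector_derivative G (f t) - L (w t)) (at t within {0..T})"
  proof (rule weak_integral_imp_vector_derivative[OF _ t])
    show "continuous_on {0..T} (\<lambda>t. G (f t) - L (w t))"
      by (intro continuous_intros continuous_on_bl[OF G_bounded_linear] f wave_L(2)[OF s])
    have "closure (range (\<lambda>x. G (G x))) \<subseteq> closure (range G)" by (intro closure_mono) auto
    then show "closure (range G) = UNIV" using range_G_dense by auto
    fix r \<psi> assume r: "r \<in> {0..T}" and "\<psi> \<in> range G"
    then obtain x where \<psi>: "\<psi> = G x" by blast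
    have "integral {0..r} (\<lambda>s. f s \<bullet> G (G x) - w s \<bullet> x) = integral {0..r} (\<lambda>s. (G (f s) - L (w s)) \<bullet> \<psi>)"
    proof (rule integral_cong)
      fix s' assume "s' \<in> {0..r}"
      then have "G (L (w s')) = w s'" using r by (intro wave_L(1)[OF s]) auto
      then have "w s' \<bullet> x = L (w s') \<bullet> G x" by (metis G_symmetric)
      then show "f s' \<bullet> G (G x) - w s' \<bullet> x = (G (f s') - L (w s')) \<bullet> \<psi>"
        unfolding \<psi> by (simp add: inner_diff_left G_symmetric)
    qed
    then show "G (w' r) \<bullet> \<psi> - G (w' 0) \<bullet> \<psi> = integral {0..r} (\<lambda>s. (G (f s) - L (w s)) \<bullet> \<psi>)"
      using wave_weak[OF s T r, of x] unfolding \<psi> by (simp add: G_symmetric)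
  qed
qed

lemma sol_imp_wave:
  assumes s: "sol T f z y" and T: "T > 0"
  shows "wave_solution D A T f (\<lambda>t. G (z t)) y"
  unfolding wave_solution_def
proof (intro conjI ballI)
  show "L2_fun T f" by (rule L2_fun_continuous[OF sol_cont_f[OF s] T])
  show "continuous_into D A 1 T (\<lambda>t. G (z t))"
    by (rule continuous_intoI[OF sol_cont_z[OF s]]) simp
  show "continuous_on {0..T} y" by (rule sol_cont_y[OF s])
  fix t assume t: "t \<in> {0..T}"
  show "((\<lambda>t. G (z t)) has_vector_derivative y t) (at t within {0..T})" by (rule sol_dz[OF s t])
  fix \<phi> assume \<phi>: "\<phi> \<in> D"
  define x where "x = A \<phi>"
  have \<phi>x: "\<phi> = G (G x)" unfolding x_def using GG_A[OF \<phi>] by simp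
  have c: "continuous_on {0..t} (\<lambda>s. f s \<bullet> \<phi> - G (z s) \<bullet> x)"
    by (intro continuous_intros continuous_on_bl[OF G_bounded_linear]
      continuous_on_subset[OF sol_cont_f[OF s]] continuous_on_subset[OF sol_cont_z[OF s]]) (use t in auto)
  have "G (y t) \<bullet> G x - G (y 0) \<bullet> G x = integral {0..t} (\<lambda>s. (G (f s) - z s) \<bullet> G x)"
    by (rule real_integral_FTC[OF bounded_linear.has_vector_derivative[OF bounded_linear_inner_left sol_dy[OF s]] t])
  also have "(\<lambda>s. (G (f s) - z s) \<bullet> G x) = (\<lambda>s. f s \<bullet> \<phi> - G (z s) \<bullet> x)"
    unfolding \<phi>x by (simp add: inner_diff_left G_symmetric)
  finally show "y t \<bullet> \<phi> = y 0 \<bullet> \<phi> + (LINT s|lebesgue_on {0..t}. f s \<bullet> \<phi> - G (z s) \<bullet> A \<phi>)"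
    using lint_continuous[OF c] unfolding \<phi>x A_GG by (simp add: G_symmetric)
qed

lemma wave_solution_diff:
  assumes s: "wave_solution D A T f w w'" and s': "wave_solution D A T g v v'" and T: "T > 0"
  shows "wave_solution D A T (\<lambda>t. f t - g t) (\<lambda>t. w t - v t) (\<lambda>t. w' t - v' t)"
  unfolding wave_solution_def
proof (intro conjI ballI)
  show "L2_fun T (\<lambda>t. f t - g t)" by (rule L2_fun_diff[OF wave_L2[OF s] wave_L2[OF s']])
  show "continuous_into D A 1 T (\<lambda>t. w t - v t)"
    using s s' unfolding wave_solution_def by (intro continuous_into_diff) auto
  show "continuous_on {0..T} (\<lambda>t. w' t - v' t)" by (intro continuous_intros wave_cy[OF s] wave_cy[OF s'])
  fix t assume t: "t \<in> {0..T}"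
  show "((\<lambda>t. w t - v t) has_vector_derivative w' t - v' t) (at t within {0..T})"
    by (intro has_vector_derivative_diff wave_dw[OF s t] wave_dw[OF s' t])
  fix \<phi> assume \<phi>: "\<phi> \<in> D"
  have i: "integrable (lebesgue_on {0..t}) (\<lambda>s. f s \<bullet> \<phi> - w s \<bullet> A \<phi>)"
    "integrable (lebesgue_on {0..t}) (\<lambda>s. g s \<bullet> \<phi> - v s \<bullet> A \<phi>)"
    using t by (auto intro!: Equivalence_Lebesgue_Henstock_Integration.integrable_subinterval[OF wave_integrable[OF s T]]
        Equivalence_Lebesgue_Henstock_Integration.integrable_subinterval[OF wave_integrable[OF s' T]])
  have "(LINT s|lebesgue_on {0..t}. (f s - g s) \<bullet> \<phi> - (w s - v s) \<bullet> A \<phi>)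
      = (LINT s|lebesgue_on {0..t}. (f s \<bullet> \<phi> - w s \<bullet> A \<phi>) - (g s \<bullet> \<phi> - v s \<bullet> A \<phi>))"
    by (simp add: inner_diff_left algebra_simps)
  also have "\<dots> = (LINT s|lebesgue_on {0..t}. f s \<bullet> \<phi> - w s \<bullet> A \<phi>) - (LINT s|lebesgue_on {0..t}. g s \<bullet> \<phi> - v s \<bullet> A \<phi>)"
    by (rule Bochner_Integration.integral_diff[OF i])
  moreover have "w' t \<bullet> \<phi> = w' 0 \<bullet> \<phi> + (LINT s|lebesgue_on {0..t}. f s \<bullet> \<phi> - w s \<bullet> A \<phi>)"
    "v' t \<bullet> \<phi> = v' 0 \<bullet> \<phi> + (LINT s|lebesgue_on {0..t}. g s \<bullet> \<phi> - v s \<bullet> A \<phi>)"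
    using s s' t \<phi> unfolding wave_solution_def by blast+
  ultimately show "(w' t - v' t) \<bullet> \<phi> = (w' 0 - v' 0) \<bullet> \<phi>
      + (LINT s|lebesgue_on {0..t}. (f s - g s) \<bullet> \<phi> - (w s - v s) \<bullet> A \<phi>)"
    by (simp add: inner_diff_left)
qed

lemma wave_energy:
  assumes s: "wave_solution D A T f w w'" and T: "T > 0" and t: "t \<in> {0..T}"
  shows "en 0 (L (w t)) (w' t) \<le> 2 * en 0 (L (w 0)) (w' 0) + 2 * T * (LINT s|lebesgue_on {0..T}. (norm (f s))\<^sup>2)"
proof -
  define z where "z t = L (w t)" for t
  have cz: "continuous_on {0..T} z" and Gz: "\<And>t. t \<in> {0..T} \<Longrightarrow> G (z t) = w t"
    unfolding z_def using wave_L[OF s] by auto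
  note cy = wave_cy[OF s] and L2f = wave_L2[OF s]
  have J: "integrable (lebesgue_on {0..T}) (\<lambda>s. (norm (f s))\<^sup>2)" using L2f unfolding L2_fun_def by blast
  have Jeq: "(LINT s|lebesgue_on {0..T}. (norm (f s))\<^sup>2) = integral {0..T} (\<lambda>s. (norm (f s))\<^sup>2)"
    by (rule lebesgue_integral_eq_integral[OF J]) simp
  have hk: "h integrable_on {0..T}" if "integrable (lebesgue_on {0..T}) h" for h :: "real \<Rightarrow> real"
    by (rule integrable_on_lebesgue_on[OF that]) simp
  have "en 0 (PN N (z t)) (PN N (w' t)) \<le> 2 * en 0 (PN N (z 0)) (PN N (w' 0))
      + 2 * T * integral {0..T} (\<lambda>s. (norm (f s))\<^sup>2)" for N
  proof (rule energy_bound[OF T, where y = "\<lambda>t. PN N (w' t)" and e = "\<lambda>t. en 0 (PN N (z t)) (PN N (w' t))"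
        and f = f and t = t])
    define \<alpha> where "\<alpha> r = PN N (f r) - LN N (z r)" for r
    have cPy: "continuous_on {0..T} (\<lambda>t. PN N (w' t))" and cPz: "continuous_on {0..T} (\<lambda>t. PN N (z t))"
      and cLz: "continuous_on {0..T} (\<lambda>t. LN N (z t))" and cLy: "continuous_on {0..T} (\<lambda>t. LN N (w' t))"
      by (rule continuous_on_bl[OF PN_bounded_linear cy] continuous_on_bl[OF PN_bounded_linear cz]
          continuous_on_bl[OF LN_bounded_linear cz] continuous_on_bl[OF LN_bounded_linear cy])+
    have L2\<alpha>: "L2_fun T \<alpha>" unfolding \<alpha>_def[abs_def]
      by (intro L2_fun_diff L2_fun_map[OF L2f PN_bounded_linear] L2_fun_continuous[OF cLz T])
    have weak: "(PN N (w' t) - PN N (w' s')) \<bullet> x = integral {s'..t} (\<lambda>r. \<alpha> r \<bullet> x)"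
      if st: "0 \<le> s'" "s' \<le> t" "t \<le> T" for s' t x
    proof -
      \<comment> \<open>The test vector for which \<open>G (G v)\<close> is \<open>PN N x\<close>,
        so that the weak equation describes the truncated velocity.\<close>
      define v where "v = LN N (LN N x)"
      have GGv: "G (G v) = PN N x" unfolding v_def by (simp add: G_LN PN_LN)
      define h where "h r = f r \<bullet> G (G v) - w r \<bullet> v" for r
      have ih: "h integrable_on {0..T}" unfolding h_def[abs_def] by (rule hk[OF wave_integrable[OF s T]])
      have "w' t \<bullet> PN N x - w' s' \<bullet> PN N x = integral {0..t} h - integral {0..s'} h"
        using wave_weak[OF s T, of t v] wave_weak[OF s T, of s' v] st unfolding GGv h_def[abs_def] by auto
      also have "\<dots> = integral {s'..t} h" by (rule integral_diff_interval[OF ih st])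
      also have "\<dots> = integral {s'..t} (\<lambda>r. \<alpha> r \<bullet> x)"
      proof (rule integral_cong)
        fix r assume "r \<in> {s'..t}"
        then have "w r \<bullet> v = z r \<bullet> G v" using Gz[of r] st by (metis G_symmetric atLeastAtMost_iff order_trans)
        also have "G v = LN N x" unfolding v_def by (simp add: G_LN PN_LN)
        finally show "h r = \<alpha> r \<bullet> x"
          unfolding h_def \<alpha>_def GGv by (simp add: inner_diff_left PN_symmetric LN_symmetric)
      qed
      finally show ?thesis by (simp add: inner_diff_left PN_symmetric)
    qed
    show "continuous_on {0..T} (\<lambda>t. en 0 (PN N (z t)) (PN N (w' t)))"
      unfolding en_0 by (intro continuous_intros cPz cPy) auto
    show "(norm (PN N (w' r)))\<^sup>2 \<le> 2 * en 0 (PN N (z r)) (PN N (w' r))" for r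
      using zero_le_power2[of "norm (PN N (z r))"] unfolding en_0 by argo
    show i1: "(\<lambda>s. PN N (w' s) \<bullet> f s) integrable_on {0..T}"
      by (intro hk L2_fun_integrable_inner L2f L2_fun_continuous[OF cPy T])
    show "(\<lambda>s. (norm (f s))\<^sup>2) integrable_on {0..T}" by (rule hk[OF J])
    fix r assume r: "r \<in> {0..T}"
    have sub: "{0..r} \<subseteq> {0..T}" using r by auto
    have y_part: "(norm (PN N (w' r)))\<^sup>2 / 2 = (norm (PN N (w' 0)))\<^sup>2 / 2 + integral {0..r} (\<lambda>r. \<alpha> r \<bullet> PN N (w' r))"
    proof (cases "r = 0")
      case False
      have i\<alpha>: "(\<lambda>r. \<alpha> r \<bullet> x) integrable_on {0..T}" for x
        by (intro hk L2_fun_integrable_inner L2\<alpha> L2_fun_continuous[OF _ T] continuous_intros)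
      have i\<alpha>y: "(\<lambda>r. \<alpha> r \<bullet> PN N (w' r)) integrable_on {0..T}"
        by (intro hk L2_fun_integrable_inner L2\<alpha> L2_fun_continuous[OF cPy T])
      \<comment> \<open>An integrable majorant of \<open>norm \<alpha>\<close>, obtained from square
        integrability by adding 1.\<close>
      have im: "(\<lambda>r. 1 + (norm (\<alpha> r))\<^sup>2) integrable_on {0..T}"
        using L2\<alpha> unfolding L2_fun_def by (intro hk) auto
      show ?thesis
      proof (rule weak_square[where m = "\<lambda>r. 1 + (norm (\<alpha> r))\<^sup>2" and T = r and \<alpha> = \<alpha>
            and b = "\<lambda>t. PN N (w' t)"])
        show "r > 0" using r False by simp
        show "continuous_on {0..r} (\<lambda>t. PN N (w' t))" by (rule continuous_on_subset[OF cPy sub])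
        show "norm (\<alpha> q) \<le> 1 + (norm (\<alpha> q))\<^sup>2" for q
          using zero_le_power2[of "norm (\<alpha> q) - 1"] zero_le_power2[of "norm (\<alpha> q)"] norm_ge_zero[of "\<alpha> q"]
          unfolding power2_diff one_power2 mult_1_right by argo
        show "(PN N (w' t) - PN N (w' s')) \<bullet> x = integral {s'..t} (\<lambda>r. \<alpha> r \<bullet> x)"
          if "0 \<le> s'" "s' \<le> t" "t \<le> r" for s' t x
          using that r by (intro weak) auto
        show "(\<lambda>r. \<alpha> r \<bullet> x) integrable_on {0..r}" for x by (rule integrable_subinterval_real[OF i\<alpha> sub])
        show "(\<lambda>r. \<alpha> r \<bullet> PN N (w' r)) integrable_on {0..r}" by (rule integrable_subinterval_real[OF i\<alpha>y sub])
        show "(\<lambda>r. 1 + (norm (\<alpha> r))\<^sup>2) integrable_on {0..r}" by (rule integrable_subinterval_real[OF im sub])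
      qed
    qed simp
    have dPz: "((\<lambda>s. PN N (z s)) has_vector_derivative LN N (w' q)) (at q within {0..T})" if q: "q \<in> {0..T}" for q
    proof (rule has_vector_derivative_transform[OF q _
          bounded_linear.has_vector_derivative[OF LN_bounded_linear wave_dw[OF s q]]])
      show "PN N (z x) = LN N (w x)" if "x \<in> {0..T}" for x using Gz[OF that] LN_G by metis
    qed
    have "((\<lambda>s. PN N (z s) \<bullet> PN N (z s) / 2) has_vector_derivative LN N (z q) \<bullet> PN N (w' q)) (at q within {0..T})"
      if q: "q \<in> {0..T}" for q
    proof -
      have "((\<lambda>s. PN N (z s) \<bullet> PN N (z s) / 2) has_vector_derivative
          (PN N (z q) \<bullet> LN N (w' q) + LN N (w' q) \<bullet> PN N (z q)) / 2) (at q within {0..T})"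
        by (intro has_vector_derivative_divide
          bounded_bilinear.has_vector_derivative[OF bounded_bilinear_inner] dPz q)
      moreover have "PN N (z q) \<bullet> LN N (w' q) = LN N (z q) \<bullet> PN N (w' q)"
        by (metis LN_PN LN_symmetric PN_symmetric)
      ultimately show ?thesis by (simp add: inner_commute)
    qed
    from real_integral_FTC[where f = "\<lambda>s. PN N (z s) \<bullet> PN N (z s) / 2"
        and f' = "\<lambda>q. LN N (z q) \<bullet> PN N (w' q)", OF this r]
    have z_part: "(norm (PN N (z r)))\<^sup>2 / 2 - (norm (PN N (z 0)))\<^sup>2 / 2 = integral {0..r} (\<lambda>q. LN N (z q) \<bullet> PN N (w' q))"
      by (simp add: power2_norm_eq_inner)
    have "integral {0..r} (\<lambda>q. \<alpha> q \<bullet> PN N (w' q)) + integral {0..r} (\<lambda>q. LN N (z q) \<bullet> PN N (w' q))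
        = integral {0..r} (\<lambda>q. \<alpha> q \<bullet> PN N (w' q) + LN N (z q) \<bullet> PN N (w' q))"
    proof (rule integral_add[symmetric])
      show "(\<lambda>q. \<alpha> q \<bullet> PN N (w' q)) integrable_on {0..r}"
        by (rule integrable_subinterval_real[OF hk[OF L2_fun_integrable_inner[OF L2\<alpha> L2_fun_continuous[OF cPy T]]] sub])
      show "(\<lambda>q. LN N (z q) \<bullet> PN N (w' q)) integrable_on {0..r}"
        by (intro integrable_continuous_interval continuous_intros continuous_on_subset[OF cLz sub]
          continuous_on_subset[OF cPy sub])
    qed
    also have "(\<lambda>q. \<alpha> q \<bullet> PN N (w' q) + LN N (z q) \<bullet> PN N (w' q)) = (\<lambda>q. PN N (w' q) \<bullet> f q)"
    proof
      fix q
      have "PN N (f q) \<bullet> PN N (w' q) = PN N (w' q) \<bullet> f q" by (metis PN_PN PN_symmetric inner_commute)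
      then show "\<alpha> q \<bullet> PN N (w' q) + LN N (z q) \<bullet> PN N (w' q) = PN N (w' q) \<bullet> f q"
        unfolding \<alpha>_def by (simp add: inner_diff_left)
    qed
    finally show "en 0 (PN N (z r)) (PN N (w' r)) = en 0 (PN N (z 0)) (PN N (w' 0)) + integral {0..r} (\<lambda>s. PN N (w' s) \<bullet> f s)"
      using y_part z_part unfolding en_0 by linarith
  qed (rule t)
  moreover have "(\<lambda>N. en 0 (PN N (z t)) (PN N (w' t))) \<longlonglongrightarrow> en 0 (z t) (w' t)" for t
    unfolding en_0 by (intro tendsto_intros PN_tendsto) auto
  ultimately have "en 0 (z t) (w' t) \<le> 2 * en 0 (z 0) (w' 0) + 2 * T * integral {0..T} (\<lambda>s. (norm (f s))\<^sup>2)"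
    by (intro LIMSEQ_le[where X = "\<lambda>N. en 0 (PN N (z t)) (PN N (w' t))"
        and Y = "\<lambda>N. 2 * en 0 (PN N (z 0)) (PN N (w' 0)) + 2 * T * integral {0..T} (\<lambda>s. (norm (f s))\<^sup>2)"]
        tendsto_add tendsto_mult_left tendsto_const exI[of _ 0]) auto
  then show ?thesis unfolding z_def Jeq .
qed

end


section \<open>Admissible observations\<close>

locale observed_operator = positive_operator D A
  for D :: "'h::{real_inner,complete_space} set" and A :: "'h \<Rightarrow> 'h" +
  fixes B :: "'h \<times> 'h \<Rightarrow> 'g::{real_inner,complete_space}"
  assumes adm: "admissible D A B"
begin

text \<open>\<open>G\<close> applied twice maps \<open>H\<close> isometrically onto the space of
  index 2, so \<open>B\<close> transported to \<open>H \<times> H\<close> is an ordinary bounded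
  operator.\<close>

definition BB :: "'h \<times> 'h \<Rightarrow> 'g" where "BB p = B (G (G (fst p)), snd p)"

lemma BB_bounded_linear: "bounded_linear BB"
proof -
  have lin: "linear_on_set (Hspace D A 2 \<times> UNIV) B"
    using adm unfolding admissible_def bounded_observation_def by blast
  obtain K where K: "\<forall>x\<in>Hspace D A 2. \<forall>y. norm (B (x, y)) \<le> K * sqrt ((Hnorm D A 2 x)\<^sup>2 + (norm y)\<^sup>2)"
    using adm unfolding admissible_def bounded_observation_def by blast
  have mem: "(G (G v), y) \<in> Hspace D A 2 \<times> UNIV" for v y using Hspace2_iff by blast
  show ?thesis
  proof (rule bounded_linear_intro[of _ K])
    fix p q :: "'h \<times> 'h"
    show "BB (p + q) = BB p + BB q"
      using lin mem[of "fst p" "snd p"] mem[of "fst q" "snd q"]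
      unfolding BB_def linear_on_set_def by (auto simp: G_add)
    show "BB (c *\<^sub>R p) = c *\<^sub>R BB p" for c
      using lin mem[of "fst p" "snd p"]
      unfolding BB_def linear_on_set_def by (auto simp: G_scale)
    show "norm (BB p) \<le> norm p * K"
      using K[rule_format, OF mem[of "fst p" "snd p", THEN SigmaD1], of "snd p"]
      unfolding BB_def by (simp add: Hnorm_2 norm_prod_def mult.commute)
  qed
qed

lemmas BB_diff = bl_diff[OF BB_bounded_linear]

text \<open>The observation of a truncated wave: \<open>LN\<close> appears because
  \<open>G (PN N z)\<close> equals \<open>G (G (LN N z))\<close>.\<close>

definition obsN :: "nat \<Rightarrow> 'h \<Rightarrow> 'h \<Rightarrow> 'g" where "obsN N z y = BB (LN N z, PN N y)"

lemma obsN_eq: "B (G (PN N z), PN N y) = obsN N z y"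
  unfolding obsN_def BB_def by (simp add: G_LN)

lemma obsN_diff: "obsN N (z - z') (y - y') = obsN N z y - obsN N z' y'"
  unfolding obsN_def by (simp add: bl_diff[OF LN_bounded_linear] bl_diff[OF PN_bounded_linear] flip: BB_diff)

lemma obsN_continuous:
  assumes "sol T f z y"
  shows "continuous_on {0..T} (\<lambda>t. obsN N (z t) (y t))"
  unfolding obsN_def
  by (intro continuous_on_bl[OF BB_bounded_linear] continuous_on_Pair
    continuous_on_bl[OF LN_bounded_linear sol_cont_z[OF assms]]
    continuous_on_bl[OF PN_bounded_linear sol_cont_y[OF assms]])

lemma regular_B_continuous:
  assumes "regular_wave_solution D A T f w w'"
  shows "continuous_on {0..T} (\<lambda>t. B (w t, w' t))"
proof -
  obtain v where v: "continuous_on {0..T} v" "\<forall>t\<in>{0..T}. w t = (G ^^ 2) (v t)"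
    using assms continuous_intoD[of 2 T w] unfolding regular_wave_solution_def by blast
  have cy: "continuous_on {0..T} w'"
    using assms wave_cy unfolding regular_wave_solution_def by blast
  have "continuous_on {0..T} (\<lambda>t. BB (v t, w' t))"
    by (intro continuous_on_bl[OF BB_bounded_linear] continuous_on_Pair v cy)
  moreover have "continuous_on {0..T} (\<lambda>t. B (w t, w' t)) = continuous_on {0..T} (\<lambda>t. BB (v t, w' t))"
    by (rule continuous_on_cong) (use v in \<open>auto simp: BB_def numeral_2_eq_2\<close>)
  ultimately show ?thesis by simp
qed

lemma regular_diff:
  assumes w: "regular_wave_solution D A T f w w'" and v: "regular_wave_solution D A T g v v'" and T: "T > 0"
  shows "regular_wave_solution D A T (\<lambda>t. f t - g t) (\<lambda>t. w t - v t) (\<lambda>t. w' t - v' t)"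
    and "t \<in> {0..T} \<Longrightarrow> B (w t - v t, w' t - v' t) = B (w t, w' t) - B (v t, v' t)"
proof -
  show "regular_wave_solution D A T (\<lambda>t. f t - g t) (\<lambda>t. w t - v t) (\<lambda>t. w' t - v' t)"
    using w v T unfolding regular_wave_solution_def
    by (auto intro: wave_solution_diff continuous_into_diff)
  assume t: "t \<in> {0..T}"
  then have "w t \<in> Hspace D A 2" "v t \<in> Hspace D A 2"
    using w v unfolding regular_wave_solution_def continuous_into_def by auto
  then obtain a b where ab: "w t = G (G a)" "v t = G (G b)" unfolding Hspace2_iff by blast
  have "B (w t - v t, w' t - v' t) = BB ((a, w' t) - (b, v' t))"
    unfolding ab BB_def by (simp add: G_diff)
  then show "B (w t - v t, w' t - v' t) = B (w t, w' t) - B (v t, v' t)"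
    unfolding BB_diff unfolding ab BB_def by simp
qed

lemma sol_regular:
  assumes s: "sol T f z y" and v: "continuous_on {0..T} v" "\<And>t. z t = G (v t)" and T: "T > 0"
  shows "regular_wave_solution D A T f (\<lambda>t. G (z t)) y"
  unfolding regular_wave_solution_def
  using sol_imp_wave[OF s T] continuous_intoI[OF v(1), of "\<lambda>t. G (z t)" 2] v(2)
  by (simp add: numeral_2_eq_2)

lemma truncation_regular:
  assumes s: "sol T f z y" and T: "T > 0"
  shows "regular_wave_solution D A T (\<lambda>t. PN N (f t)) (\<lambda>t. G (PN N (z t))) (\<lambda>t. PN N (y t))"
  by (rule sol_regular[OF sol_PN[OF s] continuous_on_bl[OF LN_bounded_linear sol_cont_z[OF s]] _ T])
    (simp add: G_LN)

lemma energy_1: "x \<in> Hspace D A 1 \<Longrightarrow> energy D A 1 x y = en 0 (L x) y"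
  using energy_eq[of 0 "L x" y] by (simp add: G_L)

text \<open>In the admissibility inequality, the energies at the final time and inside the interval
  are bounded by the initial energy and the forcing, through \<open>wave_energy\<close>.\<close>

lemma regular_observation_bound:
  assumes T: "T > 0"
  shows "\<exists>K>0. \<forall>f w w'. regular_wave_solution D A T f w w' \<longrightarrow>
    (LINT t|lebesgue_on {0..T}. (norm (B (w t, w' t)))\<^sup>2)
      \<le> K * (en 0 (L (w 0)) (w' 0) + (LINT t|lebesgue_on {0..T}. (norm (f t))\<^sup>2))"
proof -
  obtain K where K: "K > 0" and le: "\<And>f w w'. regular_wave_solution D A T f w w' \<Longrightarrow>
        (LINT t|lebesgue_on {0..T}. (norm (B (w t, w' t)))\<^sup>2)
          \<le> K * (energy D A 1 (w 0) (w' 0) + energy D A 1 (w T) (w' T)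
                  + (LINT t|lebesgue_on {0..T}. energy D A 1 (w t) (w' t))
                  + (LINT t|lebesgue_on {0..T}. (norm (f t))\<^sup>2))"
    using adm T unfolding admissible_def by blast
  \<comment> \<open>Dominates both constants 2 and \<open>2 * T\<close> of the energy
    estimate.\<close>
  define c where "c = 2 + 2 * T"
  define K' where "K' = K * ((1 + c) + T * c + 1)"
  have c: "c > 0" unfolding c_def using T by simp
  have K': "K' > 0" unfolding K'_def using K c T by (intro mult_pos_pos add_pos_pos) auto
  have "(LINT t|lebesgue_on {0..T}. (norm (B (w t, w' t)))\<^sup>2)
      \<le> K' * (en 0 (L (w 0)) (w' 0) + (LINT t|lebesgue_on {0..T}. (norm (f t))\<^sup>2))"
    if r: "regular_wave_solution D A T f w w'" for f w w'
  proof -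
    have s: "wave_solution D A T f w w'" using r unfolding regular_wave_solution_def by blast
    define e where "e t = en 0 (L (w t)) (w' t)" for t
    define J where "J = (LINT t|lebesgue_on {0..T}. (norm (f t))\<^sup>2)"
    have J0: "J \<ge> 0" unfolding J_def by simp
    have e0: "e 0 \<ge> 0" unfolding e_def by (rule en_nonneg)
    have H1: "w t \<in> Hspace D A 1" if "t \<in> {0..T}" for t
      using s that unfolding wave_solution_def continuous_into_def by blast
    then have en: "energy D A 1 (w t) (w' t) = e t" if "t \<in> {0..T}" for t
      unfolding e_def using that by (simp add: energy_1)
    have eb: "e t \<le> c * (e 0 + J)" if t: "t \<in> {0..T}" for t
    proof -
      have "e t \<le> 2 * e 0 + 2 * T * J" using wave_energy[OF s T t] unfolding e_def J_def .
      moreover have "c * (e 0 + J) = 2 * e 0 + 2 * T * J + (2 * J + 2 * T * e 0)"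
        unfolding c_def by (simp add: algebra_simps)
      moreover have "0 \<le> 2 * J + 2 * T * e 0" using J0 e0 T by simp
      ultimately show ?thesis by linarith
    qed
    have ce: "continuous_on {0..T} e"
      unfolding e_def[abs_def] en_0 by (intro continuous_intros wave_L(2)[OF s] wave_cy[OF s]) auto
    have "(LINT t|lebesgue_on {0..T}. energy D A 1 (w t) (w' t)) = (LINT t|lebesgue_on {0..T}. e t)"
      by (rule Bochner_Integration.integral_cong) (use en in auto)
    also have "\<dots> = integral {0..T} e" by (rule lint_continuous[OF ce])
    also have "\<dots> \<le> integral {0..T} (\<lambda>_. c * (e 0 + J))"
      by (intro integral_le integrable_continuous_interval ce continuous_intros eb)
    also have "\<dots> = T * (c * (e 0 + J))" using T by simp
    finally have I: "(LINT t|lebesgue_on {0..T}. energy D A 1 (w t) (w' t)) \<le> T * (c * (e 0 + J))" .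
    have "energy D A 1 (w 0) (w' 0) + energy D A 1 (w T) (w' T)
                  + (LINT t|lebesgue_on {0..T}. energy D A 1 (w t) (w' t)) + J
        \<le> e 0 + c * (e 0 + J) + T * (c * (e 0 + J)) + J"
      using I en[of 0] en[of T] eb[of T] T by simp
    also have "\<dots> = ((1 + c) + T * c) * (e 0 + J)" by (simp add: algebra_simps)
    also have "\<dots> \<le> ((1 + c) + T * c + 1) * (e 0 + J)" using e0 J0 by (intro mult_right_mono) auto
    finally have *: "energy D A 1 (w 0) (w' 0) + energy D A 1 (w T) (w' T)
                  + (LINT t|lebesgue_on {0..T}. energy D A 1 (w t) (w' t)) + J
        \<le> ((1 + c) + T * c + 1) * (e 0 + J)" .
    have "(LINT t|lebesgue_on {0..T}. (norm (B (w t, w' t)))\<^sup>2)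
          \<le> K * (energy D A 1 (w 0) (w' 0) + energy D A 1 (w T) (w' T)
                  + (LINT t|lebesgue_on {0..T}. energy D A 1 (w t) (w' t)) + J)"
      using le[OF r] unfolding J_def .
    also have "\<dots> \<le> K * (((1 + c) + T * c + 1) * (e 0 + J))"
      using * K by (intro mult_left_mono) auto
    also have "\<dots> = K' * (e 0 + J)" unfolding K'_def by simp
    finally show ?thesis unfolding e_def J_def .
  qed
  with K' show ?thesis by blast
qed

section \<open>The observation of a finite energy wave\<close>

lemma observation_Cauchy:
  assumes s: "sol T f z y" and T: "T > 0"
  shows "\<exists>d. d \<longlonglongrightarrow> 0 \<and> (\<forall>N M. (LINT t|lebesgue_on {0..T}. (norm (obsN N (z t) (y t) - obsN M (z t) (y t)))\<^sup>2) \<le> d N + d M)"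
proof -
  obtain K where K: "K > 0" and le: "\<And>f w w'. regular_wave_solution D A T f w w' \<Longrightarrow>
    (LINT t|lebesgue_on {0..T}. (norm (B (w t, w' t)))\<^sup>2)
      \<le> K * (en 0 (L (w 0)) (w' 0) + (LINT t|lebesgue_on {0..T}. (norm (f t))\<^sup>2))"
    using regular_observation_bound[OF T] by blast
  note f = sol_cont_f[OF s]
  have cPf: "continuous_on {0..T} (\<lambda>t. PN N (f t) - f t)" for N
    by (intro continuous_intros continuous_on_bl[OF PN_bounded_linear f] f)
  define J where "J N = (LINT t|lebesgue_on {0..T}. (norm (PN N (f t) - f t))\<^sup>2)" for N
  have "J N = integral {0..T} (\<lambda>t. (norm (PN N (f t) - f t))\<^sup>2)" for N
    unfolding J_def by (intro lint_continuous continuous_intros cPf)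
  then have "J = (\<lambda>k. integral {0..T} (\<lambda>t. (norm (PN k (f t) - f t))\<^sup>2))" by (simp add: fun_eq_iff)
  then have J: "J \<longlonglongrightarrow> 0" using PN_sq_integral_tendsto_0[OF f] by simp
  define r where "r N = en 0 (PN N (z 0) - z 0) (PN N (y 0) - y 0)" for N
  have "r \<longlonglongrightarrow> en 0 (z 0 - z 0) (y 0 - y 0)"
    unfolding r_def en_0 by (intro tendsto_intros PN_tendsto) auto
  then have r: "r \<longlonglongrightarrow> 0" by (simp add: en_0)
  define d where "d N = K * (2 * r N + 2 * J N)" for N
  have "d \<longlonglongrightarrow> K * (2 * 0 + 2 * 0)" unfolding d_def by (intro tendsto_intros r J)
  then have d: "d \<longlonglongrightarrow> 0" by simp
  have "(LINT t|lebesgue_on {0..T}. (norm (obsN N (z t) (y t) - obsN M (z t) (y t)))\<^sup>2) \<le> d N + d M" for N M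
  proof -
    note reg = truncation_regular[OF s T, of N] truncation_regular[OF s T, of M]
    have "(LINT t|lebesgue_on {0..T}. (norm (obsN N (z t) (y t) - obsN M (z t) (y t)))\<^sup>2)
      = (LINT t|lebesgue_on {0..T}. (norm (B (G (PN N (z t)) - G (PN M (z t)), PN N (y t) - PN M (y t))))\<^sup>2)"
      by (rule Bochner_Integration.integral_cong) (auto simp: regular_diff(2)[OF reg T] obsN_eq)
    also have "\<dots> \<le> K * (en 0 (L (G (PN N (z 0)) - G (PN M (z 0)))) (PN N (y 0) - PN M (y 0))
        + (LINT t|lebesgue_on {0..T}. (norm (PN N (f t) - PN M (f t)))\<^sup>2))"
      by (rule le[OF regular_diff(1)[OF reg T]])
    also have "\<dots> \<le> K * ((2 * r N + 2 * r M) + (2 * J N + 2 * J M))"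
    proof (intro mult_left_mono add_mono)
      have "L (G (PN N (z 0)) - G (PN M (z 0))) = PN N (z 0) - PN M (z 0)"
        by (simp flip: G_diff)
      then show "en 0 (L (G (PN N (z 0)) - G (PN M (z 0)))) (PN N (y 0) - PN M (y 0)) \<le> 2 * r N + 2 * r M"
        using en0_diff_le[of "PN N (z 0) - z 0" "PN M (z 0) - z 0" "PN N (y 0) - y 0" "PN M (y 0) - y 0"]
        unfolding r_def by simp
      show "(LINT t|lebesgue_on {0..T}. (norm (PN N (f t) - PN M (f t)))\<^sup>2) \<le> 2 * J N + 2 * J M"
        using L2_diff_integral_le[OF L2_fun_continuous[OF cPf T] L2_fun_continuous[OF cPf T], of N M]
        unfolding J_def by simp
    qed (use K in simp)
    also have "\<dots> = d N + d M" unfolding d_def by (simp add: algebra_simps)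
    finally show ?thesis .
  qed
  with d show ?thesis by blast
qed

lemma observation_limit:
  assumes s: "sol T f z y" and T: "T > 0"
  shows "\<exists>g. L2_fun T g \<and> (\<lambda>N. LINT t|lebesgue_on {0..T}. (norm (obsN N (z t) (y t) - g t))\<^sup>2) \<longlonglongrightarrow> 0"
proof -
  obtain d where d: "d \<longlonglongrightarrow> 0" "\<And>N M. (LINT t|lebesgue_on {0..T}.
      (norm (obsN N (z t) (y t) - obsN M (z t) (y t)))\<^sup>2) \<le> d N + d M"
    using observation_Cauchy[OF s T] by blast
  show ?thesis
    by (rule riesz_fischer[where b = "\<lambda>N t. obsN N (z t) (y t)" and d = d])
      (use d T L2_fun_continuous[OF obsN_continuous[OF s]] in auto)
qed

text \<open>The squared norm of the extended observation, read off from the truncations, so that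
  inequalities can be proved at fixed \<open>N\<close> without naming the limit function.\<close>

definition Obs :: "real \<Rightarrow> (real \<Rightarrow> 'h) \<Rightarrow> (real \<Rightarrow> 'h) \<Rightarrow> real" where
  "Obs T z y = lim (\<lambda>N. LINT t|lebesgue_on {0..T}. (norm (obsN N (z t) (y t)))\<^sup>2)"

lemma Obs_eqI:
  assumes s: "sol T f z y" and T: "T > 0" and g: "L2_fun T g"
    and lim: "(\<lambda>N. LINT t|lebesgue_on {0..T}. (norm (obsN N (z t) (y t) - g t))\<^sup>2) \<longlonglongrightarrow> 0"
  shows "(LINT t|lebesgue_on {0..T}. (norm (g t))\<^sup>2) = Obs T z y"
  unfolding Obs_def
  by (rule limI[symmetric], rule L2_norm_tendsto[OF L2_fun_continuous[OF obsN_continuous[OF s] T] g lim])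

lemma Obs_tendsto:
  assumes s: "sol T f z y" and T: "T > 0"
  shows "(\<lambda>N. integral {0..T} (\<lambda>t. (norm (obsN N (z t) (y t)))\<^sup>2)) \<longlonglongrightarrow> Obs T z y"
proof -
  obtain g where g: "L2_fun T g"
    "(\<lambda>N. LINT t|lebesgue_on {0..T}. (norm (obsN N (z t) (y t) - g t))\<^sup>2) \<longlonglongrightarrow> 0"
    using observation_limit[OF s T] by blast
  have eq: "(LINT t|lebesgue_on {0..T}. (norm (obsN N (z t) (y t)))\<^sup>2) = integral {0..T} (\<lambda>t. (norm (obsN N (z t) (y t)))\<^sup>2)" for N
    by (intro lint_continuous continuous_intros obsN_continuous[OF s])
  show ?thesis
    using L2_norm_tendsto[OF L2_fun_continuous[OF obsN_continuous[OF s] T] g]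
    unfolding Obs_eqI[OF s T g] eq .
qed

lemma observation_exists:
  assumes s: "wave_solution D A T f w w'" and f: "continuous_on {0..T} f" and T: "T > 0"
  shows "\<exists>g. is_observation D A B T f w w' g"
proof -
  define z where "z t = L (w t)" for t
  have sz: "sol T f z w'" unfolding z_def[abs_def] by (rule wave_imp_sol[OF s T f])
  have w0: "w 0 = G (z 0)" unfolding z_def using wave_L(1)[OF s, of 0] T by simp
  obtain g where g: "L2_fun T g"
    "(\<lambda>N. LINT t|lebesgue_on {0..T}. (norm (obsN N (z t) (w' t) - g t))\<^sup>2) \<longlonglongrightarrow> 0"
    using observation_limit[OF sz T] by blast
  have "is_observation D A B T f w w' g"
    unfolding is_observation_def
  proof (intro conjI exI allI)
    show "regular_wave_solution D A T (\<lambda>t. PN k (f t)) (\<lambda>t. G (PN k (z t))) (\<lambda>t. PN k (w' t))" for k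
      by (rule truncation_regular[OF sz T])
    have "energy D A 1 (G (PN k (z 0)) - w 0) (PN k (w' 0) - w' 0) = en 0 (PN k (z 0) - z 0) (PN k (w' 0) - w' 0)" for k
      using energy_eq[of 0 "PN k (z 0) - z 0"] unfolding w0 by (simp add: G_diff)
    moreover have "(\<lambda>k. en 0 (PN k (z 0) - z 0) (PN k (w' 0) - w' 0)) \<longlonglongrightarrow> en 0 (z 0 - z 0) (w' 0 - w' 0)"
      unfolding en_0 by (intro tendsto_intros PN_tendsto) auto
    ultimately show "(\<lambda>k. energy D A 1 (G (PN k (z 0)) - w 0) (PN k (w' 0) - w' 0)) \<longlonglongrightarrow> 0"
      by (simp add: en_0)
    have "(LINT t|lebesgue_on {0..T}. (norm (PN k (f t) - f t))\<^sup>2) = integral {0..T} (\<lambda>t. (norm (PN k (f t) - f t))\<^sup>2)" for k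
      by (intro lint_continuous continuous_intros continuous_on_bl[OF PN_bounded_linear f] f)
    then show "(\<lambda>k. LINT t|lebesgue_on {0..T}. (norm (PN k (f t) - f t))\<^sup>2) \<longlonglongrightarrow> 0"
      using PN_sq_integral_tendsto_0[OF f] by simp
    show "(\<lambda>k. LINT t|lebesgue_on {0..T}. (norm (B (G (PN k (z t)), PN k (w' t)) - g t))\<^sup>2) \<longlonglongrightarrow> 0"
      unfolding obsN_eq by (rule g(2))
  qed (use s g(1) in auto)
  then show ?thesis by blast
qed

lemma observation_unique:
  assumes o: "is_observation D A B T f w w' g" and f: "continuous_on {0..T} f" and T: "T > 0"
  shows "(LINT t|lebesgue_on {0..T}. (norm (g t))\<^sup>2) = Obs T (\<lambda>t. L (w t)) w'"
proof -
  have s: "wave_solution D A T f w w'" and g: "L2_fun T g" using o unfolding is_observation_def by auto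
  define z where "z t = L (w t)" for t
  have sz: "sol T f z w'" unfolding z_def[abs_def] by (rule wave_imp_sol[OF s T f])
  have w0: "w 0 = G (z 0)" unfolding z_def using wave_L(1)[OF s, of 0] T by simp
  obtain F W W' where reg: "\<And>k::nat. regular_wave_solution D A T (F k) (W k) (W' k)"
    and lim: "(\<lambda>k. energy D A 1 (W k 0 - w 0) (W' k 0 - w' 0)) \<longlonglongrightarrow> 0"
        "(\<lambda>k. LINT t|lebesgue_on {0..T}. (norm (F k t - f t))\<^sup>2) \<longlonglongrightarrow> 0"
        "(\<lambda>k. LINT t|lebesgue_on {0..T}. (norm (B (W k t, W' k t) - g t))\<^sup>2) \<longlonglongrightarrow> 0"
    using o unfolding is_observation_def by blast
  obtain K where K: "K > 0" and le: "\<And>f w w'. regular_wave_solution D A T f w w' \<Longrightarrow>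
    (LINT t|lebesgue_on {0..T}. (norm (B (w t, w' t)))\<^sup>2)
      \<le> K * (en 0 (L (w 0)) (w' 0) + (LINT t|lebesgue_on {0..T}. (norm (f t))\<^sup>2))"
    using regular_observation_bound[OF T] by blast
  define J where "J k = (LINT t|lebesgue_on {0..T}. (norm (PN k (f t) - f t))\<^sup>2)" for k
  define r where "r k = en 0 (PN k (z 0) - z 0) (PN k (w' 0) - w' 0)" for k
  define J' where "J' k = (LINT t|lebesgue_on {0..T}. (norm (F k t - f t))\<^sup>2)" for k
  define r' where "r' k = energy D A 1 (W k 0 - w 0) (W' k 0 - w' 0)" for k
  define h where "h k = (LINT t|lebesgue_on {0..T}. (norm (B (W k t, W' k t) - g t))\<^sup>2)" for k
  have cPf: "continuous_on {0..T} (\<lambda>t. PN N (f t) - f t)" for N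
    by (intro continuous_intros continuous_on_bl[OF PN_bounded_linear f] f)
  have "J k = integral {0..T} (\<lambda>t. (norm (PN k (f t) - f t))\<^sup>2)" for k
    unfolding J_def by (intro lint_continuous continuous_intros cPf)
  then have "J = (\<lambda>k. integral {0..T} (\<lambda>t. (norm (PN k (f t) - f t))\<^sup>2))" by (simp add: fun_eq_iff)
  then have J: "J \<longlonglongrightarrow> 0" using PN_sq_integral_tendsto_0[OF f] by simp
  have "r \<longlonglongrightarrow> en 0 (z 0 - z 0) (w' 0 - w' 0)"
    unfolding r_def en_0 by (intro tendsto_intros PN_tendsto) auto
  then have r: "r \<longlonglongrightarrow> 0" by (simp add: en_0)
  have bound: "(LINT t|lebesgue_on {0..T}. (norm (obsN k (z t) (w' t) - g t))\<^sup>2)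
      \<le> 2 * (K * ((2 * r' k + 2 * r k) + (2 * J' k + 2 * J k))) + 2 * h k" for k
  proof -
    note reg2 = reg[of k] truncation_regular[OF sz T, of k]
    have L2W: "L2_fun T (\<lambda>t. B (W k t, W' k t))"
      by (rule L2_fun_continuous[OF regular_B_continuous[OF reg] T])
    have L2o: "L2_fun T (\<lambda>t. obsN k (z t) (w' t))" by (rule L2_fun_continuous[OF obsN_continuous[OF sz] T])
    have "(LINT t|lebesgue_on {0..T}. (norm (obsN k (z t) (w' t) - g t))\<^sup>2)
       = (LINT t|lebesgue_on {0..T}. (norm ((B (W k t, W' k t) - g t) - (B (W k t, W' k t) - obsN k (z t) (w' t))))\<^sup>2)"
      by simp
    also have "\<dots> \<le> 2 * h k + 2 * (LINT t|lebesgue_on {0..T}. (norm (B (W k t, W' k t) - obsN k (z t) (w' t)))\<^sup>2)"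
      unfolding h_def by (rule L2_diff_integral_le[OF L2_fun_diff[OF L2W g] L2_fun_diff[OF L2W L2o]])
    also have "(LINT t|lebesgue_on {0..T}. (norm (B (W k t, W' k t) - obsN k (z t) (w' t)))\<^sup>2)
       = (LINT t|lebesgue_on {0..T}. (norm (B (W k t - G (PN k (z t)), W' k t - PN k (w' t))))\<^sup>2)"
      by (rule Bochner_Integration.integral_cong) (auto simp: regular_diff(2)[OF reg2 T] obsN_eq)
    also have "\<dots> \<le> K * (en 0 (L (W k 0 - G (PN k (z 0)))) (W' k 0 - PN k (w' 0))
        + (LINT t|lebesgue_on {0..T}. (norm (F k t - PN k (f t)))\<^sup>2))"
      by (rule le[OF regular_diff(1)[OF reg2 T]])
    also have "\<dots> \<le> K * ((2 * r' k + 2 * r k) + (2 * J' k + 2 * J k))"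
    proof (intro mult_left_mono add_mono)
      have "W k 0 \<in> Hspace D A 1"
        using reg[of k] T unfolding regular_wave_solution_def wave_solution_def continuous_into_def by auto
      then obtain a where a: "W k 0 = G a" unfolding Hspace1_iff by blast
      have "L (W k 0 - G (PN k (z 0))) = (a - z 0) - (PN k (z 0) - z 0)"
        unfolding a by (simp flip: G_diff)
      moreover have "r' k = en 0 (a - z 0) (W' k 0 - w' 0)"
        unfolding r'_def a w0 using energy_eq[of 0 "a - z 0"] by (simp add: G_diff)
      ultimately show "en 0 (L (W k 0 - G (PN k (z 0)))) (W' k 0 - PN k (w' 0)) \<le> 2 * r' k + 2 * r k"
        using en0_diff_le[of "a - z 0" "PN k (z 0) - z 0" "W' k 0 - w' 0" "PN k (w' 0) - w' 0"]
        unfolding r_def by simp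
      have "L2_fun T (F k)" using reg[of k] wave_L2 unfolding regular_wave_solution_def by blast
      then show "(LINT t|lebesgue_on {0..T}. (norm (F k t - PN k (f t)))\<^sup>2) \<le> 2 * J' k + 2 * J k"
        using L2_diff_integral_le[OF L2_fun_diff[OF _ L2_fun_continuous[OF f T]] L2_fun_continuous[OF cPf T], of "F k" k]
        unfolding J_def J'_def by simp
    qed (use K in simp)
    finally show ?thesis by simp
  qed
  have "(\<lambda>k. 2 * (K * ((2 * r' k + 2 * r k) + (2 * J' k + 2 * J k))) + 2 * h k)
      \<longlonglongrightarrow> 2 * (K * ((2 * 0 + 2 * 0) + (2 * 0 + 2 * 0))) + 2 * 0"
    using lim unfolding r'_def J'_def h_def by (intro tendsto_intros r J)
  then have up: "(\<lambda>k. 2 * (K * ((2 * r' k + 2 * r k) + (2 * J' k + 2 * J k))) + 2 * h k) \<longlonglongrightarrow> 0" by simp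
  have "(\<lambda>k. LINT t|lebesgue_on {0..T}. (norm (obsN k (z t) (w' t) - g t))\<^sup>2) \<longlonglongrightarrow> 0"
    by (rule tendsto_sandwich[OF always_eventually always_eventually tendsto_const up]) (use bound in auto)
  from Obs_eqI[OF sz T g this] show ?thesis unfolding z_def[abs_def] .
qed

lemma Obs_nonneg: "sol T f z y \<Longrightarrow> T > 0 \<Longrightarrow> Obs T z y \<ge> 0"
  by (rule LIMSEQ_le_const[OF Obs_tendsto]) (auto intro!: exI[of _ 0] integral_nonneg
    integrable_continuous_interval continuous_intros obsN_continuous)

lemma Obs_le:
  assumes T: "T > 0"
  shows "\<exists>K>0. \<forall>f z y. sol T f z y \<longrightarrow> Obs T z y \<le> K * (en 0 (z 0) (y 0) + integral {0..T} (\<lambda>t. (norm (f t))\<^sup>2))"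
proof -
  obtain K where K: "K > 0" and le: "\<And>f w w'. regular_wave_solution D A T f w w' \<Longrightarrow>
    (LINT t|lebesgue_on {0..T}. (norm (B (w t, w' t)))\<^sup>2)
      \<le> K * (en 0 (L (w 0)) (w' 0) + (LINT t|lebesgue_on {0..T}. (norm (f t))\<^sup>2))"
    using regular_observation_bound[OF T] by blast
  have "Obs T z y \<le> K * (en 0 (z 0) (y 0) + integral {0..T} (\<lambda>t. (norm (f t))\<^sup>2))" if s: "sol T f z y" for f z y
  proof (rule LIMSEQ_le_const2[OF Obs_tendsto[OF s T]], intro exI[of _ 0] allI impI)
    fix N
    note f = sol_cont_f[OF s]
    have "integral {0..T} (\<lambda>t. (norm (obsN N (z t) (y t)))\<^sup>2) = (LINT t|lebesgue_on {0..T}. (norm (obsN N (z t) (y t)))\<^sup>2)"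
      by (intro lint_continuous[symmetric] continuous_intros obsN_continuous[OF s])
    also have "\<dots> \<le> K * (en 0 (PN N (z 0)) (PN N (y 0)) + (LINT t|lebesgue_on {0..T}. (norm (PN N (f t)))\<^sup>2))"
      using le[OF truncation_regular[OF s T, of N]] by (simp add: obsN_eq)
    also have "(LINT t|lebesgue_on {0..T}. (norm (PN N (f t)))\<^sup>2) = integral {0..T} (\<lambda>t. (norm (PN N (f t)))\<^sup>2)"
      by (intro lint_continuous continuous_intros continuous_on_bl[OF PN_bounded_linear f])
    also have "K * (en 0 (PN N (z 0)) (PN N (y 0)) + integral {0..T} (\<lambda>t. (norm (PN N (f t)))\<^sup>2))
        \<le> K * (en 0 (z 0) (y 0) + integral {0..T} (\<lambda>t. (norm (f t))\<^sup>2))"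
    proof (intro mult_left_mono add_mono)
      show "en 0 (PN N (z 0)) (PN N (y 0)) \<le> en 0 (z 0) (y 0)"
        unfolding en_0 by (intro divide_right_mono add_mono power_mono PN_norm_le) auto
      show "integral {0..T} (\<lambda>t. (norm (PN N (f t)))\<^sup>2) \<le> integral {0..T} (\<lambda>t. (norm (f t))\<^sup>2)"
        by (intro integral_le integrable_continuous_interval continuous_intros
          continuous_on_bl[OF PN_bounded_linear f] f power_mono PN_norm_le) auto
    qed (use K in simp)
    finally show "integral {0..T} (\<lambda>t. (norm (obsN N (z t) (y t)))\<^sup>2)
        \<le> K * (en 0 (z 0) (y 0) + integral {0..T} (\<lambda>t. (norm (f t))\<^sup>2))" .
  qed
  with K show ?thesis by blast
qed

lemma Obs_diff_le:
  assumes s: "sol T f z y" and s': "sol T f' z' y'" and T: "T > 0"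
  shows "Obs T (\<lambda>t. z t - z' t) (\<lambda>t. y t - y' t) \<le> 2 * Obs T z y + 2 * Obs T z' y'"
proof (rule LIMSEQ_le[OF Obs_tendsto[OF sol_diff[OF s s'] T]])
  show "(\<lambda>N. 2 * integral {0..T} (\<lambda>t. (norm (obsN N (z t) (y t)))\<^sup>2)
      + 2 * integral {0..T} (\<lambda>t. (norm (obsN N (z' t) (y' t)))\<^sup>2)) \<longlonglongrightarrow> 2 * Obs T z y + 2 * Obs T z' y'"
    by (intro tendsto_intros Obs_tendsto[OF s T] Obs_tendsto[OF s' T])
  have "integral {0..T} (\<lambda>t. (norm (obsN N (z t) (y t) - obsN N (z' t) (y' t)))\<^sup>2)
    \<le> integral {0..T} (\<lambda>t. 2 * (norm (obsN N (z t) (y t)))\<^sup>2 + 2 * (norm (obsN N (z' t) (y' t)))\<^sup>2)" for N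
    by (intro integral_le integrable_continuous_interval continuous_intros obsN_continuous[OF s]
      obsN_continuous[OF s'] norm_diff_sq_le)
  moreover have "integral {0..T} (\<lambda>t. 2 * (norm (obsN N (z t) (y t)))\<^sup>2 + 2 * (norm (obsN N (z' t) (y' t)))\<^sup>2)
    = 2 * integral {0..T} (\<lambda>t. (norm (obsN N (z t) (y t)))\<^sup>2) + 2 * integral {0..T} (\<lambda>t. (norm (obsN N (z' t) (y' t)))\<^sup>2)" for N
    unfolding integral_mult_right[symmetric]
    by (intro integral_add integrable_continuous_interval continuous_intros obsN_continuous[OF s]
      obsN_continuous[OF s'])
  ultimately show "\<exists>N0. \<forall>N\<ge>N0. integral {0..T} (\<lambda>t. (norm (obsN N (z t - z' t) (y t - y' t)))\<^sup>2)
    \<le> 2 * integral {0..T} (\<lambda>t. (norm (obsN N (z t) (y t)))\<^sup>2) + 2 * integral {0..T} (\<lambda>t. (norm (obsN N (z' t) (y' t)))\<^sup>2)"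
    unfolding obsN_diff by simp
qed

lemma integral_shift_le:
  fixes h :: "real \<Rightarrow> real"
  assumes h: "continuous_on {0..T} h" "\<And>t. t \<in> {0..T} \<Longrightarrow> h t \<ge> 0" and s: "0 \<le> s" "0 \<le> T'" "s + T' \<le> T"
  shows "integral {0..T'} (\<lambda>t. h (s + t)) \<le> integral {0..T} h"
proof -
  have c: "continuous_on {s..s + T'} h" by (rule continuous_on_subset[OF h(1)]) (use s in auto)
  have "integral {0..T'} (\<lambda>t. h (s + t)) = integral {s..s + T'} h"
    using integral_shift_Icc_real[of 0 T' h s] by (simp add: o_def add.commute)
  also have "\<dots> \<le> integral {0..T} h"
    by (rule integral_subset_le) (use s h c in \<open>auto intro: integrable_continuous_interval\<close>)
  finally show ?thesis .
qed

lemma Obs_shift_le: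
  assumes s: "sol T f z y" and st: "0 \<le> s" "0 < T'" "s + T' \<le> T"
  shows "Obs T' (\<lambda>t. z (s + t)) (\<lambda>t. y (s + t)) \<le> Obs T z y"
proof (rule LIMSEQ_le[OF Obs_tendsto[OF sol_shift[OF s st(1,3)] st(2)] Obs_tendsto[OF s]])
  show "T > 0" using st by simp
  show "\<exists>N0. \<forall>N\<ge>N0. integral {0..T'} (\<lambda>t. (norm (obsN N (z (s + t)) (y (s + t))))\<^sup>2)
      \<le> integral {0..T} (\<lambda>t. (norm (obsN N (z t) (y t)))\<^sup>2)"
    using st by (intro exI[of _ 0] allI impI
      integral_shift_le[of T "\<lambda>t. (norm (obsN _ (z t) (y t)))\<^sup>2"] continuous_intros obsN_continuous[OF s]) auto
qed

end


section \<open>Observability of the cascade\<close>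

locale cascade_operator = observed_operator D A B
  for D :: "'h::{real_inner,complete_space} set" and A :: "'h \<Rightarrow> 'h"
    and B :: "'h \<times> 'h \<Rightarrow> 'g::{real_inner,complete_space}" +
  fixes n :: nat and C :: "nat \<Rightarrow> 'h \<Rightarrow> 'h"
  assumes n_ge: "n \<ge> 2" and coupling: "coupling_hypothesis D A n C C"
begin

section \<open>The coupling operators on the negative scale\<close>

lemma C_bounded_linear: "i \<in> {2..n} \<Longrightarrow> bounded_linear (C i)"
  using coupling unfolding coupling_hypothesis_def by blast

lemma C_coercive: "i \<in> {2..n} \<Longrightarrow> \<exists>\<alpha>>0. \<forall>w. \<alpha> * (norm (C i w))\<^sup>2 \<le> C i w \<bullet> w"
  using coupling unfolding coupling_hypothesis_def by blast

text \<open>\<open>C i\<close> extends to the dual of \<open>H\<^sub>k\<close> because its adjoint preserves \<open>H\<^sub>k\<close>.\<close>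

lemma C_negative_scale:
  assumes i: "i \<in> {2..n}" and k: "k \<le> n - i + 1"
  shows "\<exists>K>0. \<forall>x. norm ((G ^^ k) (C i x)) \<le> K * norm ((G ^^ k) x)"
proof -
  have "bounded_on_Hspace D A k (adjoint (C i))"
    using coupling i k unfolding coupling_hypothesis_def by auto
  then obtain K where K: "\<And>x. x \<in> Hspace D A k \<Longrightarrow> adjoint (C i) x \<in> Hspace D A k"
    "\<And>x. x \<in> Hspace D A k \<Longrightarrow> Hnorm D A (int k) (adjoint (C i) x) \<le> K * Hnorm D A (int k) x"
    unfolding bounded_on_Hspace_def by blast
  have "norm ((G ^^ k) (C i x)) \<le> (\<bar>K\<bar> + 1) * norm ((G ^^ k) x)" for x
  proof -
    define y where "y = (G ^^ k) (C i x)"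
    have Gy: "(G ^^ k) y \<in> Hspace D A k" unfolding Hspace_iff by blast
    then obtain z where z: "adjoint (C i) ((G ^^ k) y) = (G ^^ k) z" using K(1) Hspace_iff by metis
    have "norm z \<le> K * norm y" using K(2)[OF Gy] unfolding z Hnorm_Gpow .
    also have "\<dots> \<le> (\<bar>K\<bar> + 1) * norm y" by (intro mult_right_mono) auto
    finally have zy: "norm z \<le> (\<bar>K\<bar> + 1) * norm y" .
    have "norm y * norm y = C i x \<bullet> (G ^^ k) y"
    proof -
      have "y \<bullet> y = C i x \<bullet> (G ^^ k) y" unfolding y_def by (rule Gpow_symmetric)
      then show ?thesis by (simp add: power2_norm_eq_inner flip: power2_eq_square)
    qed
    also have "\<dots> = (G ^^ k) x \<bullet> z"
      using adjoint_inner[OF C_bounded_linear[OF i], of x "(G ^^ k) y"] by (simp add: z Gpow_symmetric)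
    also have "\<dots> \<le> norm ((G ^^ k) x) * norm z" by (rule norm_cauchy_schwarz)
    also have "\<dots> \<le> norm ((G ^^ k) x) * ((\<bar>K\<bar> + 1) * norm y)" by (intro mult_left_mono zy) auto
    finally have "norm y * norm y \<le> ((\<bar>K\<bar> + 1) * norm ((G ^^ k) x)) * norm y" by (simp add: ac_simps)
    then show ?thesis unfolding y_def[symmetric] by (cases "y = 0") auto
  qed
  moreover have "\<bar>K\<bar> + 1 > 0" by (rule add_nonneg_pos) auto
  ultimately show ?thesis by blast
qed

lemma C_negative_scale_sq:
  assumes i: "i \<in> {2..n}" and k: "k \<le> n - i + 1"
  shows "\<exists>K>0. \<forall>x. (norm ((G ^^ k) (C i x)))\<^sup>2 \<le> K * (norm ((G ^^ k) x))\<^sup>2"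
proof -
  obtain K where K: "K > 0" "\<forall>x. norm ((G ^^ k) (C i x)) \<le> K * norm ((G ^^ k) x)"
    using C_negative_scale[OF assms] by blast
  have "(norm ((G ^^ k) (C i x)))\<^sup>2 \<le> K\<^sup>2 * (norm ((G ^^ k) x))\<^sup>2" for x
    using power_mono[OF K(2)[rule_format, of x], of 2] by (simp add: power_mult_distrib)
  then show ?thesis using K(1) by (intro exI[of _ "K\<^sup>2"]) auto
qed

section \<open>Tails of the cascade\<close>

lemma norm_fst_le_en: "(norm ((G ^^ m) z))\<^sup>2 \<le> 2 * en m z y"
  using zero_le_power2[of "norm ((G ^^ m) y)"] unfolding en_def by argo

lemma norm_snd_le_en: "(norm ((G ^^ m) y))\<^sup>2 \<le> 2 * en m z y"
  using zero_le_power2[of "norm ((G ^^ m) z)"] unfolding en_def by argo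

definition src :: "nat \<Rightarrow> (real \<Rightarrow> 'h) \<Rightarrow> (nat \<Rightarrow> real \<Rightarrow> 'h) \<Rightarrow> nat \<Rightarrow> real \<Rightarrow> 'h" where
  "src j F Z i = (if i = j then F else (\<lambda>t. - C i (G (Z (i - 1) t))))"

text \<open>The forcing \<open>F\<close> of the first component is kept free: it is zero for an
  unforced tail and the coupling with the preceding component when a longer solution is cut.
  Superposition combines the two cases.\<close>

definition chain :: "nat \<Rightarrow> real \<Rightarrow> (real \<Rightarrow> 'h) \<Rightarrow> (nat \<Rightarrow> real \<Rightarrow> 'h) \<Rightarrow> (nat \<Rightarrow> real \<Rightarrow> 'h) \<Rightarrow> bool" where
  "chain j T F Z Y \<longleftrightarrow> (\<forall>i\<in>{j..n}. sol T (src j F Z i) (Z i) (Y i))"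

lemma chainD: "chain j T F Z Y \<Longrightarrow> i \<in> {j..n} \<Longrightarrow> sol T (src j F Z i) (Z i) (Y i)"
  unfolding chain_def by blast

lemma C_source_continuous:
  assumes "i \<in> {2..n}" "continuous_on X z"
  shows "continuous_on X (\<lambda>t. - C i (G (z t)))"
  by (intro continuous_intros continuous_on_bl[OF C_bounded_linear[OF assms(1)]]
    continuous_on_bl[OF G_bounded_linear] assms(2))

lemma chain_exists:
  assumes j: "1 \<le> j" and F: "continuous_on {0..T} F" and T: "T > 0"
  shows "\<exists>Z Y. chain j T F Z Y \<and> (\<forall>i\<in>{j..n}. Z i 0 = z0 i \<and> Y i 0 = y0 i)"
proof (cases "j \<le> n")
  case True
  have "m \<le> n \<longrightarrow> (\<exists>Z Y. (\<forall>i\<in>{j..m}. sol T (src j F Z i) (Z i) (Y i)) \<and> (\<forall>i\<in>{j..m}. Z i 0 = z0 i \<and> Y i 0 = y0 i))"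
    if "j \<le> m" for m
    using that
  proof (induction m rule: dec_induct)
    case base
    obtain z y where "sol T F z y" "z 0 = z0 j" "y 0 = y0 j" using sol_exists[OF F T] by blast
    then show ?case by (intro impI exI[of _ "\<lambda>_. z"] exI[of _ "\<lambda>_. y"]) (auto simp: src_def)
  next
    case (step m)
    show ?case
    proof
      assume m: "Suc m \<le> n"
      then obtain Z Y where ZY: "\<forall>i\<in>{j..m}. sol T (src j F Z i) (Z i) (Y i)"
        "\<forall>i\<in>{j..m}. Z i 0 = z0 i \<and> Y i 0 = y0 i" using step by auto
      have "continuous_on {0..T} (\<lambda>t. - C (Suc m) (G (Z m t)))"
        using ZY(1) step m j by (intro C_source_continuous) (auto intro: sol_cont_z)
      then obtain z y where zy: "sol T (\<lambda>t. - C (Suc m) (G (Z m t))) z y" "z 0 = z0 (Suc m)" "y 0 = y0 (Suc m)"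
        using sol_exists[OF _ T] by blast
      have src: "src j F (Z(Suc m := z)) i = (if i = Suc m then (\<lambda>t. - C (Suc m) (G (Z m t))) else src j F Z i)"
        if "i \<in> {j..Suc m}" for i
        using that step by (auto simp: src_def fun_eq_iff)
      show "\<exists>Z Y. (\<forall>i\<in>{j..Suc m}. sol T (src j F Z i) (Z i) (Y i)) \<and> (\<forall>i\<in>{j..Suc m}. Z i 0 = z0 i \<and> Y i 0 = y0 i)"
      proof (rule exI[of _ "Z(Suc m := z)"], rule exI[of _ "Y(Suc m := y)"], intro conjI ballI)
        fix i assume i: "i \<in> {j..Suc m}"
        show "sol T (src j F (Z(Suc m := z)) i) ((Z(Suc m := z)) i) ((Y(Suc m := y)) i)"
          unfolding src[OF i] using zy ZY i by (cases "i = Suc m") auto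
        show "(Z(Suc m := z)) i 0 = z0 i" "(Y(Suc m := y)) i 0 = y0 i" using zy ZY i by auto
      qed
    qed
  qed
  from this[OF True] show ?thesis unfolding chain_def by blast
qed (auto simp: chain_def)

lemma chain_diff:
  assumes j: "1 \<le> j" and Z: "chain j T F Z Y" and Z': "chain j T F' Z' Y'"
  shows "chain j T (\<lambda>t. F t - F' t) (\<lambda>i t. Z i t - Z' i t) (\<lambda>i t. Y i t - Y' i t)"
  unfolding chain_def
proof
  fix i assume i: "i \<in> {j..n}"
  show "sol T (src j (\<lambda>t. F t - F' t) (\<lambda>i t. Z i t - Z' i t) i) (\<lambda>t. Z i t - Z' i t) (\<lambda>t. Y i t - Y' i t)"
  proof (rule sol_cong[OF sol_diff[OF chainD[OF Z i] chainD[OF Z' i]]])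
    show "src j F Z i t - src j F' Z' i t = src j (\<lambda>t. F t - F' t) (\<lambda>i t. Z i t - Z' i t) i t" for t
    proof (cases "i = j")
      case False
      then have "i \<in> {2..n}" using i j by auto
      then show ?thesis using False by (simp add: src_def G_diff bl_diff[OF C_bounded_linear])
    qed (simp add: src_def)
  qed auto
qed

lemma chain_shift:
  assumes Z: "chain j T F Z Y" and s: "0 \<le> s" "s + T' \<le> T"
  shows "chain j T' (\<lambda>t. F (s + t)) (\<lambda>i t. Z i (s + t)) (\<lambda>i t. Y i (s + t))"
  unfolding chain_def
proof
  fix i assume i: "i \<in> {j..n}"
  show "sol T' (src j (\<lambda>t. F (s + t)) (\<lambda>i t. Z i (s + t)) i) (\<lambda>t. Z i (s + t)) (\<lambda>t. Y i (s + t))"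
    using sol_shift[OF chainD[OF Z i] s] by (auto simp: src_def split: if_splits)
qed

lemma chain_tail:
  assumes Z: "chain j T F Z Y" and j: "j < n"
  shows "chain (Suc j) T (\<lambda>t. - C (Suc j) (G (Z j t))) Z Y"
  unfolding chain_def
proof
  fix i assume i: "i \<in> {Suc j..n}"
  then have "src (Suc j) (\<lambda>t. - C (Suc j) (G (Z j t))) Z i = src j F Z i"
    by (auto simp: src_def)
  then show "sol T (src (Suc j) (\<lambda>t. - C (Suc j) (G (Z j t))) Z i) (Z i) (Y i)"
    using chainD[OF Z, of i] i by simp
qed

lemma integral_sq_le:
  fixes p :: "real \<Rightarrow> 'h"
  assumes "continuous_on {0..T} p" "T \<ge> 0" "\<And>t. t \<in> {0..T} \<Longrightarrow> (norm (p t))\<^sup>2 \<le> c"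
  shows "integral {0..T} (\<lambda>t. (norm (p t))\<^sup>2) \<le> T * c"
proof -
  have "integral {0..T} (\<lambda>t. (norm (p t))\<^sup>2) \<le> integral {0..T} (\<lambda>_. c)"
    by (intro integral_le integrable_continuous_interval continuous_intros assms)
  then show ?thesis using assms(2) by simp
qed

text \<open>Starting from rest, component \<open>i\<close> at level \<open>n - i\<close> is bounded
  by its source at that level. The next source contains \<open>G\<close> applied to it, so the bound
  of \<open>C (Suc i)\<close> at level \<open>n - Suc i\<close> closes the induction with exactly
  one level exchanged.\<close>

lemma forced_source_bound:
  assumes j: "1 \<le> j" "j \<le> i" "i \<le> n" and T: "T > 0"
  shows "\<exists>K>0. \<forall>F Z Y. chain j T F Z Y \<longrightarrow> (\<forall>i\<in>{j..n}. Z i 0 = 0 \<and> Y i 0 = 0) \<longrightarrow>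
    integral {0..T} (\<lambda>t. (norm ((G ^^ (n - i)) (src j F Z i t)))\<^sup>2)
      \<le> K * integral {0..T} (\<lambda>t. (norm ((G ^^ (n - j)) (F t)))\<^sup>2)"
  using j(2,3)
proof (induction i rule: dec_induct)
  case base
  show ?case by (intro exI[of _ 1]) (simp add: src_def)
next
  case (step i)
  then obtain K where K: "K > 0" and IH: "\<And>F Z Y. chain j T F Z Y \<Longrightarrow> \<forall>i\<in>{j..n}. Z i 0 = 0 \<and> Y i 0 = 0 \<Longrightarrow>
    integral {0..T} (\<lambda>t. (norm ((G ^^ (n - i)) (src j F Z i t)))\<^sup>2)
      \<le> K * integral {0..T} (\<lambda>t. (norm ((G ^^ (n - j)) (F t)))\<^sup>2)" by auto
  have i2: "Suc i \<in> {2..n}" using step j by auto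
  obtain Kc where Kc: "Kc > 0" "\<And>x. (norm ((G ^^ (n - Suc i)) (C (Suc i) x)))\<^sup>2 \<le> Kc * (norm ((G ^^ (n - Suc i)) x))\<^sup>2"
    using C_negative_scale_sq[OF i2, of "n - Suc i"] by auto
  \<comment> \<open>From the inside out: energy estimate, passage from energy to norm, coupling
    bound, length of the interval.\<close>
  define K' where "K' = T * (Kc * (2 * (2 * T * K)))"
  have "integral {0..T} (\<lambda>t. (norm ((G ^^ (n - Suc i)) (src j F Z (Suc i) t)))\<^sup>2)
      \<le> K' * integral {0..T} (\<lambda>t. (norm ((G ^^ (n - j)) (F t)))\<^sup>2)"
    if ch: "chain j T F Z Y" and zero: "\<forall>i\<in>{j..n}. Z i 0 = 0 \<and> Y i 0 = 0" for F Z Y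
  proof -
    define J where "J = integral {0..T} (\<lambda>t. (norm ((G ^^ (n - j)) (F t)))\<^sup>2)"
    have ij: "i \<in> {j..n}" "Suc i \<in> {j..n}" using step by auto
    have n_i: "n - i = Suc (n - Suc i)" using step by simp
    have src: "src j F Z (Suc i) t = - C (Suc i) (G (Z i t))" for t using step by (simp add: src_def)
    have "integral {0..T} (\<lambda>t. (norm ((G ^^ (n - Suc i)) (src j F Z (Suc i) t)))\<^sup>2) \<le> T * (Kc * (2 * (2 * T * K * J)))"
    proof (rule integral_sq_le)
      show "continuous_on {0..T} (\<lambda>t. (G ^^ (n - Suc i)) (src j F Z (Suc i) t))"
        by (rule continuous_on_bl[OF Gpow_bounded_linear sol_cont_f[OF chainD[OF ch ij(2)]]])
      fix t assume t: "t \<in> {0..T}"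
      have "2 * T * integral {0..T} (\<lambda>t. (norm ((G ^^ (n - i)) (src j F Z i t)))\<^sup>2) \<le> 2 * T * (K * J)"
        using IH[OF ch zero] T unfolding J_def by (intro mult_left_mono) auto
      then have e: "en (n - i) (Z i t) (Y i t) \<le> 2 * T * K * J"
        using energy_estimate[OF chainD[OF ch ij(1)] t T, of "n - i"] zero ij(1)
        by (simp add: en_def bl_zero[OF Gpow_bounded_linear])
      have "(norm ((G ^^ (n - Suc i)) (src j F Z (Suc i) t)))\<^sup>2 = (norm ((G ^^ (n - Suc i)) (C (Suc i) (G (Z i t)))))\<^sup>2"
        unfolding src bl_neg[OF Gpow_bounded_linear] by simp
      also have "\<dots> \<le> Kc * (norm ((G ^^ (n - Suc i)) (G (Z i t))))\<^sup>2" by (rule Kc(2))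
      also have "(G ^^ (n - Suc i)) (G (Z i t)) = (G ^^ (n - i)) (Z i t)"
        unfolding n_i by (simp add: funpow_swap1)
      also have "Kc * (norm ((G ^^ (n - i)) (Z i t)))\<^sup>2 \<le> Kc * (2 * en (n - i) (Z i t) (Y i t))"
        using Kc(1) by (intro mult_left_mono norm_fst_le_en) auto
      also have "\<dots> \<le> Kc * (2 * (2 * T * K * J))" using e Kc(1) by (intro mult_left_mono) auto
      finally show "(norm ((G ^^ (n - Suc i)) (src j F Z (Suc i) t)))\<^sup>2 \<le> Kc * (2 * (2 * T * K * J))" .
    qed (use T in simp)
    also have "\<dots> = K' * J" unfolding K'_def by simp
    finally show ?thesis unfolding J_def .
  qed
  moreover have "K' > 0" unfolding K'_def using T Kc K by simp
  ultimately show ?case by blast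
qed

text \<open>For the last component the level is 0, where admissibility converts a bound on the
  source into a bound on the observation.\<close>

lemma forced_Obs_bound:
  assumes j: "1 \<le> j" "j \<le> n" and T: "T > 0"
  shows "\<exists>K>0. \<forall>F Z Y. chain j T F Z Y \<longrightarrow> (\<forall>i\<in>{j..n}. Z i 0 = 0 \<and> Y i 0 = 0) \<longrightarrow>
    Obs T (Z n) (Y n) \<le> K * integral {0..T} (\<lambda>t. (norm ((G ^^ (n - j)) (F t)))\<^sup>2)"
proof -
  obtain K where K: "K > 0" "\<And>F Z Y. chain j T F Z Y \<Longrightarrow> \<forall>i\<in>{j..n}. Z i 0 = 0 \<and> Y i 0 = 0 \<Longrightarrow>
    integral {0..T} (\<lambda>t. (norm ((G ^^ (n - n)) (src j F Z n t)))\<^sup>2)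
      \<le> K * integral {0..T} (\<lambda>t. (norm ((G ^^ (n - j)) (F t)))\<^sup>2)"
    using forced_source_bound[OF j order_refl T] by blast
  obtain Ko where Ko: "Ko > 0" "\<And>f z y. sol T f z y \<Longrightarrow>
      Obs T z y \<le> Ko * (en 0 (z 0) (y 0) + integral {0..T} (\<lambda>t. (norm (f t))\<^sup>2))"
    using Obs_le[OF T] by blast
  have "Obs T (Z n) (Y n) \<le> Ko * K * integral {0..T} (\<lambda>t. (norm ((G ^^ (n - j)) (F t)))\<^sup>2)"
    if ch: "chain j T F Z Y" and zero: "\<forall>i\<in>{j..n}. Z i 0 = 0 \<and> Y i 0 = 0" for F Z Y
  proof -
    have nj: "n \<in> {j..n}" using j by simp
    have "Obs T (Z n) (Y n) \<le> Ko * (en 0 (Z n 0) (Y n 0) + integral {0..T} (\<lambda>t. (norm (src j F Z n t))\<^sup>2))"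
      by (rule Ko(2)[OF chainD[OF ch nj]])
    also have "\<dots> = Ko * integral {0..T} (\<lambda>t. (norm (src j F Z n t))\<^sup>2)" using zero nj by (simp add: en_0)
    also have "\<dots> \<le> Ko * (K * integral {0..T} (\<lambda>t. (norm ((G ^^ (n - j)) (F t)))\<^sup>2))"
      using K(2)[OF ch zero] Ko(1) by (intro mult_left_mono) auto
    finally show ?thesis by simp
  qed
  moreover have "Ko * K > 0" using Ko K by simp
  ultimately show ?thesis by blast
qed

text \<open>Integrating \<open>m\<close> times in time raises both components by \<open>m\<close> levels of the scale.\<close>

lemma pair_primitives:
  assumes i: "i \<in> {2..n}" and m: "m \<le> n - i"
  shows "\<exists>K>0. \<forall>T z1 y1 z2 y2. sol T (\<lambda>_. 0) z1 y1 \<longrightarrow> sol T (\<lambda>t. - C i (G (z1 t))) z2 y2 \<longrightarrow>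
    (\<exists>Z1 Y1 Z2 Y2. sol T (\<lambda>_. 0) Z1 Y1 \<and> sol T (\<lambda>t. - C i (G (Z1 t))) Z2 Y2 \<and>
      (\<forall>t r. en r (Z1 t) (Y1 t) = en (r + m) (z1 t) (y1 t)) \<and>
      (\<forall>t. en 0 (Z2 t) (Y2 t) \<le> K * (en m (z2 t) (y2 t) + en (Suc m) (z1 t) (y1 t))))"
  using m
proof (induction m)
  case 0
  show ?case
  proof (intro exI[of _ 1] conjI allI impI)
    fix T z1 y1 z2 y2
    assume "sol T (\<lambda>_. 0) z1 y1" "sol T (\<lambda>t. - C i (G (z1 t))) z2 y2"
    then show "\<exists>Z1 Y1 Z2 Y2. sol T (\<lambda>_. 0) Z1 Y1 \<and> sol T (\<lambda>t. - C i (G (Z1 t))) Z2 Y2 \<and>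
      (\<forall>t r. en r (Z1 t) (Y1 t) = en (r + 0) (z1 t) (y1 t)) \<and>
      (\<forall>t. en 0 (Z2 t) (Y2 t) \<le> 1 * (en 0 (z2 t) (y2 t) + en (Suc 0) (z1 t) (y1 t)))"
      by (intro exI[of _ z1] exI[of _ y1] exI[of _ z2] exI[of _ y2]) (auto simp: en_nonneg)
  qed simp
next
  case (Suc m)
  then obtain K where K: "K > 0" and IH: "\<And>T z1 y1 z2 y2. sol T (\<lambda>_. 0) z1 y1 \<Longrightarrow> sol T (\<lambda>t. - C i (G (z1 t))) z2 y2 \<Longrightarrow>
    (\<exists>Z1 Y1 Z2 Y2. sol T (\<lambda>_. 0) Z1 Y1 \<and> sol T (\<lambda>t. - C i (G (Z1 t))) Z2 Y2 \<and>
      (\<forall>t r. en r (Z1 t) (Y1 t) = en (r + m) (z1 t) (y1 t)) \<and>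
      (\<forall>t. en 0 (Z2 t) (Y2 t) \<le> K * (en m (z2 t) (y2 t) + en (Suc m) (z1 t) (y1 t))))"
    by auto
  obtain Kc where Kc: "Kc > 0" "\<And>x. (norm ((G ^^ Suc m) (C i x)))\<^sup>2 \<le> Kc * (norm ((G ^^ Suc m) x))\<^sup>2"
    using C_negative_scale_sq[OF i, of "Suc m"] Suc.prems by auto
  \<comment> \<open>Collects the splitting of \<open>\<Phi> - y2\<close>, the coupling bound on
    \<Phi> with one \<open>G\<close> spent as \<open>cG\<close>, and the energy of the first
    component. Like \<open>K\<close>, it does not depend on \<open>T\<close>, which the growth
    argument requires.\<close>
  define c where "c = 3 + 2 * Kc * cG\<^sup>2"
  have c: "c > 0" "c \<ge> 2" "c \<ge> 1 + 2 * Kc * cG\<^sup>2" unfolding c_def using Kc by (auto intro: add_pos_nonneg)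
  show ?case
  proof (intro exI[of _ "K * c"] conjI allI impI)
    show "K * c > 0" using K c by simp
    fix T z1 y1 z2 y2
    assume s1: "sol T (\<lambda>_. 0) z1 y1" and s2: "sol T (\<lambda>t. - C i (G (z1 t))) z2 y2"
    define p where "p t = - G (y1 t)" for t
    define q where "q t = G (z1 t)" for t
    \<comment> \<open>A primitive of the source: \<open>G p\<close> has derivative
      \<open>q = G z1\<close>. With this choice the lifted pair is again coupled by
      \<open>C i\<close>.\<close>
    define \<Phi> where "\<Phi> t = - C i (G (p t))" for t
    have sp: "sol T (\<lambda>_. 0) p q" unfolding p_def[abs_def] q_def[abs_def] by (rule sol_primitive_free[OF s1])
    have "(\<Phi> has_vector_derivative - C i (G (z1 t))) (at t within {0..T})" if "t \<in> {0..T}" for t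
    proof -
      have "((\<lambda>t. - C i (G (p t))) has_vector_derivative - C i (q t)) (at t within {0..T})"
        by (intro has_vector_derivative_minus
          bounded_linear.has_vector_derivative[OF C_bounded_linear[OF i]] sol_dz[OF sp that])
      then show ?thesis unfolding \<Phi>_def[abs_def] q_def .
    qed
    from sol_primitive[OF s2 this]
    have sq: "sol T (\<lambda>t. - C i (G (p t))) (\<lambda>t. G (\<Phi> t - y2 t)) (\<lambda>t. G (z2 t))"
      unfolding \<Phi>_def[abs_def] .
    obtain Z1 Y1 Z2 Y2 where ZY: "sol T (\<lambda>_. 0) Z1 Y1" "sol T (\<lambda>t. - C i (G (Z1 t))) Z2 Y2"
      "\<And>t r. en r (Z1 t) (Y1 t) = en (r + m) (p t) (q t)"
      "\<And>t. en 0 (Z2 t) (Y2 t) \<le> K * (en m (G (\<Phi> t - y2 t)) (G (z2 t)) + en (Suc m) (p t) (q t))"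
      using IH[OF sp sq] by blast
    have en_pq: "en r (p t) (q t) = en (Suc r) (z1 t) (y1 t)" for r t
      unfolding en_def p_def q_def by (simp add: bl_neg[OF Gpow_bounded_linear] funpow_swap1)
    have "en m (G (\<Phi> t - y2 t)) (G (z2 t)) + en (Suc m) (p t) (q t)
        \<le> c * (en (Suc m) (z2 t) (y2 t) + en (Suc (Suc m)) (z1 t) (y1 t))" for t
    proof -
      have "(norm ((G ^^ Suc m) (\<Phi> t)))\<^sup>2 = (norm ((G ^^ Suc m) (C i (G (p t)))))\<^sup>2"
        unfolding \<Phi>_def bl_neg[OF Gpow_bounded_linear] by simp
      also have "\<dots> \<le> Kc * (norm ((G ^^ Suc m) (G (p t))))\<^sup>2" by (rule Kc(2))
      also have "(G ^^ Suc m) (G (p t)) = - G ((G ^^ Suc (Suc m)) (y1 t))"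
        unfolding p_def by (simp add: G_minus bl_neg[OF Gpow_bounded_linear] funpow_swap1)
      also have "(norm (- G ((G ^^ Suc (Suc m)) (y1 t))))\<^sup>2 \<le> (cG * norm ((G ^^ Suc (Suc m)) (y1 t)))\<^sup>2"
        unfolding norm_minus_cancel by (intro power_mono norm_G_le) auto
      also have "\<dots> = cG\<^sup>2 * (norm ((G ^^ Suc (Suc m)) (y1 t)))\<^sup>2" by (simp add: power_mult_distrib)
      also have "\<dots> \<le> cG\<^sup>2 * (2 * en (Suc (Suc m)) (z1 t) (y1 t))" by (intro mult_left_mono norm_snd_le_en) auto
      finally have P: "(norm ((G ^^ Suc m) (\<Phi> t)))\<^sup>2 \<le> Kc * (cG\<^sup>2 * (2 * en (Suc (Suc m)) (z1 t) (y1 t)))"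
        using Kc(1) by (simp add: mult_left_mono)
      have "(G ^^ m) (G (\<Phi> t - y2 t)) = (G ^^ Suc m) (\<Phi> t) - (G ^^ Suc m) (y2 t)"
        by (simp only: funpow_Suc_right o_apply bl_diff[OF Gpow_bounded_linear] G_diff)
      then have "en m (G (\<Phi> t - y2 t)) (G (z2 t))
          = (norm ((G ^^ Suc m) (\<Phi> t) - (G ^^ Suc m) (y2 t)))\<^sup>2 / 2 + (norm ((G ^^ Suc m) (z2 t)))\<^sup>2 / 2"
        unfolding en_def by (simp add: funpow_swap1)
      also have "\<dots> \<le> (norm ((G ^^ Suc m) (\<Phi> t)))\<^sup>2 + 2 * en (Suc m) (z2 t) (y2 t)"
        using norm_diff_sq_le[of "(G ^^ Suc m) (\<Phi> t)" "(G ^^ Suc m) (y2 t)"]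
          zero_le_power2[of "norm ((G ^^ Suc m) (z2 t))"] unfolding en_def by argo
      finally have "en m (G (\<Phi> t - y2 t)) (G (z2 t)) + en (Suc m) (p t) (q t)
          \<le> 2 * en (Suc m) (z2 t) (y2 t) + (1 + 2 * Kc * cG\<^sup>2) * en (Suc (Suc m)) (z1 t) (y1 t)"
        using P unfolding en_pq by (simp add: algebra_simps)
      also have "\<dots> \<le> c * en (Suc m) (z2 t) (y2 t) + c * en (Suc (Suc m)) (z1 t) (y1 t)"
        by (intro add_mono mult_right_mono c en_nonneg)
      finally show ?thesis by (simp add: algebra_simps)
    qed
    then have "K * (en m (G (\<Phi> t - y2 t)) (G (z2 t)) + en (Suc m) (p t) (q t))
        \<le> K * (c * (en (Suc m) (z2 t) (y2 t) + en (Suc (Suc m)) (z1 t) (y1 t)))" for t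
      using K by (intro mult_left_mono) auto
    then have "en 0 (Z2 t) (Y2 t) \<le> K * c * (en (Suc m) (z2 t) (y2 t) + en (Suc (Suc m)) (z1 t) (y1 t))" for t
      using order_trans[OF ZY(4)] by (metis mult.assoc)
    moreover have "en r (Z1 t) (Y1 t) = en (r + Suc m) (z1 t) (y1 t)" for t r
      using ZY(3)[of r t] en_pq[of "r + m" t] by simp
    ultimately show "\<exists>Z1 Y1 Z2 Y2. sol T (\<lambda>_. 0) Z1 Y1 \<and> sol T (\<lambda>t. - C i (G (Z1 t))) Z2 Y2 \<and>
      (\<forall>t r. en r (Z1 t) (Y1 t) = en (r + Suc m) (z1 t) (y1 t)) \<and>
      (\<forall>t. en 0 (Z2 t) (Y2 t) \<le> K * c * (en (Suc m) (z2 t) (y2 t) + en (Suc (Suc m)) (z1 t) (y1 t)))"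
      using ZY(1,2) by blast
  qed
qed

text \<open>Observability on one time window, conservation of energy and translation in time make the
  observation grow linearly with the number of windows.\<close>

lemma coupling_growth:
  assumes i: "i \<in> {2..n}" and T1: "T1 > 0"
    and obs: "\<And>z y. sol T1 (\<lambda>_. 0) z y \<Longrightarrow> \<gamma> * en 0 (z 0) (y 0) \<le> integral {0..T1} (\<lambda>t. (norm (C i (y t)))\<^sup>2)"
    and s: "sol T (\<lambda>_. 0) z y" and M: "real M * T1 \<le> T"
  shows "real M * (\<gamma> * en 0 (z 0) (y 0)) \<le> integral {0..real M * T1} (\<lambda>t. (norm (C i (y t)))\<^sup>2)"
  using M
proof (induction M)
  case (Suc M)
  define a where "a = real M * T1"
  define h where "h t = (norm (C i (y t)))\<^sup>2" for t
  have a0: "0 \<le> a" "a + T1 \<le> T" "real (Suc M) * T1 = a + T1"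
    unfolding a_def using T1 Suc.prems by (auto simp: algebra_simps)
  have ch: "continuous_on {0..T} h" unfolding h_def[abs_def]
    by (intro continuous_intros continuous_on_bl[OF C_bounded_linear[OF i] sol_cont_y[OF s]])
  have int: "h integrable_on {0..a + T1}"
    by (intro integrable_continuous_interval continuous_on_subset[OF ch]) (use a0 in auto)
  have "\<gamma> * en 0 (z (a + 0)) (y (a + 0)) \<le> integral {0..T1} (\<lambda>t. h (a + t))"
    unfolding h_def by (rule obs[OF sol_shift[OF s a0(1,2)]])
  also have "\<dots> = integral {a..a + T1} h"
    using integral_shift_Icc_real[of 0 T1 h a] by (simp add: o_def add.commute)
  finally have "\<gamma> * en 0 (z 0) (y 0) \<le> integral {a..a + T1} h"
    using energy_conserved[OF s, of a 0] a0 T1 by simp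
  moreover have "integral {0..a} h + integral {a..a + T1} h = integral {0..a + T1} h"
    using Henstock_Kurzweil_Integration.integral_combine[OF a0(1) _ int] T1 by simp
  moreover have "real M * (\<gamma> * en 0 (z 0) (y 0)) \<le> integral {0..a} h"
    using Suc a0 T1 unfolding a_def h_def[abs_def] by simp
  ultimately show ?case unfolding a0(3) h_def[abs_def] by (simp add: algebra_simps)
qed simp

section \<open>Peeling one component off the tail\<close>

definition coupling_obs :: "nat \<Rightarrow> real \<Rightarrow> bool" where
  "coupling_obs i T \<longleftrightarrow> (\<exists>\<gamma>>0. \<forall>z y. sol T (\<lambda>_. 0) z y \<longrightarrow>
     \<gamma> * en 0 (z 0) (y 0) \<le> integral {0..T} (\<lambda>t. (norm (C i (y t)))\<^sup>2))"

text \<open>The induction statement of the peeling: component \<open>j\<close> is free, and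
  component \<open>i\<close> is measured at the level it has in the full cascade.\<close>

definition tail_obs :: "nat \<Rightarrow> real \<Rightarrow> bool" where
  "tail_obs j T \<longleftrightarrow> (\<exists>K>0. \<forall>Z Y. chain j T (\<lambda>_. 0) Z Y \<longrightarrow>
     (\<Sum>i=j..n. en (n - i) (Z i 0) (Y i 0)) \<le> K * Obs T (Z n) (Y n))"

text \<open>On the window starting at \<open>s\<close>, subtract the solution from rest driven by
  the same coupling with component \<open>j\<close>; the remainder is an unforced tail. The
  subtracted observation is controlled by the energy of component \<open>j\<close>, which is
  conserved. Hence \<open>K\<close> depends on \<open>T'\<close> alone, neither on \<open>s\<close>
  nor on \<open>T\<close>.\<close>

lemma tail_window:
  assumes j: "1 \<le> j" "j < n" and T': "T' > 0" and tail: "tail_obs (Suc j) T'"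
  shows "\<exists>K>0. \<forall>T s Z Y. chain j T (\<lambda>_. 0) Z Y \<longrightarrow> 0 \<le> s \<longrightarrow> s + T' \<le> T \<longrightarrow>
    (\<Sum>i=Suc j..n. en (n - i) (Z i s) (Y i s)) \<le> K * (Obs T (Z n) (Y n) + en (n - j) (Z j 0) (Y j 0))"
proof -
  obtain K where K: "K > 0" and le: "\<And>Z Y. chain (Suc j) T' (\<lambda>_. 0) Z Y \<Longrightarrow>
     (\<Sum>i=Suc j..n. en (n - i) (Z i 0) (Y i 0)) \<le> K * Obs T' (Z n) (Y n)"
    using tail unfolding tail_obs_def by blast
  have j2: "Suc j \<in> {2..n}" using j by auto
  define m where "m = n - Suc j"
  have nj: "n - j = Suc m" unfolding m_def using j by simp
  obtain KF where KF: "KF > 0" "\<And>F Z Y. chain (Suc j) T' F Z Y \<Longrightarrow> \<forall>i\<in>{Suc j..n}. Z i 0 = 0 \<and> Y i 0 = 0 \<Longrightarrow>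
    Obs T' (Z n) (Y n) \<le> KF * integral {0..T'} (\<lambda>t. (norm ((G ^^ m) (F t)))\<^sup>2)"
    using forced_Obs_bound[of "Suc j" T'] j T' unfolding m_def by auto
  obtain Kc where Kc: "Kc > 0" "\<And>x. (norm ((G ^^ m) (C (Suc j) x)))\<^sup>2 \<le> Kc * (norm ((G ^^ m) x))\<^sup>2"
    using C_negative_scale_sq[OF j2, of m] unfolding m_def by auto
  \<comment> \<open>The observation from rest costs \<open>KF\<close>; its source is bounded over
    the window by \<open>T'\<close>, the coupling constant, and twice the energy of component
    \<open>j\<close>.\<close>
  define c where "c = KF * (T' * (Kc * 2))"
  have c: "c > 0" unfolding c_def using KF Kc T' by simp
  show ?thesis
  proof (intro exI[of _ "K * (2 + 2 * c)"] conjI allI impI)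
    show "K * (2 + 2 * c) > 0" using K c by (intro mult_pos_pos add_pos_pos) auto
    fix T s Z Y
    assume ch: "chain j T (\<lambda>_. 0) Z Y" and s: "0 \<le> s" "s + T' \<le> T"
    define E where "E = en (n - j) (Z j 0) (Y j 0)"
    have jn: "j \<in> {j..n}" "n \<in> {j..n}" "n \<in> {Suc j..n}" using j by auto
    have free: "sol T (\<lambda>_. 0) (Z j) (Y j)" using chainD[OF ch jn(1)] by (simp add: src_def)
    define F where "F t = - C (Suc j) (G (Z j (s + t)))" for t
    have chs: "chain (Suc j) T' F (\<lambda>i t. Z i (s + t)) (\<lambda>i t. Y i (s + t))"
      unfolding F_def[abs_def] by (rule chain_shift[OF chain_tail[OF ch j(2)] s])
    have cF: "continuous_on {0..T'} F" using sol_cont_f[OF chainD[OF chs, of "Suc j"]] j by (simp add: src_def)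
    obtain Z' Y' where Z': "chain (Suc j) T' F Z' Y'" and zero: "\<forall>i\<in>{Suc j..n}. Z' i 0 = 0 \<and> Y' i 0 = 0"
      using chain_exists[of "Suc j" T' F "\<lambda>_. 0" "\<lambda>_. 0"] cF T' by auto
    have "chain (Suc j) T' (\<lambda>_. 0) (\<lambda>i t. Z i (s + t) - Z' i t) (\<lambda>i t. Y i (s + t) - Y' i t)"
      using chain_diff[OF _ chs Z'] by simp
    from le[OF this] have "(\<Sum>i=Suc j..n. en (n - i) (Z i s) (Y i s))
        \<le> K * Obs T' (\<lambda>t. Z n (s + t) - Z' n t) (\<lambda>t. Y n (s + t) - Y' n t)"
      using zero by simp
    also have "\<dots> \<le> K * (2 * Obs T (Z n) (Y n) + 2 * (c * E))"
    proof (intro mult_left_mono)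
      have "Obs T' (\<lambda>t. Z n (s + t) - Z' n t) (\<lambda>t. Y n (s + t) - Y' n t)
          \<le> 2 * Obs T' (\<lambda>t. Z n (s + t)) (\<lambda>t. Y n (s + t)) + 2 * Obs T' (Z' n) (Y' n)"
        by (rule Obs_diff_le[OF chainD[OF chs jn(3)] chainD[OF Z' jn(3)] T'])
      moreover have "Obs T' (\<lambda>t. Z n (s + t)) (\<lambda>t. Y n (s + t)) \<le> Obs T (Z n) (Y n)"
        by (rule Obs_shift_le[OF chainD[OF ch jn(2)] s(1) T' s(2)])
      moreover have "Obs T' (Z' n) (Y' n) \<le> c * E"
      proof -
        have "integral {0..T'} (\<lambda>t. (norm ((G ^^ m) (F t)))\<^sup>2) \<le> T' * (Kc * (2 * E))"
        proof (rule integral_sq_le)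
          show "continuous_on {0..T'} (\<lambda>t. (G ^^ m) (F t))"
            by (rule continuous_on_bl[OF Gpow_bounded_linear cF])
          fix t assume t: "t \<in> {0..T'}"
          have "(norm ((G ^^ m) (F t)))\<^sup>2 \<le> Kc * (norm ((G ^^ m) (G (Z j (s + t)))))\<^sup>2"
            unfolding F_def bl_neg[OF Gpow_bounded_linear] norm_minus_cancel by (rule Kc(2))
          also have "(G ^^ m) (G (Z j (s + t))) = (G ^^ (n - j)) (Z j (s + t))"
            unfolding nj by (simp add: funpow_swap1)
          also have "Kc * (norm ((G ^^ (n - j)) (Z j (s + t))))\<^sup>2 \<le> Kc * (2 * en (n - j) (Z j (s + t)) (Y j (s + t)))"
            using Kc(1) by (intro mult_left_mono norm_fst_le_en) auto
          also have "en (n - j) (Z j (s + t)) (Y j (s + t)) = E"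
            unfolding E_def by (rule energy_conserved[OF free]) (use t s in auto)
          finally show "(norm ((G ^^ m) (F t)))\<^sup>2 \<le> Kc * (2 * E)" .
        qed (use T' in simp)
        then have "KF * integral {0..T'} (\<lambda>t. (norm ((G ^^ m) (F t)))\<^sup>2) \<le> KF * (T' * (Kc * (2 * E)))"
          using KF(1) by (intro mult_left_mono) auto
        with KF(2)[OF Z' zero] show ?thesis unfolding c_def by simp
      qed
      ultimately show "Obs T' (\<lambda>t. Z n (s + t) - Z' n t) (\<lambda>t. Y n (s + t) - Y' n t)
          \<le> 2 * Obs T (Z n) (Y n) + 2 * (c * E)" by linarith
    qed (use K in simp)
    also have "\<dots> \<le> K * ((2 + 2 * c) * (Obs T (Z n) (Y n) + E))"
    proof (intro mult_left_mono)
      have "0 \<le> Obs T (Z n) (Y n)" by (rule Obs_nonneg[OF chainD[OF ch jn(2)]]) (use T' s in simp)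
      then have "0 \<le> 2 * c * Obs T (Z n) (Y n) + 2 * E" using c en_nonneg unfolding E_def by simp
      then show "2 * Obs T (Z n) (Y n) + 2 * (c * E) \<le> (2 + 2 * c) * (Obs T (Z n) (Y n) + E)"
        by (simp add: algebra_simps)
    qed (use K in simp)
    finally show "(\<Sum>i=Suc j..n. en (n - i) (Z i s) (Y i s)) \<le> K * (2 + 2 * c) * (Obs T (Z n) (Y n) + en (n - j) (Z j 0) (Y j 0))"
      unfolding E_def by (simp add: mult.assoc)
  qed
qed

text \<open>Both components are first lifted by \<open>m\<close> levels, so that the pairing is made
  with component \<open>Suc j\<close> at level 0 and component \<open>j\<close> at level 1. These
  are the quantities the windows at the two ends control.\<close>

lemma tail_obs_step:
  assumes j: "1 \<le> j" "j < n" and T': "T' > 0" and tail: "tail_obs (Suc j) T'"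
    and T1: "T1 > 0" and cobs: "coupling_obs (Suc j) T1"
  shows "\<exists>T>0. tail_obs j T"
proof -
  have j2: "Suc j \<in> {2..n}" using j by auto
  define m where "m = n - Suc j"
  have nj: "n - j = Suc m" unfolding m_def using j by simp
  obtain K1 where K1: "K1 > 0" and window: "\<And>T s Z Y. chain j T (\<lambda>_. 0) Z Y \<Longrightarrow> 0 \<le> s \<Longrightarrow> s + T' \<le> T \<Longrightarrow>
    (\<Sum>i=Suc j..n. en (n - i) (Z i s) (Y i s)) \<le> K1 * (Obs T (Z n) (Y n) + en (n - j) (Z j 0) (Y j 0))"
    using tail_window[OF j T' tail] by blast
  obtain KL where KL: "KL > 0" and lift: "\<And>T z1 y1 z2 y2. sol T (\<lambda>_. 0) z1 y1 \<Longrightarrow> sol T (\<lambda>t. - C (Suc j) (G (z1 t))) z2 y2 \<Longrightarrow>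
    (\<exists>Z1 Y1 Z2 Y2. sol T (\<lambda>_. 0) Z1 Y1 \<and> sol T (\<lambda>t. - C (Suc j) (G (Z1 t))) Z2 Y2 \<and>
      (\<forall>t r. en r (Z1 t) (Y1 t) = en (r + m) (z1 t) (y1 t)) \<and>
      (\<forall>t. en 0 (Z2 t) (Y2 t) \<le> KL * (en m (z2 t) (y2 t) + en (Suc m) (z1 t) (y1 t))))"
    using pair_primitives[OF j2, of m] unfolding m_def by blast
  obtain \<gamma> where \<gamma>: "\<gamma> > 0" "\<And>z y. sol T1 (\<lambda>_. 0) z y \<Longrightarrow>
     \<gamma> * en 0 (z 0) (y 0) \<le> integral {0..T1} (\<lambda>t. (norm (C (Suc j) (y t)))\<^sup>2)"
    using cobs unfolding coupling_obs_def by blast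
  obtain \<alpha> where \<alpha>: "\<alpha> > 0" "\<And>w. \<alpha> * (norm (C (Suc j) w))\<^sup>2 \<le> C (Suc j) w \<bullet> w"
    using C_coercive[OF j2] by blast
  \<comment> \<open>\<open>K3\<close> and \<open>K4\<close> are the coefficients of the energy of
    component \<open>j\<close> and of the observation in the two boundary terms together.\<close>
  define K3 where "K3 = 2 + 2 * (KL * (K1 + 1))"
  define K4 where "K4 = 2 * (KL * K1)"
  have K4: "K4 > 0" unfolding K4_def using KL K1 by simp
  \<comment> \<open>Enough windows for the integral to exceed the boundary coefficient
    \<open>K3\<close> by at least one full energy, so that this energy can be absorbed.\<close>
  obtain M :: nat where M: "(K3 + 1) / (\<alpha> * \<gamma>) < real M" using reals_Archimedean2 by blast
  then have M: "K3 + 1 \<le> \<alpha> * \<gamma> * real M" using \<alpha> \<gamma> by (simp add: pos_divide_less_eq mult.commute)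
  define S where "S = real M * T1"
  \<comment> \<open>The extra \<open>T'\<close> leaves room for the window that starts at the right
    end \<open>S\<close>.\<close>
  define T where "T = S + T'"
  have S0: "S \<ge> 0" unfolding S_def using T1 by simp
  have T: "T > 0" "S \<le> T" unfolding T_def using S0 T' by auto
  define K where "K = K4 + K1 * (1 + K4)"
  have K: "K > 0" unfolding K_def using K4 K1 by (intro add_pos_pos mult_pos_pos) auto
  have "(\<Sum>i=j..n. en (n - i) (Z i 0) (Y i 0)) \<le> K * Obs T (Z n) (Y n)"
    if ch: "chain j T (\<lambda>_. 0) Z Y" for Z Y
  proof -
    define E where "E = en (n - j) (Z j 0) (Y j 0)"
    define O' where "O' = Obs T (Z n) (Y n)"
    have jn: "j \<in> {j..n}" "n \<in> {j..n}" "Suc j \<in> {j..n}" using j by auto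
    have O0: "O' \<ge> 0" unfolding O'_def by (rule Obs_nonneg[OF chainD[OF ch jn(2)] T(1)])
    have E0: "E \<ge> 0" unfolding E_def by (rule en_nonneg)
    have s1: "sol T (\<lambda>_. 0) (Z j) (Y j)" using chainD[OF ch jn(1)] by (simp add: src_def)
    have s2: "sol T (\<lambda>t. - C (Suc j) (G (Z j t))) (Z (Suc j)) (Y (Suc j))"
      using chainD[OF ch jn(3)] by (simp add: src_def)
    have Ec: "en (Suc m) (Z j t) (Y j t) = E" if "t \<in> {0..T}" for t
      unfolding E_def nj by (rule energy_conserved[OF s1 that])
    obtain Z1 Y1 Z2 Y2 where ZY: "sol T (\<lambda>_. 0) Z1 Y1" "sol T (\<lambda>t. - C (Suc j) (G (Z1 t))) Z2 Y2"
      "\<And>t r. en r (Z1 t) (Y1 t) = en (r + m) (Z j t) (Y j t)"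
      "\<And>t. en 0 (Z2 t) (Y2 t) \<le> KL * (en m (Z (Suc j) t) (Y (Suc j) t) + en (Suc m) (Z j t) (Y j t))"
      using lift[OF s1 s2] by blast
    have win: "(\<Sum>i=Suc j..n. en (n - i) (Z i s) (Y i s)) \<le> K1 * (O' + E)" if "s \<in> {0, S}" for s
      unfolding O'_def E_def by (rule window[OF ch]) (use that S0 T' in \<open>auto simp: T_def\<close>)
    \<comment> \<open>In the first product \<open>G\<close> is moved onto \<open>Y1\<close>, so that
      the first wave is measured at level 1 and the second at level 0.\<close>
    have X: "\<bar>Y1 s \<bullet> G (Z2 s) - G (Z1 s) \<bullet> Y2 s\<bar> \<le> E + KL * (K1 * (O' + E) + E)" if s: "s \<in> {0, S}" for s
    proof -
      have sT: "s \<in> {0..T}" using s S0 T by auto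
      have "en m (Z (Suc j) s) (Y (Suc j) s) \<le> (\<Sum>i=Suc j..n. en (n - i) (Z i s) (Y i s))"
        using member_le_sum[of "Suc j" "{Suc j..n}" "\<lambda>i. en (n - i) (Z i s) (Y i s)"] j
        by (simp add: en_nonneg m_def)
      also have "\<dots> \<le> K1 * (O' + E)" by (rule win[OF s])
      finally have "KL * (en m (Z (Suc j) s) (Y (Suc j) s) + en (Suc m) (Z j s) (Y j s)) \<le> KL * (K1 * (O' + E) + E)"
        unfolding Ec[OF sT] using KL by (intro mult_left_mono add_mono) auto
      then have e2: "en 0 (Z2 s) (Y2 s) \<le> KL * (K1 * (O' + E) + E)" using ZY(4)[of s] by simp
      have e1: "en 1 (Z1 s) (Y1 s) = E" using ZY(3)[of 1 s] Ec[OF sT] by simp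
      have "\<bar>Y1 s \<bullet> G (Z2 s)\<bar> \<le> (norm (G (Y1 s)))\<^sup>2 / 2 + (norm (Z2 s))\<^sup>2 / 2"
        using Cauchy_Schwarz_ineq2[of "G (Y1 s)" "Z2 s"] zero_le_power2[of "norm (G (Y1 s)) - norm (Z2 s)"]
        unfolding power2_diff G_symmetric by argo
      moreover have "\<bar>G (Z1 s) \<bullet> Y2 s\<bar> \<le> (norm (G (Z1 s)))\<^sup>2 / 2 + (norm (Y2 s))\<^sup>2 / 2"
        using Cauchy_Schwarz_ineq2[of "G (Z1 s)" "Y2 s"] zero_le_power2[of "norm (G (Z1 s)) - norm (Y2 s)"]
        unfolding power2_diff by argo
      moreover have "en 1 (Z1 s) (Y1 s) = (norm (G (Z1 s)))\<^sup>2 / 2 + (norm (G (Y1 s)))\<^sup>2 / 2"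
        unfolding en_def by simp
      ultimately show ?thesis using e1 e2 unfolding en_0 by argo
    qed
    have sub: "{0..S} \<subseteq> {0..T}" using T by auto
    define h where "h t = (norm (C (Suc j) (G (Z1 t))))\<^sup>2" for t
    have ch: "continuous_on {0..S} h" unfolding h_def[abs_def]
      by (intro continuous_intros continuous_on_bl[OF C_bounded_linear[OF j2]]
        continuous_on_bl[OF G_bounded_linear] continuous_on_subset[OF sol_cont_z[OF ZY(1)] sub])
    \<comment> \<open>The pairing yields \<open>C\<close> applied to the displacement
      \<open>G Z1\<close>, whereas coupling observability concerns velocities. The free wave
      \<open>(- G Y1, G Z1)\<close> has \<open>G Z1\<close> as its velocity, and its energy is that
      of \<open>(Z1, Y1)\<close> at level 1.\<close>
    have "real M * (\<gamma> * en 0 (- G (Y1 0)) (G (Z1 0))) \<le> integral {0..S} h"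
      unfolding S_def h_def[abs_def]
    proof (rule coupling_growth[where T = T and z = "\<lambda>t. - G (Y1 t)" and y = "\<lambda>t. G (Z1 t)"])
      show "\<gamma> * en 0 (z 0) (y 0) \<le> integral {0..T1} (\<lambda>t. (norm (C (Suc j) (y t)))\<^sup>2)"
        if "sol T1 (\<lambda>_. 0) z y" for z y using \<gamma>(2)[OF that] .
      show "sol T (\<lambda>_. 0) (\<lambda>t. - G (Y1 t)) (\<lambda>t. G (Z1 t))" by (rule sol_primitive_free[OF ZY(1)])
      show "real M * T1 \<le> T" using T unfolding S_def by simp
    qed (use j2 T1 in auto)
    also have "en 0 (- G (Y1 0)) (G (Z1 0)) = en 1 (Z1 0) (Y1 0)" unfolding en_def by simp
    also have "\<dots> = E" using ZY(3)[of 1 0] Ec[of 0] T by simp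
    finally have "\<alpha> * (real M * (\<gamma> * E)) \<le> \<alpha> * integral {0..S} h" using \<alpha>(1) by (intro mult_left_mono) auto
    also have "\<dots> = integral {0..S} (\<lambda>t. \<alpha> * h t)" by simp
    also have "\<dots> \<le> integral {0..S} (\<lambda>t. - (G (Z1 t) \<bullet> - C (Suc j) (G (Z1 t))))"
      using \<alpha>(2) unfolding h_def
      by (intro integral_le integrable_continuous_interval continuous_intros
        continuous_on_bl[OF C_bounded_linear[OF j2]] continuous_on_bl[OF G_bounded_linear]
        continuous_on_subset[OF sol_cont_z[OF ZY(1)] sub]) (auto simp: inner_commute)
    also have "\<dots> = (Y1 S \<bullet> G (Z2 S) - G (Z1 S) \<bullet> Y2 S) - (Y1 0 \<bullet> G (Z2 0) - G (Z1 0) \<bullet> Y2 0)"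
      using pairing[OF sol_restrict[OF ZY(1) T(2)] sol_restrict[OF ZY(2) T(2)] S0] by simp
    also have "\<dots> \<le> 2 * (E + KL * (K1 * (O' + E) + E))" using X[of 0] X[of S] by simp
    also have "\<dots> = K3 * E + K4 * O'" unfolding K3_def K4_def by (simp add: algebra_simps)
    finally have "\<alpha> * \<gamma> * real M * E \<le> K3 * E + K4 * O'" by (simp add: ac_simps)
    moreover have "(K3 + 1) * E \<le> \<alpha> * \<gamma> * real M * E" by (intro mult_right_mono M E0)
    ultimately have EO: "E \<le> K4 * O'" by (simp add: algebra_simps)
    have "(\<Sum>i=j..n. en (n - i) (Z i 0) (Y i 0)) = E + (\<Sum>i=Suc j..n. en (n - i) (Z i 0) (Y i 0))"
      unfolding E_def using j by (simp add: sum.atLeast_Suc_atMost)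
    also have "\<dots> \<le> E + K1 * (O' + E)" using win[of 0] by simp
    also have "\<dots> \<le> K4 * O' + K1 * (O' + K4 * O')" using EO K1 by (intro add_mono mult_left_mono) auto
    also have "\<dots> = K * O'" unfolding K_def by (simp add: algebra_simps)
    finally show ?thesis unfolding O'_def .
  qed
  then show ?thesis using T K unfolding tail_obs_def by blast
qed

end


section \<open>Necessary conditions\<close>

context cascade_operator
begin

text \<open>The cascade is driven from lower to higher index, so a tail extended by zero components
  is a solution of the whole system.\<close>

lemma tail_obs_of_cascade:
  assumes full: "tail_obs 1 T" and j: "1 \<le> j" "j \<le> n"
  shows "tail_obs j T"
proof -
  obtain K where K: "K > 0" and le: "\<And>Z Y. chain 1 T (\<lambda>_. 0) Z Y \<Longrightarrow>
     (\<Sum>i=1..n. en (n - i) (Z i 0) (Y i 0)) \<le> K * Obs T (Z n) (Y n)"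
    using full unfolding tail_obs_def by blast
  have "(\<Sum>i=j..n. en (n - i) (Z i 0) (Y i 0)) \<le> K * Obs T (Z n) (Y n)"
    if ch: "chain j T (\<lambda>_. 0) Z Y" for Z Y
  proof -
    define Z' where "Z' i = (if i < j then (\<lambda>_. 0) else Z i)" for i
    define Y' where "Y' i = (if i < j then (\<lambda>_. 0) else Y i)" for i
    have "chain 1 T (\<lambda>_. 0) Z' Y'"
      unfolding chain_def
    proof
      fix i assume i: "i \<in> {1..n}"
      have C0: "- C i (G 0) = 0" if "i \<noteq> 1"
        using bl_zero[OF C_bounded_linear[of i]] that i by (simp add: G_zero)
      show "sol T (src 1 (\<lambda>_. 0) Z' i) (Z' i) (Y' i)"
      proof (cases "i \<le> j")
        case True
        then have "src 1 (\<lambda>_. 0) Z' i = (\<lambda>_. 0)"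
          using C0 i unfolding src_def Z'_def by (auto simp: fun_eq_iff)
        moreover have "sol T (\<lambda>_. 0) (Z' i) (Y' i)"
          using True sol_zero chainD[OF ch, of j] j by (auto simp: Z'_def Y'_def src_def)
        ultimately show ?thesis by simp
      next
        case False
        then have "src 1 (\<lambda>_. 0) Z' i = src j (\<lambda>_. 0) Z i"
          using j unfolding src_def Z'_def by (auto simp: fun_eq_iff)
        then show ?thesis using chainD[OF ch, of i] False i by (simp add: Z'_def Y'_def)
      qed
    qed
    from le[OF this] have "(\<Sum>i=1..n. en (n - i) (Z' i 0) (Y' i 0)) \<le> K * Obs T (Z n) (Y n)"
      using j by (simp add: Z'_def Y'_def)
    moreover have "(\<Sum>i=j..n. en (n - i) (Z i 0) (Y i 0)) = (\<Sum>i=j..n. en (n - i) (Z' i 0) (Y' i 0))"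
      by (rule sum.cong) (auto simp: Z'_def Y'_def)
    moreover have "(\<Sum>i=j..n. en (n - i) (Z' i 0) (Y' i 0)) \<le> (\<Sum>i=1..n. en (n - i) (Z' i 0) (Y' i 0))"
      using j by (intro sum_mono2) (auto simp: en_nonneg)
    ultimately show ?thesis by linarith
  qed
  then show ?thesis unfolding tail_obs_def using K by blast
qed

lemma tail_obs_mono:
  assumes P: "tail_obs j T" and j: "j \<le> n" and T: "0 < T" "T \<le> T'"
  shows "tail_obs j T'"
proof -
  obtain K where K: "K > 0" and le: "\<And>Z Y. chain j T (\<lambda>_. 0) Z Y \<Longrightarrow>
     (\<Sum>i=j..n. en (n - i) (Z i 0) (Y i 0)) \<le> K * Obs T (Z n) (Y n)"
    using P unfolding tail_obs_def by blast
  have "(\<Sum>i=j..n. en (n - i) (Z i 0) (Y i 0)) \<le> K * Obs T' (Z n) (Y n)" if ch: "chain j T' (\<lambda>_. 0) Z Y" for Z Y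
  proof -
    have "chain j T (\<lambda>_. 0) Z Y" using chain_shift[OF ch, of 0 T] T by simp
    from le[OF this] have "(\<Sum>i=j..n. en (n - i) (Z i 0) (Y i 0)) \<le> K * Obs T (Z n) (Y n)" .
    also have "\<dots> \<le> K * Obs T' (Z n) (Y n)"
      using Obs_shift_le[OF chainD[OF ch, of n], of 0 T] T j K by (intro mult_left_mono) auto
    finally show ?thesis .
  qed
  then show ?thesis unfolding tail_obs_def using K by blast
qed

lemma coupling_obs_mono:
  assumes P: "coupling_obs i T" and i: "i \<in> {2..n}" and T: "0 < T" "T \<le> T'"
  shows "coupling_obs i T'"
proof -
  obtain \<gamma> where \<gamma>: "\<gamma> > 0" "\<And>z y. sol T (\<lambda>_. 0) z y \<Longrightarrow>
     \<gamma> * en 0 (z 0) (y 0) \<le> integral {0..T} (\<lambda>t. (norm (C i (y t)))\<^sup>2)"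
    using P unfolding coupling_obs_def by blast
  have "\<gamma> * en 0 (z 0) (y 0) \<le> integral {0..T'} (\<lambda>t. (norm (C i (y t)))\<^sup>2)" if s: "sol T' (\<lambda>_. 0) z y" for z y
  proof -
    have c: "continuous_on {0..T'} (\<lambda>t. (norm (C i (y t)))\<^sup>2)"
      by (intro continuous_intros continuous_on_bl[OF C_bounded_linear[OF i] sol_cont_y[OF s]])
    have "\<gamma> * en 0 (z 0) (y 0) \<le> integral {0..T} (\<lambda>t. (norm (C i (y t)))\<^sup>2)"
      by (rule \<gamma>(2)[OF sol_restrict[OF s T(2)]])
    also have "\<dots> \<le> integral {0..T'} (\<lambda>t. (norm (C i (y t)))\<^sup>2)"
      using T integral_shift_le[OF c, of 0 T] by simp
    finally show ?thesis .
  qed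
  with \<gamma>(1) show ?thesis unfolding coupling_obs_def by blast
qed

text \<open>Observing \<open>u\<^sub>n\<close> while \<open>u\<^sub>i, \<dots>, u\<^sub>n\<close> start at rest and \<open>u\<^bsub>i-1\<^esub>\<close> is an arbitrary
  free wave gives observability by \<open>C i\<close>, but only in a negative level of the scale.\<close>

lemma weak_coupling_obs:
  assumes full: "tail_obs 1 T" and i: "i \<in> {2..n}" and T: "T > 0"
  shows "\<exists>K>0. \<forall>z y. sol T (\<lambda>_. 0) z y \<longrightarrow>
    en (Suc (n - i)) (z 0) (y 0) \<le> K * integral {0..T} (\<lambda>t. (norm ((G ^^ (n - i)) (C i (G (z t)))))\<^sup>2)"
proof -
  define j where "j = i - 1"
  have j: "1 \<le> j" "j < n" "i = Suc j" "n - j = Suc (n - i)" unfolding j_def using i by auto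
  obtain K where K: "K > 0" and le: "\<And>Z Y. chain j T (\<lambda>_. 0) Z Y \<Longrightarrow>
     (\<Sum>i=j..n. en (n - i) (Z i 0) (Y i 0)) \<le> K * Obs T (Z n) (Y n)"
    using tail_obs_of_cascade[OF full, of j] j unfolding tail_obs_def by auto
  obtain KF where KF: "KF > 0" "\<And>F Z Y. chain i T F Z Y \<Longrightarrow> \<forall>l\<in>{i..n}. Z l 0 = 0 \<and> Y l 0 = 0 \<Longrightarrow>
    Obs T (Z n) (Y n) \<le> KF * integral {0..T} (\<lambda>t. (norm ((G ^^ (n - i)) (F t)))\<^sup>2)"
    using forced_Obs_bound[of i T] i T by auto
  have "en (Suc (n - i)) (z 0) (y 0) \<le> K * KF * integral {0..T} (\<lambda>t. (norm ((G ^^ (n - i)) (C i (G (z t)))))\<^sup>2)"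
    if s: "sol T (\<lambda>_. 0) z y" for z y
  proof -
    define F where "F t = - C i (G (z t))" for t
    have cF: "continuous_on {0..T} F"
      unfolding F_def[abs_def] by (rule C_source_continuous[OF i sol_cont_z[OF s]])
    obtain Z' Y' where Z': "chain i T F Z' Y'" and zero: "\<forall>l\<in>{i..n}. Z' l 0 = 0 \<and> Y' l 0 = 0"
      using chain_exists[of i T F "\<lambda>_. 0" "\<lambda>_. 0"] i cF T by auto
    define Z where "Z = Z'(j := z)"
    define Y where "Y = Y'(j := y)"
    have "chain j T (\<lambda>_. 0) Z Y"
      unfolding chain_def
    proof
      fix l assume l: "l \<in> {j..n}"
      show "sol T (src j (\<lambda>_. 0) Z l) (Z l) (Y l)"
      proof (cases "l = j")
        case True
        then show ?thesis using s by (simp add: src_def Z_def Y_def)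
      next
        case False
        then have "src j (\<lambda>_. 0) Z l = src i F Z' l"
          using l unfolding src_def Z_def F_def j(3) by (auto simp: fun_eq_iff)
        then show ?thesis using chainD[OF Z', of l] l False j(3) by (simp add: Z_def Y_def)
      qed
    qed
    from le[OF this] have "(\<Sum>l=j..n. en (n - l) (Z l 0) (Y l 0)) \<le> K * Obs T (Z n) (Y n)" .
    moreover have "en (Suc (n - i)) (z 0) (y 0) \<le> (\<Sum>l=j..n. en (n - l) (Z l 0) (Y l 0))"
      using member_le_sum[of j "{j..n}" "\<lambda>l. en (n - l) (Z l 0) (Y l 0)"] j(2)
      by (simp add: en_nonneg Z_def Y_def j(4))
    moreover have "K * Obs T (Z n) (Y n) \<le> K * (KF * integral {0..T} (\<lambda>t. (norm ((G ^^ (n - i)) (F t)))\<^sup>2))"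
      using KF(2)[OF Z' zero] K j(2) by (intro mult_left_mono) (auto simp: Z_def Y_def)
    ultimately show ?thesis unfolding F_def bl_neg[OF Gpow_bounded_linear] by simp
  qed
  moreover have "K * KF > 0" using K KF by simp
  ultimately show ?thesis by blast
qed

text \<open>The data of the primitive in time of a free wave.\<close>

definition prim :: "'h \<times> 'h \<Rightarrow> 'h \<times> 'h" where "prim p = (- G (snd p), G (fst p))"

lemma sol_prim:
  "sol T (\<lambda>_. 0) z y \<Longrightarrow> sol T (\<lambda>_. 0) (\<lambda>t. fst ((prim ^^ r) (z t, y t))) (\<lambda>t. snd ((prim ^^ r) (z t, y t)))"
proof (induction r)
  case (Suc r)
  from sol_primitive_free[OF Suc.IH[OF Suc.prems]] show ?case by (simp add: prim_def)
qed simp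

lemma en_prim: "en k (fst ((prim ^^ r) p)) (snd ((prim ^^ r) p)) = en (k + r) (fst p) (snd p)"
proof (induction r arbitrary: k)
  case (Suc r)
  have "en k (fst (prim q)) (snd (prim q)) = en (Suc k) (fst q) (snd q)" for q
    unfolding en_def prim_def by (simp add: bl_neg[OF Gpow_bounded_linear] funpow_swap1)
  from this[of "(prim ^^ r) p"] show ?case using Suc[of "Suc k"] by simp
qed simp

text \<open>A truncated free wave is smooth in time, and its derivative
  \<open>(LN N y, - LN N z)\<close> is again a free wave, mapped back by \<open>prim\<close>.
  Truncations thus provide the dense class of waves with arbitrarily many time derivatives.\<close>

lemma truncation_is_primitive:
  "sol T (\<lambda>_. 0) z y \<Longrightarrow> \<exists>z' y'. sol T (\<lambda>_. 0) z' y' \<and> (\<forall>t. (prim ^^ r) (z' t, y' t) = (PN N (z t), PN N (y t)))"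
proof (induction r arbitrary: z y)
  case 0
  from sol_PN[OF 0, of N] show ?case
    by (intro exI[of _ "\<lambda>t. PN N (z t)"] exI[of _ "\<lambda>t. PN N (y t)"]) (simp add: bl_zero[OF PN_bounded_linear])
next
  case (Suc r)
  note s = Suc.prems
  have "sol T (\<lambda>_. 0) (\<lambda>t. LN N (y t)) (\<lambda>t. - LN N (z t))"
    unfolding sol_def
  proof (intro conjI ballI)
    show "continuous_on {0..T} (\<lambda>t. LN N (y t))" "continuous_on {0..T} (\<lambda>t. - LN N (z t))"
      by (intro continuous_intros continuous_on_bl[OF LN_bounded_linear sol_cont_y[OF s]]
        continuous_on_bl[OF LN_bounded_linear sol_cont_z[OF s]])+
    fix t assume t: "t \<in> {0..T}"
    show "((\<lambda>t. G (LN N (y t))) has_vector_derivative - LN N (z t)) (at t within {0..T})"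
      using sol_dPNy[OF s t, of N] by (simp add: G_LN bl_zero[OF PN_bounded_linear])
    show "((\<lambda>t. G (- LN N (z t))) has_vector_derivative G 0 - LN N (y t)) (at t within {0..T})"
      using has_vector_derivative_minus[OF sol_dPNz[OF s t, of N]] by (simp add: G_LN G_minus G_zero)
  qed simp
  from Suc.IH[OF this] obtain z' y' where s': "sol T (\<lambda>_. 0) z' y'"
    and pr: "\<forall>t. (prim ^^ r) (z' t, y' t) = (PN N (LN N (y t)), PN N (- LN N (z t)))" by blast
  have "(prim ^^ Suc r) (z' t, y' t) = prim (PN N (LN N (y t)), PN N (- LN N (z t)))" for t
    using pr by simp
  moreover have "prim (PN N (LN N (y t)), PN N (- LN N (z t))) = (PN N (z t), PN N (y t))" for t
    by (simp add: prim_def PN_LN bl_neg[OF PN_bounded_linear] G_minus G_LN)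
  ultimately show ?case using s' by metis
qed

text \<open>Interpolation in the scale: integrate by parts in time against the weight \<open>t (T - t)\<close>,
  which vanishes at both ends, and move one power of \<open>G\<close> from one factor to the other.\<close>

lemma interpolation:
  assumes i: "i \<in> {2..n}" and k: "1 \<le> k" "k \<le> n - i" and T: "T > 0"
  shows "\<exists>c>0. \<forall>p q \<eta>. sol T (\<lambda>_. 0) p q \<longrightarrow> \<eta> > 0 \<longrightarrow>
    integral {0..T} (\<lambda>t. t * (T - t) * (norm ((G ^^ k) (C i (G (p t)))))\<^sup>2)
      \<le> T * (\<eta> * en (Suc k) (p 0) (q 0))
        + c / \<eta> * integral {0..T} (\<lambda>t. (norm ((G ^^ (k - 1)) (C i (G (- G (q t))))))\<^sup>2)"
proof -
  obtain Kc where Kc: "Kc > 0" "\<And>x. (norm ((G ^^ Suc k) (C i x)))\<^sup>2 \<le> Kc * (norm ((G ^^ Suc k) x))\<^sup>2"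
    using C_negative_scale_sq[OF i, of "Suc k"] k by auto
  obtain l where l: "k = Suc l" using k by (cases k) auto
  \<comment> \<open>The squared norms of \<open>u\<close> and \<open>v\<close> add up to at most
    \<open>2 * \<kappa>\<close> times the energy; \<open>c\<close> is then what Young's inequality
    leaves in front of \<open>x\<close>.\<close>
  define \<kappa> where "\<kappa> = Kc * (cG\<^sup>2 + 1)"
  define c where "c = (T\<^sup>2 + T^4) * \<kappa> / 2"
  have \<kappa>: "\<kappa> > 0" unfolding \<kappa>_def using Kc by (intro mult_pos_pos add_nonneg_pos) auto
  have c: "c > 0" unfolding c_def using \<kappa> T by (simp add: add_pos_pos)
  note Cbl = C_bounded_linear[OF i]
  have "integral {0..T} (\<lambda>t. t * (T - t) * (norm ((G ^^ k) (C i (G (p t)))))\<^sup>2)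
      \<le> T * (\<eta> * en (Suc k) (p 0) (q 0))
        + c / \<eta> * integral {0..T} (\<lambda>t. (norm ((G ^^ (k - 1)) (C i (G (- G (q t))))))\<^sup>2)"
    if s: "sol T (\<lambda>_. 0) p q" and \<eta>: "\<eta> > 0" for p q \<eta>
  proof -
    define M where "M = en (Suc k) (p 0) (q 0)"
    define x where "x t = (G ^^ l) (C i (G (- G (q t))))" for t
    define a where "a t = (G ^^ k) (C i (G (- G (q t))))" for t
    define b where "b t = (G ^^ k) (C i (G (p t)))" for t
    define d where "d t = (G ^^ k) (C i (q t))" for t
    define u where "u t = (G ^^ Suc k) (C i (G (p t)))" for t
    define v where "v t = (G ^^ Suc k) (C i (q t))" for t
    have prim: "sol T (\<lambda>_. 0) (\<lambda>t. - G (q t)) (\<lambda>t. G (p t))" by (rule sol_primitive_free[OF s])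
    have cx: "continuous_on {0..T} x" and cb: "continuous_on {0..T} b"
      unfolding x_def[abs_def] b_def[abs_def]
      by (rule continuous_on_bl[OF Gpow_bounded_linear continuous_on_bl[OF Cbl
            continuous_on_bl[OF G_bounded_linear sol_cont_z[OF prim]]]]
          continuous_on_bl[OF Gpow_bounded_linear continuous_on_bl[OF Cbl
            continuous_on_bl[OF G_bounded_linear sol_cont_z[OF s]]]])+
    have cd: "continuous_on {0..T} d"
      unfolding d_def[abs_def]
      by (rule continuous_on_bl[OF Gpow_bounded_linear continuous_on_bl[OF Cbl sol_cont_y[OF s]]])
    have ca: "continuous_on {0..T} a"
      unfolding a_def[abs_def]
      by (rule continuous_on_bl[OF Gpow_bounded_linear continuous_on_bl[OF Cbl
            continuous_on_bl[OF G_bounded_linear sol_cont_z[OF prim]]]])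
    have da: "(a has_vector_derivative b t) (at t within {0..T})"
      and db: "(b has_vector_derivative d t) (at t within {0..T})" if t: "t \<in> {0..T}" for t
      unfolding a_def[abs_def] b_def[abs_def] d_def
      by (rule bounded_linear.has_vector_derivative[OF Gpow_bounded_linear
            bounded_linear.has_vector_derivative[OF Cbl sol_dz[OF prim t]]]
          bounded_linear.has_vector_derivative[OF Gpow_bounded_linear
            bounded_linear.has_vector_derivative[OF Cbl sol_dz[OF s t]]])+
    \<comment> \<open>\<open>a\<close> is \<open>G\<close> applied to \<open>x\<close>; moving this
      \<open>G\<close> to the other side takes \<open>b\<close> and \<open>d\<close> to
      \<open>u\<close> and \<open>v\<close> at level \<open>k + 1\<close>, where conservation of
      energy bounds them.\<close>
    have a_b: "a t \<bullet> b t = x t \<bullet> u t" and a_d: "a t \<bullet> d t = x t \<bullet> v t" for t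
      unfolding a_def x_def b_def d_def u_def v_def l by (simp_all add: G_symmetric)
    define F' where "F' t = t * (T - t) * (a t \<bullet> d t + b t \<bullet> b t) + (T - 2 * t) * (a t \<bullet> b t)" for t
    have "((\<lambda>t. (t * (T - t)) *\<^sub>R (a t \<bullet> b t)) has_vector_derivative
        (t * (T - t)) *\<^sub>R (a t \<bullet> d t + b t \<bullet> b t) + (T - 2 * t) *\<^sub>R (a t \<bullet> b t)) (at t within {0..T})"
      if t: "t \<in> {0..T}" for t
      by (rule has_vector_derivative_scaleR[OF _
          bounded_bilinear.has_vector_derivative[OF bounded_bilinear_inner da[OF t] db[OF t]]])
        (auto intro!: derivative_eq_intros)
    then have "((\<lambda>t. t * (T - t) * (a t \<bullet> b t)) has_vector_derivative F' t) (at t within {0..T})"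
      if "t \<in> {0..T}" for t
      using that unfolding F'_def by simp
    from real_integral_FTC[where f = "\<lambda>t. t * (T - t) * (a t \<bullet> b t)" and f' = F', OF this, of T] T
    have F0: "integral {0..T} F' = 0" by simp
    have cF: "continuous_on {0..T} F'"
      unfolding F'_def[abs_def] by (intro continuous_intros ca cb cd)
    have "integral {0..T} (\<lambda>t. t * (T - t) * (norm (b t))\<^sup>2)
        = integral {0..T} (\<lambda>t. F' t - (t * (T - t) * (x t \<bullet> v t) + (T - 2 * t) * (x t \<bullet> u t)))"
      unfolding F'_def a_b a_d by (simp add: power2_norm_eq_inner algebra_simps)
    also have "\<dots> = integral {0..T} F' - integral {0..T} (\<lambda>t. t * (T - t) * (a t \<bullet> d t) + (T - 2 * t) * (a t \<bullet> b t))"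
      unfolding a_b[symmetric] a_d[symmetric]
      by (intro integral_diff integrable_continuous_interval cF continuous_intros ca cb cd)
    also have "\<dots> = integral {0..T} (\<lambda>t. - (t * (T - t) * (a t \<bullet> d t) + (T - 2 * t) * (a t \<bullet> b t)))"
      by (simp only: F0 integral_neg diff_0)
    also have "\<dots> \<le> integral {0..T} (\<lambda>t. \<eta> * M + c / \<eta> * (norm (x t))\<^sup>2)"
    proof (intro integral_le integrable_continuous_interval continuous_intros ca cb cd cx)
      fix t assume t: "t \<in> {0..T}"
      have Mt: "en (Suc k) (p t) (q t) = M" unfolding M_def by (rule energy_conserved[OF s t])
      have "(norm (u t))\<^sup>2 \<le> Kc * (norm ((G ^^ Suc k) (G (p t))))\<^sup>2" unfolding u_def by (rule Kc(2))
      also have "(G ^^ Suc k) (G (p t)) = G ((G ^^ Suc k) (p t))" by (simp add: funpow_swap1)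
      also have "(norm (G ((G ^^ Suc k) (p t))))\<^sup>2 \<le> (cG * norm ((G ^^ Suc k) (p t)))\<^sup>2"
        by (intro power_mono norm_G_le) auto
      also have "\<dots> = cG\<^sup>2 * (norm ((G ^^ Suc k) (p t)))\<^sup>2" by (simp add: power_mult_distrib)
      also have "\<dots> \<le> cG\<^sup>2 * (2 * M)" unfolding Mt[symmetric] by (intro mult_left_mono norm_fst_le_en) auto
      finally have U: "(norm (u t))\<^sup>2 \<le> Kc * (cG\<^sup>2 * (2 * M))" using Kc(1) by (simp add: mult_left_mono)
      have "(norm (v t))\<^sup>2 \<le> Kc * (norm ((G ^^ Suc k) (q t)))\<^sup>2" unfolding v_def by (rule Kc(2))
      also have "\<dots> \<le> Kc * (2 * M)" unfolding Mt[symmetric]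
        using Kc(1) by (intro mult_left_mono norm_snd_le_en) auto
      finally have V: "(norm (v t))\<^sup>2 \<le> Kc * (2 * M)" .
      \<comment> \<open>The Young parameter for which the total coefficient of the energy
        \<open>M\<close> is exactly \<eta>.\<close>
      define \<delta> where "\<delta> = \<eta> / \<kappa>"
      have \<delta>: "\<delta> > 0" unfolding \<delta>_def using \<eta> \<kappa> by simp
      have young: "R * (X * W) \<le> \<delta> * W\<^sup>2 / 2 + R\<^sup>2 / (2 * \<delta>) * X\<^sup>2" for R X W :: real
      proof -
        have "0 \<le> (sqrt \<delta> * W - R * X / sqrt \<delta>)\<^sup>2" by simp
        also have "\<dots> = \<delta> * W\<^sup>2 + R\<^sup>2 / \<delta> * X\<^sup>2 - 2 * (R * (X * W))"
          using \<delta> by (simp add: power2_diff power_divide power_mult_distrib)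
        finally show ?thesis by simp
      qed
      have th: "\<bar>t * (T - t)\<bar> \<le> T\<^sup>2" "\<bar>T - 2 * t\<bar> \<le> T"
      proof -
        have "t * (T - t) \<le> T * T" using t by (intro mult_mono) auto
        moreover have "0 \<le> t * (T - t)" using t by simp
        ultimately show "\<bar>t * (T - t)\<bar> \<le> T\<^sup>2" by (simp add: power2_eq_square)
        show "\<bar>T - 2 * t\<bar> \<le> T" using t by auto
      qed
      have 1: "\<bar>t * (T - t) * (x t \<bullet> v t)\<bar> \<le> T\<^sup>2 * (norm (x t) * norm (v t))"
        unfolding abs_mult[of "t * (T - t)"] by (intro mult_mono th Cauchy_Schwarz_ineq2) auto
      have 2: "\<bar>(T - 2 * t) * (x t \<bullet> u t)\<bar> \<le> T * (norm (x t) * norm (u t))"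
        unfolding abs_mult using T by (intro mult_mono th Cauchy_Schwarz_ineq2) auto
      have "- (t * (T - t) * (a t \<bullet> d t) + (T - 2 * t) * (a t \<bullet> b t))
          \<le> T\<^sup>2 * (norm (x t) * norm (v t)) + T * (norm (x t) * norm (u t))"
        unfolding a_b a_d using 1 2 by linarith
      also have "\<dots> \<le> (\<delta> * (norm (v t))\<^sup>2 / 2 + (T\<^sup>2)\<^sup>2 / (2 * \<delta>) * (norm (x t))\<^sup>2)
          + (\<delta> * (norm (u t))\<^sup>2 / 2 + T\<^sup>2 / (2 * \<delta>) * (norm (x t))\<^sup>2)"
        by (intro add_mono young)
      also have "\<dots> \<le> (\<delta> * (Kc * (2 * M)) / 2 + (T\<^sup>2)\<^sup>2 / (2 * \<delta>) * (norm (x t))\<^sup>2)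
          + (\<delta> * (Kc * (cG\<^sup>2 * (2 * M))) / 2 + T\<^sup>2 / (2 * \<delta>) * (norm (x t))\<^sup>2)"
        using U V \<delta> by (intro add_mono divide_right_mono mult_left_mono order_refl) auto
      also have "\<dots> = \<delta> * \<kappa> * M + (T\<^sup>2 + T^4) / (2 * \<delta>) * (norm (x t))\<^sup>2"
      proof -
        have "(T\<^sup>2)\<^sup>2 = T^4" by (simp flip: power_mult)
        then show ?thesis unfolding \<kappa>_def by (simp add: algebra_simps add_divide_distrib)
      qed
      also have "\<delta> * \<kappa> = \<eta>" unfolding \<delta>_def using \<kappa> by simp
      also have "(T\<^sup>2 + T^4) / (2 * \<delta>) = c / \<eta>" unfolding \<delta>_def c_def using \<kappa> \<eta> by simp
      finally show "- (t * (T - t) * (a t \<bullet> d t) + (T - 2 * t) * (a t \<bullet> b t)) \<le> \<eta> * M + c / \<eta> * (norm (x t))\<^sup>2" .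
    qed
    also have "\<dots> = T * (\<eta> * M) + c / \<eta> * integral {0..T} (\<lambda>t. (norm (x t))\<^sup>2)"
    proof -
      have "integral {0..T} (\<lambda>t. \<eta> * M + c / \<eta> * (norm (x t))\<^sup>2)
          = integral {0..T} (\<lambda>t. \<eta> * M) + integral {0..T} (\<lambda>t. c / \<eta> * (norm (x t))\<^sup>2)"
        by (intro integral_add integrable_continuous_interval continuous_intros cx)
      then show ?thesis using T by simp
    qed
    finally show ?thesis unfolding b_def x_def M_def l by simp
  qed
  with c show ?thesis by blast
qed

text \<open>Each step takes one more primitive of the wave and removes one power of \<open>G\<close>
  outside \<open>C i\<close>, while the energy on the left stays the same. \<open>T\<close> is
  arbitrary in the induction because the hypothesis is used on a strictly shorter interval that is
  still longer than \<open>Ts\<close>.\<close>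

lemma level_obs:
  assumes full: "\<And>T. T > Ts \<Longrightarrow> tail_obs 1 T" and i: "i \<in> {2..n}" and Ts: "Ts \<ge> 0"
    and r: "r \<le> n - i" and T: "T > Ts"
  shows "\<exists>K>0. \<forall>z y. sol T (\<lambda>_. 0) z y \<longrightarrow> en (Suc (n - i)) (z 0) (y 0)
    \<le> K * integral {0..T} (\<lambda>t. (norm ((G ^^ (n - i - r)) (C i (G (fst ((prim ^^ r) (z t, y t)))))))\<^sup>2)"
  using r T
proof (induction r arbitrary: T)
  case 0
  then show ?case using weak_coupling_obs[OF full i] Ts by auto
next
  case (Suc r)
  define k where "k = n - i - r"
  have k: "1 \<le> k" "k \<le> n - i" "n - i - Suc r = k - 1" "Suc k + r = Suc (n - i)"
    unfolding k_def using Suc.prems by auto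
  have T0: "T > 0" using Suc.prems Ts by simp
  \<comment> \<open>Halfway between \<open>Ts\<close> and \<open>T\<close>; the interval of length
    \<open>S\<close> is centred in \<open>{0..T}\<close>, leaving a margin \<open>e\<close> at both
    ends where the weight degenerates.\<close>
  define S where "S = (T + Ts) / 2"
  define e where "e = (T - S) / 2"
  have S: "S > Ts" "S < T" unfolding S_def using Suc.prems(2) by (auto simp: field_simps)
  have e: "e > 0" "e + S = T - e" "e < T" unfolding e_def using S T0 Ts by (auto simp: field_simps)
  obtain K where K: "K > 0" and IH: "\<And>z y. sol S (\<lambda>_. 0) z y \<Longrightarrow> en (Suc (n - i)) (z 0) (y 0)
    \<le> K * integral {0..S} (\<lambda>t. (norm ((G ^^ k) (C i (G (fst ((prim ^^ r) (z t, y t)))))))\<^sup>2)"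
    using Suc.IH[of S] Suc.prems(1) S unfolding k_def by auto
  obtain c where c: "c > 0" and interp: "\<And>p q \<eta>. sol T (\<lambda>_. 0) p q \<Longrightarrow> \<eta> > 0 \<Longrightarrow>
    integral {0..T} (\<lambda>t. t * (T - t) * (norm ((G ^^ k) (C i (G (p t)))))\<^sup>2)
      \<le> T * (\<eta> * en (Suc k) (p 0) (q 0))
        + c / \<eta> * integral {0..T} (\<lambda>t. (norm ((G ^^ (k - 1)) (C i (G (- G (q t))))))\<^sup>2)"
    using interpolation[OF i k(1,2) T0] by blast
  define \<kappa> where "\<kappa> = e * (T - e)"
  \<comment> \<open>\<kappa> is the least value of the weight \<open>t * (T - t)\<close> on the
    inner interval; \<eta> makes the interpolation cost \<open>K * T * \<eta>\<close> equal to half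
    of it, so half of the energy is absorbed.\<close>
  define \<eta> where "\<eta> = \<kappa> / (2 * K * T)"
  have \<kappa>: "\<kappa> > 0" unfolding \<kappa>_def using e by simp
  have \<eta>: "\<eta> > 0" unfolding \<eta>_def using \<kappa> K T0 by simp
  define K' where "K' = 2 * (K * (c / \<eta>)) / \<kappa>"
  have K': "K' > 0" unfolding K'_def using K c \<eta> \<kappa> by simp
  have "en (Suc (n - i)) (z 0) (y 0)
    \<le> K' * integral {0..T} (\<lambda>t. (norm ((G ^^ (n - i - Suc r)) (C i (G (fst ((prim ^^ Suc r) (z t, y t)))))))\<^sup>2)"
    if s: "sol T (\<lambda>_. 0) z y" for z y
  proof -
    define M where "M = en (Suc (n - i)) (z 0) (y 0)"
    define p where "p t = fst ((prim ^^ r) (z t, y t))" for t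
    define q where "q t = snd ((prim ^^ r) (z t, y t))" for t
    define J where "J = integral {0..T} (\<lambda>t. (norm ((G ^^ (k - 1)) (C i (G (- G (q t))))))\<^sup>2)"
    have spq: "sol T (\<lambda>_. 0) p q" unfolding p_def[abs_def] q_def[abs_def] by (rule sol_prim[OF s])
    have Mpq: "en (Suc k) (p 0) (q 0) = M"
      unfolding p_def q_def M_def en_prim k(4) by simp
    define g where "g t = (norm ((G ^^ k) (C i (G (p t)))))\<^sup>2" for t
    have cg: "continuous_on {0..T} g"
      unfolding g_def[abs_def]
      by (intro continuous_intros continuous_on_bl[OF Gpow_bounded_linear continuous_on_bl[OF C_bounded_linear[OF i]
            continuous_on_bl[OF G_bounded_linear sol_cont_z[OF spq]]]])
    have sub: "{e..T - e} \<subseteq> {0..T}" using e by auto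
    have "M \<le> K * integral {0..S} (\<lambda>t. g (e + t))"
    proof -
      have "sol S (\<lambda>_. 0) (\<lambda>t. z (e + t)) (\<lambda>t. y (e + t))"
        by (rule sol_shift[OF s]) (use e S in auto)
      from IH[OF this] have "en (Suc (n - i)) (z e) (y e) \<le> K * integral {0..S} (\<lambda>t. g (e + t))"
        unfolding g_def p_def by simp
      moreover have "en (Suc (n - i)) (z e) (y e) = M"
        unfolding M_def by (rule energy_conserved[OF s]) (use e in auto)
      ultimately show ?thesis by simp
    qed
    also have "integral {0..S} (\<lambda>t. g (e + t)) = integral {e..T - e} g"
      using integral_shift_Icc_real[of 0 S g e] unfolding e(2)[symmetric] by (simp add: o_def add.commute)
    finally have "\<kappa> * M \<le> \<kappa> * (K * integral {e..T - e} g)" using \<kappa> by (intro mult_left_mono) auto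
    also have "\<dots> = K * integral {e..T - e} (\<lambda>t. \<kappa> * g t)" by simp
    also have "\<dots> \<le> K * integral {0..T} (\<lambda>t. t * (T - t) * g t)"
    proof (intro mult_left_mono)
      have "integral {e..T - e} (\<lambda>t. \<kappa> * g t) \<le> integral {e..T - e} (\<lambda>t. t * (T - t) * g t)"
      proof (intro integral_le integrable_continuous_interval continuous_intros continuous_on_subset[OF cg sub])
        fix t assume t: "t \<in> {e..T - e}"
        have "0 \<le> (t - e) * (T - e - t)" using t by simp
        then have "\<kappa> \<le> t * (T - t)" unfolding \<kappa>_def by (simp add: algebra_simps)
        then show "\<kappa> * g t \<le> t * (T - t) * g t" by (intro mult_right_mono) (auto simp: g_def)
      qed
      also have "\<dots> \<le> integral {0..T} (\<lambda>t. t * (T - t) * g t)"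
        by (intro integral_subset_le sub integrable_continuous_interval continuous_intros
          continuous_on_subset[OF cg sub] cg) (auto simp: g_def)
      finally show "integral {e..T - e} (\<lambda>t. \<kappa> * g t) \<le> integral {0..T} (\<lambda>t. t * (T - t) * g t)" .
    qed (use K in simp)
    also have "\<dots> \<le> K * (T * (\<eta> * M) + c / \<eta> * J)"
      using interp[OF spq \<eta>] K unfolding g_def Mpq J_def by (intro mult_left_mono) auto
    also have "\<dots> = (K * T * \<eta>) * M + K * (c / \<eta>) * J" by (simp add: algebra_simps)
    also have "K * T * \<eta> = \<kappa> / 2" unfolding \<eta>_def using K T0 by simp
    finally have "\<kappa> * M \<le> 2 * (K * (c / \<eta>) * J)" by simp
    then have "M \<le> 2 * (K * (c / \<eta>) * J) / \<kappa>" by (simp only: pos_le_divide_eq[OF \<kappa>] mult.commute[of M])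
    also have "\<dots> = K' * J" unfolding K'_def by simp
    also have "J = integral {0..T} (\<lambda>t. (norm ((G ^^ (n - i - Suc r)) (C i (G (fst ((prim ^^ Suc r) (z t, y t)))))))\<^sup>2)"
      unfolding J_def k(3) q_def by (simp add: prim_def)
    finally show ?thesis unfolding M_def .
  qed
  with K' show ?case by blast
qed

text \<open>Apply the last level to the time derivative of order \<open>m + 1\<close> of a truncated
  wave: undoing the primitives returns the energy to level 0, and the last one turns displacement
  into velocity. The constant is independent of \<open>N\<close>, so the truncation can be
  removed.\<close>

lemma coupling_obs_necessary:
  assumes full: "\<And>T. T > Ts \<Longrightarrow> tail_obs 1 T" and i: "i \<in> {2..n}" and Ts: "Ts \<ge> 0" and T: "T > Ts"
  shows "coupling_obs i T"
proof -
  define m where "m = n - i"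
  obtain K where K: "K > 0" and le: "\<And>z y. sol T (\<lambda>_. 0) z y \<Longrightarrow> en (Suc m) (z 0) (y 0)
    \<le> K * integral {0..T} (\<lambda>t. (norm (C i (G (fst ((prim ^^ m) (z t, y t))))))\<^sup>2)"
    using level_obs[OF full i Ts order_refl T] unfolding m_def by auto
  note Cbl = C_bounded_linear[OF i]
  have T0: "0 \<in> {0..T}" using T Ts by simp
  have "en 0 (z 0) (y 0) \<le> K * integral {0..T} (\<lambda>t. (norm (C i (y t)))\<^sup>2)" if s: "sol T (\<lambda>_. 0) z y" for z y
  proof -
    have trunc: "en 0 (PN N (z 0)) (PN N (y 0)) \<le> K * integral {0..T} (\<lambda>t. (norm (C i (PN N (y t))))\<^sup>2)" for N
    proof -
      obtain z' y' where s': "sol T (\<lambda>_. 0) z' y'"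
        and pr: "\<And>t. (prim ^^ Suc m) (z' t, y' t) = (PN N (z t), PN N (y t))"
        using truncation_is_primitive[OF s, of "Suc m" N] by blast
      have "en 0 (PN N (z 0)) (PN N (y 0)) = en (Suc m) (z' 0) (y' 0)"
        using en_prim[of 0 "Suc m" "(z' 0, y' 0)"] unfolding pr by simp
      moreover have "G (fst ((prim ^^ m) (z' t, y' t))) = PN N (y t)" for t
        using arg_cong[OF pr[of t], of snd] by (simp add: prim_def)
      ultimately show ?thesis using le[OF s'] by simp
    qed
    obtain Kb where Kb: "\<And>x. norm (C i x) \<le> norm x * Kb" "Kb > 0" using bounded_linear.pos_bounded[OF Cbl] by blast
    have "(\<lambda>N. integral {0..T} (\<lambda>t. (norm (C i (PN N (y t))))\<^sup>2)) \<longlonglongrightarrow> integral {0..T} (\<lambda>t. (norm (C i (y t)))\<^sup>2)"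
    proof (rule dominated_convergence(2))
      show "(\<lambda>t. (norm (C i (PN N (y t))))\<^sup>2) integrable_on {0..T}" for N
        by (intro integrable_continuous_interval continuous_intros
          continuous_on_bl[OF Cbl continuous_on_bl[OF PN_bounded_linear sol_cont_y[OF s]]])
      show "(\<lambda>t. (norm (y t) * Kb)\<^sup>2) integrable_on {0..T}"
        by (intro integrable_continuous_interval continuous_intros sol_cont_y[OF s])
      show "norm ((norm (C i (PN N (y t))))\<^sup>2) \<le> (norm (y t) * Kb)\<^sup>2" for N t
      proof -
        have "norm (C i (PN N (y t))) \<le> norm (PN N (y t)) * Kb" by (rule Kb(1))
        also have "\<dots> \<le> norm (y t) * Kb" using Kb(2) by (intro mult_right_mono PN_norm_le) auto
        finally have "(norm (C i (PN N (y t))))\<^sup>2 \<le> (norm (y t) * Kb)\<^sup>2" by (intro power_mono) auto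
        then show ?thesis by simp
      qed
      show "(\<lambda>N. (norm (C i (PN N (y t))))\<^sup>2) \<longlonglongrightarrow> (norm (C i (y t)))\<^sup>2" for t
        by (intro tendsto_intros bounded_linear.tendsto[OF Cbl] PN_tendsto)
    qed
    then have R: "(\<lambda>N. K * integral {0..T} (\<lambda>t. (norm (C i (PN N (y t))))\<^sup>2)) \<longlonglongrightarrow> K * integral {0..T} (\<lambda>t. (norm (C i (y t)))\<^sup>2)"
      by (rule tendsto_mult_left)
    have L: "(\<lambda>N. en 0 (PN N (z 0)) (PN N (y 0))) \<longlonglongrightarrow> en 0 (z 0) (y 0)"
      unfolding en_0 by (intro tendsto_intros PN_tendsto) auto
    show ?thesis by (rule LIMSEQ_le[OF L R]) (use trunc in blast)
  qed
  then have "1 / K * en 0 (z 0) (y 0) \<le> integral {0..T} (\<lambda>t. (norm (C i (y t)))\<^sup>2)" if "sol T (\<lambda>_. 0) z y" for z y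
    using K that by (simp add: pos_divide_le_eq mult.commute)
  then show ?thesis unfolding coupling_obs_def using K by (intro exI[of _ "1 / K"]) auto
qed

end

section \<open>The stated inequalities in terms of the first-order system\<close>

context observed_operator
begin

lemma observability_inequality_iff:
  assumes T: "T > 0"
  shows "observability_inequality D A B T \<longleftrightarrow> (\<exists>R>0. \<forall>z y. sol T (\<lambda>_. 0) z y \<longrightarrow> R * en 0 (z 0) (y 0) \<le> Obs T z y)"
proof
  assume "observability_inequality D A B T"
  then obtain R where R: "R > 0" "\<And>w w'. wave_solution D A T (\<lambda>_. 0) w w' \<Longrightarrow>
        (\<exists>g. is_observation D A B T (\<lambda>_. 0) w w' g \<and>
           (LINT t|lebesgue_on {0..T}. (norm (g t))\<^sup>2) \<ge> R * energy D A 1 (w 0) (w' 0))"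
    unfolding observability_inequality_def by blast
  have "R * en 0 (z 0) (y 0) \<le> Obs T z y" if s: "sol T (\<lambda>_. 0) z y" for z y
  proof -
    obtain g where g: "is_observation D A B T (\<lambda>_. 0) (\<lambda>t. G (z t)) y g"
      "(LINT t|lebesgue_on {0..T}. (norm (g t))\<^sup>2) \<ge> R * energy D A 1 (G (z 0)) (y 0)"
      using R(2)[OF sol_imp_wave[OF s T]] by blast
    then show ?thesis
      using observation_unique[OF g(1) _ T] energy_eq[of 0 "z 0" "y 0"] by simp
  qed
  with R(1) show "\<exists>R>0. \<forall>z y. sol T (\<lambda>_. 0) z y \<longrightarrow> R * en 0 (z 0) (y 0) \<le> Obs T z y" by blast
next
  assume "\<exists>R>0. \<forall>z y. sol T (\<lambda>_. 0) z y \<longrightarrow> R * en 0 (z 0) (y 0) \<le> Obs T z y"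
  then obtain R where R: "R > 0" "\<And>z y. sol T (\<lambda>_. 0) z y \<Longrightarrow> R * en 0 (z 0) (y 0) \<le> Obs T z y" by blast
  have "\<exists>g. is_observation D A B T (\<lambda>_. 0) w w' g \<and>
      (LINT t|lebesgue_on {0..T}. (norm (g t))\<^sup>2) \<ge> R * energy D A 1 (w 0) (w' 0)"
    if s: "wave_solution D A T (\<lambda>_. 0) w w'" for w w'
  proof -
    obtain g where g: "is_observation D A B T (\<lambda>_. 0) w w' g" using observation_exists[OF s _ T] by auto
    have "w 0 \<in> Hspace D A 1" using s T unfolding wave_solution_def continuous_into_def by auto
    then have "energy D A 1 (w 0) (w' 0) = en 0 (L (w 0)) (w' 0)" by (rule energy_1)
    then show ?thesis
      using g observation_unique[OF g _ T] R(2)[OF wave_imp_sol[OF s T]] by auto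
  qed
  with R(1) show "observability_inequality D A B T" unfolding observability_inequality_def by blast
qed

lemma observability_inequality_mono:
  assumes P: "observability_inequality D A B T" and T: "0 < T" "T \<le> T'"
  shows "observability_inequality D A B T'"
proof -
  obtain R where R: "R > 0" "\<And>z y. sol T (\<lambda>_. 0) z y \<Longrightarrow> R * en 0 (z 0) (y 0) \<le> Obs T z y"
    using P unfolding observability_inequality_iff[OF T(1)] by blast
  have "R * en 0 (z 0) (y 0) \<le> Obs T' z y" if s: "sol T' (\<lambda>_. 0) z y" for z y
    using R(2)[OF sol_restrict[OF s T(2)]] Obs_shift_le[OF s, of 0 T] T by simp
  with R(1) T show ?thesis by (subst observability_inequality_iff) auto
qed

end

context cascade_operator
begin

lemma coupling_observability_inequality_iff:
  assumes i: "i \<in> {2..n}" and T: "T > 0"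
  shows "coupling_observability_inequality D A (C i) T \<longleftrightarrow> coupling_obs i T"
proof
  assume "coupling_observability_inequality D A (C i) T"
  then obtain \<gamma> where \<gamma>: "\<gamma> > 0" "\<And>w w'. wave_solution D A T (\<lambda>_. 0) w w' \<Longrightarrow>
        (LINT t|lebesgue_on {0..T}. (norm (C i (w' t)))\<^sup>2) \<ge> \<gamma> * energy D A 1 (w 0) (w' 0)"
    unfolding coupling_observability_inequality_def by blast
  have "\<gamma> * en 0 (z 0) (y 0) \<le> integral {0..T} (\<lambda>t. (norm (C i (y t)))\<^sup>2)" if s: "sol T (\<lambda>_. 0) z y" for z y
  proof -
    have "(LINT t|lebesgue_on {0..T}. (norm (C i (y t)))\<^sup>2) = integral {0..T} (\<lambda>t. (norm (C i (y t)))\<^sup>2)"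
      by (intro lint_continuous continuous_intros continuous_on_bl[OF C_bounded_linear[OF i] sol_cont_y[OF s]])
    then show ?thesis using \<gamma>(2)[OF sol_imp_wave[OF s T]] energy_eq[of 0 "z 0" "y 0"] by simp
  qed
  with \<gamma>(1) show "coupling_obs i T" unfolding coupling_obs_def by blast
next
  assume "coupling_obs i T"
  then obtain \<gamma> where \<gamma>: "\<gamma> > 0" "\<And>z y. sol T (\<lambda>_. 0) z y \<Longrightarrow>
     \<gamma> * en 0 (z 0) (y 0) \<le> integral {0..T} (\<lambda>t. (norm (C i (y t)))\<^sup>2)"
    unfolding coupling_obs_def by blast
  have "(LINT t|lebesgue_on {0..T}. (norm (C i (w' t)))\<^sup>2) \<ge> \<gamma> * energy D A 1 (w 0) (w' 0)"
    if s: "wave_solution D A T (\<lambda>_. 0) w w'" for w w'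
  proof -
    have "(LINT t|lebesgue_on {0..T}. (norm (C i (w' t)))\<^sup>2) = integral {0..T} (\<lambda>t. (norm (C i (w' t)))\<^sup>2)"
      by (intro lint_continuous continuous_intros continuous_on_bl[OF C_bounded_linear[OF i] wave_cy[OF s]])
    moreover have "w 0 \<in> Hspace D A 1" using s T unfolding wave_solution_def continuous_into_def by auto
    then have "energy D A 1 (w 0) (w' 0) = en 0 (L (w 0)) (w' 0)" by (rule energy_1)
    ultimately show ?thesis using \<gamma>(2)[OF wave_imp_sol[OF s T]] by simp
  qed
  with \<gamma>(1) show "coupling_observability_inequality D A (C i) T"
    unfolding coupling_observability_inequality_def by blast
qed

lemma energy_level:
  "i \<in> {1..n} \<Longrightarrow> energy D A (1 + int i - int n) (G z) y = en (n - i) z y"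
  using energy_eq[of "n - i" z y] by (simp add: of_nat_diff algebra_simps)

text \<open>Components and first-order variables correspond through \<open>u = G Z\<close>. All
  sources are continuous because the components are, so the observation exists and its squared norm
  is \<open>Obs\<close>; the constants are merely inverted.\<close>

lemma cascade_observable_after_iff:
  assumes Ts: "Ts \<ge> 0"
  shows "cascade_observable_after D A n C B Ts \<longleftrightarrow> (\<forall>T>Ts. tail_obs 1 T)"
proof
  assume obs: "cascade_observable_after D A n C B Ts"
  show "\<forall>T>Ts. tail_obs 1 T"
  proof (intro allI impI)
    fix T assume TT: "T > Ts"
    then have T: "T > 0" using Ts by simp
    obtain c where c: "c > 0" and le: "\<forall>u0 u0'. (\<forall>i\<in>{1..n}. u0 i \<in> Hspace D A 1) \<longrightarrow>
        (\<forall>u u'. cascade_solution D A n C T u u' \<and> (\<forall>i\<in>{1..n}. u i 0 = u0 i \<and> u' i 0 = u0' i) \<longrightarrow>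
           (\<exists>g. is_observation D A B T (\<lambda>t. - C n (u (n - 1) t)) (u n) (u' n) g \<and>
              c * (\<Sum>i=1..n. energy D A (1 + int i - int n) (u i 0) (u' i 0))
                \<le> (LINT t|lebesgue_on {0..T}. (norm (g t))\<^sup>2)))"
      using obs TT unfolding cascade_observable_after_def by blast
    have "(\<Sum>i=1..n. en (n - i) (Z i 0) (Y i 0)) \<le> 1 / c * Obs T (Z n) (Y n)"
      if ch: "chain 1 T (\<lambda>_. 0) Z Y" for Z Y
    proof -
      define u where "u i t = G (Z i t)" for i t
      have src: "src 1 (\<lambda>_. 0) Z i = (\<lambda>t. - C i (u (i - 1) t))" if "i \<in> {2..n}" for i
        using that unfolding src_def u_def by auto
      have "cascade_solution D A n C T u Y"
        unfolding cascade_solution_def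
      proof (intro conjI ballI)
        have "sol T (\<lambda>_. 0) (Z 1) (Y 1)" using chainD[OF ch, of 1] n_ge by (simp add: src_def)
        from sol_imp_wave[OF this T] show "wave_solution D A T (\<lambda>_. 0) (u 1) (Y 1)" unfolding u_def[abs_def] .
        fix i assume i: "i \<in> {2..n}"
        have "sol T (\<lambda>t. - C i (u (i - 1) t)) (Z i) (Y i)" using chainD[OF ch, of i] i src[OF i] by simp
        from sol_imp_wave[OF this T] show "wave_solution D A T (\<lambda>t. - C i (u (i - 1) t)) (u i) (Y i)"
          unfolding u_def[abs_def] .
      qed
      moreover have "u i 0 \<in> Hspace D A 1" for i unfolding u_def Hspace1_iff by blast
      ultimately obtain g where g: "is_observation D A B T (\<lambda>t. - C n (u (n - 1) t)) (u n) (Y n) g"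
        "c * (\<Sum>i=1..n. energy D A (1 + int i - int n) (u i 0) (Y i 0)) \<le> (LINT t|lebesgue_on {0..T}. (norm (g t))\<^sup>2)"
        using le[THEN spec[of _ "\<lambda>i. u i 0"], THEN spec[of _ "\<lambda>i. Y i 0"]] by blast
      have "continuous_on {0..T} (\<lambda>t. - C n (u (n - 1) t))"
        using sol_cont_f[OF chainD[OF ch, of n]] n_ge src[of n] by simp
      from observation_unique[OF g(1) this T] have "(LINT t|lebesgue_on {0..T}. (norm (g t))\<^sup>2) = Obs T (Z n) (Y n)"
        unfolding u_def by simp
      moreover have "(\<Sum>i=1..n. energy D A (1 + int i - int n) (u i 0) (Y i 0)) = (\<Sum>i=1..n. en (n - i) (Z i 0) (Y i 0))"
        unfolding u_def by (intro sum.cong refl energy_level)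
      ultimately show ?thesis using g(2) c by (simp add: pos_le_divide_eq mult.commute)
    qed
    then show "tail_obs 1 T" unfolding tail_obs_def using c by (intro exI[of _ "1 / c"]) auto
  qed
next
  assume all: "\<forall>T>Ts. tail_obs 1 T"
  show "cascade_observable_after D A n C B Ts"
    unfolding cascade_observable_after_def
  proof (intro allI impI)
    fix T assume TT: "T > Ts"
    then have T: "T > 0" using Ts by simp
    obtain K where K: "K > 0" and le: "\<And>Z Y. chain 1 T (\<lambda>_. 0) Z Y \<Longrightarrow>
       (\<Sum>i=1..n. en (n - i) (Z i 0) (Y i 0)) \<le> K * Obs T (Z n) (Y n)"
      using all TT unfolding tail_obs_def by blast
    have main: "\<exists>g. is_observation D A B T (\<lambda>t. - C n (u (n - 1) t)) (u n) (u' n) g \<and>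
        1 / K * (\<Sum>i=1..n. energy D A (1 + int i - int n) (u i 0) (u' i 0)) \<le> (LINT t|lebesgue_on {0..T}. (norm (g t))\<^sup>2)"
      if cs: "cascade_solution D A n C T u u'" for u u'
    proof -
      define Z where "Z i t = L (u i t)" for i t
      have w1: "wave_solution D A T (\<lambda>_. 0) (u 1) (u' 1)"
        and wi: "\<And>i. i \<in> {2..n} \<Longrightarrow> wave_solution D A T (\<lambda>t. - C i (u (i - 1) t)) (u i) (u' i)"
        using cs unfolding cascade_solution_def by auto
      have w: "\<exists>f. wave_solution D A T f (u i) (u' i)" if "i \<in> {1..n}" for i
        using w1 wi[of i] that by (cases "i = 1") auto
      have GZ: "G (Z i t) = u i t" if "i \<in> {1..n}" "t \<in> {0..T}" for i t
        using w[OF that(1)] wave_L(1)[OF _ that(2)] unfolding Z_def by blast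
      have cf: "continuous_on {0..T} (\<lambda>t. - C i (u (i - 1) t))" if i: "i \<in> {2..n}" for i
      proof -
        have "i - 1 \<in> {1..n}" using i by (cases i) auto
        from w[OF this] obtain f where "wave_solution D A T f (u (i - 1)) (u' (i - 1))" by blast
        from wave_cw[OF this] show ?thesis
          by (intro continuous_intros continuous_on_bl[OF C_bounded_linear[OF i]])
      qed
      have "chain 1 T (\<lambda>_. 0) Z u'"
        unfolding chain_def
      proof
        fix i assume i: "i \<in> {1..n}"
        show "sol T (src 1 (\<lambda>_. 0) Z i) (Z i) (u' i)"
        proof (cases "i = 1")
          case True
          then show ?thesis using wave_imp_sol[OF w1 T] unfolding Z_def[abs_def] by (simp add: src_def)
        next
          case False
          then have i2: "i \<in> {2..n}" using i by auto
          show ?thesis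
          proof (rule sol_cong[OF wave_imp_sol[OF wi[OF i2] T cf[OF i2]]])
            have "i - 1 \<in> {1..n}" using i2 by (cases i) auto
            then show "- C i (u (i - 1) t) = src 1 (\<lambda>_. 0) Z i t" if "t \<in> {0..T}" for t
              using GZ[of "i - 1" t] i2 that by (simp add: src_def)
          qed (auto simp: Z_def)
        qed
      qed
      from le[OF this] have sum_le: "(\<Sum>i=1..n. en (n - i) (Z i 0) (u' i 0)) \<le> K * Obs T (Z n) (u' n)" .
      have n2: "n \<in> {2..n}" using n_ge by simp
      obtain g where g: "is_observation D A B T (\<lambda>t. - C n (u (n - 1) t)) (u n) (u' n) g"
        using observation_exists[OF wi[OF n2] cf[OF n2] T] by blast
      have "(\<Sum>i=1..n. energy D A (1 + int i - int n) (u i 0) (u' i 0)) = (\<Sum>i=1..n. en (n - i) (Z i 0) (u' i 0))"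
      proof (intro sum.cong refl)
        fix i assume i: "i \<in> {1..n}"
        then show "energy D A (1 + int i - int n) (u i 0) (u' i 0) = en (n - i) (Z i 0) (u' i 0)"
          using energy_level[OF i, of "Z i 0" "u' i 0"] GZ[OF i, of 0] T by simp
      qed
      moreover have "(LINT t|lebesgue_on {0..T}. (norm (g t))\<^sup>2) = Obs T (Z n) (u' n)"
        using observation_unique[OF g cf[OF n2] T] unfolding Z_def[abs_def] .
      ultimately show ?thesis using g sum_le K by (auto simp: pos_divide_le_eq mult.commute)
    qed
    show "\<exists>c>0. \<forall>u0 u0'. (\<forall>i\<in>{1..n}. u0 i \<in> Hspace D A 1) \<longrightarrow>
        (\<forall>u u'. cascade_solution D A n C T u u' \<and> (\<forall>i\<in>{1..n}. u i 0 = u0 i \<and> u' i 0 = u0' i) \<longrightarrow>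
           (\<exists>g. is_observation D A B T (\<lambda>t. - C n (u (n - 1) t)) (u n) (u' n) g \<and>
              c * (\<Sum>i=1..n. energy D A (1 + int i - int n) (u i 0) (u' i 0))
                \<le> (LINT t|lebesgue_on {0..T}. (norm (g t))\<^sup>2)))"
    proof (rule exI[of _ "1 / K"], rule conjI)
      show "1 / K > 0" using K by simp
    qed (use main in blast)
  qed
qed

text \<open>With all earlier components at rest, the last one is an arbitrary free wave.\<close>

lemma observability_of_cascade:
  assumes full: "tail_obs 1 T" and T: "T > 0"
  shows "observability_inequality D A B T"
proof -
  have "tail_obs n T" by (rule tail_obs_of_cascade[OF full]) (use n_ge in auto)
  then obtain K where K: "K > 0" and le: "\<And>Z Y. chain n T (\<lambda>_. 0) Z Y \<Longrightarrow>
     (\<Sum>i=n..n. en (n - i) (Z i 0) (Y i 0)) \<le> K * Obs T (Z n) (Y n)"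
    unfolding tail_obs_def by blast
  have "1 / K * en 0 (z 0) (y 0) \<le> Obs T z y" if s: "sol T (\<lambda>_. 0) z y" for z y
  proof -
    have "chain n T (\<lambda>_. 0) (\<lambda>_. z) (\<lambda>_. y)" using s by (simp add: chain_def src_def)
    from le[OF this] show ?thesis using K by (simp add: pos_divide_le_eq mult.commute)
  qed
  then show ?thesis
    unfolding observability_inequality_iff[OF T] using K by (intro exI[of _ "1 / K"]) auto
qed

text \<open>Descending induction on the first index of the tail: observability of free waves starts
  it at \<open>n\<close>, and each step consumes one coupling observability.\<close>

lemma cascade_of_observability:
  assumes cobs: "\<And>i. i \<in> {2..n} \<Longrightarrow> \<exists>T>0. coupling_obs i T"
    and obs: "T0 > 0" "observability_inequality D A B T0"
  shows "\<exists>T>0. tail_obs 1 T"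
proof -
  obtain R where R: "R > 0" "\<And>z y. sol T0 (\<lambda>_. 0) z y \<Longrightarrow> R * en 0 (z 0) (y 0) \<le> Obs T0 z y"
    using obs(2) unfolding observability_inequality_iff[OF obs(1)] by blast
  have base: "tail_obs n T0"
    unfolding tail_obs_def
  proof (intro exI[of _ "1 / R"] conjI allI impI)
    fix Z Y assume "chain n T0 (\<lambda>_. 0) Z Y"
    then have "sol T0 (\<lambda>_. 0) (Z n) (Y n)" by (simp add: chain_def src_def)
    from R(2)[OF this] show "(\<Sum>i=n..n. en (n - i) (Z i 0) (Y i 0)) \<le> 1 / R * Obs T0 (Z n) (Y n)"
      using R(1) by (simp add: pos_le_divide_eq mult.commute)
  qed (use R in simp)
  have "1 \<le> n" using n_ge by simp
  then show ?thesis
  proof (induction rule: inc_induct)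
    case base
    show ?case using \<open>tail_obs n T0\<close> obs(1) by blast
  next
    case (step j)
    then obtain T' where T': "T' > 0" "tail_obs (Suc j) T'" by blast
    obtain T1 where T1: "T1 > 0" "coupling_obs (Suc j) T1" using cobs[of "Suc j"] step by auto
    show ?case by (rule tail_obs_step[OF _ _ T' T1]) (use step in auto)
  qed
qed

end

text \<open>The minimal time is a definite description, so its value is known only once such a time
  exists. Monotonicity in the length of the interval makes the infimum of the positive lengths
  satisfying \<open>P\<close> a minimal time.\<close>

lemma minimal_control_time_le:
  assumes mono: "\<And>T T'. 0 < T \<Longrightarrow> T \<le> T' \<Longrightarrow> P T \<Longrightarrow> P T'"
    and P: "\<And>T. T > Ts \<Longrightarrow> P T" and Ts: "Ts \<ge> 0"
  shows "minimal_control_time P \<le> Ts"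
proof -
  define S where "S = {T. 0 < T \<and> P T}"
  have "Ts + 1 \<in> S" unfolding S_def using P[of "Ts + 1"] Ts by simp
  then have ne: "S \<noteq> {}" by blast
  have bd: "bdd_below S" unfolding S_def by (rule bdd_belowI[of _ 0]) auto
  have "is_minimal_control_time P (Inf S)"
    unfolding is_minimal_control_time_def
  proof (intro conjI allI impI)
    show "0 \<le> Inf S" by (rule cInf_greatest[OF ne]) (auto simp: S_def)
    show "P T" if "T > Inf S" for T
      using cInf_lessD[OF ne that] mono unfolding S_def by auto
    show "\<not> P T" if "0 < T \<and> T < Inf S" for T
      using cInf_lower[OF _ bd, of T] that unfolding S_def by auto
  qed
  then have "minimal_control_time P = Inf S" by (rule minimal_control_time_eqI)
  also have "Inf S \<le> Ts"
  proof (rule dense_ge)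
    fix T assume "T > Ts"
    then show "Inf S \<le> T" using P[of T] Ts by (intro cInf_lower bd) (auto simp: S_def)
  qed
  finally show ?thesis .
qed

theorem corollary2p8:
  fixes D :: "'h::{real_inner,complete_space} set"
    and A :: "'h \<Rightarrow> 'h"
    and C :: "nat \<Rightarrow> 'h \<Rightarrow> 'h"
    and B :: "'h \<times> 'h \<Rightarrow> 'g::{real_inner,complete_space}"
    and n :: nat
  assumes "n \<ge> 2"
    and "abstract_setting D A"
    and "coupling_hypothesis D A n C C"
    and "admissible D A B"
  shows "((\<exists>Tstar>0. cascade_observable_after D A n C B Tstar) \<longleftrightarrow>
            coupling_observability_hypothesis D A n C \<and> observability_hypothesis D A B) \<and>
         (\<forall>Tstar>0. cascade_observable_after D A n C B Tstar \<longrightarrow>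
            Tstar \<ge> max (MAX i\<in>{2..n}. minimal_control_time (coupling_observability_inequality D A (C i)))
                        (minimal_control_time (observability_inequality D A B)))"
proof -
  interpret cascade_operator D A B n C
    by unfold_locales (rule assms)+
  have necessary: "coupling_observability_inequality D A (C i) T" "observability_inequality D A B T"
    if obs: "cascade_observable_after D A n C B Ts" and Ts: "Ts > 0" and T: "T > Ts" and i: "i \<in> {2..n}" for Ts T i
  proof -
    have full: "\<And>T. T > Ts \<Longrightarrow> tail_obs 1 T" using obs Ts by (simp add: cascade_observable_after_iff)
    show "coupling_observability_inequality D A (C i) T"
      using coupling_obs_necessary[OF full i _ T] Ts T i by (simp add: coupling_observability_inequality_iff)
    show "observability_inequality D A B T"
      using observability_of_cascade[OF full[OF T]] Ts T by simp
  qed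
  have n2: "n \<in> {2..n}" using assms(1) by simp
  have iff: "(\<exists>Tstar>0. cascade_observable_after D A n C B Tstar) \<longleftrightarrow>
      coupling_observability_hypothesis D A n C \<and> observability_hypothesis D A B"
  proof
    assume "\<exists>Tstar>0. cascade_observable_after D A n C B Tstar"
    then obtain Ts where Ts: "Ts > 0" "cascade_observable_after D A n C B Ts" by blast
    show "coupling_observability_hypothesis D A n C \<and> observability_hypothesis D A B"
      unfolding coupling_observability_hypothesis_def observability_hypothesis_def
      using necessary[OF Ts(2,1)] Ts(1) C_bounded_linear n2 by blast
  next
    assume h: "coupling_observability_hypothesis D A n C \<and> observability_hypothesis D A B"
    have cobs: "\<exists>T>0. coupling_obs i T" if i: "i \<in> {2..n}" for i
    proof -
      obtain T0 where T0: "T0 > 0" "\<forall>T>T0. coupling_observability_inequality D A (C i) T"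
        using h i unfolding coupling_observability_hypothesis_def by blast
      then have "coupling_obs i (T0 + 1)" using i by (simp flip: coupling_observability_inequality_iff)
      then show ?thesis using T0(1) by (intro exI[of _ "T0 + 1"]) simp
    qed
    obtain T0 where T0: "T0 > 0" "\<forall>T>T0. observability_inequality D A B T"
      using h unfolding observability_hypothesis_def by blast
    obtain T where T: "T > 0" "tail_obs 1 T"
      using cascade_of_observability[OF cobs, of "T0 + 1"] T0 by auto
    \<comment> \<open>Peeling produces a single good time; later ones follow because a longer
      observation dominates.\<close>
    then have "\<forall>T'>T. tail_obs 1 T'" using tail_obs_mono[OF T(2) _ T(1)] n_ge by auto
    then have "cascade_observable_after D A n C B T" using T(1) by (simp add: cascade_observable_after_iff)
    then show "\<exists>Tstar>0. cascade_observable_after D A n C B Tstar" using T(1) by blast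
  qed
  have "Ts \<ge> max (MAX i\<in>{2..n}. minimal_control_time (coupling_observability_inequality D A (C i)))
                        (minimal_control_time (observability_inequality D A B))"
    if Ts: "Ts > 0" and obs: "cascade_observable_after D A n C B Ts" for Ts
  proof (rule max.boundedI)
    have "minimal_control_time (coupling_observability_inequality D A (C i)) \<le> Ts" if i: "i \<in> {2..n}" for i
    proof (rule minimal_control_time_le)
      show "coupling_observability_inequality D A (C i) T'"
        if "0 < T" "T \<le> T'" "coupling_observability_inequality D A (C i) T" for T T'
        using coupling_obs_mono[OF _ i that(1,2)] that i by (simp add: coupling_observability_inequality_iff)
      show "coupling_observability_inequality D A (C i) T" if "T > Ts" for T
        by (rule necessary(1)[OF obs Ts that i])
    qed (use Ts in simp)
    then show "(MAX i\<in>{2..n}. minimal_control_time (coupling_observability_inequality D A (C i))) \<le> Ts"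
      using n2 by (subst Max_le_iff) auto
    show "minimal_control_time (observability_inequality D A B) \<le> Ts"
    proof (rule minimal_control_time_le)
      show "observability_inequality D A B T'" if "0 < T" "T \<le> T'" "observability_inequality D A B T" for T T'
        by (rule observability_inequality_mono[OF that(3,1,2)])
      show "observability_inequality D A B T" if "T > Ts" for T
        by (rule necessary(2)[OF obs Ts that n2])
    qed (use Ts in simp)
  qed
  with iff show ?thesis by blast
qed

end
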